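(* Let $n\ge 2$ be an integer and let $1<p<n$ and $q>0$ satisfy $q(p-1)<1$. Let $u$ be a non-negative bounded weak solution of $\partial_t u=\Delta_p u^q$ in $\mathbb{H}^n\times[0,\infty)$ with non-negative initial function $u(\cdot,0)=u_0\in L^1(\mathbb{H}^n)\cap L^\infty(\mathbb{H}^n)$. Then $u$ has a finite extinction time, i.e. there exists $T>0$ such that $u(\cdot,t)\equiv 0$ for all $t\ge T$.
   Context: $\mathbb{H}^n$ is the $n$-dimensional hyperbolic space with its Riemannian measure $\mu$. The Riemannian $p$-Laplacian is $\Delta_p v=\operatorname{div}(|\nabla v|^{p-2}\nabla v)$. Weak solution (with $M=\mathbb{H}^n$, $I=[0,\infty)$): a non-negative function $u=u(x,t)$ is a weak solution of $\partial_t u=\Delta_p u^q$ in $M\times I$ if $u\in C(I;L^{q+1}(M))$, $u^q\in L^p_{loc}(I;W^{1,p}(M))$, and for all $t_1<t_2$ in $I$ and all non-negative test functions $\psi\in W^{1,1+\frac1q}_{loc}(I;L^{1+\frac1q}(M))\cap L^p_{loc}(I;W^{1,p}_0(M))$, $$\left[\int_M u\psi\,d\mu\right]_{t_1}^{t_2}+\int_{t_1}^{t_2}\int_M\left(-u\,\partial_t\psi+|\nabla u^q|^{p-2}\langle\nabla u^q,\nabla\psi\rangle\right)d\mu\,dt=0 .$$ *)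

theory Defs
  imports "HOL-Analysis.Analysis"
begin

section \<open>Smooth compactly supported functions\<close>

primrec Ck :: "nat \<Rightarrow> ('a::euclidean_space \<Rightarrow> real) \<Rightarrow> bool" where
  "Ck 0 f \<longleftrightarrow> continuous_on UNIV f"
| "Ck (Suc k) f \<longleftrightarrow>
     (\<forall>x. f differentiable (at x)) \<and> (\<forall>b\<in>Basis. Ck k (\<lambda>x. frechet_derivative f (at x) b))"

text \<open>\<open>Cc_smooth U\<close> is \<open>C\<^sub>c\<^sup>\<infinity>(U)\<close> for open \<open>U\<close>, its elements being extended by zero to the
  whole space.\<close>

definition Cc_smooth :: "'a::euclidean_space set \<Rightarrow> ('a \<Rightarrow> real) set" where
  "Cc_smooth U = {f. (\<forall>k. Ck k f) \<and> (\<exists>K. compact K \<and> K \<subseteq> U \<and> (\<forall>x. x \<notin> K \<longrightarrow> f x = 0))}"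

section \<open>Hyperbolic space\<close>

text \<open>Hyperbolic space of dimension \<open>DIM('a)\<close> is the Poincare ball model: the manifold is the open
  unit ball of \<open>'a\<close>, with the Riemannian metric \<open>g = (2 / (1 - |x|\<^sup>2))\<^sup>2 g_eucl\<close>, which has constant
  sectional curvature \<open>-1\<close>. Tangent vectors are elements of \<open>'a\<close>, through the global chart. The
  values of functions and vector fields outside the ball play no role.\<close>

abbreviation hyp_space :: "'a::euclidean_space set" where
  "hyp_space \<equiv> ball 0 1"

definition hyp_factor :: "'a::euclidean_space \<Rightarrow> real" where
  "hyp_factor x = 2 / (1 - (norm x)\<^sup>2)"

definition hyp_inner :: "'a::euclidean_space \<Rightarrow> 'a \<Rightarrow> 'a \<Rightarrow> real" where
  "hyp_inner x v w = (hyp_factor x)\<^sup>2 * (v \<bullet> w)"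

definition hyp_norm :: "'a::euclidean_space \<Rightarrow> 'a \<Rightarrow> real" where
  "hyp_norm x v = sqrt (hyp_inner x v v)"

text \<open>The density of the Riemannian measure is \<open>sqrt (det g)\<close>.\<close>

definition hyp_measure :: "'a::euclidean_space measure" where
  "hyp_measure = density (lebesgue_on hyp_space) (\<lambda>x. ennreal (hyp_factor x ^ DIM('a)))"

text \<open>The Riemannian divergence \<open>(1 / sqrt (det g)) \<Sum>\<^sub>b \<partial>\<^sub>b (sqrt (det g) X\<^sup>b)\<close>.\<close>

definition hyp_div :: "('a::euclidean_space \<Rightarrow> 'a) \<Rightarrow> 'a \<Rightarrow> real" where
  "hyp_div X x =
     (\<Sum>b\<in>Basis. frechet_derivative (\<lambda>y. hyp_factor y ^ DIM('a) * (X y \<bullet> b)) (at x) b)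
       / hyp_factor x ^ DIM('a)"

definition hyp_weak_grad :: "('a::euclidean_space \<Rightarrow> real) \<Rightarrow> ('a \<Rightarrow> 'a) \<Rightarrow> bool" where
  "hyp_weak_grad v G \<longleftrightarrow>
     (\<forall>K. compact K \<longrightarrow> K \<subseteq> hyp_space \<longrightarrow>
        set_integrable hyp_measure K v \<and> set_integrable hyp_measure K G) \<and>
     (\<forall>X. (\<forall>b\<in>Basis. (\<lambda>x. X x \<bullet> b) \<in> Cc_smooth hyp_space) \<longrightarrow>
        (\<integral>x. hyp_inner x (G x) (X x) \<partial>hyp_measure) = - (\<integral>x. v x * hyp_div X x \<partial>hyp_measure))"

text \<open>The weak gradient is determined up to a null set.\<close>

definition hyp_grad :: "('a::euclidean_space \<Rightarrow> real) \<Rightarrow> 'a \<Rightarrow> 'a" where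
  "hyp_grad v = (SOME G. hyp_weak_grad v G)"

section \<open>Lebesgue and Sobolev spaces on hyperbolic space\<close>

text \<open>Elements are functions rather than classes modulo equality almost everywhere, so the norms
  below are seminorms on these sets.\<close>

definition Lp_hyp :: "real \<Rightarrow> ('a::euclidean_space \<Rightarrow> real) set" where
  "Lp_hyp p = {v \<in> borel_measurable hyp_measure. integrable hyp_measure (\<lambda>x. \<bar>v x\<bar> powr p)}"

definition Lp_norm :: "real \<Rightarrow> ('a::euclidean_space \<Rightarrow> real) \<Rightarrow> real" where
  "Lp_norm p v = (\<integral>x. \<bar>v x\<bar> powr p \<partial>hyp_measure) powr (1 / p)"

definition Linf_hyp :: "('a::euclidean_space \<Rightarrow> real) set" where
  "Linf_hyp = {v \<in> borel_measurable hyp_measure. \<exists>C. AE x in hyp_measure. \<bar>v x\<bar> \<le> C}"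

definition W1p_hyp :: "real \<Rightarrow> ('a::euclidean_space \<Rightarrow> real) set" where
  "W1p_hyp p = {v \<in> Lp_hyp p. \<exists>G. hyp_weak_grad v G \<and>
                  integrable hyp_measure (\<lambda>x. hyp_norm x (G x) powr p)}"

definition W1p_norm :: "real \<Rightarrow> ('a::euclidean_space \<Rightarrow> real) \<Rightarrow> real" where
  "W1p_norm p v = ((\<integral>x. \<bar>v x\<bar> powr p \<partial>hyp_measure)
                   + (\<integral>x. hyp_norm x (hyp_grad v x) powr p \<partial>hyp_measure)) powr (1 / p)"

definition W1p0_hyp :: "real \<Rightarrow> ('a::euclidean_space \<Rightarrow> real) set" where
  "W1p0_hyp p = {v \<in> W1p_hyp p. \<exists>\<phi> :: nat \<Rightarrow> 'a \<Rightarrow> real. (\<forall>k. \<phi> k \<in> Cc_smooth hyp_space) \<and>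
                   (\<lambda>k. W1p_norm p (\<lambda>x. v x - \<phi> k x)) \<longlonglongrightarrow> 0}"

section \<open>Function-space-valued curves\<close>

text \<open>In this section \<open>X\<close> is a linear space of functions with seminorm \<open>N\<close>. Time carries the
  completed Lebesgue measure because strong measurability only yields scalar functions that are
  almost everywhere limits of measurable ones.\<close>

definition curve_continuous ::
  "('a \<Rightarrow> real) set \<Rightarrow> (('a \<Rightarrow> real) \<Rightarrow> real) \<Rightarrow> real set \<Rightarrow> (real \<Rightarrow> 'a \<Rightarrow> real) \<Rightarrow> bool" where
  "curve_continuous X N I v \<longleftrightarrow> (\<forall>t\<in>I. v t \<in> X) \<and>
     (\<forall>t\<in>I. ((\<lambda>s. N (\<lambda>x. v s x - v t x)) \<longlongrightarrow> 0) (at t within I))"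

text \<open>\<open>s\<close> is an \<open>X\<close>-valued simple function on \<open>I\<close>, and \<open>S\<close> is its integral.\<close>

definition simple_curve_integral ::
  "('a \<Rightarrow> real) set \<Rightarrow> real set \<Rightarrow> (real \<Rightarrow> 'a \<Rightarrow> real) \<Rightarrow> ('a \<Rightarrow> real) \<Rightarrow> bool" where
  "simple_curve_integral X I s S \<longleftrightarrow>
     (\<exists>(m::nat) A f. (\<forall>i<m. A i \<in> lmeasurable \<and> A i \<subseteq> I \<and> f i \<in> X) \<and>
        s = (\<lambda>t x. \<Sum>i<m. indicat_real (A i) t * f i x) \<and>
        S = (\<lambda>x. \<Sum>i<m. measure lebesgue (A i) * f i x))"

definition strongly_measurable ::
  "('a \<Rightarrow> real) set \<Rightarrow> (('a \<Rightarrow> real) \<Rightarrow> real) \<Rightarrow> real set \<Rightarrow> (real \<Rightarrow> 'a \<Rightarrow> real) \<Rightarrow> bool" where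
  "strongly_measurable X N I v \<longleftrightarrow> (AE t in lebesgue_on I. v t \<in> X) \<and>
     (\<exists>s S. (\<forall>k::nat. simple_curve_integral X I (s k) (S k)) \<and>
        (AE t in lebesgue_on I. (\<lambda>k. N (\<lambda>x. v t x - s k t x)) \<longlonglongrightarrow> 0))"

definition has_curve_integral ::
  "('a \<Rightarrow> real) set \<Rightarrow> (('a \<Rightarrow> real) \<Rightarrow> real) \<Rightarrow> real set \<Rightarrow> (real \<Rightarrow> 'a \<Rightarrow> real) \<Rightarrow> ('a \<Rightarrow> real) \<Rightarrow> bool"
  where
  "has_curve_integral X N I v V \<longleftrightarrow> strongly_measurable X N I v \<and> V \<in> X \<and>
     (\<exists>s S. (\<forall>k::nat. simple_curve_integral X I (s k) (S k)) \<and>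
        (\<forall>k. integrable (lebesgue_on I) (\<lambda>t. N (\<lambda>x. v t x - s k t x))) \<and>
        (\<lambda>k. \<integral>t. N (\<lambda>x. v t x - s k t x) \<partial>lebesgue_on I) \<longlonglongrightarrow> 0 \<and>
        (\<lambda>k. N (\<lambda>x. V x - S k x)) \<longlonglongrightarrow> 0)"

definition Lp_loc_curve ::
  "real \<Rightarrow> ('a \<Rightarrow> real) set \<Rightarrow> (('a \<Rightarrow> real) \<Rightarrow> real) \<Rightarrow> real set \<Rightarrow> (real \<Rightarrow> 'a \<Rightarrow> real) \<Rightarrow> bool" where
  "Lp_loc_curve r X N I v \<longleftrightarrow> strongly_measurable X N I v \<and>
     (\<forall>J. compact J \<longrightarrow> J \<subseteq> I \<longrightarrow> integrable (lebesgue_on J) (\<lambda>t. N (v t) powr r))"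

text \<open>\<open>v \<in> W\<^sup>1\<^sup>,\<^sup>r\<^sub>l\<^sub>o\<^sub>c(I; X)\<close> with weak derivative \<open>v'\<close>, that is \<open>\<integral> \<eta>' v dt = - \<integral> \<eta> v' dt\<close> in \<open>X\<close>.\<close>

definition W1r_loc_curve ::
  "real \<Rightarrow> ('a \<Rightarrow> real) set \<Rightarrow> (('a \<Rightarrow> real) \<Rightarrow> real) \<Rightarrow> real set \<Rightarrow>
     (real \<Rightarrow> 'a \<Rightarrow> real) \<Rightarrow> (real \<Rightarrow> 'a \<Rightarrow> real) \<Rightarrow> bool" where
  "W1r_loc_curve r X N I v v' \<longleftrightarrow> Lp_loc_curve r X N I v \<and> Lp_loc_curve r X N I v' \<and>
     (\<forall>\<eta>\<in>Cc_smooth (interior I). \<exists>V.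
        has_curve_integral X N I (\<lambda>t x. deriv \<eta> t * v t x) V \<and>
        has_curve_integral X N I (\<lambda>t x. \<eta> t * v' t x) (\<lambda>x. - V x))"

section \<open>Weak solutions\<close>

text \<open>A test function \<open>\<psi>\<close> together with its weak time derivative \<open>\<psi>'\<close>. Elements of
  \<open>W\<^sup>1\<^sup>,\<^sup>r\<^sub>l\<^sub>o\<^sub>c(I; X)\<close> have a unique continuous representative; the boundary terms in the definition of
  weak solutions refer to it, so \<open>\<psi>\<close> is required to be that representative.\<close>

definition test_function ::
  "real \<Rightarrow> real \<Rightarrow> real set \<Rightarrow> (real \<Rightarrow> 'a::euclidean_space \<Rightarrow> real) \<Rightarrow> (real \<Rightarrow> 'a \<Rightarrow> real) \<Rightarrow> bool" where
  "test_function p q I \<psi> \<psi>' \<longleftrightarrow>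
     W1r_loc_curve (1 + 1 / q) (Lp_hyp (1 + 1 / q)) (Lp_norm (1 + 1 / q)) I \<psi> \<psi>' \<and>
     curve_continuous (Lp_hyp (1 + 1 / q)) (Lp_norm (1 + 1 / q)) I \<psi> \<and>
     Lp_loc_curve p (W1p0_hyp p) (W1p_norm p) I \<psi>"

definition weak_solution ::
  "real \<Rightarrow> real \<Rightarrow> real set \<Rightarrow> (real \<Rightarrow> 'a::euclidean_space \<Rightarrow> real) \<Rightarrow> bool" where
  "weak_solution p q I u \<longleftrightarrow>
     (\<forall>t\<in>I. AE x in hyp_measure. 0 \<le> u t x) \<and>
     curve_continuous (Lp_hyp (q + 1)) (Lp_norm (q + 1)) I u \<and>
     Lp_loc_curve p (W1p_hyp p) (W1p_norm p) I (\<lambda>t x. u t x powr q) \<and>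
     (\<forall>\<psi> \<psi>' t1 t2. test_function p q I \<psi> \<psi>' \<longrightarrow> (\<forall>t\<in>I. AE x in hyp_measure. 0 \<le> \<psi> t x) \<longrightarrow>
        t1 \<in> I \<longrightarrow> t2 \<in> I \<longrightarrow> t1 < t2 \<longrightarrow>
        (\<integral>x. u t2 x * \<psi> t2 x \<partial>hyp_measure) - (\<integral>x. u t1 x * \<psi> t1 x \<partial>hyp_measure)
        + (\<integral>t. (\<integral>x. - u t x * \<psi>' t x
                  + hyp_norm x (hyp_grad (\<lambda>y. u t y powr q) x) powr (p - 2)
                    * hyp_inner x (hyp_grad (\<lambda>y. u t y powr q) x) (hyp_grad (\<psi> t) x)
               \<partial>hyp_measure) \<partial>lebesgue_on {t1..t2}) = 0)"

end

theory Submission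
  imports Defs
begin

text \<open>
  Write \<open>v = u\<^sup>q\<close>, \<open>r = 1 + 1/q\<close> and \<open>y(t) = \<integral> u\<^bsup>q+1\<^esup> = \<integral> v\<^sup>r\<close>. Testing the equation with \<open>v\<close> gives the
  energy inequality \<open>y' \<le> - c \<integral> |\<nabla>v|\<^sup>p\<close>. The hypothesis \<open>q (p - 1) < 1\<close> says that \<open>r > p\<close>. Hyperbolic space
  has a spectral gap, \<open>\<integral> |v|\<^sup>p \<le> C \<integral> |\<nabla>v|\<^sup>p\<close>, and local regularization gains a little more: for
  \<open>0 \<le> v \<le> M\<close> with small energy, \<open>\<integral> v\<^sup>r \<le> C (\<integral> |\<nabla>v|\<^sup>p)\<^bsup>1+\<eta>\<^esup>\<close> for some \<open>\<eta> > 0\<close>. Hence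
  \<open>y' \<le> - \<kappa> min(1, (y/C)\<^sup>\<theta>)\<close> with \<open>\<theta> = 1 / (1 + \<eta>) < 1\<close>, and \<open>y\<close> vanishes after a finite time.

  The function \<open>v\<close> has no time derivative and is not an admissible test function. Its value \<open>w = v(t)\<close> at
  a single time is one, constant in time. By convexity of \<open>s \<mapsto> s\<^bsup>q+1\<^esup>\<close>,
  \<open>y(t) - y(s) \<le> (q + 1) \<integral> (u(t) - u(s)) w\<close> for \<open>s < t\<close>, and by strong measurability of the curve \<open>v\<close> the
  error made in replacing \<open>\<integral> |\<nabla>v(\<tau>)|\<^bsup>p-2\<^esup> \<nabla>v(\<tau>) \<cdot> \<nabla>w\<close> by the energy of \<open>v(\<tau>)\<close>, up to a constant factor,
  is small on average over \<open>s < \<tau> < t\<close>.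
\<close>

section \<open>Smooth functions\<close>

text \<open>A power of the energy slightly above 1 is all that extinction needs, so no sharp Sobolev
  inequality is sought. Around \<open>x\<close> the Euclidean ball of radius
  \<open>\<delta> * hyp_dfac x\<close> has hyperbolic volume of order \<delta>^n, uniformly in
  \<open>x\<close>; the oscillation of a function on such balls costs \<delta>^p times the energy,
  and \<delta> is chosen as a power of the energy itself. Hence the restriction to energy below 1,
  and the minimum with 1 in the decay rate: for larger energy the rate is bounded below by a
  constant. A time slice of v is admissible as a test function only if it lies in the closure of the
  smooth compactly supported functions. Completeness of hyperbolic space makes that closure all of
  W^(1,p); the proof runs Euclidean mollification inside the ball model. In time, p-th powers of
  norms replace the norms. They are convex p-homogeneous functionals on linear spaces of functions,
  and measurability and approximation of curves are deduced from that and from simple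
  curves.\<close>

abbreviation pd :: "('a::euclidean_space \<Rightarrow> real) \<Rightarrow> 'a \<Rightarrow> 'a \<Rightarrow> real" where
  "pd f b x \<equiv> frechet_derivative f (at x) b"

lemma pd_eq: "(f has_derivative D) (at x) \<Longrightarrow> pd f b x = D b"
  using frechet_derivative_at by metis

lemma Ck_Suc_imp: "Ck (Suc k) f \<Longrightarrow> Ck k f"
proof (induction k arbitrary: f)
  case 0
  then show ?case
    by (auto intro!: differentiable_imp_continuous_on simp: differentiable_on_def)
next
  case (Suc k)
  then show ?case by (metis Ck.simps(2))
qed

lemma Ck_differentiable: "Ck (Suc k) f \<Longrightarrow> f differentiable (at x)"
  by simp

lemma Ck_continuous: "Ck k f \<Longrightarrow> continuous_on UNIV f"
  by (induction k) (use Ck_Suc_imp in auto)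

lemma Ck_const [simp]: "Ck k (\<lambda>x. c)"
proof (induction k arbitrary: c)
  case (Suc k)
  have "pd (\<lambda>x. c) b = (\<lambda>x. 0)" for b :: 'a
    by (auto simp: fun_eq_iff intro: pd_eq derivative_eq_intros)
  then show ?case using Suc by simp
qed simp

lemma Ck_add: "Ck k f \<Longrightarrow> Ck k g \<Longrightarrow> Ck k (\<lambda>x. f x + g x)"
proof (induction k arbitrary: f g)
  case 0
  then show ?case by (auto intro: continuous_intros)
next
  case (Suc k)
  have "pd (\<lambda>x. f x + g x) b = (\<lambda>x. pd f b x + pd g b x)" for b
    using Suc.prems
    by (intro ext pd_eq has_derivative_add) (auto simp: frechet_derivative_works)
  then show ?case using Suc by auto
qed

lemma Ck_mult: "Ck k f \<Longrightarrow> Ck k g \<Longrightarrow> Ck k (\<lambda>x. f x * g x)"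
proof (induction k arbitrary: f g)
  case 0
  then show ?case by (auto intro: continuous_intros)
next
  case (Suc k)
  have "pd (\<lambda>x. f x * g x) b = (\<lambda>x. f x * pd g b x + pd f b x * g x)" for b
    using Suc.prems
    by (intro ext pd_eq has_derivative_mult) (auto simp: frechet_derivative_works)
  moreover have "Ck k f" "Ck k g" using Suc.prems Ck_Suc_imp by blast+
  ultimately show ?case using Suc by (auto intro!: Ck_add)
qed

lemma Ck_sum: "(\<And>i. i \<in> I \<Longrightarrow> Ck k (f i)) \<Longrightarrow> Ck k (\<lambda>x. \<Sum>i\<in>I. f i x)"
  by (induction I rule: infinite_finite_induct) (auto intro: Ck_add)

lemma Ck_power: "Ck k f \<Longrightarrow> Ck k (\<lambda>x. f x ^ n)"
  by (induction n) (auto intro: Ck_mult)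

lemma Ck_minus: "Ck k f \<Longrightarrow> Ck k (\<lambda>x. - f x)"
  using Ck_mult[of k "\<lambda>x. -1" f] by simp

lemma Ck_diff: "Ck k f \<Longrightarrow> Ck k g \<Longrightarrow> Ck k (\<lambda>x. f x - g x)"
  using Ck_add[of k f "\<lambda>x. - g x"] Ck_minus by auto

lemma Ck_inner: "Ck k (\<lambda>x. x \<bullet> v)"
proof (cases k)
  case (Suc j)
  have "pd (\<lambda>x. x \<bullet> v) b = (\<lambda>x. b \<bullet> v)" for b :: 'a
    by (auto simp: fun_eq_iff intro!: pd_eq derivative_eq_intros)
  moreover have "(\<lambda>x. x \<bullet> v) differentiable (at x)" for x :: 'a
    by (intro bounded_linear_imp_differentiable bounded_linear_inner_left)
  ultimately show ?thesis using Suc by simp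
qed (auto intro: continuous_intros)

lemma Ck_norm_sq: "Ck k (\<lambda>x. (norm x)\<^sup>2)"
proof -
  have "(norm x)\<^sup>2 = (\<Sum>b\<in>Basis. (x \<bullet> b) ^ 2)" for x :: 'a
    unfolding power2_norm_eq_inner by (subst euclidean_inner) (simp add: power2_eq_square)
  then show ?thesis by (simp add: Ck_sum Ck_power Ck_inner)
qed

lemma Ck_affine: "Ck k f \<Longrightarrow> Ck k (\<lambda>x. f (a + c *\<^sub>R x))"
proof (induction k arbitrary: f)
  case 0
  then show ?case
    by (auto intro!: continuous_on_compose2[of UNIV f] continuous_intros)
next
  case (Suc k)
  have D: "((\<lambda>x. f (a + c *\<^sub>R x)) has_derivative (\<lambda>h. pd f (c *\<^sub>R h) (a + c *\<^sub>R x))) (at x)" for x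
    using Suc.prems
    by (intro has_derivative_compose[of "\<lambda>x. a + c *\<^sub>R x" _ _ _ f])
       (auto simp: frechet_derivative_works intro!: derivative_eq_intros)
  have "pd (\<lambda>x. f (a + c *\<^sub>R x)) b x = c * pd f b (a + c *\<^sub>R x)" for b x
  proof -
    have "linear (frechet_derivative f (at (a + c *\<^sub>R x)))"
      using Suc.prems by (auto intro: linear_frechet_derivative)
    then show ?thesis using pd_eq[OF D] by (simp add: linear_cmul)
  qed
  moreover have "(\<lambda>x. f (a + c *\<^sub>R x)) differentiable (at x)" for x
    using D by (auto simp: differentiable_def)
  moreover have "Ck k (\<lambda>x. c * pd f b (a + c *\<^sub>R x))" if "b \<in> Basis" for b
    using Suc.IH[of "pd f b"] Suc.prems that by (intro Ck_mult) auto
  ultimately show ?case by simp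
qed

text \<open>\<open>S\<close> stands in for smoothness of the outer function: being closed under
  differentiation, it lets the induction hypothesis apply to \<open>g'\<close>, so that only the
  first-order chain rule occurs.\<close>

lemma Ck_compose_real:
  fixes S :: "(real \<Rightarrow> real) set"
  assumes S: "\<And>g. g \<in> S \<Longrightarrow> \<exists>g'\<in>S. \<forall>s. (g has_real_derivative g' s) (at s)"
    and f: "\<And>k. Ck k f" and g: "g \<in> S"
  shows "Ck k (\<lambda>x. g (f x))"
  using g
proof (induction k arbitrary: g)
  case 0
  obtain g' where "\<forall>s. (g has_real_derivative g' s) (at s)" using S 0 by blast
  then have "continuous_on UNIV g"
    by (meson DERIV_isCont continuous_at_imp_continuous_on)
  then show ?case using f[of 0] by (auto intro: continuous_on_compose2)
next
  case (Suc k)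
  obtain g' where g': "g' \<in> S" "\<forall>s. (g has_real_derivative g' s) (at s)" using S Suc by blast
  have D: "((\<lambda>x. g (f x)) has_derivative (\<lambda>h. g' (f x) * pd f h x)) (at x)" for x
    using f[of 1] g'(2) has_derivative_compose[of f "frechet_derivative f (at x)" x UNIV g]
    by (auto simp: frechet_derivative_works has_field_derivative_def)
  have "pd (\<lambda>x. g (f x)) b = (\<lambda>x. g' (f x) * pd f b x)" for b
    using pd_eq[OF D] by auto
  moreover have "(\<lambda>x. g (f x)) differentiable (at x)" for x
    using D by (auto simp: differentiable_def)
  moreover have "Ck k (\<lambda>x. g' (f x))" using Suc.IH g' by blast
  moreover have "Ck k (pd f b)" if "b \<in> Basis" for b using f[of "Suc k"] that by auto
  ultimately show ?case by (auto intro!: Ck_mult)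
qed

subsection \<open>A bump function\<close>

text \<open>The family of all \<open>flat_exp P\<close> is closed under differentiation, which makes its members smooth.\<close>

definition flat_exp :: "real poly \<Rightarrow> real \<Rightarrow> real" where
  "flat_exp P s = (if s \<le> 0 then 0 else poly P (1 / s) * exp (- 1 / s))"

lemma poly_times_exp_neg: "((\<lambda>w. poly P w * exp (- w)) \<longlongrightarrow> 0) at_top" for P :: "real poly"
proof -
  have "((\<lambda>w. \<Sum>i\<le>degree P. coeff P i * (w ^ i / exp w)) \<longlongrightarrow> (\<Sum>i\<le>degree P. coeff P i * 0)) at_top"
    by (intro tendsto_sum tendsto_mult tendsto_power_div_exp_0 tendsto_const)
  then show ?thesis
    by (simp add: poly_altdef exp_minus sum_divide_distrib field_simps)
qed

lemma flat_exp_at_0: "((flat_exp P) \<longlongrightarrow> 0) (at 0)"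
proof -
  have "((\<lambda>s. poly P (inverse s) * exp (- inverse s)) \<longlongrightarrow> 0) (at_right 0)"
    using filterlim_compose[OF poly_times_exp_neg filterlim_inverse_at_top_right] by simp
  moreover have "eventually (\<lambda>s. flat_exp P s = poly P (inverse s) * exp (- inverse s)) (at_right 0)"
    by (auto simp: flat_exp_def eventually_at_filter field_simps)
  ultimately have "(flat_exp P \<longlongrightarrow> 0) (at_right 0)"
    by (simp add: tendsto_cong)
  moreover have "eventually (\<lambda>s. flat_exp P s = 0) (at_left 0)"
    by (auto simp: flat_exp_def eventually_at_filter)
  then have "(flat_exp P \<longlongrightarrow> 0) (at_left 0)"
    by (rule tendsto_eventually)
  ultimately show ?thesis by (simp add: filterlim_split_at)
qed

text \<open>With w = 1/s and dw/ds = -w^2, the derivative of P(w) exp(-w) is w^2 (P - P')(w)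
  exp(-w); this is the origin of the new polynomial.\<close>

lemma flat_exp_deriv:
  "(flat_exp P has_real_derivative flat_exp ([:0,0,1:] * (P - pderiv P)) s) (at s)"
proof (cases s "0::real" rule: linorder_cases)
  case less
  have "((\<lambda>s. 0) has_real_derivative 0) (at s)" by simp
  then have "(flat_exp P has_real_derivative 0) (at s)"
    by (rule has_field_derivative_transform_within_open[of _ _ _ "{..<0}"])
       (use less in \<open>auto simp: flat_exp_def\<close>)
  then show ?thesis using less by (simp add: flat_exp_def)
next
  case equal
  have "((\<lambda>h. (flat_exp P (0 + h) - flat_exp P 0) / h) \<longlongrightarrow> 0) (at 0)"
  proof -
    \<comment> \<open>The difference quotient at 0 is itself a member of the family, for the
      polynomial X P, and every member tends to 0 there.\<close>
    have "flat_exp ([:0,1:] * P) h = (flat_exp P (0 + h) - flat_exp P 0) / h" if "h \<noteq> 0" for h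
      using that by (simp add: flat_exp_def)
    then show ?thesis
      using flat_exp_at_0[of "[:0,1:] * P"]
      by (subst tendsto_cong[where g = "flat_exp ([:0,1:] * P)"]) (auto simp: eventually_at_filter)
  qed
  then have "(flat_exp P has_real_derivative 0) (at 0)"
    by (simp add: DERIV_def)
  then show ?thesis using equal by (simp add: flat_exp_def)
next
  case greater
  have "((\<lambda>s. poly P (1 / s) * exp (- 1 / s)) has_real_derivative
      flat_exp ([:0,0,1:] * (P - pderiv P)) s) (at s)"
    using greater
    by (auto intro!: derivative_eq_intros DERIV_chain2[of "poly P"] poly_DERIV
          simp: flat_exp_def field_simps power2_eq_square)
  then show ?thesis
    by (rule has_field_derivative_transform_within_open[of _ _ _ "{0<..}"])
       (use greater in \<open>auto simp: flat_exp_def\<close>)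
qed

text \<open>The classical exp(-1/(1 - |x|^2)), extended by zero outside the unit ball.\<close>

definition bump :: "'a::euclidean_space \<Rightarrow> real" where
  "bump x = flat_exp 1 (1 - (norm x)\<^sup>2)"

lemma Ck_bump: "Ck k bump"
  unfolding bump_def
  by (rule Ck_compose_real[of "range flat_exp" _ "flat_exp 1"])
     (use flat_exp_deriv in \<open>auto intro!: Ck_diff Ck_norm_sq\<close>)

lemma bump_nonneg: "0 \<le> bump x"
  by (simp add: bump_def flat_exp_def)

lemma bump_pos_iff: "0 < bump x \<longleftrightarrow> norm x < 1"
  using abs_square_less_1[of "norm x"] by (auto simp: bump_def flat_exp_def not_le)

lemma bump_eq_0: "1 \<le> norm x \<Longrightarrow> bump x = 0"
  using bump_pos_iff[of x] bump_nonneg[of x] by linarith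

section \<open>Mollification\<close>

lemma powr_add_le: "(a + b) powr p \<le> 2 powr p * (a powr p + b powr p)"
  if "0 \<le> a" "0 \<le> b" "0 \<le> p" for a b p :: real
proof -
  have "(a + b) powr p \<le> (2 * max a b) powr p"
    using that by (intro powr_mono2) auto
  also have "\<dots> = 2 powr p * max a b powr p"
    using that by (simp add: powr_mult)
  also have "\<dots> \<le> 2 powr p * (a powr p + b powr p)"
    using that by (intro mult_left_mono) (auto simp: max_def)
  finally show ?thesis .
qed

text \<open>The tangent form of convexity is the source of Jensen's inequality, of the weighted
  inequality for sums, and of the comparison of \<open>u\<close> at two times.\<close>

lemma powr_tangent: "m powr p + p * m powr (p - 1) * (x - m) \<le> x powr p"
  if "1 \<le> p" "0 \<le> x" "0 \<le> m" for m x p :: real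
proof (cases "m = 0 \<or> x = 0")
  case True
  \<comment> \<open>The convexity argument lives on the open half-line, so 0 is treated by hand. The
    slope at \<open>m = 0\<close> is 0 even for \<open>p = 1\<close>, because
    \<open>0 powr 0 = 0\<close>.\<close>
  show ?thesis
  proof (cases "m = 0")
    case False
    then have "m powr (p - 1) * m = m powr p" using that by (simp add: powr_diff)
    then have "p * m powr (p - 1) * (0 - m) = - (p * m powr p)" by (simp add: mult.assoc)
    moreover have "1 * m powr p \<le> p * m powr p" using that by (intro mult_right_mono) auto
    ultimately have "m powr p + p * m powr (p - 1) * (0 - m) \<le> 0" by linarith
    then show ?thesis using True False by simp
  qed (use that in auto)
next
  case False
  then have "x > 0" "m > 0" using that by auto
  have "x powr p - m powr p \<ge> (p * m powr (p - 1)) * (x - m)"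
  proof (rule convex_on_imp_above_tangent[OF powr_convex])
    show "((\<lambda>x. x powr p) has_field_derivative p * m powr (p - 1)) (at m within {0<..})"
      using \<open>m > 0\<close> by (auto intro!: derivative_eq_intros simp: powr_diff)
  qed (use \<open>x > 0\<close> \<open>m > 0\<close> that in \<open>auto simp: connected_Ioi interior_open\<close>)
  then show ?thesis by linarith
qed

section \<open>Continuous functions with compact support\<close>

lemma integrable_continuous_compact_support:
  fixes f :: "'a::euclidean_space \<Rightarrow> real"
  assumes "continuous_on UNIV f" "compact K" "\<And>x. x \<notin> K \<Longrightarrow> f x = 0"
  shows "integrable lborel f"
proof -
  have "integrable lborel (\<lambda>x. indicator K x *\<^sub>R f x)"
    using assms by (intro borel_integrable_compact) (auto intro: continuous_on_subset)
  moreover have "(\<lambda>x. indicator K x *\<^sub>R f x) = f"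
    using assms(3) by (auto simp: indicator_def fun_eq_iff)
  ultimately show ?thesis by simp
qed

lemma continuous_compact_support_bounded:
  fixes f :: "'a::euclidean_space \<Rightarrow> real"
  assumes "continuous_on UNIV f" "compact K" "\<And>x. x \<notin> K \<Longrightarrow> f x = 0"
  obtains B where "0 \<le> B" "\<And>x. \<bar>f x\<bar> \<le> B"
proof -
  have "compact (f ` K)" using assms by (blast intro: compact_continuous_image continuous_on_subset)
  then obtain B where B: "\<And>x. x \<in> K \<Longrightarrow> \<bar>f x\<bar> \<le> B"
    by (metis bounded_iff compact_imp_bounded image_eqI real_norm_def)
  show ?thesis
  proof
    show "\<bar>f x\<bar> \<le> max 0 B" for x using B[of x] assms(3)[of x] by (cases "x \<in> K") auto
  qed auto
qed

lemma uniformly_continuous_compact_support: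
  fixes f :: "'a::euclidean_space \<Rightarrow> real"
  assumes f: "continuous_on UNIV f" and z: "\<And>x. R \<le> norm x \<Longrightarrow> f x = 0" and "0 < e"
  obtains d where "0 < d" "d \<le> 1" "\<And>x h. norm h < d \<Longrightarrow> \<bar>f (x + h) - f x\<bar> < e"
proof -
  have "uniformly_continuous_on (cball 0 (R + 1)) f"
    using f by (intro compact_uniformly_continuous) (auto intro: continuous_on_subset)
  then obtain d where d: "0 < d"
    "\<And>x y. x \<in> cball 0 (R+1) \<Longrightarrow> y \<in> cball 0 (R+1) \<Longrightarrow> dist y x < d \<Longrightarrow> dist (f y) (f x) < e"
    using \<open>0 < e\<close> unfolding uniformly_continuous_on_def by metis
  \<comment> \<open>An increment below 1 keeps both points in the ball of radius
    \<open>R + 1\<close>, unless both values vanish.\<close>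
  have "\<bar>f (x + h) - f x\<bar> < e" if h: "norm h < min d 1" for x h
  proof (cases "R \<le> norm x \<and> R \<le> norm (x + h)")
    case False
    then have "norm x \<le> R + 1 \<and> norm (x + h) \<le> R + 1"
      using h norm_triangle_ineq[of x h] norm_triangle_ineq4[of "x + h" h] by (auto simp: not_le)
    then have "x \<in> cball 0 (R+1)" "x + h \<in> cball 0 (R+1)" by (simp_all only: mem_cball_0)
    moreover have "dist (x + h) x < d" using h by (simp add: dist_norm)
    ultimately show ?thesis using d(2)[of x "x + h"] by (simp add: dist_real_def)
  qed (use z \<open>0 < e\<close> in auto)
  then show ?thesis using that[of "min d 1"] d(1) by auto
qed

lemma frechet_derivative_expand:
  assumes "f differentiable (at x)"
  shows "frechet_derivative f (at x) h = (\<Sum>b\<in>Basis. (h \<bullet> b) * pd f b x)"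
proof -
  have l: "linear (frechet_derivative f (at x))" using assms by (rule linear_frechet_derivative)
  have "frechet_derivative f (at x) h = frechet_derivative f (at x) (\<Sum>b\<in>Basis. (h \<bullet> b) *\<^sub>R b)"
    by (simp add: euclidean_representation)
  also have "\<dots> = (\<Sum>b\<in>Basis. (h \<bullet> b) * pd f b x)"
    by (simp add: linear_sum[OF l] linear_cmul[OF l])
  finally show ?thesis .
qed

lemma mvt_frechet:
  fixes f :: "'a::euclidean_space \<Rightarrow> real"
  assumes "\<And>x. f differentiable (at x)"
  obtains s where "0 < s" "s < 1" "f (x + h) - f x = (\<Sum>b\<in>Basis. (h \<bullet> b) * pd f b (x + s *\<^sub>R h))"
proof -
  have D: "((\<lambda>s. f (x + s *\<^sub>R h)) has_derivative (\<lambda>t. frechet_derivative f (at (x + s *\<^sub>R h)) (t *\<^sub>R h))) (at s)" for s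
    using assms
    by (intro has_derivative_compose[of "\<lambda>s. x + s *\<^sub>R h" _ _ _ f])
       (auto simp: frechet_derivative_works intro!: derivative_eq_intros)
  have "\<exists>s\<in>{0<..<1}. f (x + 1 *\<^sub>R h) - f (x + 0 *\<^sub>R h) = frechet_derivative f (at (x + s *\<^sub>R h)) ((1 - 0) *\<^sub>R h)"
    using mvt_simple[of 0 1 "\<lambda>s. f (x + s *\<^sub>R h)"
        "\<lambda>s t. frechet_derivative f (at (x + s *\<^sub>R h)) (t *\<^sub>R h)"] D
    by (auto intro: has_derivative_at_withinI)
  then obtain s where "0 < s" "s < 1" "f (x + h) - f x = frechet_derivative f (at (x + s *\<^sub>R h)) h"
    by auto
  then show ?thesis using that[of s] frechet_derivative_expand[OF assms, of "x + s *\<^sub>R h" h] by simp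
qed

lemma pd_eq_0_outside:
  assumes "\<And>x. R \<le> norm x \<Longrightarrow> f x = 0" "R < norm x"
  shows "pd f b x = 0"
proof -
  have "((\<lambda>x. 0) has_derivative (\<lambda>_. 0)) (at x)" by simp
  then have "(f has_derivative (\<lambda>_. 0)) (at x)"
    by (rule has_derivative_transform_within_open[of _ _ _ _ "- cball 0 R"])
       (use assms in \<open>auto simp: open_Compl\<close>)
  then show ?thesis by (rule pd_eq)
qed

section \<open>Convolution with a smooth kernel\<close>

lemma integrable_mult_bounded:
  fixes w :: "'a::euclidean_space \<Rightarrow> real"
  assumes "integrable lebesgue w" "f \<in> borel_measurable lebesgue" "\<And>x. \<bar>f x\<bar> \<le> B"
  shows "integrable lebesgue (\<lambda>x. f x * w x)"
proof (rule Bochner_Integration.integrable_bound[of _ "\<lambda>x. B * w x"])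
  show "AE x in lebesgue. norm (f x * w x) \<le> norm (B * w x)"
    by (intro AE_I2) (use assms(3) in \<open>auto simp: abs_mult intro!: mult_right_mono intro: order_trans[OF _ abs_ge_self]\<close>)
  show "(\<lambda>x. f x * w x) \<in> borel_measurable lebesgue"
    using assms by auto
qed (use assms in auto)

lemma continuous_lebesgue_measurable:
  "continuous_on UNIV f \<Longrightarrow> f \<in> borel_measurable lebesgue" for f :: "'a::euclidean_space \<Rightarrow> 'b::euclidean_space"
  by (simp add: borel_measurable_continuous_onI measurable_completion)

lemma conv_integrable:
  fixes w :: "'a::euclidean_space \<Rightarrow> real"
  assumes "integrable lebesgue w" "continuous_on UNIV \<eta>" "\<And>x. R \<le> norm x \<Longrightarrow> \<eta> x = 0"
  shows "integrable lebesgue (\<lambda>y. \<eta> (x - y) * w y)"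
proof -
  obtain B where "\<And>x. \<bar>\<eta> x\<bar> \<le> B"
    using continuous_compact_support_bounded[of \<eta> "cball 0 R"] assms by (metis compact_cball linear mem_cball_0)
  then show ?thesis
    using assms
    by (intro integrable_mult_bounded continuous_lebesgue_measurable)
       (auto intro!: continuous_on_compose2[of UNIV \<eta>] continuous_intros)
qed

text \<open>All the smoothness sits in the kernel. Its partial derivatives are uniformly continuous,
  so its first-order remainder is small relative to the norm of h, uniformly in the base point, and
  can be integrated against \<open>\<bar>w\<bar>\<close>.\<close>

lemma conv_has_derivative:
  fixes w :: "'a::euclidean_space \<Rightarrow> real"
  assumes w: "integrable lebesgue w" and \<eta>: "Ck 1 \<eta>" and z: "\<And>x. R \<le> norm x \<Longrightarrow> \<eta> x = 0"
  shows "((\<lambda>x. \<integral>y. \<eta> (x - y) * w y \<partial>lebesgue) has_derivative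
          (\<lambda>h. \<Sum>b\<in>Basis. (h \<bullet> b) * (\<integral>y. pd \<eta> b (x - y) * w y \<partial>lebesgue))) (at x)"
proof -
  have dif: "\<eta> differentiable (at x)" for x using \<eta> by simp
  have cpd: "continuous_on UNIV (pd \<eta> b)" if "b \<in> Basis" for b using \<eta> that by simp
  have c\<eta>: "continuous_on UNIV \<eta>" using \<eta> by (rule Ck_continuous)
  \<comment> \<open>The derivative is known to vanish only strictly outside radius \<open>R\<close>;
    the larger radius restores the non-strict form.\<close>
  have zpd: "pd \<eta> b x = 0" if "R + 1 \<le> norm x" for b x
    using pd_eq_0_outside[of R \<eta> x b] z that by auto
  have int_pd: "integrable lebesgue (\<lambda>y. pd \<eta> b (x - y) * w y)" if "b \<in> Basis" for b x
    using conv_integrable[OF w cpd[OF that] zpd] by simp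
  note int_\<eta> = conv_integrable[OF w c\<eta> z]
  define W where "W = (\<integral>y. \<bar>w y\<bar> \<partial>lebesgue)"
  have "W \<ge> 0" by (simp add: W_def)
  show ?thesis
    unfolding has_derivative_at2
  proof (intro conjI)
    show "bounded_linear (\<lambda>h. \<Sum>b\<in>Basis. (h \<bullet> b) * (\<integral>y. pd \<eta> b (x - y) * w y \<partial>lebesgue))"
      by (intro bounded_linear_sum bounded_linear_mult_const bounded_linear_inner_left)
  next
    show "((\<lambda>y. (1 / norm (y - x)) *\<^sub>R ((\<integral>ya. \<eta> (y - ya) * w ya \<partial>lebesgue) -
         ((\<integral>y. \<eta> (x - y) * w y \<partial>lebesgue) + (\<Sum>b\<in>Basis. ((y - x) \<bullet> b) * (\<integral>y. pd \<eta> b (x - y) * w y \<partial>lebesgue)))))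
         \<longlongrightarrow> 0) (at x)" (is "(?Q \<longlongrightarrow> 0) (at x)")
    proof (rule tendstoI)
      fix e :: real assume "0 < e"
      \<comment> \<open>Chosen so that the final bound is e W / (2 (W + 1)); the added 1 covers W =
        0.\<close>
      define e' where "e' = e / (2 * real DIM('a) * (W + 1))"
      have "e' > 0" using \<open>0 < e\<close> \<open>W \<ge> 0\<close> by (simp add: e'_def)
      have "\<exists>d>0. \<forall>x h. norm h < d \<longrightarrow> \<bar>pd \<eta> b (x + h) - pd \<eta> b x\<bar> < e'" if "b \<in> Basis" for b
        using uniformly_continuous_compact_support[OF cpd[OF that] zpd \<open>e' > 0\<close>] by metis
      then obtain D where D: "\<And>b. b \<in> Basis \<Longrightarrow> D b > 0"
        "\<And>b x h. b \<in> Basis \<Longrightarrow> norm h < D b \<Longrightarrow> \<bar>pd \<eta> b (x + h) - pd \<eta> b x\<bar> < e'"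
        by metis
      define d where "d = Min (D ` Basis)"
      have "d > 0" using D(1) by (auto simp: d_def)
      have dD: "d \<le> D b" if "b \<in> Basis" for b using that by (auto simp: d_def)
      have rem: "\<bar>\<eta> (x + h) - \<eta> x - (\<Sum>b\<in>Basis. (h \<bullet> b) * pd \<eta> b x)\<bar> \<le> real DIM('a) * e' * norm h"
        if "norm h < d" for x h
      proof -
        obtain s where s: "0 < s" "s < 1" "\<eta> (x + h) - \<eta> x = (\<Sum>b\<in>Basis. (h \<bullet> b) * pd \<eta> b (x + s *\<^sub>R h))"
          using mvt_frechet[OF dif] by metis
        have ns: "norm (s *\<^sub>R h) < d" using s that mult_left_le_one_le[of "norm h" s] by simp
        have "\<bar>\<eta> (x + h) - \<eta> x - (\<Sum>b\<in>Basis. (h \<bullet> b) * pd \<eta> b x)\<bar>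
            = \<bar>\<Sum>b\<in>Basis. (h \<bullet> b) * (pd \<eta> b (x + s *\<^sub>R h) - pd \<eta> b x)\<bar>"
          by (simp add: s(3) sum_subtractf right_diff_distrib)
        also have "\<dots> \<le> (\<Sum>b\<in>(Basis::'a set). norm h * e')"
        proof (rule order_trans[OF sum_abs], rule sum_mono)
          fix b :: 'a assume b: "b \<in> Basis"
          show "\<bar>h \<bullet> b * (pd \<eta> b (x + s *\<^sub>R h) - pd \<eta> b x)\<bar> \<le> norm h * e'"
            unfolding abs_mult
            using D(2)[OF b, of "s *\<^sub>R h" x] ns dD[OF b] Basis_le_norm[OF b, of h]
            by (intro mult_mono) auto
        qed
        finally show ?thesis by (simp add: mult_ac)
      qed
      show "\<forall>\<^sub>F y in at x. dist (?Q y) 0 < e"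
        unfolding eventually_at
      proof (intro exI conjI ballI impI)
        fix y assume y: "y \<noteq> x \<and> dist y x < d"
        define h where "h = y - x"
        have h: "y = x + h" "h \<noteq> 0" "norm h < d" using y by (auto simp: h_def dist_norm)
        have "(\<integral>ya. \<eta> (y - ya) * w ya \<partial>lebesgue) -
           ((\<integral>y. \<eta> (x - y) * w y \<partial>lebesgue) + (\<Sum>b\<in>Basis. (h \<bullet> b) * (\<integral>y. pd \<eta> b (x - y) * w y \<partial>lebesgue)))
          = (\<integral>ya. (\<eta> (y - ya) * w ya - \<eta> (x - ya) * w ya - (\<Sum>b\<in>Basis. (h \<bullet> b) * (pd \<eta> b (x - ya) * w ya))) \<partial>lebesgue)"
          using int_\<eta> int_pd by (simp add: Bochner_Integration.integral_sum)
        also have "\<bar>\<dots>\<bar> \<le> (\<integral>ya. real DIM('a) * e' * norm h * \<bar>w ya\<bar> \<partial>lebesgue)"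
        proof (rule integral_abs_bound_integral)
          fix ya
          have "\<eta> (y - ya) * w ya - \<eta> (x - ya) * w ya - (\<Sum>b\<in>Basis. (h \<bullet> b) * (pd \<eta> b (x - ya) * w ya))
            = (\<eta> ((x - ya) + h) - \<eta> (x - ya) - (\<Sum>b\<in>Basis. (h \<bullet> b) * pd \<eta> b (x - ya))) * w ya"
            by (simp add: h algebra_simps sum_distrib_left)
          then show "\<bar>\<eta> (y - ya) * w ya - \<eta> (x - ya) * w ya - (\<Sum>b\<in>Basis. (h \<bullet> b) * (pd \<eta> b (x - ya) * w ya))\<bar>
            \<le> real DIM('a) * e' * norm h * \<bar>w ya\<bar>"
            using rem[OF h(3), of "x - ya"] by (simp add: abs_mult mult_right_mono)
        qed (use int_\<eta> int_pd w in auto)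
        also have "\<dots> = real DIM('a) * e' * norm h * W"
          by (simp add: W_def)
        finally have "\<bar>(\<integral>ya. \<eta> (y - ya) * w ya \<partial>lebesgue) -
           ((\<integral>y. \<eta> (x - y) * w y \<partial>lebesgue) + (\<Sum>b\<in>Basis. (h \<bullet> b) * (\<integral>y. pd \<eta> b (x - y) * w y \<partial>lebesgue)))\<bar>
           \<le> real DIM('a) * e' * norm h * W" .
        then have "norm (?Q y) \<le> real DIM('a) * e' * W"
          using h(2) by (simp add: h_def abs_mult field_simps)
        also have "\<dots> = e * (W / (2 * (W + 1)))"
          by (simp add: e'_def)
        also have "\<dots> < e * 1"
          using \<open>0 < e\<close> \<open>W \<ge> 0\<close> by (intro mult_strict_left_mono) (auto simp: field_simps)
        finally show "dist (?Q y) 0 < e" by simp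
      qed (use \<open>d > 0\<close> in auto)
    qed
  qed
qed

text \<open>Each derivative falls on the kernel, whose partial derivatives are again smooth with
  compact support; the support radius grows by 1 per step, so \<open>R\<close> is generalized in the
  induction.\<close>

lemma Ck_conv:
  fixes w :: "'a::euclidean_space \<Rightarrow> real"
  assumes "integrable lebesgue w" "\<And>k. Ck k \<eta>" "\<And>x. R \<le> norm x \<Longrightarrow> \<eta> x = 0"
  shows "Ck k (\<lambda>x. \<integral>y. \<eta> (x - y) * w y \<partial>lebesgue)"
  using assms(2,3)
proof (induction k arbitrary: \<eta> R)
  case 0
  note D = conv_has_derivative[OF assms(1) 0(1)[of 1] 0(2)]
  show ?case
    unfolding Ck.simps by (intro continuous_at_imp_continuous_on ballI has_derivative_continuous[OF D])
next
  case (Suc k)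
  note D = conv_has_derivative[OF assms(1) Suc.prems(1)[of 1] Suc.prems(2)]
  have pd: "pd (\<lambda>x. \<integral>y. \<eta> (x - y) * w y \<partial>lebesgue) b = (\<lambda>x. \<integral>y. pd \<eta> b (x - y) * w y \<partial>lebesgue)"
    if "b \<in> Basis" for b
    using pd_eq[OF D] that
    by (auto simp: fun_eq_iff inner_Basis if_distrib if_distribR sum.delta cong: if_cong)
  have "Ck k (\<lambda>x. \<integral>y. pd \<eta> b (x - y) * w y \<partial>lebesgue)" if "b \<in> Basis" for b
  proof (rule Suc.IH)
    show "Ck j (pd \<eta> b)" for j using Suc.prems(1)[of "Suc j"] that by simp
    show "pd \<eta> b x = 0" if "R + 1 \<le> norm x" for x
      using pd_eq_0_outside[of R \<eta> x b] Suc.prems(2) that by auto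
  qed
  then show ?case using D pd by (auto simp: differentiable_def)
qed

text \<open>Jensen's inequality for the probability density \<open>\<eta>\<close>: the tangent
  inequality is integrated at the weighted mean of \<open>\<bar>h\<bar>\<close>, where its linear
  part cancels. The right side is an \<open>nn_integral\<close> so that an infinite value is
  covered.\<close>

lemma integral_jensen_powr:
  assumes p: "1 \<le> p" and \<eta>: "\<And>x. 0 \<le> \<eta> x" "integrable M \<eta>" "(\<integral>x. \<eta> x \<partial>M) = 1"
    and h: "h \<in> borel_measurable M" "integrable M (\<lambda>x. \<eta> x * h x)"
  shows "ennreal (\<bar>\<integral>x. \<eta> x * h x \<partial>M\<bar> powr p) \<le> (\<integral>\<^sup>+x. ennreal (\<eta> x * \<bar>h x\<bar> powr p) \<partial>M)"
proof (cases "(\<integral>\<^sup>+x. ennreal (\<eta> x * \<bar>h x\<bar> powr p) \<partial>M) = \<infinity>")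
  case False
  have [measurable]: "\<eta> \<in> borel_measurable M" "h \<in> borel_measurable M" using \<eta> h by auto
  have int: "integrable M (\<lambda>x. \<eta> x * \<bar>h x\<bar> powr p)"
    using False \<eta>(1) by (intro integrableI_nonneg) (auto simp: top.not_eq_extremum)
  have "integrable M (\<lambda>x. \<bar>\<eta> x * h x\<bar>)" using h(2) by simp
  then have int1: "integrable M (\<lambda>x. \<eta> x * \<bar>h x\<bar>)" by (simp add: abs_mult \<eta>(1))
  define m where "m = (\<integral>x. \<eta> x * \<bar>h x\<bar> \<partial>M)"
  have "0 \<le> m" unfolding m_def using \<eta>(1) by simp
  have "\<bar>\<integral>x. \<eta> x * h x \<partial>M\<bar> \<le> m"
    unfolding m_def using integral_abs_bound[of M "\<lambda>x. \<eta> x * h x"] by (simp add: abs_mult \<eta>(1))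
  then have "\<bar>\<integral>x. \<eta> x * h x \<partial>M\<bar> powr p \<le> m powr p"
    using p by (intro powr_mono2) auto
  also have "m powr p = (\<integral>x. \<eta> x * (m powr p - p * m powr (p - 1) * m) + (p * m powr (p - 1)) * (\<eta> x * \<bar>h x\<bar>) \<partial>M)"
    using \<eta> int1 by (simp add: m_def[symmetric])
  also have "\<dots> \<le> (\<integral>x. \<eta> x * \<bar>h x\<bar> powr p \<partial>M)"
  proof (rule integral_mono)
    fix x
    have "\<eta> x * (m powr p + p * m powr (p - 1) * (\<bar>h x\<bar> - m)) \<le> \<eta> x * \<bar>h x\<bar> powr p"
      using powr_tangent[OF p _ \<open>0 \<le> m\<close>, of "\<bar>h x\<bar>"] \<eta>(1) by (intro mult_left_mono) auto
    then show "\<eta> x * (m powr p - p * m powr (p - 1) * m) + (p * m powr (p - 1)) * (\<eta> x * \<bar>h x\<bar>) \<le> \<eta> x * \<bar>h x\<bar> powr p"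
      by (simp add: algebra_simps)
  qed (use \<eta> int int1 in auto)
  finally show ?thesis
    using \<eta>(1) by (subst nn_integral_eq_integral[OF int]) (auto intro: ennreal_leI)
qed simp

text \<open>The function is first truncated in size and in support, then the truncation is
  approximated by continuous functions obeying the same bounds, so that dominated convergence
  applies both times.\<close>

lemma Lp_dense_continuous:
  fixes f :: "'a::euclidean_space \<Rightarrow> real"
  assumes f [measurable]: "f \<in> borel_measurable borel" and fp: "integrable lborel (\<lambda>x. \<bar>f x\<bar> powr p)"
    and p: "1 \<le> p" and e: "0 < e"
  obtains g R where "continuous_on UNIV g" "\<And>x. R \<le> norm x \<Longrightarrow> g x = 0"
    "integrable lborel (\<lambda>x. \<bar>f x - g x\<bar> powr p)" "(\<integral>x. \<bar>f x - g x\<bar> powr p \<partial>lborel) < e"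
proof -
  have p0: "0 < p" using p by simp
  \<comment> \<open>Two errors of size \<open>c\<close>, added with the constant
    \<open>2 powr p\<close> of \<open>powr_add_le\<close>, make up \<open>e\<close>.\<close>
  define c where "c = e / (2 * 2 powr p)"
  have "c > 0" using e by (simp add: c_def)
  define F where "F M x = (if \<bar>f x\<bar> \<le> real M \<and> norm x \<le> real M then f x else 0)" for M x
  have [measurable]: "F M \<in> borel_measurable borel" for M unfolding F_def by measurable
  have "(\<lambda>M. \<integral>x. \<bar>f x - F M x\<bar> powr p \<partial>lborel) \<longlonglongrightarrow> (\<integral>x. 0 \<partial>(lborel::'a measure))"
  proof (rule integral_dominated_convergence[where w = "\<lambda>x. \<bar>f x\<bar> powr p"])
    show "AE x in lborel. (\<lambda>M. \<bar>f x - F M x\<bar> powr p) \<longlonglongrightarrow> 0"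
    proof (rule AE_I2, rule tendsto_eventually)
      fix x
      obtain N where "max \<bar>f x\<bar> (norm x) \<le> real N" using real_arch_simple by blast
      then show "\<forall>\<^sub>F M in sequentially. \<bar>f x - F M x\<bar> powr p = 0"
        using p by (intro eventually_sequentiallyI[of N]) (auto simp: F_def)
    qed
    show "AE x in lborel. norm (\<bar>f x - F M x\<bar> powr p) \<le> \<bar>f x\<bar> powr p" for M
      by (rule AE_I2) (auto simp: F_def)
  qed (use fp in auto)
  then have "\<forall>\<^sub>F M in sequentially. (\<integral>x. \<bar>f x - F M x\<bar> powr p \<partial>lborel) < c"
    using \<open>c > 0\<close> by (intro order_tendstoD(2)) auto
  then obtain M where M: "(\<integral>x. \<bar>f x - F M x\<bar> powr p \<partial>lborel) < c"
    by (auto simp: eventually_sequentially)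
  have iM: "integrable lborel (\<lambda>x. \<bar>f x - F M x\<bar> powr p)"
    by (rule Bochner_Integration.integrable_bound[OF fp]) (auto simp: F_def)
  \<comment> \<open>Lebesgue measurability itself supplies the approximants: by
    \<open>measurable_on\<close> the truncation is an almost everywhere limit of continuous
    functions. They are then clipped and multiplied by the cutoff \<open>\<kappa>\<close>, which is
    1 on the support of \<open>F M\<close>.\<close>
  have "F M \<in> borel_measurable lebesgue" by (simp add: measurable_completion)
  then have "F M measurable_on UNIV"
    by (simp add: measurable_on_iff_borel_measurable)
  then obtain N g where N: "negligible N" and g: "\<And>n. continuous_on UNIV (g n)"
    "\<And>x. x \<notin> N \<Longrightarrow> (\<lambda>n::nat. g n x) \<longlonglongrightarrow> F M x"
    unfolding measurable_on_def by auto
  define \<kappa> where "\<kappa> x = max 0 (min 1 (real M + 1 - norm x))" for x :: 'a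
  define G where "G n x = \<kappa> x * max (- real M) (min (real M) (g n x))" for n x
  have cG: "continuous_on UNIV (G n)" for n
    unfolding G_def \<kappa>_def by (intro continuous_intros g)
  have zG: "G n x = 0" if "real M + 1 \<le> norm x" for n x using that by (simp add: G_def \<kappa>_def)
  have [measurable]: "G n \<in> borel_measurable borel" for n using cG by (rule borel_measurable_continuous_onI)
  have kF: "\<kappa> x * F M x = F M x" for x by (auto simp: \<kappa>_def F_def)
  have bd: "\<bar>F M x - G n x\<bar> powr p \<le> (2 * real M) powr p * indicator (cball 0 (real M + 1)) x" for n x
  proof (cases "norm x \<le> real M + 1")
    case True
    have "\<bar>F M x - G n x\<bar> = \<kappa> x * \<bar>F M x - max (- real M) (min (real M) (g n x))\<bar>"
    proof -
      have "F M x - G n x = \<kappa> x * (F M x - max (- real M) (min (real M) (g n x)))"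
        unfolding G_def right_diff_distrib kF ..
      then show ?thesis by (simp add: abs_mult \<kappa>_def)
    qed
    also have "\<dots> \<le> 1 * (2 * real M)"
      by (intro mult_mono) (auto simp: \<kappa>_def F_def)
    finally show ?thesis using True p by (auto intro!: powr_mono2)
  next
    case False
    then show ?thesis using zG[of x n] p by (auto simp: F_def)
  qed
  have iw: "integrable lborel (\<lambda>x::'a. (2 * real M) powr p * indicator (cball 0 (real M + 1)) x)"
    by (intro integrable_mult_right integrable_real_indicator) (use emeasure_lborel_cball_finite[of "0::'a" "real M + 1"] in \<open>auto simp: less_top\<close>)
  have iG: "integrable lborel (\<lambda>x. \<bar>F M x - G n x\<bar> powr p)" for n
    by (rule Bochner_Integration.integrable_bound[OF iw]) (use bd in auto)
  have "(\<lambda>n. \<integral>x. \<bar>F M x - G n x\<bar> powr p \<partial>lborel) \<longlonglongrightarrow> (\<integral>x. 0 \<partial>(lborel::'a measure))"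
  proof (rule integral_dominated_convergence[OF _ _ iw])
    have "AE x in lborel. x \<notin> N"
      using N by (metis AE_completion_iff AE_not_in negligible_iff_null_sets)
    then show "AE x in lborel. (\<lambda>n. \<bar>F M x - G n x\<bar> powr p) \<longlonglongrightarrow> 0"
    proof eventually_elim
      case (elim x)
      have "(\<lambda>n. G n x) \<longlonglongrightarrow> \<kappa> x * max (- real M) (min (real M) (F M x))"
        unfolding G_def by (intro tendsto_intros g elim)
      also have "\<kappa> x * max (- real M) (min (real M) (F M x)) = \<kappa> x * F M x"
        by (auto simp: F_def max_def min_def)
      finally have "(\<lambda>n. \<bar>F M x - G n x\<bar> powr p) \<longlonglongrightarrow> \<bar>F M x - F M x\<bar> powr p"
        unfolding kF using p0 by (intro tendsto_powr2 tendsto_intros) auto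
      then show ?case using p by simp
    qed
    show "AE x in lborel. norm (\<bar>F M x - G n x\<bar> powr p) \<le> (2 * real M) powr p * indicator (cball 0 (real M + 1)) x" for n
      by (rule AE_I2) (use bd in simp)
  qed auto
  then have "\<forall>\<^sub>F n in sequentially. (\<integral>x. \<bar>F M x - G n x\<bar> powr p \<partial>lborel) < c"
    using \<open>c > 0\<close> by (intro order_tendstoD(2)) auto
  then obtain n where n: "(\<integral>x. \<bar>F M x - G n x\<bar> powr p \<partial>lborel) < c"
    by (auto simp: eventually_sequentially)
  have le: "\<bar>f x - G n x\<bar> powr p \<le> 2 powr p * (\<bar>f x - F M x\<bar> powr p + \<bar>F M x - G n x\<bar> powr p)" for x
  proof -
    have "\<bar>f x - G n x\<bar> powr p \<le> (\<bar>f x - F M x\<bar> + \<bar>F M x - G n x\<bar>) powr p"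
      using p by (intro powr_mono2) auto
    also have "\<dots> \<le> 2 powr p * (\<bar>f x - F M x\<bar> powr p + \<bar>F M x - G n x\<bar> powr p)"
      using p by (intro powr_add_le) auto
    finally show ?thesis .
  qed
  show ?thesis
  proof (rule that[of "G n" "real M + 1"])
    have iS: "integrable lborel (\<lambda>x. 2 powr p * (\<bar>f x - F M x\<bar> powr p + \<bar>F M x - G n x\<bar> powr p))"
      using iM iG by simp
    show "integrable lborel (\<lambda>x. \<bar>f x - G n x\<bar> powr p)"
      by (rule Bochner_Integration.integrable_bound[OF iS]) (auto intro!: AE_I2 order_trans[OF le] abs_ge_self simp del: abs_mult)
    then have "(\<integral>x. \<bar>f x - G n x\<bar> powr p \<partial>lborel) \<le> (\<integral>x. 2 powr p * (\<bar>f x - F M x\<bar> powr p + \<bar>F M x - G n x\<bar> powr p) \<partial>lborel)"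
      by (intro integral_mono iS le)
    also have "\<dots> = 2 powr p * ((\<integral>x. \<bar>f x - F M x\<bar> powr p \<partial>lborel) + (\<integral>x. \<bar>F M x - G n x\<bar> powr p \<partial>lborel))"
      using iM iG by simp
    also have "\<dots> < 2 powr p * (c + c)" using M n by (intro mult_strict_left_mono add_strict_mono) auto
    also have "\<dots> = e" by (simp add: c_def)
    finally show "(\<integral>x. \<bar>f x - G n x\<bar> powr p \<partial>lborel) < e" .
  qed (use cG zG in auto)
qed

lemma nn_integral_lborel_translate:
  fixes h :: "'a::euclidean_space \<Rightarrow> ennreal"
  assumes "h \<in> borel_measurable borel"
  shows "(\<integral>\<^sup>+x. h (x + z) \<partial>lborel) = (\<integral>\<^sup>+x. h x \<partial>lborel)"
proof -
  have "(\<integral>\<^sup>+x. h x \<partial>lborel) = (\<integral>\<^sup>+x. h x \<partial>distr lborel borel ((+) z))"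
    by (simp add: lborel_distr_plus)
  also have "\<dots> = (\<integral>\<^sup>+x. h (z + x) \<partial>lborel)" using assms by (subst nn_integral_distr) auto
  finally show ?thesis by (simp add: add.commute)
qed

text \<open>With g continuous and close to f, the increment of f splits into two copies of f - g, of
  equal integral by translation invariance, and the increment of g, which is uniformly small on a
  fixed ball. Two uses of \<open>powr_add_le\<close> give the factor 4^p.\<close>

lemma Lp_translation_continuous:
  fixes f :: "'a::euclidean_space \<Rightarrow> real"
  assumes f [measurable]: "f \<in> borel_measurable borel" and fp: "integrable lborel (\<lambda>x. \<bar>f x\<bar> powr p)"
    and p: "1 \<le> p" and e: "0 < e"
  obtains d where "0 < d"
    "\<And>z. norm z < d \<Longrightarrow> (\<integral>\<^sup>+x. ennreal (\<bar>f (x + z) - f x\<bar> powr p) \<partial>lborel) \<le> ennreal e"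
proof -
  define c where "c = e / (3 * 4 powr p)"
  have "c > 0" using e by (simp add: c_def)
  obtain g R where g: "continuous_on UNIV g" "\<And>x. R \<le> norm x \<Longrightarrow> g x = 0"
    "integrable lborel (\<lambda>x. \<bar>f x - g x\<bar> powr p)" "(\<integral>x. \<bar>f x - g x\<bar> powr p \<partial>lborel) < c"
    using Lp_dense_continuous[OF f fp p \<open>c > 0\<close>] by blast
  have [measurable]: "g \<in> borel_measurable borel" using g(1) by (rule borel_measurable_continuous_onI)
  have fg: "(\<integral>\<^sup>+x. ennreal (\<bar>f x - g x\<bar> powr p) \<partial>lborel) \<le> ennreal c"
    using g(4) by (subst nn_integral_eq_integral[OF g(3)]) (auto intro: ennreal_leI)
  \<comment> \<open>\<open>V\<close> bounds the volume of the ball carrying all increments of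
    \<open>g\<close>, and the added 1 makes it positive; \<open>k\<close> is then chosen with k^p V
    = c.\<close>
  define V where "V = measure lborel (cball (0::'a) (R + 1)) + 1"
  have "V > 0" by (simp add: V_def add_nonneg_pos)
  define k where "k = (c / V) powr (1 / p)"
  have "k > 0" using \<open>c > 0\<close> \<open>V > 0\<close> by (simp add: k_def)
  have kp: "k powr p * V = c" using \<open>c > 0\<close> \<open>V > 0\<close> p by (simp add: k_def powr_powr)
  obtain d where d: "0 < d" "d \<le> 1" "\<And>x h. norm h < d \<Longrightarrow> \<bar>g (x + h) - g x\<bar> < k"
    using uniformly_continuous_compact_support[OF g(1,2) \<open>k > 0\<close>] by blast
  show ?thesis
  proof (rule that[OF d(1)])
    fix z :: 'a assume z: "norm z < d"
    have le: "\<bar>f (x + z) - f x\<bar> powr p \<le> 4 powr p * (\<bar>f (x + z) - g (x + z)\<bar> powr p + (\<bar>f x - g x\<bar> powr p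
        + k powr p * indicator (cball 0 (R + 1)) x))" for x
    proof -
      have gk: "\<bar>g (x + z) - g x\<bar> powr p \<le> k powr p * indicator (cball 0 (R + 1)) x"
      proof (cases "norm x \<le> R + 1")
        case False
        then have "R \<le> norm x" "R \<le> norm (x + z)"
          using z d(2) norm_triangle_ineq4[of "x + z" z] by auto
        then show ?thesis using g(2) p by simp
      qed (use d(3)[OF z, of x] p in \<open>auto intro!: powr_mono2\<close>)
      have "\<bar>f (x + z) - f x\<bar> powr p \<le> (\<bar>f (x + z) - g (x + z)\<bar> + (\<bar>f x - g x\<bar> + \<bar>g (x + z) - g x\<bar>)) powr p"
        using p by (intro powr_mono2) auto
      also have "\<dots> \<le> 2 powr p * (\<bar>f (x + z) - g (x + z)\<bar> powr p + (\<bar>f x - g x\<bar> + \<bar>g (x + z) - g x\<bar>) powr p)"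
        using p by (intro powr_add_le) auto
      also have "\<dots> \<le> 2 powr p * (2 powr p * \<bar>f (x + z) - g (x + z)\<bar> powr p + 2 powr p * (\<bar>f x - g x\<bar> powr p + \<bar>g (x + z) - g x\<bar> powr p))"
      proof (intro mult_left_mono add_mono)
        have "1 \<le> 2 powr p" using p by (intro ge_one_powr_ge_zero) auto
        then show "\<bar>f (x + z) - g (x + z)\<bar> powr p \<le> 2 powr p * \<bar>f (x + z) - g (x + z)\<bar> powr p"
          using mult_right_mono[of 1 "2 powr p" "\<bar>f (x + z) - g (x + z)\<bar> powr p"] by simp
      qed (use p in \<open>auto intro!: powr_add_le\<close>)
      also have "\<dots> = 4 powr p * (\<bar>f (x + z) - g (x + z)\<bar> powr p + (\<bar>f x - g x\<bar> powr p + \<bar>g (x + z) - g x\<bar> powr p))"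
        using powr_mult[of 2 2 p] by (simp add: algebra_simps)
      also have "\<dots> \<le> 4 powr p * (\<bar>f (x + z) - g (x + z)\<bar> powr p + (\<bar>f x - g x\<bar> powr p + k powr p * indicator (cball 0 (R + 1)) x))"
        using gk by (intro mult_left_mono add_mono) auto
      finally show ?thesis .
    qed
    have "(\<integral>\<^sup>+x. ennreal (\<bar>f (x + z) - f x\<bar> powr p) \<partial>lborel) \<le>
      (\<integral>\<^sup>+x. ennreal (4 powr p) * (ennreal (\<bar>f (x + z) - g (x + z)\<bar> powr p) + (ennreal (\<bar>f x - g x\<bar> powr p)
        + ennreal (k powr p) * indicator (cball 0 (R + 1)) x)) \<partial>lborel)"
    proof (rule nn_integral_mono)
      fix x
      have "ennreal (\<bar>f (x + z) - f x\<bar> powr p) \<le> ennreal (4 powr p * (\<bar>f (x + z) - g (x + z)\<bar> powr p +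
          (\<bar>f x - g x\<bar> powr p + k powr p * indicator (cball 0 (R + 1)) x)))"
        by (rule ennreal_leI[OF le])
      also have "\<dots> = ennreal (4 powr p) * (ennreal (\<bar>f (x + z) - g (x + z)\<bar> powr p) + (ennreal (\<bar>f x - g x\<bar> powr p)
        + ennreal (k powr p) * indicator (cball 0 (R + 1)) x))"
        by (cases "x \<in> cball 0 (R + 1)") (simp_all add: ennreal_mult ennreal_plus del: mem_cball_0 mem_cball)
      finally show "ennreal (\<bar>f (x + z) - f x\<bar> powr p) \<le> ennreal (4 powr p) * (ennreal (\<bar>f (x + z) - g (x + z)\<bar> powr p) + (ennreal (\<bar>f x - g x\<bar> powr p)
        + ennreal (k powr p) * indicator (cball 0 (R + 1)) x))" .
    qed
    also have "\<dots> = ennreal (4 powr p) * ((\<integral>\<^sup>+x. ennreal (\<bar>f (x + z) - g (x + z)\<bar> powr p) \<partial>lborel) +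
        ((\<integral>\<^sup>+x. ennreal (\<bar>f x - g x\<bar> powr p) \<partial>lborel) + ennreal (k powr p) * emeasure lborel (cball (0::'a) (R+1))))"
    proof -
      define A B C where "A = (\<lambda>x. ennreal (\<bar>f (x + z) - g (x + z)\<bar> powr p))"
        and "B = (\<lambda>x. ennreal (\<bar>f x - g x\<bar> powr p))" and "C = (\<lambda>x. ennreal (k powr p) * indicator (cball 0 (R + 1)) (x::'a))"
      have "(\<lambda>x. f (x + z)) \<in> borel_measurable borel" "(\<lambda>x. g (x + z)) \<in> borel_measurable borel"
        by (rule measurable_compose[of "\<lambda>x. x + z" _ borel], simp, rule assms)
           (rule measurable_compose[of "\<lambda>x. x + z" _ borel], simp, rule borel_measurable_continuous_onI[OF g(1)])
      then have A: "A \<in> borel_measurable lborel"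
        unfolding A_def by simp
      have B: "B \<in> borel_measurable lborel"
        unfolding B_def by simp
      have C: "C \<in> borel_measurable lborel"
        unfolding C_def by (intro borel_measurable_times_ennreal borel_measurable_const borel_measurable_indicator)
          (simp only: sets_lborel, rule borel_closed, rule closed_cball)
      note [measurable] = A B C
      have "(\<integral>\<^sup>+x. ennreal (4 powr p) * (A x + (B x + C x)) \<partial>lborel) =
        ennreal (4 powr p) * (nn_integral lborel A + (nn_integral lborel B + nn_integral lborel C))"
        by (simp add: nn_integral_cmult nn_integral_add)
      moreover have "nn_integral lborel C = ennreal (k powr p) * emeasure lborel (cball (0::'a) (R+1))"
        unfolding C_def by (rule nn_integral_cmult_indicator) simp
      ultimately show ?thesis by (simp only: A_def B_def C_def)
    qed
    also have "\<dots> \<le> ennreal (4 powr p) * (ennreal c + (ennreal c + ennreal c))"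
    proof (intro mult_left_mono add_mono fg)
      have "(\<integral>\<^sup>+x. ennreal (\<bar>f (x + z) - g (x + z)\<bar> powr p) \<partial>lborel) = (\<integral>\<^sup>+x. ennreal (\<bar>f x - g x\<bar> powr p) \<partial>lborel)"
        by (rule nn_integral_lborel_translate[where h = "\<lambda>x. ennreal (\<bar>f x - g x\<bar> powr p)"]) measurable
      then show "(\<integral>\<^sup>+x. ennreal (\<bar>f (x + z) - g (x + z)\<bar> powr p) \<partial>lborel) \<le> ennreal c" using fg by simp
      have "emeasure lborel (cball (0::'a) (R+1)) = ennreal (measure lborel (cball (0::'a) (R+1)))"
        by (rule emeasure_eq_ennreal_measure) (use emeasure_lborel_cball_finite[of "0::'a" "R+1"] in simp)
      also have "\<dots> \<le> ennreal V" by (intro ennreal_leI) (simp add: V_def)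
      finally have "ennreal (k powr p) * emeasure lborel (cball (0::'a) (R+1)) \<le> ennreal (k powr p) * ennreal V"
        by (rule mult_left_mono) simp
      also have "\<dots> = ennreal c" using kp \<open>V > 0\<close> by (simp add: ennreal_mult[symmetric])
      finally show "ennreal (k powr p) * emeasure lborel (cball (0::'a) (R+1)) \<le> ennreal c" .
    qed auto
    also have "\<dots> = ennreal (4 powr p * (c + (c + c)))"
      using \<open>c > 0\<close> by (simp add: ennreal_plus[symmetric] ennreal_mult[symmetric] del: ennreal_plus)
    also have "4 powr p * (c + (c + c)) = e" by (simp add: c_def)
    finally show "(\<integral>\<^sup>+x. ennreal (\<bar>f (x + z) - f x\<bar> powr p) \<partial>lborel) \<le> ennreal e" .
  qed
qed

section \<open>Mollifiers\<close>

lemma lebesgue_integral_reflect: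
  fixes g :: "'a::euclidean_space \<Rightarrow> real"
  assumes [measurable]: "g \<in> borel_measurable borel"
  shows "(\<integral>z. g (x - z) \<partial>lborel) = (\<integral>z. g z \<partial>lborel)"
    and "integrable lborel (\<lambda>z. g (x - z)) \<longleftrightarrow> integrable lborel g"
proof -
  have eq: "lborel = distr lborel borel (\<lambda>z. x - z)"
    using lborel_affine[of "-1" x] by (simp add: density_1)
  have [measurable]: "(\<lambda>z. x - z) \<in> borel_measurable lborel" by simp
  show "(\<integral>z. g (x - z) \<partial>lborel) = (\<integral>z. g z \<partial>lborel)"
    by (subst (2) eq, subst integral_distr) auto
  show "integrable lborel (\<lambda>z. g (x - z)) \<longleftrightarrow> integrable lborel g"
    by (subst (2) eq, subst integrable_distr_eq) auto
qed

lemma bump_scaled_integrable: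
  assumes "0 < \<epsilon>"
  shows "integrable lborel (\<lambda>y::'a::euclidean_space. bump ((1 / \<epsilon>) *\<^sub>R y))"
proof (rule integrable_continuous_compact_support[where K = "cball 0 \<epsilon>"])
  show "continuous_on UNIV (\<lambda>y::'a. bump ((1 / \<epsilon>) *\<^sub>R y))"
    using Ck_continuous[OF Ck_affine[OF Ck_bump, of 0 0 "1 / \<epsilon>"]] by simp
qed (use assms in \<open>auto intro!: bump_eq_0 simp: field_simps\<close>)

lemma bump_scaled_integral_pos:
  assumes "0 < \<epsilon>"
  shows "0 < (\<integral>y. bump ((1 / \<epsilon>) *\<^sub>R y) \<partial>(lborel :: 'a::euclidean_space measure))"
proof -
  have "(\<integral>y. bump ((1 / \<epsilon>) *\<^sub>R y) \<partial>(lborel :: 'a measure)) \<noteq> 0"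
  proof
    assume "(\<integral>y. bump ((1 / \<epsilon>) *\<^sub>R y) \<partial>(lborel :: 'a measure)) = 0"
    then have "AE y in (lborel :: 'a measure). bump ((1 / \<epsilon>) *\<^sub>R y) = 0"
      using integral_nonneg_eq_0_iff_AE[OF bump_scaled_integrable[OF assms]] bump_nonneg by auto
    then have "AE y in (lborel :: 'a measure). y \<notin> ball 0 \<epsilon>"
    proof eventually_elim
      case (elim y)
      then show ?case using bump_pos_iff[of "(1 / \<epsilon>) *\<^sub>R y"] assms by (auto simp: field_simps)
    qed
    then have "ball (0::'a) \<epsilon> \<in> null_sets lborel"
      by (subst AE_iff_null_sets) auto
    then have "negligible (ball (0::'a) \<epsilon>)"
      by (simp add: negligible_iff_null_sets null_sets_completionI)
    then show False using open_not_negligible[of "ball (0::'a) \<epsilon>"] assms by simp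
  qed
  moreover have "0 \<le> (\<integral>y. bump ((1 / \<epsilon>) *\<^sub>R y) \<partial>(lborel :: 'a measure))"
    by (simp add: bump_nonneg)
  ultimately show ?thesis by linarith
qed

text \<open>Normalized at each scale by its own integral, so that no scaling rule for integrals is
  needed.\<close>

definition mollifier :: "real \<Rightarrow> 'a::euclidean_space \<Rightarrow> real" where
  "mollifier \<epsilon> z = bump ((1 / \<epsilon>) *\<^sub>R z) / (\<integral>y. bump ((1 / \<epsilon>) *\<^sub>R y) \<partial>(lborel :: 'a measure))"

lemma Ck_mollifier: "Ck k (mollifier \<epsilon>)"
proof -
  have "Ck k (\<lambda>z. inverse (\<integral>y. bump ((1 / \<epsilon>) *\<^sub>R y) \<partial>(lborel :: 'a measure)) * bump (0 + (1 / \<epsilon>) *\<^sub>R z))"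
    by (intro Ck_mult Ck_const Ck_affine Ck_bump)
  then show ?thesis by (simp add: mollifier_def[abs_def] field_simps)
qed

lemma mollifier_nonneg: "0 \<le> mollifier \<epsilon> z"
  by (simp add: mollifier_def bump_nonneg)

lemma mollifier_eq_0: "0 < \<epsilon> \<Longrightarrow> \<epsilon> \<le> norm z \<Longrightarrow> mollifier \<epsilon> z = 0"
  by (simp add: mollifier_def bump_eq_0 field_simps)

lemma mollifier_integral:
  assumes "0 < \<epsilon>"
  shows "integrable lborel (mollifier \<epsilon> :: 'a::euclidean_space \<Rightarrow> real)"
    "(\<integral>z. mollifier \<epsilon> z \<partial>(lborel :: 'a measure)) = 1"
  using bump_scaled_integrable[OF assms, where 'a = 'a] bump_scaled_integral_pos[OF assms, where 'a = 'a]
  by (auto simp: mollifier_def[abs_def])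

definition moll :: "real \<Rightarrow> ('a::euclidean_space \<Rightarrow> real) \<Rightarrow> 'a \<Rightarrow> real" where
  "moll \<epsilon> f x = (\<integral>y. mollifier \<epsilon> (x - y) * f y \<partial>lebesgue)"

lemma moll_cong_AE:
  fixes f g :: "'a::euclidean_space \<Rightarrow> real"
  assumes "AE x in lebesgue. f x = g x" "f \<in> borel_measurable lebesgue" "g \<in> borel_measurable lebesgue"
  shows "moll \<epsilon> f = moll \<epsilon> g"
proof
  fix x :: 'a
  have m: "(\<lambda>y. mollifier \<epsilon> (x - y)) \<in> borel_measurable lebesgue"
    using Ck_continuous[OF Ck_mollifier]
    by (intro continuous_lebesgue_measurable continuous_on_compose2[of UNIV "mollifier \<epsilon>" UNIV "\<lambda>y. x - y"]) (auto intro!: continuous_intros)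
  show "moll \<epsilon> f x = moll \<epsilon> g x"
    unfolding moll_def by (rule integral_cong_AE) (use assms m in auto)
qed

lemma Ck_moll: "integrable lebesgue f \<Longrightarrow> 0 < \<epsilon> \<Longrightarrow> Ck k (moll \<epsilon> f)"
  unfolding moll_def[abs_def] by (rule Ck_conv[where R = \<epsilon>]) (auto intro: Ck_mollifier mollifier_eq_0)

text \<open>The mollifier is a probability density, so Jensen moves the p-th power inside the
  convolution. After Tonelli the inner integral is the translation error, controlled for all shifts
  up to \<epsilon>.\<close>

lemma moll_Lp_le:
  fixes f :: "'a::euclidean_space \<Rightarrow> real"
  assumes f: "f \<in> borel_measurable borel" and i: "integrable lborel f"
    and fp: "integrable lborel (\<lambda>x. \<bar>f x\<bar> powr p)" and p: "1 \<le> p" and \<epsilon>: "0 < \<epsilon>" and "0 < e"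
    and d: "\<And>z. norm z \<le> \<epsilon> \<Longrightarrow> (\<integral>\<^sup>+x. ennreal (\<bar>f (x + z) - f x\<bar> powr p) \<partial>lborel) \<le> ennreal e"
  shows "(\<integral>\<^sup>+x. ennreal (\<bar>moll \<epsilon> f x - f x\<bar> powr p) \<partial>lborel) \<le> ennreal e"
proof -
  let ?\<eta> = "mollifier \<epsilon> :: 'a \<Rightarrow> real"
  have c\<eta>: "continuous_on UNIV ?\<eta>" by (rule Ck_continuous[OF Ck_mollifier])
  then have m\<eta>: "?\<eta> \<in> borel_measurable borel" by (rule borel_measurable_continuous_onI)
  have \<eta>: "integrable lborel ?\<eta>" "(\<integral>z. ?\<eta> z \<partial>lborel) = 1"
    using mollifier_integral[OF \<epsilon>] by auto
  have meq: "moll \<epsilon> f x = (\<integral>z. ?\<eta> z * f (x - z) \<partial>lborel)"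
    and mint: "integrable lborel (\<lambda>z. ?\<eta> z * f (x - z))" for x
  proof -
    have mm: "(\<lambda>y. ?\<eta> (x - y) * f y) \<in> borel_measurable borel"
      using m\<eta> f by simp
    have "integrable lebesgue f" using i f by (simp add: integrable_completion)
    then have "integrable lebesgue (\<lambda>y. ?\<eta> (x - y) * f y)"
      using conv_integrable[OF _ c\<eta>, of f \<epsilon>] mollifier_eq_0[OF \<epsilon>] by blast
    then have "integrable lborel (\<lambda>y. ?\<eta> (x - y) * f y)"
      using mm by (simp add: integrable_completion)
    then show "integrable lborel (\<lambda>z. ?\<eta> z * f (x - z))"
      using lebesgue_integral_reflect(2)[OF mm, of x] by simp
    have "moll \<epsilon> f x = (\<integral>y. ?\<eta> (x - y) * f y \<partial>lborel)"
      unfolding moll_def using mm by (simp add: integral_completion)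
    then show "moll \<epsilon> f x = (\<integral>z. ?\<eta> z * f (x - z) \<partial>lborel)"
      using lebesgue_integral_reflect(1)[OF mm, of x] by simp
  qed
  have fxz: "(\<lambda>x. f (x - z)) \<in> borel_measurable borel" "(\<lambda>z. f (x - z)) \<in> borel_measurable borel" for x z
    by (rule measurable_compose[OF _ f], simp)+
  have "(\<integral>\<^sup>+x. ennreal (\<bar>moll \<epsilon> f x - f x\<bar> powr p) \<partial>lborel)
      \<le> (\<integral>\<^sup>+x. \<integral>\<^sup>+z. ennreal (?\<eta> z * \<bar>f (x - z) - f x\<bar> powr p) \<partial>lborel \<partial>lborel)"
  proof (rule nn_integral_mono)
    fix x
    have "moll \<epsilon> f x - f x = (\<integral>z. ?\<eta> z * (f (x - z) - f x) \<partial>lborel)"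
      using \<eta> mint[of x] by (simp add: meq right_diff_distrib)
    moreover have "integrable lborel (\<lambda>z. ?\<eta> z * (f (x - z) - f x))"
      using \<eta> mint[of x] by (simp add: right_diff_distrib)
    ultimately show "ennreal (\<bar>moll \<epsilon> f x - f x\<bar> powr p) \<le> (\<integral>\<^sup>+z. ennreal (?\<eta> z * \<bar>f (x - z) - f x\<bar> powr p) \<partial>lborel)"
      using integral_jensen_powr[OF p mollifier_nonneg \<eta>, of "\<lambda>z. f (x - z) - f x"] fxz by simp
  qed
  also have "\<dots> = (\<integral>\<^sup>+z. \<integral>\<^sup>+x. ennreal (?\<eta> z * \<bar>f (x - z) - f x\<bar> powr p) \<partial>lborel \<partial>lborel)"
  proof (rule lborel_pair.Fubini')
    have "(\<lambda>zx. f (snd zx - fst zx)) \<in> borel_measurable (borel \<Otimes>\<^sub>M borel)"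
      by (rule measurable_compose[OF _ f]) simp
    moreover have "(\<lambda>zx::'a \<times> 'a. f (snd zx)) \<in> borel_measurable (borel \<Otimes>\<^sub>M borel)" "(\<lambda>zx::'a \<times> 'a. ?\<eta> (fst zx)) \<in> borel_measurable (borel \<Otimes>\<^sub>M borel)"
      by (rule measurable_compose[OF _ f], simp) (rule measurable_compose[OF _ m\<eta>], simp)
    ultimately have "(\<lambda>zx. ennreal (?\<eta> (fst zx) * \<bar>f (snd zx - fst zx) - f (snd zx)\<bar> powr p)) \<in> borel_measurable (borel \<Otimes>\<^sub>M borel)"
      by simp
    then show "(\<lambda>(z, x). ennreal (?\<eta> z * \<bar>f (x - z) - f x\<bar> powr p)) \<in> borel_measurable (lborel \<Otimes>\<^sub>M lborel)"
      by (simp add: case_prod_beta cong: measurable_cong_sets)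
  qed
  also have "\<dots> \<le> (\<integral>\<^sup>+z. ennreal (?\<eta> z) * ennreal e \<partial>lborel)"
  proof (rule nn_integral_mono)
    fix z :: 'a
    have "(\<integral>\<^sup>+x. ennreal (?\<eta> z * \<bar>f (x - z) - f x\<bar> powr p) \<partial>lborel) = ennreal (?\<eta> z) * (\<integral>\<^sup>+x. ennreal (\<bar>f (x + (- z)) - f x\<bar> powr p) \<partial>lborel)"
      using fxz f by (simp add: ennreal_mult mollifier_nonneg nn_integral_cmult)
    also have "\<dots> \<le> ennreal (?\<eta> z) * ennreal e"
    proof (cases "norm z \<le> \<epsilon>")
      case True
      then show ?thesis by (intro mult_left_mono d) auto
    qed (simp add: mollifier_eq_0 \<epsilon>)
    finally show "(\<integral>\<^sup>+x. ennreal (?\<eta> z * \<bar>f (x - z) - f x\<bar> powr p) \<partial>lborel) \<le> ennreal (?\<eta> z) * ennreal e" .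
  qed
  also have "\<dots> = ennreal e"
    using \<eta> m\<eta> by (simp add: nn_integral_multc nn_integral_eq_integral mollifier_nonneg)
  finally show ?thesis .
qed

text \<open>Tonelli on \<open>lborel\<close> asks for Borel functions, while elements of the
  function spaces are only Lebesgue measurable; f is replaced by a Borel representative, a change on
  a null set that \<open>moll\<close> does not see.\<close>

proposition moll_Lp_tendsto:
  fixes f :: "'a::euclidean_space \<Rightarrow> real"
  assumes i: "integrable lebesgue f" and fp: "integrable lebesgue (\<lambda>x. \<bar>f x\<bar> powr p)" and p: "1 \<le> p" and e: "0 < e"
  obtains d where "0 < d" "\<And>\<epsilon>. 0 < \<epsilon> \<Longrightarrow> \<epsilon> < d \<Longrightarrow>
    integrable lebesgue (\<lambda>x. \<bar>moll \<epsilon> f x - f x\<bar> powr p) \<and> (\<integral>x. \<bar>moll \<epsilon> f x - f x\<bar> powr p \<partial>lebesgue) \<le> e"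
proof -
  have fm: "f \<in> borel_measurable lebesgue" using i by simp
  then obtain g where g: "g \<in> borel_measurable borel" and ae: "AE x in lborel. f x = g x"
    using completion_ex_borel_measurable_real[of f lborel] by auto
  have ae': "AE x in lebesgue. f x = g x" using ae by (rule AE_completion)
  have gm: "g \<in> borel_measurable lebesgue" using g by (simp add: measurable_completion)
  have gi: "integrable lborel g"
    using integrable_cong_AE_imp[OF i gm] ae' g by (simp add: integrable_completion eq_commute)
  have "integrable lebesgue (\<lambda>x. \<bar>g x\<bar> powr p)"
    using ae' by (intro integrable_cong_AE_imp[OF fp]) (use gm in auto)
  then have gp: "integrable lborel (\<lambda>x. \<bar>g x\<bar> powr p)"
    using g by (simp add: integrable_completion)
  obtain d where d: "0 < d"
    "\<And>z. norm z < d \<Longrightarrow> (\<integral>\<^sup>+x. ennreal (\<bar>g (x + z) - g x\<bar> powr p) \<partial>lborel) \<le> ennreal e"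
    using Lp_translation_continuous[OF g gp p e] by blast
  show ?thesis
  proof (rule that[OF d(1)])
    fix \<epsilon> :: real assume \<epsilon>: "0 < \<epsilon>" "\<epsilon> < d"
    have eq: "moll \<epsilon> f = moll \<epsilon> g" by (rule moll_cong_AE[OF ae' fm gm])
    have "(\<integral>\<^sup>+x. ennreal (\<bar>moll \<epsilon> g x - g x\<bar> powr p) \<partial>lborel) \<le> ennreal e"
      using \<epsilon> by (intro moll_Lp_le[OF g gi gp p \<epsilon>(1) e] d(2)) auto
    also have "(\<integral>\<^sup>+x. ennreal (\<bar>moll \<epsilon> g x - g x\<bar> powr p) \<partial>lborel) = (\<integral>\<^sup>+x. ennreal (\<bar>moll \<epsilon> f x - f x\<bar> powr p) \<partial>lebesgue)"
      unfolding nn_integral_completion[symmetric, of lborel] eq using ae' by (intro nn_integral_cong_AE) auto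
    finally have le: "(\<integral>\<^sup>+x. ennreal (\<bar>moll \<epsilon> f x - f x\<bar> powr p) \<partial>lebesgue) \<le> ennreal e" .
    have mm: "moll \<epsilon> f \<in> borel_measurable lebesgue"
      using Ck_continuous[OF Ck_moll[OF i \<epsilon>(1)]] by (rule continuous_lebesgue_measurable)
    have int: "integrable lebesgue (\<lambda>x. \<bar>moll \<epsilon> f x - f x\<bar> powr p)"
      using le mm fm by (intro integrableI_nonneg) (auto intro: le_less_trans)
    then show "integrable lebesgue (\<lambda>x. \<bar>moll \<epsilon> f x - f x\<bar> powr p) \<and> (\<integral>x. \<bar>moll \<epsilon> f x - f x\<bar> powr p \<partial>lebesgue) \<le> e"
      using le e by (simp add: nn_integral_eq_integral)
  qed
qed

section \<open>Weak gradients on hyperbolic space\<close>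

text \<open>The reciprocal of the conformal factor. Being a polynomial it is smooth on the whole
  space, and it is positive exactly on the ball; smooth constructions are therefore written with it
  instead of \<open>hyp_factor\<close>.\<close>

definition hyp_dfac :: "'a::euclidean_space \<Rightarrow> real" where
  "hyp_dfac x = (1 - (norm x)\<^sup>2) / 2"

lemma hyp_dfac_pos: "x \<in> hyp_space \<Longrightarrow> 0 < hyp_dfac x"
  using abs_square_less_1[of "norm x"] by (simp add: hyp_dfac_def)

lemma hyp_factor_eq: "hyp_factor x = 1 / hyp_dfac x"
  by (simp add: hyp_factor_def hyp_dfac_def)

lemma hyp_factor_pos: "x \<in> hyp_space \<Longrightarrow> 0 < hyp_factor x"
  using hyp_dfac_pos by (simp add: hyp_factor_eq)

lemma hyp_dfac_factor: "x \<in> hyp_space \<Longrightarrow> hyp_dfac x * hyp_factor x = 1"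
  using hyp_dfac_pos[of x] by (simp add: hyp_factor_eq)

lemma Ck_dfac: "Ck k hyp_dfac"
  unfolding hyp_dfac_def[abs_def] divide_inverse
  by (intro Ck_mult Ck_diff Ck_const Ck_norm_sq)

lemma continuous_on_dfac: "continuous_on S hyp_dfac"
  using Ck_continuous[OF Ck_dfac] continuous_on_subset by blast

lemma continuous_on_factor: "S \<subseteq> hyp_space \<Longrightarrow> continuous_on S hyp_factor"
  unfolding hyp_factor_eq[abs_def]
  using hyp_dfac_pos by (force intro!: continuous_intros continuous_on_dfac)

lemma hyp_inner_eq: "hyp_inner x v w = (hyp_factor x)\<^sup>2 * (v \<bullet> w)"
  by (simp add: hyp_inner_def)

lemma hyp_norm_eq: "hyp_norm x v = \<bar>hyp_factor x\<bar> * norm v"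
  by (simp add: hyp_norm_def hyp_inner_def real_sqrt_mult norm_eq_sqrt_inner)

section \<open>The Riemannian measure of the ball model\<close>

lemma hyp_factor_measurable: "hyp_factor \<in> borel_measurable (lebesgue_on hyp_space)"
  using continuous_imp_measurable_on_sets_lebesgue[OF continuous_on_factor[OF subset_refl]] by simp

lemma space_hyp_measure [simp]: "space hyp_measure = hyp_space"
  by (simp add: hyp_measure_def)

lemma sets_hyp_measure: "sets hyp_measure = sets (lebesgue_on hyp_space)"
  by (simp add: hyp_measure_def)

lemma measurable_hyp: "borel_measurable hyp_measure = borel_measurable (lebesgue_on hyp_space)"
  by (rule measurable_cong_sets) (auto simp: sets_hyp_measure)

lemma continuous_measurable_hyp:
  "continuous_on hyp_space f \<Longrightarrow> f \<in> borel_measurable hyp_measure" for f :: "'a::euclidean_space \<Rightarrow> 'b::euclidean_space"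
  unfolding measurable_hyp by (rule continuous_imp_measurable_on_sets_lebesgue) auto

lemma hyp_factor_measurable' [measurable]: "hyp_factor \<in> borel_measurable hyp_measure"
  by (simp add: measurable_hyp hyp_factor_measurable)

lemma AE_hyp_iff:
  fixes P :: "'a::euclidean_space \<Rightarrow> bool"
  shows "(AE x in hyp_measure. P x) \<longleftrightarrow> (AE x in lebesgue. x \<in> hyp_space \<longrightarrow> P x)"
proof -
  have "(AE x in hyp_measure. P x) \<longleftrightarrow> (AE x in lebesgue_on hyp_space. 0 < ennreal (hyp_factor x ^ DIM('a)) \<longrightarrow> P x)"
    unfolding hyp_measure_def using hyp_factor_measurable[where 'a='a] by (intro AE_density) simp
  also have "\<dots> \<longleftrightarrow> (AE x in lebesgue. x \<in> hyp_space \<longrightarrow> 0 < ennreal (hyp_factor x ^ DIM('a)) \<longrightarrow> P x)"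
    by (rule AE_restrict_space_iff) auto
  also have "\<dots> \<longleftrightarrow> (AE x in lebesgue. x \<in> hyp_space \<longrightarrow> P x)"
    using zero_less_power[OF hyp_factor_pos] by (intro AE_cong) auto
  finally show ?thesis .
qed

lemma integrable_hyp_iff:
  fixes f :: "'a::euclidean_space \<Rightarrow> 'b::euclidean_space"
  assumes "f \<in> borel_measurable hyp_measure"
  shows "integrable hyp_measure f \<longleftrightarrow>
    integrable lebesgue (\<lambda>x. indicat_real hyp_space x *\<^sub>R (hyp_factor x ^ DIM('a) *\<^sub>R f x))"
proof -
  have "integrable hyp_measure f \<longleftrightarrow> integrable (lebesgue_on hyp_space) (\<lambda>x. hyp_factor x ^ DIM('a) *\<^sub>R f x)"
    unfolding hyp_measure_def using assms hyp_factor_measurable[where 'a='a] hyp_factor_pos[where 'a='a]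
    by (intro integrable_density) (auto simp: measurable_hyp intro!: AE_I2 less_imp_le)
  also have "\<dots> \<longleftrightarrow> integrable lebesgue (\<lambda>x. indicat_real hyp_space x *\<^sub>R (hyp_factor x ^ DIM('a) *\<^sub>R f x))"
    by (rule integrable_restrict_space) auto
  finally show ?thesis .
qed

lemma integral_hyp:
  fixes f :: "'a::euclidean_space \<Rightarrow> 'b::euclidean_space"
  assumes "f \<in> borel_measurable hyp_measure"
  shows "(\<integral>x. f x \<partial>hyp_measure) =
    (\<integral>x. indicat_real hyp_space x *\<^sub>R (hyp_factor x ^ DIM('a) *\<^sub>R f x) \<partial>lebesgue)"
proof -
  have "(\<integral>x. f x \<partial>hyp_measure) = (\<integral>x. hyp_factor x ^ DIM('a) *\<^sub>R f x \<partial>lebesgue_on hyp_space)"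
    unfolding hyp_measure_def using assms hyp_factor_measurable[where 'a='a] hyp_factor_pos[where 'a='a]
    by (intro integral_density) (auto simp: measurable_hyp intro!: AE_I2 less_imp_le)
  also have "\<dots> = (\<integral>x. indicat_real hyp_space x *\<^sub>R (hyp_factor x ^ DIM('a) *\<^sub>R f x) \<partial>lebesgue)"
    by (rule integral_restrict_space) auto
  finally show ?thesis .
qed

lemma emeasure_hyp_compact:
  fixes K :: "'a::euclidean_space set"
  assumes "compact K" "K \<subseteq> hyp_space"
  shows "K \<in> sets hyp_measure" "emeasure hyp_measure K < \<infinity>"
proof -
  have Kl: "K \<in> sets lebesgue" using lmeasurable_compact[OF assms(1)] by blast
  show K: "K \<in> sets hyp_measure" using Kl assms(2) by (auto simp: sets_hyp_measure sets_restrict_space_iff)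
  have "compact (hyp_factor ` K)" by (intro compact_continuous_image continuous_on_factor assms)
  then obtain B where B: "\<And>x. x \<in> K \<Longrightarrow> \<bar>hyp_factor x\<bar> \<le> B"
    by (metis bounded_iff compact_imp_bounded image_eqI real_norm_def)
  have "emeasure hyp_measure K = (\<integral>\<^sup>+x\<in>K. ennreal (hyp_factor x ^ DIM('a)) \<partial>lebesgue_on hyp_space)"
    unfolding hyp_measure_def using K hyp_factor_measurable[where 'a='a] by (intro emeasure_density) (auto simp: sets_hyp_measure)
  also have "\<dots> \<le> (\<integral>\<^sup>+x. ennreal (\<bar>B\<bar> ^ DIM('a)) * indicator K x \<partial>lebesgue_on hyp_space)"
  proof (rule nn_integral_mono)
    fix x
    show "ennreal (hyp_factor x ^ DIM('a)) * indicator K x \<le> ennreal (\<bar>B\<bar> ^ DIM('a)) * indicator K x"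
    proof (cases "x \<in> K")
      case True
      then have "hyp_factor x ^ DIM('a) \<le> \<bar>B\<bar> ^ DIM('a)"
        using B[of x] hyp_factor_pos[of x] assms(2) by (intro power_mono) auto
      then show ?thesis by (intro mult_right_mono ennreal_leI) auto
    qed simp
  qed
  also have "\<dots> = ennreal (\<bar>B\<bar> ^ DIM('a)) * emeasure (lebesgue_on hyp_space) K"
    using K by (intro nn_integral_cmult_indicator) (simp add: sets_hyp_measure)
  also have "\<dots> < \<infinity>"
  proof -
    have "emeasure (lebesgue_on hyp_space) K = emeasure lebesgue K"
      using assms(2) by (intro emeasure_restrict_space) auto
    also have "\<dots> < \<infinity>" using fmeasurableD2[OF lmeasurable_compact[OF assms(1)]] by (simp only: less_top infinity_ennreal_def)
    finally show ?thesis by (simp add: ennreal_mult_less_top)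
  qed
  finally show "emeasure hyp_measure K < \<infinity>" .
qed

lemma set_integrable_hyp_mult:
  fixes v :: "'a::euclidean_space \<Rightarrow> 'b::euclidean_space"
  assumes v: "set_integrable hyp_measure K v" and f: "f \<in> borel_measurable hyp_measure"
    and C: "\<And>x. x \<in> hyp_space \<Longrightarrow> \<bar>f x\<bar> \<le> C" and z: "\<And>x. x \<in> hyp_space \<Longrightarrow> x \<notin> K \<Longrightarrow> f x = 0"
  shows "integrable hyp_measure (\<lambda>x. f x *\<^sub>R v x)"
proof -
  have eq: "f x *\<^sub>R v x = f x *\<^sub>R (indicat_real K x *\<^sub>R v x)" if "x \<in> hyp_space" for x
    using z[OF that] by (cases "x \<in> K") auto
  have iv: "integrable hyp_measure (\<lambda>x. indicat_real K x *\<^sub>R v x)" using v by (simp add: set_integrable_def)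
  have "integrable hyp_measure (\<lambda>x. f x *\<^sub>R (indicat_real K x *\<^sub>R v x))"
  proof (rule Bochner_Integration.integrable_bound[of _ "\<lambda>x. C *\<^sub>R (indicat_real K x *\<^sub>R v x)"])
    show "AE x in hyp_measure. norm (f x *\<^sub>R (indicat_real K x *\<^sub>R v x)) \<le> norm (C *\<^sub>R (indicat_real K x *\<^sub>R v x))"
    proof (rule AE_I2)
      fix x :: 'a assume "x \<in> space hyp_measure"
      then have "\<bar>f x\<bar> \<le> \<bar>C\<bar>" using C[of x] by auto
      then show "norm (f x *\<^sub>R (indicat_real K x *\<^sub>R v x)) \<le> norm (C *\<^sub>R (indicat_real K x *\<^sub>R v x))"
        by (auto simp: abs_mult intro!: mult_right_mono)
    qed
  qed (intro integrable_scaleR_right iv borel_measurable_scaleR f borel_measurable_integrable[OF iv])+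
  then show ?thesis
    by (subst Bochner_Integration.integrable_cong[OF refl]) (auto simp: eq)
qed

text \<open>Closed balls of radius 1 - 1/(k+1) exhaust the open ball, and the function is the
  pointwise limit of its restrictions to them.\<close>

lemma locally_integrable_hyp_measurable:
  fixes v :: "'a::euclidean_space \<Rightarrow> 'b::euclidean_space"
  assumes "\<And>K. compact K \<Longrightarrow> K \<subseteq> hyp_space \<Longrightarrow> set_integrable hyp_measure K v"
  shows "v \<in> borel_measurable hyp_measure"
proof (rule borel_measurable_LIMSEQ_metric)
  fix k :: nat
  have "cball 0 (1 - 1 / real (k + 1)) \<subseteq> (hyp_space :: 'a set)"
  proof
    fix x :: 'a assume "x \<in> cball 0 (1 - 1 / real (k + 1))"
    then have "norm x \<le> 1 - 1 / real (k + 1)" by simp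
    also have "\<dots> < 1" by simp
    finally show "x \<in> hyp_space" by simp
  qed
  then have "set_integrable hyp_measure (cball 0 (1 - 1 / real (k + 1))) v"
    by (intro assms) auto
  then show "(\<lambda>x. indicat_real (cball 0 (1 - 1 / real (k + 1))) x *\<^sub>R v x) \<in> borel_measurable hyp_measure"
    by (simp add: set_integrable_def)
next
  fix x :: 'a assume "x \<in> space hyp_measure"
  then have x: "norm x < 1" by simp
  then obtain N where N: "1 / real (Suc N) < 1 - norm x"
    using nat_approx_posE[of "1 - norm x"] by auto
  have "norm x \<le> 1 - 1 / real (k + 1)" if "N \<le> k" for k
  proof -
    have "1 / real (k + 1) \<le> 1 / real (Suc N)" using that by (intro divide_left_mono) auto
    then show ?thesis using N by simp
  qed
  then show "(\<lambda>k. indicat_real (cball 0 (1 - 1 / real (k + 1))) x *\<^sub>R v x) \<longlonglongrightarrow> v x"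
    by (intro tendsto_eventually eventually_sequentiallyI[of N]) simp
qed

subsection \<open>Test fields\<close>

abbreviation test_field :: "('a::euclidean_space \<Rightarrow> 'a) \<Rightarrow> bool" where
  "test_field X \<equiv> (\<forall>b\<in>Basis. (\<lambda>x. X x \<bullet> b) \<in> Cc_smooth hyp_space)"

lemma Cc_smooth_Ck: "f \<in> Cc_smooth U \<Longrightarrow> Ck k f"
  by (simp add: Cc_smooth_def)

lemma Cc_smooth_mult: "f \<in> Cc_smooth U \<Longrightarrow> (\<And>k. Ck k g) \<Longrightarrow> (\<lambda>x. g x * f x) \<in> Cc_smooth U"
proof -
  assume f: "f \<in> Cc_smooth U" and g: "\<And>k. Ck k g"
  then obtain K where K: "compact K" "K \<subseteq> U" "\<And>x. x \<notin> K \<Longrightarrow> f x = 0" by (auto simp: Cc_smooth_def)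
  have "Ck k (\<lambda>x. g x * f x)" for k by (rule Ck_mult[OF g Cc_smooth_Ck[OF f]])
  moreover have "\<forall>x. x \<notin> K \<longrightarrow> g x * f x = 0" using K(3) by simp
  ultimately show "(\<lambda>x. g x * f x) \<in> Cc_smooth U" using K(1,2) unfolding Cc_smooth_def by blast
qed

lemma pd_eq_0_off_closed:
  assumes "closed K" "\<And>x. x \<notin> K \<Longrightarrow> f x = 0" "x \<notin> K"
  shows "pd f b x = 0"
proof -
  have "((\<lambda>x. 0) has_derivative (\<lambda>_. 0)) (at x)" by simp
  then have "(f has_derivative (\<lambda>_. 0)) (at x)"
    by (rule has_derivative_transform_within_open[of _ _ _ _ "- K"])
       (use assms in \<open>auto simp: open_Compl\<close>)
  then show ?thesis by (rule pd_eq)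
qed

lemma has_derivative_hyp_factor:
  assumes "x \<in> hyp_space"
  shows "(hyp_factor has_derivative (\<lambda>h. (hyp_factor x)\<^sup>2 * (x \<bullet> h))) (at x)"
proof -
  have "1 - x \<bullet> x \<noteq> 0" using hyp_dfac_pos[OF assms] by (simp add: hyp_dfac_def power2_norm_eq_inner)
  then show ?thesis
    unfolding hyp_factor_def[abs_def] power2_norm_eq_inner
    by (auto intro!: derivative_eq_intros simp: power2_eq_square inner_commute field_simps)
qed

lemma has_derivative_factor_power_mult:
  assumes "x \<in> hyp_space" "f differentiable (at x)"
  shows "((\<lambda>y. hyp_factor y ^ n * f y) has_derivative
    (\<lambda>h. hyp_factor x ^ n * (frechet_derivative f (at x) h + real n * hyp_factor x * (x \<bullet> h) * f x))) (at x)"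
proof -
  have "((\<lambda>y. hyp_factor y ^ n * f y) has_derivative
     (\<lambda>h. hyp_factor x ^ n * frechet_derivative f (at x) h + (real n * ((hyp_factor x)\<^sup>2 * (x \<bullet> h)) * hyp_factor x ^ (n - 1)) * f x)) (at x)"
    using assms(2)
    by (intro has_derivative_mult has_derivative_power has_derivative_hyp_factor[OF assms(1)])
       (simp add: frechet_derivative_works)
  moreover have "hyp_factor x ^ n * A + (real n * ((hyp_factor x)\<^sup>2 * c) * hyp_factor x ^ (n - 1)) * f x
      = hyp_factor x ^ n * (A + real n * hyp_factor x * c * f x)" for A c
    by (cases n) (auto simp: power2_eq_square algebra_simps)
  ultimately show ?thesis by (simp only:)
qed

text \<open>The logarithmic derivative of the n-th power of \<open>hyp_factor\<close> in direction b
  is n \<open>hyp_factor x\<close> (x . b); it adds one zeroth-order term to the Euclidean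
  divergence.\<close>

lemma hyp_div_formula:
  fixes X :: "'a::euclidean_space \<Rightarrow> 'a"
  assumes "x \<in> hyp_space" "\<And>b. b \<in> Basis \<Longrightarrow> (\<lambda>x. X x \<bullet> b) differentiable (at x)"
  shows "hyp_div X x = (\<Sum>b\<in>Basis. pd (\<lambda>x. X x \<bullet> b) b x) + real DIM('a) * hyp_factor x * (x \<bullet> X x)"
proof -
  have "hyp_div X x = (\<Sum>b\<in>Basis. hyp_factor x ^ DIM('a) * (pd (\<lambda>x. X x \<bullet> b) b x + real DIM('a) * hyp_factor x * (x \<bullet> b) * (X x \<bullet> b)))
     / hyp_factor x ^ DIM('a)"
    unfolding hyp_div_def using pd_eq[OF has_derivative_factor_power_mult[OF assms(1) assms(2)]] by simp
  also have "\<dots> = (\<Sum>b\<in>Basis. pd (\<lambda>x. X x \<bullet> b) b x + real DIM('a) * hyp_factor x * (x \<bullet> b) * (X x \<bullet> b))"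
    using hyp_factor_pos[OF assms(1)] by (simp add: sum_distrib_left[symmetric])
  also have "\<dots> = (\<Sum>b\<in>Basis. pd (\<lambda>x. X x \<bullet> b) b x) + real DIM('a) * hyp_factor x * (x \<bullet> X x)"
    by (simp add: sum.distrib euclidean_inner[of x "X x"] sum_distrib_left mult.assoc)
  finally show ?thesis .
qed

text \<open>One derivative only: the divergence theorem will be applied to |\<phi>|^p X, which for p
  near 1 is no smoother.\<close>

definition C1_field :: "('a::euclidean_space \<Rightarrow> 'a) \<Rightarrow> bool" where
  "C1_field X \<longleftrightarrow> (\<forall>b\<in>Basis. Ck 1 (\<lambda>x. X x \<bullet> b)) \<and>
    (\<exists>K. compact K \<and> K \<subseteq> hyp_space \<and> (\<forall>x. x \<notin> K \<longrightarrow> X x = 0))"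

lemma test_field_C1:
  fixes X :: "'a::euclidean_space \<Rightarrow> 'a"
  assumes X: "test_field X"
  shows "C1_field X"
proof -
  have "\<exists>K. compact K \<and> K \<subseteq> hyp_space \<and> (\<forall>x. x \<notin> K \<longrightarrow> X x \<bullet> b = 0)" if "b \<in> Basis" for b
    using X that by (auto simp: Cc_smooth_def)
  then obtain Kb where Kb: "\<And>b. b \<in> Basis \<Longrightarrow> compact (Kb b)" "\<And>b. b \<in> Basis \<Longrightarrow> Kb b \<subseteq> hyp_space"
    "\<And>b x. b \<in> Basis \<Longrightarrow> x \<notin> Kb b \<Longrightarrow> X x \<bullet> b = 0" by metis
  define K where "K = (\<Union>b\<in>Basis. Kb b)"
  have K: "compact K" "K \<subseteq> hyp_space" unfolding K_def using Kb(1,2) by (auto intro!: compact_UN)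
  have zX: "X x = 0" if "x \<notin> K" for x
    by (rule euclidean_eqI) (use Kb(3) that in \<open>auto simp: K_def\<close>)
  show ?thesis unfolding C1_field_def
  proof (intro conjI ballI exI[of _ K] allI impI)
    show "Ck 1 (\<lambda>x. X x \<bullet> b)" if "b \<in> Basis" for b
      by (rule Cc_smooth_Ck[OF X[rule_format, OF that]])
  qed (use K zX in auto)
qed

lemma C1_field_bounds:
  fixes X :: "'a::euclidean_space \<Rightarrow> 'a"
  assumes X: "C1_field X"
  obtains K C where "compact K" "K \<subseteq> hyp_space" "0 \<le> C"
    "\<And>x. x \<notin> K \<Longrightarrow> X x = 0" "\<And>x. norm (X x) \<le> C" "continuous_on UNIV X"
    "\<And>x. x \<in> hyp_space \<Longrightarrow> x \<notin> K \<Longrightarrow> hyp_div X x = 0"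
    "\<And>x. x \<in> hyp_space \<Longrightarrow> \<bar>hyp_div X x\<bar> \<le> C" "continuous_on hyp_space (hyp_div X)"
proof -
  obtain K where K: "compact K" "K \<subseteq> hyp_space" and zX: "\<And>x. x \<notin> K \<Longrightarrow> X x = 0"
    using X unfolding C1_field_def by blast
  have C1: "Ck 1 (\<lambda>x. X x \<bullet> b)" if "b \<in> Basis" for b using X that unfolding C1_field_def by blast
  have "continuous_on UNIV (\<lambda>x. \<Sum>b\<in>Basis. (X x \<bullet> b) *\<^sub>R b)"
    by (intro continuous_intros Ck_continuous[OF C1])
  then have cX: "continuous_on UNIV X" by (simp add: euclidean_representation)
  have cp: "continuous_on UNIV (pd (\<lambda>x. X x \<bullet> b) b)" if "b \<in> Basis" for b
    using C1[OF that] that by simp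
  have dif: "(\<lambda>x. X x \<bullet> b) differentiable (at x)" if "b \<in> Basis" for b x
    using C1[OF that] that by simp
  define D where "D x = (\<Sum>b\<in>Basis. pd (\<lambda>x. X x \<bullet> b) b x) + real DIM('a) * hyp_factor x * (x \<bullet> X x)" for x
  have D: "hyp_div X x = D x" if "x \<in> hyp_space" for x
    unfolding D_def by (rule hyp_div_formula[OF that dif])
  have cD: "continuous_on hyp_space D"
    unfolding D_def
    by (intro continuous_intros continuous_on_factor subset_refl continuous_on_subset[OF cp]
        continuous_on_subset[OF cX]) auto
  have zD: "D x = 0" if "x \<notin> K" for x
  proof -
    have "pd (\<lambda>x. X x \<bullet> b) b x = 0" for b
      by (rule pd_eq_0_off_closed[of K]) (use K(1) zX that in \<open>auto simp: compact_imp_closed\<close>)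
    then show ?thesis using zX[OF that] by (simp add: D_def)
  qed
  have "compact (D ` K)" "compact (X ` K)"
    using K cD cX by (auto intro!: compact_continuous_image intro: continuous_on_subset)
  then obtain C1 C2 where C: "\<And>x. x \<in> K \<Longrightarrow> \<bar>D x\<bar> \<le> C1" "\<And>x. x \<in> K \<Longrightarrow> norm (X x) \<le> C2"
    by (metis bounded_iff compact_imp_bounded image_eqI real_norm_def)
  show ?thesis
  proof (rule that[OF K, of "\<bar>C1\<bar> + \<bar>C2\<bar>"])
    show "norm (X x) \<le> \<bar>C1\<bar> + \<bar>C2\<bar>" for x using C(2)[of x] zX[of x] by (cases "x \<in> K") auto
    show "\<bar>hyp_div X x\<bar> \<le> \<bar>C1\<bar> + \<bar>C2\<bar>" if "x \<in> hyp_space" for x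
      using C(1)[of x] zD[of x] D[OF that] by (cases "x \<in> K") auto
    show "continuous_on hyp_space (hyp_div X)" using cD by (subst continuous_on_cong[OF refl D]) auto
  qed (use zX zD D cX in auto)
qed

lemma hyp_weak_grad_measurable:
  assumes "hyp_weak_grad v G"
  shows "v \<in> borel_measurable hyp_measure" "G \<in> borel_measurable hyp_measure"
  using assms unfolding hyp_weak_grad_def by (auto intro!: locally_integrable_hyp_measurable)

lemma hyp_weak_grad_integrable:
  assumes vG: "hyp_weak_grad v G" and X: "test_field X"
  shows "integrable hyp_measure (\<lambda>x. v x * hyp_div X x)"
    "integrable hyp_measure (\<lambda>x. hyp_inner x (G x) (X x))"
proof -
  obtain K C where K: "compact K" "K \<subseteq> hyp_space" "0 \<le> C"
    "\<And>x. x \<notin> K \<Longrightarrow> X x = 0" "\<And>x. norm (X x) \<le> C" "continuous_on UNIV X"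
    "\<And>x. x \<in> hyp_space \<Longrightarrow> x \<notin> K \<Longrightarrow> hyp_div X x = 0"
    "\<And>x. x \<in> hyp_space \<Longrightarrow> \<bar>hyp_div X x\<bar> \<le> C" "continuous_on hyp_space (hyp_div X)"
    by (rule C1_field_bounds[OF test_field_C1[OF X]]) blast
  have vi: "set_integrable hyp_measure K v" and Gi: "set_integrable hyp_measure K G"
    using vG K(1,2) by (auto simp: hyp_weak_grad_def)
  have "integrable hyp_measure (\<lambda>x. hyp_div X x *\<^sub>R v x)"
    by (rule set_integrable_hyp_mult[OF vi _ K(8,7)]) (auto intro: continuous_measurable_hyp K(9))
  then show "integrable hyp_measure (\<lambda>x. v x * hyp_div X x)" by (simp add: mult.commute)
  have mX: "X \<in> borel_measurable hyp_measure"
    by (rule continuous_measurable_hyp) (rule continuous_on_subset[OF K(6)], simp)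
  have "compact (hyp_factor ` K)" by (intro compact_continuous_image continuous_on_factor K)
  then obtain B where B: "\<And>x. x \<in> K \<Longrightarrow> \<bar>hyp_factor x\<bar> \<le> B"
    by (metis bounded_iff compact_imp_bounded image_eqI real_norm_def)
  have "integrable hyp_measure (\<lambda>x. indicat_real K x *\<^sub>R G x)" using Gi by (simp add: set_integrable_def)
  then have iG: "integrable hyp_measure (\<lambda>x. (B\<^sup>2 * C) * norm (indicat_real K x *\<^sub>R G x))"
    by (intro integrable_mult_right integrable_norm)
  show "integrable hyp_measure (\<lambda>x. hyp_inner x (G x) (X x))"
  proof (rule Bochner_Integration.integrable_bound[OF iG])
    show "(\<lambda>x. hyp_inner x (G x) (X x)) \<in> borel_measurable hyp_measure"
      unfolding hyp_inner_def using mX hyp_weak_grad_measurable[OF vG] by simp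
    show "AE x in hyp_measure. norm (hyp_inner x (G x) (X x)) \<le> norm ((B\<^sup>2 * C) * norm (indicat_real K x *\<^sub>R G x))"
    proof (rule AE_I2)
      fix x
      show "norm (hyp_inner x (G x) (X x)) \<le> norm ((B\<^sup>2 * C) * norm (indicat_real K x *\<^sub>R G x))"
      proof (cases "x \<in> K")
        case True
        have "\<bar>hyp_inner x (G x) (X x)\<bar> \<le> (hyp_factor x)\<^sup>2 * (norm (G x) * norm (X x))"
          unfolding hyp_inner_def abs_mult by (intro mult_mono Cauchy_Schwarz_ineq2) auto
        also have "\<dots> \<le> B\<^sup>2 * (norm (G x) * C)"
          using B[OF True] K(5)[of x] K(3)
          by (intro mult_mono) (auto simp: abs_le_square_iff[symmetric] intro: order_trans[OF _ abs_ge_self])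
        finally show ?thesis using True K(3) by (simp add: mult_ac)
      qed (simp add: hyp_inner_def K(4))
    qed
  qed
qed

lemma set_integrable_scale_add:
  fixes v w :: "'a::euclidean_space \<Rightarrow> 'b::euclidean_space"
  assumes "set_integrable M K v" "set_integrable M K w"
  shows "set_integrable M K (\<lambda>x. a *\<^sub>R v x + b *\<^sub>R w x)"
proof -
  have "integrable M (\<lambda>x. a *\<^sub>R (indicat_real K x *\<^sub>R v x) + b *\<^sub>R (indicat_real K x *\<^sub>R w x))"
    using assms by (intro Bochner_Integration.integrable_add integrable_scaleR_right) (auto simp: set_integrable_def)
  then show ?thesis by (simp add: set_integrable_def algebra_simps)
qed

lemma hyp_weak_grad_linear:
  fixes v w :: "'a::euclidean_space \<Rightarrow> real"
  assumes "hyp_weak_grad v G" "hyp_weak_grad w H"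
  shows "hyp_weak_grad (\<lambda>x. a * v x + b * w x) (\<lambda>x. a *\<^sub>R G x + b *\<^sub>R H x)"
  unfolding hyp_weak_grad_def
proof (intro conjI allI impI)
  fix K :: "'a set" assume "compact K" "K \<subseteq> hyp_space"
  then show "set_integrable hyp_measure K (\<lambda>x. a * v x + b * w x)" "set_integrable hyp_measure K (\<lambda>x. a *\<^sub>R G x + b *\<^sub>R H x)"
    using assms set_integrable_scale_add[of hyp_measure K v w a b] set_integrable_scale_add[of hyp_measure K G H a b]
    by (auto simp: hyp_weak_grad_def)
next
  fix X :: "'a \<Rightarrow> 'a" assume X: "test_field X"
  note i = hyp_weak_grad_integrable[OF assms(1) X] hyp_weak_grad_integrable[OF assms(2) X]
  have "(\<integral>x. hyp_inner x (a *\<^sub>R G x + b *\<^sub>R H x) (X x) \<partial>hyp_measure)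
    = (\<integral>x. a * hyp_inner x (G x) (X x) + b * hyp_inner x (H x) (X x) \<partial>hyp_measure)"
    by (intro Bochner_Integration.integral_cong refl) (simp add: hyp_inner_def algebra_simps)
  also have "\<dots> = a * (\<integral>x. hyp_inner x (G x) (X x) \<partial>hyp_measure) + b * (\<integral>x. hyp_inner x (H x) (X x) \<partial>hyp_measure)"
    using i by simp
  also have "\<dots> = - (a * (\<integral>x. v x * hyp_div X x \<partial>hyp_measure) + b * (\<integral>x. w x * hyp_div X x \<partial>hyp_measure))"
    using assms X by (auto simp: hyp_weak_grad_def)
  also have "a * (\<integral>x. v x * hyp_div X x \<partial>hyp_measure) + b * (\<integral>x. w x * hyp_div X x \<partial>hyp_measure)
     = (\<integral>x. a * (v x * hyp_div X x) + b * (w x * hyp_div X x) \<partial>hyp_measure)"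
    using i by simp
  also have "\<dots> = (\<integral>x. (a * v x + b * w x) * hyp_div X x \<partial>hyp_measure)"
    by (intro Bochner_Integration.integral_cong refl) (simp add: algebra_simps)
  finally show "(\<integral>x. hyp_inner x (a *\<^sub>R G x + b *\<^sub>R H x) (X x) \<partial>hyp_measure) = - (\<integral>x. (a * v x + b * w x) * hyp_div X x \<partial>hyp_measure)" .
qed

section \<open>The divergence theorem\<close>

lemma lborel_integral_translate:
  fixes f :: "'a::euclidean_space \<Rightarrow> real"
  assumes "f \<in> borel_measurable borel"
  shows "(\<integral>x. f (x + z) \<partial>lborel) = (\<integral>x. f x \<partial>lborel)"
    "integrable lborel (\<lambda>x. f (x + z)) \<longleftrightarrow> integrable lborel f"
proof -
  have "(\<integral>x. f x \<partial>lborel) = (\<integral>x. f x \<partial>distr lborel borel ((+) z))"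
    by (simp add: lborel_distr_plus)
  also have "\<dots> = (\<integral>x. f (z + x) \<partial>lborel)" using assms by (subst integral_distr) auto
  finally show "(\<integral>x. f (x + z) \<partial>lborel) = (\<integral>x. f x \<partial>lborel)" by (simp add: add.commute)
  have "integrable lborel f \<longleftrightarrow> integrable (distr lborel borel ((+) z)) f"
    by (simp add: lborel_distr_plus)
  also have "\<dots> \<longleftrightarrow> integrable lborel (\<lambda>x. f (z + x))" using assms by (subst integrable_distr_eq) auto
  finally show "integrable lborel (\<lambda>x. f (x + z)) \<longleftrightarrow> integrable lborel f" by (simp add: add.commute)
qed

text \<open>Difference quotients have integral 0 by translation invariance, and they converge
  boundedly, with supports in a fixed ball, to the partial derivative. No iterated integration is
  involved.\<close>

lemma integral_pd_eq_0:
  fixes F :: "'a::euclidean_space \<Rightarrow> real"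
  assumes dif: "\<And>x. F differentiable (at x)" and c: "continuous_on UNIV (pd F b)" and b: "b \<in> Basis"
    and K: "compact K" "\<And>x. x \<notin> K \<Longrightarrow> F x = 0"
  shows "(\<integral>x. pd F b x \<partial>lborel) = 0"
proof -
  have cF: "continuous_on UNIV F"
    using dif by (simp add: continuous_at_imp_continuous_on differentiable_imp_continuous_within)
  then have mF: "F \<in> borel_measurable borel" by (rule borel_measurable_continuous_onI)
  have iF: "integrable lborel F" by (rule integrable_continuous_compact_support[OF cF K])
  have zp: "pd F b x = 0" if "x \<notin> K" for x
    by (rule pd_eq_0_off_closed[OF compact_imp_closed[OF K(1)] K(2) that])
  obtain C where C: "0 \<le> C" "\<And>x. \<bar>pd F b x\<bar> \<le> C"
    using continuous_compact_support_bounded[OF c K(1) zp] by blast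
  obtain R where R: "\<And>x. x \<in> K \<Longrightarrow> norm x \<le> R"
    using compact_imp_bounded[OF K(1)] unfolding bounded_iff by blast
  \<comment> \<open>At most 1, so that all difference quotients vanish outside the ball of radius
    \<open>R + 1\<close>.\<close>
  define h where "h k = 1 / real (Suc k)" for k
  have h: "0 < h k" "h k \<le> 1" for k by (auto simp: h_def)
  define D where "D k x = (F (x + h k *\<^sub>R b) - F x) / h k" for k x
  have Deq: "\<exists>s. 0 < s \<and> s < 1 \<and> D k x = pd F b (x + (s * h k) *\<^sub>R b)" for k x
  proof -
    obtain s where s: "0 < s" "s < 1"
      "F (x + h k *\<^sub>R b) - F x = (\<Sum>b'\<in>Basis. (h k *\<^sub>R b \<bullet> b') * pd F b' (x + s *\<^sub>R h k *\<^sub>R b))"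
      using mvt_frechet[OF dif] by blast
    have "(\<Sum>b'\<in>Basis. (h k *\<^sub>R b \<bullet> b') * pd F b' (x + s *\<^sub>R h k *\<^sub>R b))
      = (\<Sum>b'\<in>Basis. if b' = b then h k * pd F b (x + (s * h k) *\<^sub>R b) else 0)"
      using b by (intro sum.cong) (auto simp: inner_Basis)
    then have "D k x = pd F b (x + (s * h k) *\<^sub>R b)" using s(3) b h(1)[of k] by (simp add: D_def)
    then show ?thesis using s by blast
  qed
  have int0: "(\<integral>x. D k x \<partial>lborel) = 0" and intD: "integrable lborel (D k)" for k
  proof -
    have i: "integrable lborel (\<lambda>x. F (x + h k *\<^sub>R b))" using lborel_integral_translate(2)[OF mF] iF by blast
    then show "integrable lborel (D k)" unfolding D_def using iF by simp
    have "(\<integral>x. D k x \<partial>lborel) = ((\<integral>x. F (x + h k *\<^sub>R b) \<partial>lborel) - (\<integral>x. F x \<partial>lborel)) / h k"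
      unfolding D_def using i iF by simp
    then show "(\<integral>x. D k x \<partial>lborel) = 0" using lborel_integral_translate(1)[OF mF] by simp
  qed
  have "(\<lambda>k. \<integral>x. D k x \<partial>lborel) \<longlonglongrightarrow> (\<integral>x. pd F b x \<partial>lborel)"
  proof (rule integral_dominated_convergence[where w = "\<lambda>x. C * indicat_real (cball 0 (R + 1)) x"])
    show "integrable lborel (\<lambda>x::'a. C * indicat_real (cball 0 (R + 1)) x)"
      using emeasure_lborel_cball_finite[of "0::'a" "R + 1"]
      by (intro integrable_mult_right integrable_real_indicator) auto
    show "AE x in lborel. (\<lambda>k. D k x) \<longlonglongrightarrow> pd F b x"
    proof (rule AE_I2)
      fix x :: 'a
      have "\<forall>k. \<exists>s. 0 < s \<and> s < 1 \<and> D k x = pd F b (x + (s * h k) *\<^sub>R b)" using Deq by blast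
      from choice[OF this] obtain s where s: "\<And>k. 0 < s k" "\<And>k. s k < 1" "\<And>k. D k x = pd F b (x + (s k * h k) *\<^sub>R b)"
        by blast
      have "(\<lambda>k. s k * h k) \<longlonglongrightarrow> 0"
      proof (rule tendsto_sandwich[of "\<lambda>_. 0" _ _ h])
        show "h \<longlonglongrightarrow> 0" unfolding h_def by (rule LIMSEQ_Suc[OF lim_1_over_n])
        show "\<forall>\<^sub>F k in sequentially. s k * h k \<le> h k"
          using s(2) h(1) by (intro always_eventually allI) (simp add: less_imp_le)
        show "\<forall>\<^sub>F k in sequentially. 0 \<le> s k * h k"
          using s(1) h(1) by (intro always_eventually allI) (simp add: less_imp_le)
      qed auto
      then have "(\<lambda>k. x + (s k * h k) *\<^sub>R b) \<longlonglongrightarrow> x + 0 *\<^sub>R b" by (intro tendsto_intros)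
      then have "(\<lambda>k. pd F b (x + (s k * h k) *\<^sub>R b)) \<longlonglongrightarrow> pd F b (x + 0 *\<^sub>R b)"
        using c by (intro isCont_tendsto_compose[of _ "pd F b"]) (auto simp: continuous_on_eq_continuous_at)
      then show "(\<lambda>k. D k x) \<longlonglongrightarrow> pd F b x" by (simp add: s(3))
    qed
    show "AE x in lborel. norm (D k x) \<le> C * indicat_real (cball 0 (R + 1)) x" for k
    proof (rule AE_I2)
      fix x :: 'a
      show "norm (D k x) \<le> C * indicat_real (cball 0 (R + 1)) x"
      proof (cases "norm x \<le> R + 1")
        case True
        obtain s where "D k x = pd F b (x + (s * h k) *\<^sub>R b)" using Deq by blast
        then show ?thesis using True C by simp
      next
        case False
        have "norm (h k *\<^sub>R b) \<le> 1" using h[of k] b by simp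
        then have "x \<notin> K" "x + h k *\<^sub>R b \<notin> K"
          using False R[of x] R[of "x + h k *\<^sub>R b"] norm_triangle_ineq4[of "x + h k *\<^sub>R b" "h k *\<^sub>R b"] by auto
        then show ?thesis using K(2) C(1) by (simp add: D_def)
      qed
    qed
    show "pd F b \<in> borel_measurable lborel" using c by (simp add: borel_measurable_continuous_onI)
    show "D k \<in> borel_measurable lborel" for k using intD by auto
  qed
  then show ?thesis by (simp add: int0 LIMSEQ_const_iff)
qed

text \<open>The density of the measure cancels the denominator in \<open>hyp_div\<close>; what
  remains is the Euclidean divergence of the field multiplied by that density, and each of its
  partial derivatives integrates to 0.\<close>

proposition hyp_divergence_theorem:
  fixes Z :: "'a::euclidean_space \<Rightarrow> 'a"
  assumes Z: "C1_field Z"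
  shows "(\<integral>x. hyp_div Z x \<partial>hyp_measure) = 0"
proof -
  let ?n = "DIM('a)"
  obtain K where K: "compact K" "K \<subseteq> hyp_space" and zZ: "\<And>x. x \<notin> K \<Longrightarrow> Z x = 0"
    using Z unfolding C1_field_def by blast
  have C1: "Ck 1 (\<lambda>x. Z x \<bullet> b)" if "b \<in> Basis" for b using Z that unfolding C1_field_def by blast
  define F where "F b y = hyp_factor y ^ ?n * (Z y \<bullet> b)" for b y
  have zF: "F b x = 0" if "x \<notin> K" for b x using zZ[OF that] by (simp add: F_def)
  have DF: "(F b has_derivative (\<lambda>h. hyp_factor x ^ ?n * (pd (\<lambda>x. Z x \<bullet> b) h x + real ?n * hyp_factor x * (x \<bullet> h) * (Z x \<bullet> b)))) (at x)"
    if "b \<in> Basis" "x \<in> hyp_space" for b x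
    unfolding F_def using C1[OF that(1)] by (intro has_derivative_factor_power_mult that) auto
  have D0: "(F b has_derivative (\<lambda>_. 0)) (at x)" if "x \<notin> K" for b x
  proof -
    have "((\<lambda>x. 0) has_derivative (\<lambda>_. 0)) (at x)" by simp
    then show ?thesis
      by (rule has_derivative_transform_within_open[of _ _ _ _ "- K"])
         (use zF that K in \<open>auto simp: open_Compl compact_imp_closed\<close>)
  qed
  have dif: "F b differentiable (at x)" if "b \<in> Basis" for b x
    using DF[OF that, of x] D0[of x b] K(2) unfolding differentiable_def by blast
  have cont: "continuous_on UNIV (pd (F b) b)" if b: "b \<in> Basis" for b
  proof -
    have "continuous_on hyp_space (\<lambda>x. hyp_factor x ^ ?n * (pd (\<lambda>x. Z x \<bullet> b) b x + real ?n * hyp_factor x * (x \<bullet> b) * (Z x \<bullet> b)))"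
    proof (intro continuous_on_mult continuous_on_add continuous_on_power continuous_on_const continuous_on_factor
        subset_refl continuous_on_inner[OF continuous_on_id])
      show "continuous_on hyp_space (pd (\<lambda>x. Z x \<bullet> b) b)"
        by (rule continuous_on_subset[of UNIV]) (use C1[OF b] b in auto)
      show "continuous_on hyp_space (\<lambda>x. Z x \<bullet> b)"
        using Ck_continuous[OF C1[OF b]] by (rule continuous_on_subset) simp
    qed
    then have 1: "continuous_on hyp_space (pd (F b) b)"
      by (subst continuous_on_cong[OF refl pd_eq[OF DF[OF b]]]) auto
    have 2: "continuous_on (- K) (pd (F b) b)"
      by (subst continuous_on_cong[OF refl pd_eq[OF D0]]) auto
    \<comment> \<open>\<open>hyp_factor\<close> is singular on the unit sphere, but the product
      vanishes off \<open>K\<close>; the ball and the complement of \<open>K\<close> are open and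
      cover the space.\<close>
    have "continuous_on (hyp_space \<union> - K) (pd (F b) b)"
      using 1 2 K by (intro continuous_on_open_Un) (auto simp: compact_imp_closed)
    moreover have "hyp_space \<union> - K = UNIV" using K by auto
    ultimately show ?thesis by simp
  qed
  have int: "integrable lborel (pd (F b) b)" if b: "b \<in> Basis" for b
    using integrable_continuous_compact_support[OF cont[OF b] K(1)] pd_eq[OF D0] by blast
  have m: "pd (F b) b \<in> borel_measurable borel" if "b \<in> Basis" for b
    using cont[OF that] by (rule borel_measurable_continuous_onI)
  obtain C where hc: "continuous_on hyp_space (hyp_div Z)"
    by (rule C1_field_bounds[OF Z]) blast
  have "(\<integral>x. hyp_div Z x \<partial>hyp_measure) =
    (\<integral>x. indicat_real hyp_space x *\<^sub>R (hyp_factor x ^ ?n *\<^sub>R hyp_div Z x) \<partial>lebesgue)"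
    by (rule integral_hyp[OF continuous_measurable_hyp[OF hc]])
  also have "\<dots> = (\<integral>x. (\<Sum>b\<in>Basis. pd (F b) b x) \<partial>lebesgue)"
  proof (rule Bochner_Integration.integral_cong[OF refl])
    fix x :: 'a
    show "indicat_real hyp_space x *\<^sub>R (hyp_factor x ^ ?n *\<^sub>R hyp_div Z x) = (\<Sum>b\<in>Basis. pd (F b) b x)"
    proof (cases "x \<in> hyp_space")
      case True
      then show ?thesis using hyp_factor_pos[OF True] by (simp add: hyp_div_def F_def[abs_def])
    next
      case False
      then have "x \<notin> K" using K by auto
      then show ?thesis using False pd_eq[OF D0] by simp
    qed
  qed
  also have "\<dots> = (\<integral>x. (\<Sum>b\<in>Basis. pd (F b) b x) \<partial>lborel)"
    using m by (intro integral_completion) simp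
  also have "\<dots> = (\<Sum>b\<in>Basis. \<integral>x. pd (F b) b x \<partial>lborel)"
    using int by (rule Bochner_Integration.integral_sum)
  also have "\<dots> = 0"
    by (intro sum.neutral ballI integral_pd_eq_0[OF dif cont _ K(1) zF])
  finally show ?thesis .
qed

section \<open>Gradients of smooth functions, product rule and uniqueness\<close>

definition egrad :: "('a::euclidean_space \<Rightarrow> real) \<Rightarrow> 'a \<Rightarrow> 'a" where
  "egrad f x = (\<Sum>b\<in>Basis. pd f b x *\<^sub>R b)"

lemma egrad_inner: "egrad f x \<bullet> w = (\<Sum>b\<in>Basis. pd f b x * (w \<bullet> b))"
  by (simp add: egrad_def inner_sum_left inner_commute[of w])

lemma egrad_inner_Basis: "b \<in> Basis \<Longrightarrow> egrad f x \<bullet> b = pd f b x"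
  by (simp add: egrad_def inner_sum_left_Basis)

lemma continuous_egrad: "Ck 1 f \<Longrightarrow> continuous_on UNIV (egrad f)"
  unfolding egrad_def[abs_def] by (intro continuous_intros) simp

lemma hyp_div_mult:
  fixes X :: "'a::euclidean_space \<Rightarrow> 'a"
  assumes "x \<in> hyp_space" "Ck 1 f" "\<And>b. b \<in> Basis \<Longrightarrow> Ck 1 (\<lambda>x. X x \<bullet> b)"
  shows "hyp_div (\<lambda>x. f x *\<^sub>R X x) x = f x * hyp_div X x + egrad f x \<bullet> X x"
proof -
  have dX: "(\<lambda>x. X x \<bullet> b) differentiable (at x)" if "b \<in> Basis" for b using assms(3)[OF that] by simp
  have df: "f differentiable (at x)" using assms(2) by simp
  have D: "((\<lambda>x. f x * (X x \<bullet> b)) has_derivative (\<lambda>h. f x * pd (\<lambda>x. X x \<bullet> b) h x + pd f h x * (X x \<bullet> b))) (at x)"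
    if "b \<in> Basis" for b
    using dX[OF that] df by (intro has_derivative_mult) (simp_all add: frechet_derivative_works)
  have D': "(\<lambda>x. f x * (X x \<bullet> b)) differentiable (at x)" if "b \<in> Basis" for b
    using D[OF that] unfolding differentiable_def by blast
  have "hyp_div (\<lambda>x. f x *\<^sub>R X x) x = (\<Sum>b\<in>Basis. pd (\<lambda>x. f x * (X x \<bullet> b)) b x) + real DIM('a) * hyp_factor x * (f x * (x \<bullet> X x))"
    using hyp_div_formula[OF assms(1), of "\<lambda>x. f x *\<^sub>R X x"] D' by simp
  also have "(\<Sum>b\<in>Basis. pd (\<lambda>x. f x * (X x \<bullet> b)) b x) = (\<Sum>b\<in>Basis. f x * pd (\<lambda>x. X x \<bullet> b) b x + pd f b x * (X x \<bullet> b))"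
    by (intro sum.cong refl pd_eq[OF D])
  finally show ?thesis
    using hyp_div_formula[OF assms(1) dX]
    by (simp add: sum.distrib sum_distrib_left egrad_inner algebra_simps)
qed

lemma test_field_mult:
  assumes "test_field X" "\<And>k. Ck k f"
  shows "test_field (\<lambda>x. f x *\<^sub>R X x)"
  using Cc_smooth_mult[OF _ assms(2)] assms(1) by simp

lemma set_integrable_hyp_bound:
  fixes v :: "'a::euclidean_space \<Rightarrow> 'b::euclidean_space" and w :: "'a \<Rightarrow> 'c::euclidean_space"
  assumes K: "compact K" "K \<subseteq> hyp_space" and v: "set_integrable hyp_measure K v" and w: "w \<in> borel_measurable hyp_measure"
    and le: "\<And>x. x \<in> K \<Longrightarrow> norm (w x) \<le> C * norm (v x)"
  shows "set_integrable hyp_measure K w"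
  unfolding set_integrable_def
proof (rule Bochner_Integration.integrable_bound[of _ "\<lambda>x. C *\<^sub>R (indicat_real K x *\<^sub>R v x)"])
  show "integrable hyp_measure (\<lambda>x. C *\<^sub>R (indicat_real K x *\<^sub>R v x))"
    using v by (intro integrable_scaleR_right) (simp add: set_integrable_def)
  show "(\<lambda>x. indicat_real K x *\<^sub>R w x) \<in> borel_measurable hyp_measure"
    using emeasure_hyp_compact(1)[OF K] w by (intro borel_measurable_scaleR borel_measurable_indicator)
  show "AE x in hyp_measure. norm (indicat_real K x *\<^sub>R w x) \<le> norm (C *\<^sub>R (indicat_real K x *\<^sub>R v x))"
  proof (rule AE_I2)
    fix x :: 'a
    show "norm (indicat_real K x *\<^sub>R w x) \<le> norm (C *\<^sub>R (indicat_real K x *\<^sub>R v x))"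
      using le[of x] mult_right_mono[OF abs_ge_self[of C] norm_ge_zero[of "v x"]] by (cases "x \<in> K") auto
  qed
qed

lemma set_integrable_hyp_continuous:
  fixes f :: "'a::euclidean_space \<Rightarrow> 'b::euclidean_space"
  assumes K: "compact K" "K \<subseteq> hyp_space" and f: "continuous_on hyp_space f"
  shows "set_integrable hyp_measure K f"
proof -
  have "compact (f ` K)" using K f by (auto intro!: compact_continuous_image intro: continuous_on_subset)
  then obtain C where C: "\<And>x. x \<in> K \<Longrightarrow> norm (f x) \<le> C"
    by (metis bounded_iff compact_imp_bounded image_eqI)
  show ?thesis
  proof (rule set_integrable_hyp_bound[OF K, of "\<lambda>_. 1::real"])
    show "set_integrable hyp_measure K (\<lambda>_. 1::real)"
      unfolding set_integrable_def using emeasure_hyp_compact[OF K] by simp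
  qed (use C continuous_measurable_hyp[OF f] in auto)
qed

text \<open>The factor \<open>(hyp_dfac x)\<^sup>2\<close> is the inverse metric: it turns the
  Euclidean gradient, which represents the differential, into the Riemannian gradient.\<close>

lemma hyp_inner_dfac: "x \<in> hyp_space \<Longrightarrow> hyp_inner x ((hyp_dfac x)\<^sup>2 *\<^sub>R e) w = e \<bullet> w"
proof -
  assume "x \<in> hyp_space"
  then have "(hyp_factor x)\<^sup>2 * (hyp_dfac x)\<^sup>2 = 1"
    using hyp_dfac_factor[of x] by (metis mult.commute power_mult_distrib power_one)
  then show ?thesis by (simp add: hyp_inner_def mult.assoc[symmetric])
qed

text \<open>The divergence theorem for the field \<phi> X, compactly supported because X is.\<close>

lemma hyp_weak_grad_smooth:
  fixes \<phi> :: "'a::euclidean_space \<Rightarrow> real"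
  assumes \<phi>: "\<And>k. Ck k \<phi>"
  shows "hyp_weak_grad \<phi> (\<lambda>x. (hyp_dfac x)\<^sup>2 *\<^sub>R egrad \<phi> x)"
  unfolding hyp_weak_grad_def
proof (intro conjI allI impI)
  have c\<phi>: "continuous_on hyp_space \<phi>" "continuous_on hyp_space (egrad \<phi>)"
    by (rule continuous_on_subset[OF Ck_continuous[OF \<phi>[of 0]]], simp)
       (rule continuous_on_subset[OF continuous_egrad[OF \<phi>]], simp)
  fix K :: "'a set" assume K: "compact K" "K \<subseteq> hyp_space"
  show "set_integrable hyp_measure K \<phi>" "set_integrable hyp_measure K (\<lambda>x. (hyp_dfac x)\<^sup>2 *\<^sub>R egrad \<phi> x)"
    by (intro set_integrable_hyp_continuous K c\<phi> continuous_intros continuous_on_dfac)+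
next
  fix X :: "'a \<Rightarrow> 'a" assume X: "test_field X"
  have X1: "Ck 1 (\<lambda>x. X x \<bullet> b)" if "b \<in> Basis" for b using X that Cc_smooth_Ck by blast
  obtain K C where K: "compact K" "K \<subseteq> hyp_space" "0 \<le> C"
    "\<And>x. x \<notin> K \<Longrightarrow> X x = 0" "\<And>x. norm (X x) \<le> C" "continuous_on UNIV X"
    "\<And>x. x \<in> hyp_space \<Longrightarrow> x \<notin> K \<Longrightarrow> hyp_div X x = 0"
    "\<And>x. x \<in> hyp_space \<Longrightarrow> \<bar>hyp_div X x\<bar> \<le> C" "continuous_on hyp_space (hyp_div X)"
    by (rule C1_field_bounds[OF test_field_C1[OF X]]) blast
  have c\<phi>: "continuous_on hyp_space \<phi>" "continuous_on hyp_space (egrad \<phi>)"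
    by (rule continuous_on_subset[OF Ck_continuous[OF \<phi>[of 0]]], simp)
       (rule continuous_on_subset[OF continuous_egrad[OF \<phi>]], simp)
  have "set_integrable hyp_measure K \<phi>" by (intro set_integrable_hyp_continuous K c\<phi>)
  then have "integrable hyp_measure (\<lambda>x. hyp_div X x *\<^sub>R \<phi> x)"
    by (rule set_integrable_hyp_mult[OF _ _ K(8,7)]) (auto intro: continuous_measurable_hyp K(9))
  then have i1: "integrable hyp_measure (\<lambda>x. \<phi> x * hyp_div X x)" by (simp add: mult.commute)
  have "set_integrable hyp_measure K (\<lambda>x. egrad \<phi> x \<bullet> X x)"
    by (intro set_integrable_hyp_continuous K c\<phi> continuous_intros continuous_on_subset[OF K(6)]) auto
  moreover have "(\<lambda>x. indicat_real K x *\<^sub>R (egrad \<phi> x \<bullet> X x)) = (\<lambda>x. egrad \<phi> x \<bullet> X x)"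
    using K(4) by (auto simp: fun_eq_iff indicator_def)
  ultimately have i2: "integrable hyp_measure (\<lambda>x. egrad \<phi> x \<bullet> X x)" by (simp add: set_integrable_def)
  have "0 = (\<integral>x. hyp_div (\<lambda>x. \<phi> x *\<^sub>R X x) x \<partial>hyp_measure)"
    using hyp_divergence_theorem[OF test_field_C1[OF test_field_mult[OF X \<phi>]]] by simp
  also have "\<dots> = (\<integral>x. \<phi> x * hyp_div X x + egrad \<phi> x \<bullet> X x \<partial>hyp_measure)"
    by (intro Bochner_Integration.integral_cong refl hyp_div_mult \<phi> X1) auto
  also have "\<dots> = (\<integral>x. \<phi> x * hyp_div X x \<partial>hyp_measure) + (\<integral>x. egrad \<phi> x \<bullet> X x \<partial>hyp_measure)"
    using i1 i2 by simp
  also have "(\<integral>x. egrad \<phi> x \<bullet> X x \<partial>hyp_measure) = (\<integral>x. hyp_inner x ((hyp_dfac x)\<^sup>2 *\<^sub>R egrad \<phi> x) (X x) \<partial>hyp_measure)"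
    by (intro Bochner_Integration.integral_cong refl hyp_inner_dfac[symmetric]) auto
  finally show "(\<integral>x. hyp_inner x ((hyp_dfac x)\<^sup>2 *\<^sub>R egrad \<phi> x) (X x) \<partial>hyp_measure) = - (\<integral>x. \<phi> x * hyp_div X x \<partial>hyp_measure)"
    by linarith
qed

text \<open>If X is a test field then so is \<kappa> X; testing v against \<kappa> X and expanding
  its divergence by the product rule isolates the term with the gradient of \<kappa>.\<close>

lemma hyp_weak_grad_mult:
  fixes v \<kappa> :: "'a::euclidean_space \<Rightarrow> real"
  assumes vG: "hyp_weak_grad v G" and \<kappa>: "\<And>k. Ck k \<kappa>"
  shows "hyp_weak_grad (\<lambda>x. \<kappa> x * v x) (\<lambda>x. \<kappa> x *\<^sub>R G x + (v x * (hyp_dfac x)\<^sup>2) *\<^sub>R egrad \<kappa> x)"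
proof -
  have c\<kappa>: "continuous_on hyp_space \<kappa>" "continuous_on hyp_space (egrad \<kappa>)"
    by (rule continuous_on_subset[OF Ck_continuous[OF \<kappa>[of 0]]], simp)
       (rule continuous_on_subset[OF continuous_egrad[OF \<kappa>]], simp)
  have m: "\<kappa> \<in> borel_measurable hyp_measure" "egrad \<kappa> \<in> borel_measurable hyp_measure"
    "hyp_dfac \<in> borel_measurable hyp_measure" "v \<in> borel_measurable hyp_measure" "G \<in> borel_measurable hyp_measure"
    using hyp_weak_grad_measurable[OF vG] by (auto intro!: continuous_measurable_hyp c\<kappa> continuous_on_dfac)
  show ?thesis
    unfolding hyp_weak_grad_def
  proof (intro conjI allI impI)
    fix K :: "'a set" assume K: "compact K" "K \<subseteq> hyp_space"
    have vi: "set_integrable hyp_measure K v" and Gi: "set_integrable hyp_measure K G"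
      using vG K by (auto simp: hyp_weak_grad_def)
    have ck: "continuous_on K \<kappa>" "continuous_on K (\<lambda>x. (hyp_dfac x)\<^sup>2 *\<^sub>R egrad \<kappa> x)"
      by (rule continuous_on_subset[OF c\<kappa>(1) K(2)],
          intro continuous_intros continuous_on_dfac continuous_on_subset[OF c\<kappa>(2) K(2)])
    obtain C1 where C1: "\<And>x. x \<in> K \<Longrightarrow> norm (\<kappa> x) \<le> C1"
      using continuous_on_compact_bound[OF K(1) ck(1)] by blast
    obtain C2 where C2: "\<And>x. x \<in> K \<Longrightarrow> norm ((hyp_dfac x)\<^sup>2 *\<^sub>R egrad \<kappa> x) \<le> C2"
      using continuous_on_compact_bound[OF K(1) ck(2)] by blast
    note C = C1[unfolded real_norm_def] C2
    show "set_integrable hyp_measure K (\<lambda>x. \<kappa> x * v x)"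
      by (rule set_integrable_hyp_bound[OF K vi, of _ C1]) (use m C(1) in \<open>auto simp: abs_mult intro!: mult_right_mono\<close>)
    have 1: "set_integrable hyp_measure K (\<lambda>x. \<kappa> x *\<^sub>R G x)"
      by (rule set_integrable_hyp_bound[OF K Gi, of _ C1]) (use m C(1) in \<open>auto intro!: mult_right_mono\<close>)
    have 2: "set_integrable hyp_measure K (\<lambda>x. (v x * (hyp_dfac x)\<^sup>2) *\<^sub>R egrad \<kappa> x)"
    proof (rule set_integrable_hyp_bound[OF K vi, of _ C2])
      fix x assume "x \<in> K"
      then show "norm ((v x * (hyp_dfac x)\<^sup>2) *\<^sub>R egrad \<kappa> x) \<le> C2 * norm (v x)"
        using mult_right_mono[OF C(2), of x "\<bar>v x\<bar>"] by (simp add: abs_mult mult_ac)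
    qed (intro borel_measurable_scaleR borel_measurable_times borel_measurable_power m)
    show "set_integrable hyp_measure K (\<lambda>x. \<kappa> x *\<^sub>R G x + (v x * (hyp_dfac x)\<^sup>2) *\<^sub>R egrad \<kappa> x)"
      using set_integrable_scale_add[OF 1 2, of 1 1] by simp
  next
    fix X :: "'a \<Rightarrow> 'a" assume X: "test_field X"
    have X1: "Ck 1 (\<lambda>x. X x \<bullet> b)" if "b \<in> Basis" for b using X that Cc_smooth_Ck by blast
    note X' = test_field_mult[OF X \<kappa>]
    note iG = hyp_weak_grad_integrable(2)[OF vG X']
    obtain K C where K: "compact K" "K \<subseteq> hyp_space" "0 \<le> C"
      "\<And>x. x \<notin> K \<Longrightarrow> X x = 0" "\<And>x. norm (X x) \<le> C" "continuous_on UNIV X"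
      "\<And>x. x \<in> hyp_space \<Longrightarrow> x \<notin> K \<Longrightarrow> hyp_div X x = 0"
      "\<And>x. x \<in> hyp_space \<Longrightarrow> \<bar>hyp_div X x\<bar> \<le> C" "continuous_on hyp_space (hyp_div X)"
      by (rule C1_field_bounds[OF test_field_C1[OF X]]) blast
    have vi: "set_integrable hyp_measure K v" using vG K by (auto simp: hyp_weak_grad_def)
    have "continuous_on K (\<lambda>x. egrad \<kappa> x \<bullet> X x)"
      by (intro continuous_on_inner continuous_on_subset[OF c\<kappa>(2) K(2)] continuous_on_subset[OF K(6)]) simp
    then obtain C1 where C1: "\<And>x. x \<in> K \<Longrightarrow> norm (egrad \<kappa> x \<bullet> X x) \<le> C1"
      using continuous_on_compact_bound[OF K(1)] by blast
    note C1 = C1[unfolded real_norm_def]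
    have mX: "X \<in> borel_measurable hyp_measure"
      by (rule continuous_measurable_hyp) (rule continuous_on_subset[OF K(6)], simp)
    have "integrable hyp_measure (\<lambda>x. (egrad \<kappa> x \<bullet> X x) *\<^sub>R v x)"
    proof (rule set_integrable_hyp_mult[OF vi, of _ "\<bar>C1\<bar>"])
      show "\<bar>egrad \<kappa> x \<bullet> X x\<bar> \<le> \<bar>C1\<bar>" for x using C1[of x] K(4)[of x] by (cases "x \<in> K") auto
    qed (use m mX K(4) in auto)
    then have ie: "integrable hyp_measure (\<lambda>x. v x * (egrad \<kappa> x \<bullet> X x))" by (simp add: mult.commute)
    have eq: "v x * hyp_div (\<lambda>x. \<kappa> x *\<^sub>R X x) x = \<kappa> x * v x * hyp_div X x + v x * (egrad \<kappa> x \<bullet> X x)" if "x \<in> hyp_space" for x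
      using hyp_div_mult[OF that \<kappa> X1] by (simp add: algebra_simps)
    have "integrable hyp_measure (\<lambda>x. v x * hyp_div (\<lambda>x. \<kappa> x *\<^sub>R X x) x)" by (rule hyp_weak_grad_integrable(1)[OF vG X'])
    then have "integrable hyp_measure (\<lambda>x. \<kappa> x * v x * hyp_div X x + v x * (egrad \<kappa> x \<bullet> X x))"
      by (subst Bochner_Integration.integrable_cong[OF refl eq[symmetric]]) auto
    from Bochner_Integration.integrable_diff[OF this ie]
    have icv: "integrable hyp_measure (\<lambda>x. \<kappa> x * v x * hyp_div X x)" by simp
    have "(\<integral>x. hyp_inner x (\<kappa> x *\<^sub>R G x + (v x * (hyp_dfac x)\<^sup>2) *\<^sub>R egrad \<kappa> x) (X x) \<partial>hyp_measure)
       = (\<integral>x. hyp_inner x (G x) (\<kappa> x *\<^sub>R X x) + v x * (egrad \<kappa> x \<bullet> X x) \<partial>hyp_measure)"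
    proof (intro Bochner_Integration.integral_cong refl)
      fix x :: 'a assume "x \<in> space hyp_measure"
      then have x: "x \<in> hyp_space" by simp
      show "hyp_inner x (\<kappa> x *\<^sub>R G x + (v x * (hyp_dfac x)\<^sup>2) *\<^sub>R egrad \<kappa> x) (X x) = hyp_inner x (G x) (\<kappa> x *\<^sub>R X x) + v x * (egrad \<kappa> x \<bullet> X x)"
        using hyp_inner_dfac[OF x, of "egrad \<kappa> x" "X x"] by (simp add: hyp_inner_def inner_add_left algebra_simps)
    qed
    also have "\<dots> = (\<integral>x. hyp_inner x (G x) (\<kappa> x *\<^sub>R X x) \<partial>hyp_measure) + (\<integral>x. v x * (egrad \<kappa> x \<bullet> X x) \<partial>hyp_measure)"
      using iG ie by simp
    also have "(\<integral>x. hyp_inner x (G x) (\<kappa> x *\<^sub>R X x) \<partial>hyp_measure) = - (\<integral>x. v x * hyp_div (\<lambda>x. \<kappa> x *\<^sub>R X x) x \<partial>hyp_measure)"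
      using vG X' by (auto simp: hyp_weak_grad_def)
    also have "(\<integral>x. v x * hyp_div (\<lambda>x. \<kappa> x *\<^sub>R X x) x \<partial>hyp_measure) = (\<integral>x. \<kappa> x * v x * hyp_div X x + v x * (egrad \<kappa> x \<bullet> X x) \<partial>hyp_measure)"
      using eq by (intro Bochner_Integration.integral_cong refl) auto
    also have "\<dots> = (\<integral>x. \<kappa> x * v x * hyp_div X x \<partial>hyp_measure) + (\<integral>x. v x * (egrad \<kappa> x \<bullet> X x) \<partial>hyp_measure)"
      using icv ie by simp
    finally show "(\<integral>x. hyp_inner x (\<kappa> x *\<^sub>R G x + (v x * (hyp_dfac x)\<^sup>2) *\<^sub>R egrad \<kappa> x) (X x) \<partial>hyp_measure) = - (\<integral>x. \<kappa> x * v x * hyp_div X x \<partial>hyp_measure)"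
      by simp
  qed
qed

text \<open>In the chart, a weak gradient G amounts to Euclidean weak partial derivatives given by
  the components of G times the squared conformal factor. This opens the way to Euclidean
  mollification.\<close>

lemma hyp_weak_grad_euclidean:
  fixes v :: "'a::euclidean_space \<Rightarrow> real"
  assumes vG: "hyp_weak_grad v G" and \<zeta>: "\<zeta> \<in> Cc_smooth hyp_space" and b: "b \<in> Basis"
  shows "(\<integral>x. indicat_real hyp_space x * ((hyp_factor x)\<^sup>2 * (G x \<bullet> b) * \<zeta> x) \<partial>lebesgue)
      = - (\<integral>x. indicat_real hyp_space x * (v x * pd \<zeta> b x) \<partial>lebesgue)"
    and "integrable lebesgue (\<lambda>x. indicat_real hyp_space x * ((hyp_factor x)\<^sup>2 * (G x \<bullet> b) * \<zeta> x))"
proof -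
  let ?n = "DIM('a)"
  \<comment> \<open>The power of \<open>hyp_dfac\<close> cancels the density of the measure. As a
    polynomial it keeps \<open>X\<close> a test field.\<close>
  define X where "X x = (hyp_dfac x ^ ?n * \<zeta> x) *\<^sub>R b" for x
  have X: "test_field X"
  proof
    fix b' :: 'a
    have "(\<lambda>x. (hyp_dfac x ^ ?n * (b \<bullet> b')) * \<zeta> x) \<in> Cc_smooth hyp_space"
      by (intro Cc_smooth_mult \<zeta> Ck_mult Ck_power Ck_dfac Ck_const)
    then show "(\<lambda>x. X x \<bullet> b') \<in> Cc_smooth hyp_space" by (simp add: X_def mult_ac)
  qed
  have \<zeta>0: "\<zeta> x = 0" if "x \<notin> hyp_space" for x
    using \<zeta> that unfolding Cc_smooth_def by blast
  have eq: "(\<lambda>y. hyp_factor y ^ ?n * (X y \<bullet> b')) = (\<lambda>y. (b \<bullet> b') * \<zeta> y)" for b'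
  proof
    fix y
    show "hyp_factor y ^ ?n * (X y \<bullet> b') = (b \<bullet> b') * \<zeta> y"
    proof (cases "y \<in> hyp_space")
      case True
      then have "hyp_factor y ^ ?n * hyp_dfac y ^ ?n = 1"
        using hyp_dfac_factor[of y] by (metis mult.commute power_mult_distrib power_one)
      then have "hyp_factor y ^ ?n * hyp_dfac y ^ ?n * (\<zeta> y * (b \<bullet> b')) = \<zeta> y * (b \<bullet> b')" by simp
      then show ?thesis by (simp add: X_def mult_ac)
    qed (simp add: X_def \<zeta>0)
  qed
  have hd: "hyp_factor x ^ ?n * hyp_div X x = pd \<zeta> b x" if "x \<in> hyp_space" for x
  proof -
    have "\<zeta> differentiable (at x)" using Cc_smooth_Ck[OF \<zeta>, of 1] by simp
    then have "((\<lambda>y. (b \<bullet> b') * \<zeta> y) has_derivative (\<lambda>h. (b \<bullet> b') * frechet_derivative \<zeta> (at x) h)) (at x)" for b'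
      by (intro has_derivative_mult_right) (simp add: frechet_derivative_works)
    then have "pd (\<lambda>y. (b \<bullet> b') * \<zeta> y) b' x = (b \<bullet> b') * pd \<zeta> b' x" for b' by (rule pd_eq)
    then have "hyp_factor x ^ ?n * hyp_div X x = (\<Sum>b'\<in>Basis. (b \<bullet> b') * pd \<zeta> b' x)"
      using hyp_factor_pos[OF that] by (simp add: hyp_div_def eq)
    also have "\<dots> = (\<Sum>b'\<in>Basis. if b' = b then pd \<zeta> b x else 0)"
      using b by (intro sum.cong) (auto simp: inner_Basis)
    finally show ?thesis using b by simp
  qed
  have hi: "hyp_factor x ^ ?n * hyp_inner x (G x) (X x) = (hyp_factor x)\<^sup>2 * (G x \<bullet> b) * \<zeta> x" if "x \<in> hyp_space" for x
  proof -
    have "hyp_factor x ^ ?n * hyp_dfac x ^ ?n = 1"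
      using hyp_dfac_factor[OF that] by (metis mult.commute power_mult_distrib power_one)
    then have "(hyp_factor x ^ ?n * hyp_dfac x ^ ?n) * ((hyp_factor x)\<^sup>2 * (G x \<bullet> b) * \<zeta> x) = (hyp_factor x)\<^sup>2 * (G x \<bullet> b) * \<zeta> x" by simp
    then show ?thesis by (simp add: hyp_inner_def X_def mult_ac)
  qed
  note i = hyp_weak_grad_integrable[OF vG X]
  have "(\<integral>x. hyp_inner x (G x) (X x) \<partial>hyp_measure) = (\<integral>x. indicat_real hyp_space x * ((hyp_factor x)\<^sup>2 * (G x \<bullet> b) * \<zeta> x) \<partial>lebesgue)"
    by (subst integral_hyp[OF borel_measurable_integrable[OF i(2)]], intro Bochner_Integration.integral_cong refl)
       (auto simp: indicator_def hi)
  moreover have "(\<integral>x. v x * hyp_div X x \<partial>hyp_measure) = (\<integral>x. indicat_real hyp_space x * (v x * pd \<zeta> b x) \<partial>lebesgue)"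
    by (subst integral_hyp[OF borel_measurable_integrable[OF i(1)]], intro Bochner_Integration.integral_cong refl)
       (auto simp: indicator_def hd[symmetric])
  ultimately show "(\<integral>x. indicat_real hyp_space x * ((hyp_factor x)\<^sup>2 * (G x \<bullet> b) * \<zeta> x) \<partial>lebesgue)
      = - (\<integral>x. indicat_real hyp_space x * (v x * pd \<zeta> b x) \<partial>lebesgue)"
    using vG X by (simp add: hyp_weak_grad_def)
  have "integrable lebesgue (\<lambda>x. indicat_real hyp_space x *\<^sub>R (hyp_factor x ^ ?n *\<^sub>R hyp_inner x (G x) (X x)))"
    using i(2) integrable_hyp_iff[OF borel_measurable_integrable[OF i(2)]] by blast
  then show "integrable lebesgue (\<lambda>x. indicat_real hyp_space x * ((hyp_factor x)\<^sup>2 * (G x \<bullet> b) * \<zeta> x))"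
    by (rule back_subst[of "integrable lebesgue"]) (auto simp: fun_eq_iff indicator_def hi)
qed

lemma Cc_smooth_bump:
  assumes "0 < r" "r < 1"
  shows "(\<lambda>x::'a::euclidean_space. bump ((1 / r) *\<^sub>R x)) \<in> Cc_smooth hyp_space"
  unfolding Cc_smooth_def
proof (intro CollectI conjI allI exI[of _ "cball 0 r"] impI)
  show "Ck k (\<lambda>x::'a. bump ((1 / r) *\<^sub>R x))" for k using Ck_affine[OF Ck_bump, of k 0 "1 / r"] by simp
  show "bump ((1 / r) *\<^sub>R x) = 0" if "x \<notin> cball 0 r" for x :: 'a
    using that assms by (intro bump_eq_0) (auto simp: field_simps)
qed (use assms in auto)

text \<open>A mollifier times a bump supported in the ball is an admissible test function, so every
  mollification of a localized component of G vanishes. Since mollifications converge in L^1, the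
  component is null.\<close>

lemma hyp_weak_grad_zero:
  fixes G :: "'a::euclidean_space \<Rightarrow> 'a"
  assumes G: "hyp_weak_grad (\<lambda>_. 0) G"
  shows "AE x in hyp_measure. G x = 0"
proof -
  \<comment> \<open>The shift by 2 keeps the radii positive; they increase to 1.\<close>
  define r where "r k = 1 - 1 / real (k + 2)" for k
  have r: "0 < r k" "r k < 1" for k by (auto simp: r_def field_simps)
  define g where "g b k x = indicat_real hyp_space x * ((hyp_factor x)\<^sup>2 * (G x \<bullet> b) * bump ((1 / r k) *\<^sub>R x))" for b k x
  have "AE x in lebesgue. g b k x = 0" if b: "b \<in> Basis" for b k
  proof -
    note \<zeta> = Cc_smooth_bump[OF r(1) r(2), where 'a = 'a, of k]
    have gi: "integrable lebesgue (g b k)"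
      unfolding g_def using hyp_weak_grad_euclidean(2)[OF G \<zeta> b] .
    have m0: "moll \<epsilon> (g b k) x = 0" for \<epsilon> x
    proof -
      have "Ck j (\<lambda>y. mollifier \<epsilon> (x - y))" for j
        using Ck_affine[OF Ck_mollifier, of j \<epsilon> x "-1"] by simp
      then have z: "(\<lambda>y. mollifier \<epsilon> (x - y) * bump ((1 / r k) *\<^sub>R y)) \<in> Cc_smooth hyp_space"
        by (intro Cc_smooth_mult \<zeta>)
      have "moll \<epsilon> (g b k) x = (\<integral>y. indicat_real hyp_space y * ((hyp_factor y)\<^sup>2 * (G y \<bullet> b) * (mollifier \<epsilon> (x - y) * bump ((1 / r k) *\<^sub>R y))) \<partial>lebesgue)"
        unfolding moll_def g_def by (intro Bochner_Integration.integral_cong refl) (simp add: mult_ac)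
      also have "\<dots> = 0" using hyp_weak_grad_euclidean(1)[OF G z b] by simp
      finally show ?thesis .
    qed
    have "(\<integral>x. \<bar>g b k x\<bar> \<partial>lebesgue) \<le> 0"
    proof (rule field_le_epsilon)
      fix e :: real assume "0 < e"
      have "integrable lebesgue (\<lambda>x. \<bar>g b k x\<bar> powr 1)" using gi by simp
      from moll_Lp_tendsto[OF gi this order_refl \<open>0 < e\<close>]
      obtain d where d: "0 < d" "\<And>\<epsilon>. 0 < \<epsilon> \<Longrightarrow> \<epsilon> < d \<Longrightarrow>
        integrable lebesgue (\<lambda>x. \<bar>moll \<epsilon> (g b k) x - g b k x\<bar> powr 1) \<and> (\<integral>x. \<bar>moll \<epsilon> (g b k) x - g b k x\<bar> powr 1 \<partial>lebesgue) \<le> e"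
        by blast
      have "(\<integral>x. \<bar>moll (d / 2) (g b k) x - g b k x\<bar> powr 1 \<partial>lebesgue) \<le> e" using d(1) d(2)[of "d / 2"] by simp
      then show "(\<integral>x. \<bar>g b k x\<bar> \<partial>lebesgue) \<le> 0 + e" by (simp add: m0)
    qed
    moreover have "0 \<le> (\<integral>x. \<bar>g b k x\<bar> \<partial>lebesgue)" by simp
    ultimately have "(\<integral>x. \<bar>g b k x\<bar> \<partial>lebesgue) = 0" by linarith
    then show ?thesis
      using integral_nonneg_eq_0_iff_AE[of lebesgue "\<lambda>x. \<bar>g b k x\<bar>"] gi by auto
  qed
  then have "AE x in lebesgue. \<forall>b\<in>Basis. g b k x = 0" for k
    by (intro AE_finite_allI) auto
  then have "AE x in lebesgue. \<forall>k. \<forall>b\<in>Basis. g b k x = 0"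
    by (simp add: AE_all_countable)
  then show ?thesis
    unfolding AE_hyp_iff
  proof (eventually_elim, intro impI)
    fix x :: 'a assume z: "\<forall>k. \<forall>b\<in>Basis. g b k x = 0" and x: "x \<in> hyp_space"
    have "0 < 1 - norm x" using x by simp
    then obtain k where k: "1 / real (Suc k) < 1 - norm x" using nat_approx_posE by blast
    have "1 / real (k + 2) \<le> 1 / real (Suc k)" by (intro divide_left_mono) auto
    then have "norm x < r k" using k by (simp add: r_def)
    then have "0 < bump ((1 / r k) *\<^sub>R x)" using r[of k] by (subst bump_pos_iff) (simp add: field_simps)
    then have "G x \<bullet> b = 0 \<bullet> b" if "b \<in> Basis" for b
    proof -
      have "g b k x = 0" using z that by blast
      moreover have "0 < bump ((1 / r k) *\<^sub>R x)" by fact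
      ultimately show ?thesis using x hyp_factor_pos[OF x] by (simp add: g_def)
    qed
    then show "G x = 0" by (rule euclidean_eqI)
  qed
qed

text \<open>\<open>hyp_grad\<close> is an arbitrary choice. This lets any explicitly computed weak
  gradient replace it under integrals.\<close>

lemma hyp_weak_grad_unique:
  fixes v :: "'a::euclidean_space \<Rightarrow> real"
  assumes "hyp_weak_grad v G" "hyp_weak_grad v H"
  shows "AE x in hyp_measure. G x = H x"
proof -
  have "hyp_weak_grad (\<lambda>x. 0) (\<lambda>x. G x - H x)"
    using hyp_weak_grad_linear[OF assms, of 1 "-1"] by simp
  from hyp_weak_grad_zero[OF this] show ?thesis by (rule eventually_mono) simp
qed

lemma hyp_weak_grad_hyp_grad: "hyp_weak_grad v G \<Longrightarrow> hyp_weak_grad v (hyp_grad v)"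
  unfolding hyp_grad_def using someI[of "\<lambda>G. hyp_weak_grad v G" G] by simp

lemma hyp_grad_AE:
  fixes v :: "'a::euclidean_space \<Rightarrow> real"
  shows "hyp_weak_grad v G \<Longrightarrow> AE x in hyp_measure. hyp_grad v x = G x"
  by (rule hyp_weak_grad_unique[OF hyp_weak_grad_hyp_grad])

section \<open>Convex homogeneous functionals\<close>

text \<open>Convexity applied to a + b = (1-s) (a/(1-s)) + s (b/s), with the tangent taken at a + b.
  Since s is free, the coefficient of a^p can be brought as close to 1 as desired, which plain
  doubling constants do not allow.\<close>

lemma powr_add_convex:
  fixes a b s p :: real
  assumes "0 \<le> a" "0 \<le> b" "1 \<le> p" "0 < s" "s < 1"
  shows "(a + b) powr p \<le> (1 - s) powr (1 - p) * a powr p + s powr (1 - p) * b powr p"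
proof -
  define m where "m = a + b"
  have "(1 - s) * (m powr p + p * m powr (p - 1) * (a / (1 - s) - m)) + s * (m powr p + p * m powr (p - 1) * (b / s - m))
     \<le> (1 - s) * (a / (1 - s)) powr p + s * (b / s) powr p"
    using assms by (intro add_mono mult_left_mono powr_tangent) (auto simp: m_def)
  also have "(1 - s) * (m powr p + p * m powr (p - 1) * (a / (1 - s) - m)) + s * (m powr p + p * m powr (p - 1) * (b / s - m))
     = m powr p + p * m powr (p - 1) * ((1 - s) * (a / (1 - s)) + s * (b / s) - m)"
    by (simp add: algebra_simps)
  also have "(1 - s) * (a / (1 - s)) + s * (b / s) - m = 0" using assms by (simp add: m_def)
  also have "(1 - s) * (a / (1 - s)) powr p = (1 - s) powr (1 - p) * a powr p"
    using assms by (simp add: powr_divide powr_diff)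
  also have "s * (b / s) powr p = s powr (1 - p) * b powr p"
    using assms by (simp add: powr_divide powr_diff)
  finally show ?thesis by (simp add: m_def)
qed

text \<open>This is convexity of a \<open>p\<close>-homogeneous functional, with its weights absorbed by homogeneity:
  \<open>f + g = (1 - s) (f / (1 - s)) + s (g / s)\<close>.\<close>

definition convex_functional :: "real \<Rightarrow> ('a \<Rightarrow> real) set \<Rightarrow> (('a \<Rightarrow> real) \<Rightarrow> real) \<Rightarrow> bool" where
  "convex_functional p X A \<longleftrightarrow> 1 \<le> p \<and>
    (\<forall>f\<in>X. \<forall>g\<in>X. \<forall>a b. (\<lambda>x. a * f x + b * g x) \<in> X) \<and> (\<forall>f\<in>X. 0 \<le> A f) \<and>
    (\<forall>f\<in>X. \<forall>c. A (\<lambda>x. c * f x) = \<bar>c\<bar> powr p * A f) \<and>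
    (\<forall>f\<in>X. \<forall>g\<in>X. \<forall>s. 0 < s \<longrightarrow> s < 1 \<longrightarrow>
      A (\<lambda>x. f x + g x) \<le> (1 - s) powr (1 - p) * A f + s powr (1 - p) * A g)"

lemma convex_functionalI:
  assumes "1 \<le> p" and "\<And>f g. f \<in> X \<Longrightarrow> g \<in> X \<Longrightarrow> (\<lambda>x. f x + g x) \<in> X"
    and "\<And>f c. f \<in> X \<Longrightarrow> (\<lambda>x. c * f x) \<in> X" and "\<And>f. f \<in> X \<Longrightarrow> 0 \<le> A f"
    and "\<And>f c. f \<in> X \<Longrightarrow> A (\<lambda>x. c * f x) = \<bar>c\<bar> powr p * A f"
    and "\<And>f g s. f \<in> X \<Longrightarrow> g \<in> X \<Longrightarrow> 0 < s \<Longrightarrow> s < 1 \<Longrightarrow>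
      A (\<lambda>x. f x + g x) \<le> (1 - s) powr (1 - p) * A f + s powr (1 - p) * A g"
  shows "convex_functional p X A"
  unfolding convex_functional_def using assms by simp

context
  fixes p :: real and X :: "('a \<Rightarrow> real) set" and A :: "('a \<Rightarrow> real) \<Rightarrow> real"
  assumes cf: "convex_functional p X A"
begin

lemma cf_lin: "f \<in> X \<Longrightarrow> g \<in> X \<Longrightarrow> (\<lambda>x. a * f x + b * g x) \<in> X"
  using cf by (auto simp: convex_functional_def)

lemma cf_diff: "f \<in> X \<Longrightarrow> g \<in> X \<Longrightarrow> (\<lambda>x. f x - g x) \<in> X"
  using cf_lin[of f g 1 "-1"] by simp

lemma cf_add: "f \<in> X \<Longrightarrow> g \<in> X \<Longrightarrow> (\<lambda>x. f x + g x) \<in> X"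
  using cf_lin[of f g 1 "1"] by simp

lemma cf_scale: "f \<in> X \<Longrightarrow> (\<lambda>x. c * f x) \<in> X"
  using cf_lin[of f f c 0] by simp

lemma cf_nonneg: "f \<in> X \<Longrightarrow> 0 \<le> A f"
  using cf by (auto simp: convex_functional_def)

lemma cf_homog: "f \<in> X \<Longrightarrow> A (\<lambda>x. c * f x) = \<bar>c\<bar> powr p * A f"
  using cf by (auto simp: convex_functional_def)

lemma cf_minus: "f \<in> X \<Longrightarrow> A (\<lambda>x. - f x) = A f"
  using cf_homog[of f "-1"] by simp

lemma cf_swap: "f \<in> X \<Longrightarrow> g \<in> X \<Longrightarrow> A (\<lambda>x. f x - g x) = A (\<lambda>x. g x - f x)"
  using cf_minus[OF cf_diff[of f g]] by simp

lemma cf_ge_1: "1 \<le> p"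
  using cf by (auto simp: convex_functional_def)

lemma cf_convex: "f \<in> X \<Longrightarrow> g \<in> X \<Longrightarrow> 0 < s \<Longrightarrow> s < 1 \<Longrightarrow>
    A (\<lambda>x. f x + g x) \<le> (1 - s) powr (1 - p) * A f + s powr (1 - p) * A g"
  using cf unfolding convex_functional_def by blast

lemma cf_quasi: "f \<in> X \<Longrightarrow> g \<in> X \<Longrightarrow> A (\<lambda>x. f x + g x) \<le> 2 powr p * (A f + A g)"
proof -
  assume fg: "f \<in> X" "g \<in> X"
  have "A (\<lambda>x. f x + g x) \<le> (1 - 1/2) powr (1 - p) * A f + (1/2) powr (1 - p) * A g"
    by (rule cf_convex) (use fg in auto)
  also have "\<dots> = (1/2) powr (1 - p) * (A f + A g)" by (simp add: algebra_simps)
  also have "(1/2::real) powr (1 - p) = 2 powr (p - 1)"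
    by (simp add: powr_divide powr_minus_divide[symmetric])
  also have "2 powr (p - 1) * (A f + A g) \<le> 2 powr p * (A f + A g)"
    using cf_nonneg fg by (intro mult_right_mono powr_mono) auto
  finally show ?thesis .
qed

text \<open>This replaces the reverse triangle inequality. Convexity is applied to fk = f + (fk - f)
  and to f = fk + (f - fk) with a small fixed s: the first coefficient is close to 1, the second is
  large but constant and multiplies a term that vanishes in the limit.\<close>

lemma cf_tendsto:
  assumes f: "f \<in> X" and fk: "eventually (\<lambda>k. fk k \<in> X) F"
    and D: "((\<lambda>k. A (\<lambda>x. fk k x - f x)) \<longlongrightarrow> 0) F"
  shows "((\<lambda>k. A (fk k)) \<longlongrightarrow> A f) F"
proof (rule tendstoI)
  fix e :: real assume e: "0 < e"
  \<comment> \<open>The two conditions: \<delta> A f is at most e/4, and \<delta> itself at most 1,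
    which is used when the first estimate is inserted into the second.\<close>
  define \<delta> where "\<delta> = min 1 (e / (4 * (A f + 1)))"
  have Af: "0 \<le> A f" by (rule cf_nonneg[OF f])
  have \<delta>: "0 < \<delta>" "\<delta> \<le> 1" "\<delta> * A f \<le> e / 4"
  proof -
    show "0 < \<delta>" "\<delta> \<le> 1" using e Af by (auto simp: \<delta>_def)
    have "\<delta> * A f \<le> e / (4 * (A f + 1)) * A f" using Af by (intro mult_right_mono) (auto simp: \<delta>_def)
    also have "\<dots> = e / 4 * (A f / (A f + 1))" by simp
    also have "\<dots> \<le> e / 4 * 1" using e Af by (intro mult_left_mono) auto
    finally show "\<delta> * A f \<le> e / 4" by simp
  qed
  have "((\<lambda>s. (1 - s) powr (1 - p)) \<longlongrightarrow> (1 - 0) powr (1 - p)) (at_right 0)"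
    by (intro tendsto_intros) auto
  then have "eventually (\<lambda>s. (1 - s) powr (1 - p) < 1 + \<delta>) (at_right 0)"
    using \<delta>(1) by (intro order_tendstoD) auto
  moreover have "eventually (\<lambda>s. s \<in> {0<..<1}) (at_right (0::real))"
    by (rule eventually_at_right_real) simp
  ultimately obtain s where s: "(1 - s) powr (1 - p) < 1 + \<delta>" "0 < s" "s < 1"
    using eventually_happens'[OF _ eventually_conj] by (metis (mono_tags, lifting) greaterThanLessThan_iff trivial_limit_at_right_real)
  define C where "C = s powr (1 - p)"
  have C: "0 < C" using s by (simp add: C_def)
  have "eventually (\<lambda>k. A (\<lambda>x. fk k x - f x) < e / (8 * C)) F"
    using D e C by (intro order_tendstoD) auto
  with fk show "eventually (\<lambda>k. dist (A (fk k)) (A f) < e) F"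
  proof eventually_elim
    case (elim k)
    have d: "(\<lambda>x. fk k x - f x) \<in> X" "(\<lambda>x. f x - fk k x) \<in> X" using cf_diff elim f by auto
    define D where "D = A (\<lambda>x. fk k x - f x)"
    have D0: "0 \<le> D" "C * D < e / 8" using cf_nonneg[OF d(1)] elim(2) C by (auto simp: D_def field_simps)
    have "A (fk k) \<le> (1 - s) powr (1 - p) * A f + C * D"
      using cf_convex[OF f d(1) s(2,3)] by (simp add: C_def D_def)
    also have "\<dots> \<le> (1 + \<delta>) * A f + C * D" using mult_right_mono[OF less_imp_le[OF s(1)] Af] by simp
    finally have 1: "A (fk k) \<le> A f + \<delta> * A f + C * D" by (simp add: algebra_simps)
    have "A f \<le> (1 - s) powr (1 - p) * A (fk k) + C * D"
      using cf_convex[OF elim(1) d(2) s(2,3)] cf_swap[OF elim(1) f] by (simp add: C_def D_def)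
    also have "\<dots> \<le> (1 + \<delta>) * A (fk k) + C * D"
      using mult_right_mono[OF less_imp_le[OF s(1)] cf_nonneg[OF elim(1)]] by simp
    finally have 2: "A f \<le> A (fk k) + \<delta> * A (fk k) + C * D" by (simp add: algebra_simps)
    \<comment> \<open>The second estimate carries the unknown \<open>A (fk k)\<close>; the first one
      bounds it again.\<close>
    have "\<delta> * A (fk k) \<le> \<delta> * (A f + \<delta> * A f + C * D)" using 1 \<delta> by (intro mult_left_mono) auto
    also have "\<dots> = \<delta> * A f + \<delta> * (\<delta> * A f + C * D)" by (simp add: algebra_simps)
    also have "\<delta> * (\<delta> * A f + C * D) \<le> 1 * (\<delta> * A f + C * D)"
      using \<delta> Af C D0 by (intro mult_right_mono) auto
    finally have "\<delta> * A (fk k) \<le> \<delta> * A f + (\<delta> * A f + C * D)" by simp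
    then show ?case using 1 2 \<delta>(3) D0 e by (simp add: dist_real_def)
  qed
qed

end

section \<open>The spaces \<open>L\<^sup>p\<close> and \<open>W\<^sup>1\<^sup>,\<^sup>p\<close>\<close>

lemma integral_powr_add_convex:
  fixes f g h :: "'b \<Rightarrow> real"
  assumes f: "f \<in> borel_measurable M" "integrable M (\<lambda>x. f x powr p)" "\<And>x. 0 \<le> f x"
    and g: "g \<in> borel_measurable M" "integrable M (\<lambda>x. g x powr p)" "\<And>x. 0 \<le> g x"
    and h: "h \<in> borel_measurable M" "\<And>x. 0 \<le> h x" "AE x in M. h x \<le> f x + g x" and p: "1 \<le> p"
  shows "integrable M (\<lambda>x. h x powr p)"
    and "0 < s \<Longrightarrow> s < 1 \<Longrightarrow> (\<integral>x. h x powr p \<partial>M) \<le> (1 - s) powr (1 - p) * (\<integral>x. f x powr p \<partial>M) + s powr (1 - p) * (\<integral>x. g x powr p \<partial>M)"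
proof -
  have le: "AE x in M. h x powr p \<le> (1 - s) powr (1 - p) * f x powr p + s powr (1 - p) * g x powr p"
    if "0 < s" "s < 1" for s
    using h(3)
  proof eventually_elim
    case (elim x)
    have "h x powr p \<le> (f x + g x) powr p" using elim h(2) p by (intro powr_mono2) auto
    also have "\<dots> \<le> (1 - s) powr (1 - p) * f x powr p + s powr (1 - p) * g x powr p"
      using f g p that by (intro powr_add_convex) auto
    finally show ?case .
  qed
  have iS: "integrable M (\<lambda>x. (1 - s) powr (1 - p) * f x powr p + s powr (1 - p) * g x powr p)" for s
    using f g by simp
  show i: "integrable M (\<lambda>x. h x powr p)"
  proof (rule Bochner_Integration.integrable_bound[OF iS[of "1/2"]])
    show "AE x in M. norm (h x powr p) \<le> norm ((1 - 1/2) powr (1 - p) * f x powr p + (1/2) powr (1 - p) * g x powr p)"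
      using le[of "1/2"] by (auto elim!: eventually_mono)
  qed (use h in simp)
  show "(\<integral>x. h x powr p \<partial>M) \<le> (1 - s) powr (1 - p) * (\<integral>x. f x powr p \<partial>M) + s powr (1 - p) * (\<integral>x. g x powr p \<partial>M)"
    if "0 < s" "s < 1"
  proof -
    have "(\<integral>x. h x powr p \<partial>M) \<le> (\<integral>x. (1 - s) powr (1 - p) * f x powr p + s powr (1 - p) * g x powr p \<partial>M)"
      by (rule integral_mono_AE[OF i iS le[OF that]])
    then show ?thesis using f g by simp
  qed
qed

lemma hyp_norm_nonneg [simp]: "0 \<le> hyp_norm x v"
  by (simp add: hyp_norm_eq)

lemma hyp_norm_triangle: "hyp_norm x (v + w) \<le> hyp_norm x v + hyp_norm x w"
  unfolding hyp_norm_eq distrib_left[symmetric] by (intro mult_left_mono norm_triangle_ineq) auto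

lemma hyp_norm_scale: "hyp_norm x (c *\<^sub>R v) = \<bar>c\<bar> * hyp_norm x v"
  by (simp add: hyp_norm_eq)

lemma hyp_norm_measurable:
  "G \<in> borel_measurable hyp_measure \<Longrightarrow> (\<lambda>x. hyp_norm x (G x)) \<in> borel_measurable hyp_measure"
  unfolding hyp_norm_eq by (intro borel_measurable_times borel_measurable_abs hyp_factor_measurable' measurable_compose[OF _ borel_measurable_norm])

text \<open>The p-th power of the norm: an honest integral, additive in the integrand, and a convex
  functional without recourse to Minkowski's inequality.\<close>

definition Lp_int :: "real \<Rightarrow> ('a::euclidean_space \<Rightarrow> real) \<Rightarrow> real" where
  "Lp_int p v = (\<integral>x. \<bar>v x\<bar> powr p \<partial>hyp_measure)"

definition grad_energy :: "real \<Rightarrow> ('a::euclidean_space \<Rightarrow> real) \<Rightarrow> real" where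
  "grad_energy p v = (\<integral>x. hyp_norm x (hyp_grad v x) powr p \<partial>hyp_measure)"

lemma Lp_norm_eq: "Lp_norm p v = Lp_int p v powr (1 / p)"
  by (simp add: Lp_norm_def Lp_int_def)

lemma W1p_norm_eq: "W1p_norm p v = (Lp_int p v + grad_energy p v) powr (1 / p)"
  by (simp add: W1p_norm_def Lp_int_def grad_energy_def)

lemma Lp_int_nonneg: "0 \<le> Lp_int p v" and grad_energy_nonneg: "0 \<le> grad_energy p v"
  by (simp_all add: Lp_int_def grad_energy_def)

lemma Lp_norm_powr: "1 \<le> p \<Longrightarrow> Lp_norm p v powr p = Lp_int p v"
  by (simp add: Lp_norm_eq powr_powr Lp_int_nonneg)

lemma W1p_norm_powr: "1 \<le> p \<Longrightarrow> W1p_norm p v powr p = Lp_int p v + grad_energy p v"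
  by (simp add: W1p_norm_eq powr_powr Lp_int_nonneg grad_energy_nonneg add_nonneg_nonneg)

lemma Lp_hypD:
  assumes "v \<in> Lp_hyp p"
  shows "v \<in> borel_measurable hyp_measure" "integrable hyp_measure (\<lambda>x. \<bar>v x\<bar> powr p)"
  using assms by (auto simp: Lp_hyp_def)

lemma Lp_hyp_scale:
  "v \<in> Lp_hyp p \<Longrightarrow> (\<lambda>x. c * v x) \<in> Lp_hyp p \<and> Lp_int p (\<lambda>x. c * v x) = \<bar>c\<bar> powr p * Lp_int p v"
  by (auto simp: Lp_hyp_def Lp_int_def abs_mult powr_mult intro!: borel_measurable_times)

lemma Lp_hyp_add:
  fixes v w :: "'a::euclidean_space \<Rightarrow> real"
  assumes p: "1 \<le> p" and v: "v \<in> Lp_hyp p" and w: "w \<in> Lp_hyp p"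
  shows "(\<lambda>x. v x + w x) \<in> Lp_hyp p"
    and "0 < s \<Longrightarrow> s < 1 \<Longrightarrow> Lp_int p (\<lambda>x. v x + w x) \<le> (1 - s) powr (1 - p) * Lp_int p v + s powr (1 - p) * Lp_int p w"
proof -
  note D = Lp_hypD[OF v] Lp_hypD[OF w]
  have h: "AE x in hyp_measure. \<bar>v x + w x\<bar> \<le> \<bar>v x\<bar> + \<bar>w x\<bar>" by (rule AE_I2) simp
  note I = integral_powr_add_convex[of "\<lambda>x. \<bar>v x\<bar>" hyp_measure p "\<lambda>x. \<bar>w x\<bar>" "\<lambda>x. \<bar>v x + w x\<bar>", OF _ D(2) _ _ D(4) _ _ _ h p]
  show "(\<lambda>x. v x + w x) \<in> Lp_hyp p" using I(1) D by (simp add: Lp_hyp_def)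
  show "Lp_int p (\<lambda>x. v x + w x) \<le> (1 - s) powr (1 - p) * Lp_int p v + s powr (1 - p) * Lp_int p w" if "0 < s" "s < 1"
    unfolding Lp_int_def using I(2)[OF _ _ _ _ _ _ that] D by simp
qed

lemma convex_functional_Lp:
  assumes "1 \<le> p" shows "convex_functional p (Lp_hyp p) (Lp_int p)"
proof (rule convex_functionalI[OF assms])
  fix f g :: "'a \<Rightarrow> real" and c s :: real assume f: "f \<in> Lp_hyp p"
  show "(\<lambda>x. c * f x) \<in> Lp_hyp p" "Lp_int p (\<lambda>x. c * f x) = \<bar>c\<bar> powr p * Lp_int p f"
    using Lp_hyp_scale[OF f] by auto
  assume g: "g \<in> Lp_hyp p"
  show "(\<lambda>x. f x + g x) \<in> Lp_hyp p" by (rule Lp_hyp_add[OF assms f g])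
  assume "0 < s" "s < 1"
  then show "Lp_int p (\<lambda>x. f x + g x) \<le> (1 - s) powr (1 - p) * Lp_int p f + s powr (1 - p) * Lp_int p g"
    by (rule Lp_hyp_add[OF assms f g])
qed (rule Lp_int_nonneg)

lemma W1p_hypI:
  fixes v :: "'a::euclidean_space \<Rightarrow> real"
  assumes "v \<in> Lp_hyp p" "hyp_weak_grad v G" "integrable hyp_measure (\<lambda>x. hyp_norm x (G x) powr p)"
  shows "v \<in> W1p_hyp p"
  using assms by (auto simp: W1p_hyp_def)

lemma grad_energy_eq:
  fixes v :: "'a::euclidean_space \<Rightarrow> real"
  assumes "hyp_weak_grad v G"
  shows "grad_energy p v = (\<integral>x. hyp_norm x (G x) powr p \<partial>hyp_measure)"
proof -
  have "AE x in hyp_measure. hyp_norm x (hyp_grad v x) powr p = hyp_norm x (G x) powr p"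
    using hyp_grad_AE[OF assms] by eventually_elim simp
  then show ?thesis
    unfolding grad_energy_def
    using hyp_norm_measurable[OF hyp_weak_grad_measurable(2)[OF assms]]
      hyp_norm_measurable[OF hyp_weak_grad_measurable(2)[OF hyp_weak_grad_hyp_grad[OF assms]]]
    by (intro integral_cong_AE) simp_all
qed

lemma W1p_hypD:
  fixes v :: "'a::euclidean_space \<Rightarrow> real"
  assumes "v \<in> W1p_hyp p"
  shows "v \<in> Lp_hyp p" "hyp_weak_grad v (hyp_grad v)" "hyp_grad v \<in> borel_measurable hyp_measure"
    "(\<lambda>x. hyp_norm x (hyp_grad v x)) \<in> borel_measurable hyp_measure"
    "integrable hyp_measure (\<lambda>x. hyp_norm x (hyp_grad v x) powr p)"
proof -
  obtain G where G: "hyp_weak_grad v G" "integrable hyp_measure (\<lambda>x. hyp_norm x (G x) powr p)"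
    using assms by (auto simp: W1p_hyp_def)
  show "v \<in> Lp_hyp p" using assms by (simp add: W1p_hyp_def)
  show g: "hyp_weak_grad v (hyp_grad v)" by (rule hyp_weak_grad_hyp_grad[OF G(1)])
  show m: "hyp_grad v \<in> borel_measurable hyp_measure" using hyp_weak_grad_measurable(2)[OF g] .
  show m': "(\<lambda>x. hyp_norm x (hyp_grad v x)) \<in> borel_measurable hyp_measure" by (rule hyp_norm_measurable[OF m])
  have "AE x in hyp_measure. hyp_norm x (G x) powr p = hyp_norm x (hyp_grad v x) powr p"
    using hyp_grad_AE[OF G(1)] by eventually_elim simp
  then show "integrable hyp_measure (\<lambda>x. hyp_norm x (hyp_grad v x) powr p)"
    using m' by (intro integrable_cong_AE_imp[OF G(2)]) simp_all
qed

lemma W1p_hyp_scale: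
  fixes v :: "'a::euclidean_space \<Rightarrow> real"
  assumes v: "v \<in> W1p_hyp p"
  shows "(\<lambda>x. c * v x) \<in> W1p_hyp p \<and> grad_energy p (\<lambda>x. c * v x) = \<bar>c\<bar> powr p * grad_energy p v"
proof -
  have g: "hyp_weak_grad (\<lambda>x. c * v x) (\<lambda>x. c *\<^sub>R hyp_grad v x)"
    using hyp_weak_grad_linear[OF W1p_hypD(2)[OF v] W1p_hypD(2)[OF v], of c 0] by simp
  have "integrable hyp_measure (\<lambda>x. hyp_norm x (c *\<^sub>R hyp_grad v x) powr p)"
    using W1p_hypD(5)[OF v] by (simp add: hyp_norm_scale powr_mult)
  then have "(\<lambda>x. c * v x) \<in> W1p_hyp p"
    using Lp_hyp_scale[OF W1p_hypD(1)[OF v]] g by (intro W1p_hypI) auto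
  moreover have "grad_energy p (\<lambda>x. c * v x) = \<bar>c\<bar> powr p * grad_energy p v"
    unfolding grad_energy_eq[OF g] by (simp add: hyp_norm_scale powr_mult grad_energy_def)
  ultimately show ?thesis by simp
qed

lemma hyp_grad_add:
  fixes v w :: "'a::euclidean_space \<Rightarrow> real"
  assumes "v \<in> W1p_hyp p" "w \<in> W1p_hyp p'"
  shows "hyp_weak_grad (\<lambda>x. v x + w x) (\<lambda>x. hyp_grad v x + hyp_grad w x)"
  using hyp_weak_grad_linear[OF W1p_hypD(2)[OF assms(1)] W1p_hypD(2)[OF assms(2)], of 1 1] by simp

lemma W1p_hyp_add:
  fixes v w :: "'a::euclidean_space \<Rightarrow> real"
  assumes p: "1 \<le> p" and v: "v \<in> W1p_hyp p" and w: "w \<in> W1p_hyp p"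
  shows "(\<lambda>x. v x + w x) \<in> W1p_hyp p"
    and "0 < s \<Longrightarrow> s < 1 \<Longrightarrow> grad_energy p (\<lambda>x. v x + w x) \<le> (1 - s) powr (1 - p) * grad_energy p v + s powr (1 - p) * grad_energy p w"
proof -
  note D = W1p_hypD(4,5)[OF v] W1p_hypD(4,5)[OF w]
  note g = hyp_grad_add[OF v w]
  have m: "(\<lambda>x. hyp_norm x (hyp_grad v x + hyp_grad w x)) \<in> borel_measurable hyp_measure"
    by (rule hyp_norm_measurable[OF hyp_weak_grad_measurable(2)[OF g]])
  have h: "AE x in hyp_measure. hyp_norm x (hyp_grad v x + hyp_grad w x) \<le> hyp_norm x (hyp_grad v x) + hyp_norm x (hyp_grad w x)"
    by (intro AE_I2 hyp_norm_triangle)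
  note I = integral_powr_add_convex[OF D(1,2) _ D(3,4) _ m _ h p]
  show "(\<lambda>x. v x + w x) \<in> W1p_hyp p"
    by (rule W1p_hypI[OF Lp_hyp_add(1)[OF p W1p_hypD(1)[OF v] W1p_hypD(1)[OF w]] g]) (rule I(1), auto)
  show "grad_energy p (\<lambda>x. v x + w x) \<le> (1 - s) powr (1 - p) * grad_energy p v + s powr (1 - p) * grad_energy p w" if "0 < s" "s < 1"
    unfolding grad_energy_eq[OF g] using I(2)[OF _ _ _ that] by (simp add: grad_energy_def)
qed

lemma convex_functional_grad_energy:
  assumes "1 \<le> p" shows "convex_functional p (W1p_hyp p) (grad_energy p)"
proof (rule convex_functionalI[OF assms])
  fix f g :: "'a \<Rightarrow> real" and c s :: real assume f: "f \<in> W1p_hyp p"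
  show "(\<lambda>x. c * f x) \<in> W1p_hyp p" "grad_energy p (\<lambda>x. c * f x) = \<bar>c\<bar> powr p * grad_energy p f"
    using W1p_hyp_scale[OF f] by auto
  assume g: "g \<in> W1p_hyp p"
  show "(\<lambda>x. f x + g x) \<in> W1p_hyp p" by (rule W1p_hyp_add[OF assms f g])
  assume "0 < s" "s < 1"
  then show "grad_energy p (\<lambda>x. f x + g x) \<le> (1 - s) powr (1 - p) * grad_energy p f + s powr (1 - p) * grad_energy p g"
    by (rule W1p_hyp_add[OF assms f g])
qed (rule grad_energy_nonneg)

lemma convex_functional_W1p:
  assumes p: "1 \<le> p" shows "convex_functional p (W1p_hyp p) (\<lambda>v. Lp_int p v + grad_energy p v)"
proof (rule convex_functionalI[OF p])
  fix f g :: "'a \<Rightarrow> real" and c s :: real assume f: "f \<in> W1p_hyp p"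
  note f' = W1p_hypD(1)[OF f]
  show "(\<lambda>x. c * f x) \<in> W1p_hyp p" using W1p_hyp_scale[OF f] by auto
  show "Lp_int p (\<lambda>x. c * f x) + grad_energy p (\<lambda>x. c * f x) = \<bar>c\<bar> powr p * (Lp_int p f + grad_energy p f)"
    using W1p_hyp_scale[OF f] Lp_hyp_scale[OF f'] by (simp add: distrib_left)
  assume g: "g \<in> W1p_hyp p"
  note g' = W1p_hypD(1)[OF g]
  show "(\<lambda>x. f x + g x) \<in> W1p_hyp p" by (rule W1p_hyp_add[OF p f g])
  assume s: "0 < s" "s < 1"
  show "Lp_int p (\<lambda>x. f x + g x) + grad_energy p (\<lambda>x. f x + g x) \<le>
      (1 - s) powr (1 - p) * (Lp_int p f + grad_energy p f) + s powr (1 - p) * (Lp_int p g + grad_energy p g)"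
    using W1p_hyp_add(2)[OF p f g s] Lp_hyp_add(2)[OF p f' g' s] by (simp add: distrib_left)
qed (simp add: Lp_int_nonneg grad_energy_nonneg)

section \<open>Density of smooth functions\<close>

lemma hyp_dfac_le_1: "hyp_dfac x \<le> 1"
proof -
  have "-1 \<le> (0::real)" by simp
  also have "0 \<le> (norm x)\<^sup>2" by simp
  finally show ?thesis by (simp add: hyp_dfac_def)
qed

lemma one_le_hyp_factor: "x \<in> hyp_space \<Longrightarrow> 1 \<le> hyp_factor x"
  using hyp_dfac_pos[of x] hyp_dfac_le_1[of x] by (simp add: hyp_factor_eq)


text \<open>The Riemannian density is at least 1 on the ball. The converse transfer needs an upper
  bound of the density, which exists only away from the sphere.\<close>

lemma integrable_lebesgue_of_hyp:
  fixes f :: "'a::euclidean_space \<Rightarrow> real"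
  assumes f: "integrable hyp_measure f"
  shows "integrable lebesgue (\<lambda>x. indicat_real hyp_space x * f x)"
proof -
  have m: "f \<in> borel_measurable hyp_measure" using f by (rule borel_measurable_integrable)
  have i: "integrable lebesgue (\<lambda>x. indicat_real hyp_space x *\<^sub>R (hyp_factor x ^ DIM('a) *\<^sub>R f x))"
    using integrable_hyp_iff[OF m] f by blast
  show ?thesis
  proof (rule Bochner_Integration.integrable_bound[OF i])
    have "(\<lambda>x. if x \<in> hyp_space then f x else 0) \<in> borel_measurable lebesgue"
      using m unfolding measurable_hyp by (rule borel_measurable_if_I) simp
    moreover have "(\<lambda>x. if x \<in> hyp_space then f x else 0) = (\<lambda>x. indicat_real hyp_space x * f x)"
      by (auto simp: fun_eq_iff)
    ultimately show "(\<lambda>x. indicat_real hyp_space x * f x) \<in> borel_measurable lebesgue" by (simp only:)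
    show "AE x in lebesgue. norm (indicat_real hyp_space x * f x) \<le> norm (indicat_real hyp_space x *\<^sub>R (hyp_factor x ^ DIM('a) *\<^sub>R f x))"
    proof (rule AE_I2)
      fix x :: 'a
      show "norm (indicat_real hyp_space x * f x) \<le> norm (indicat_real hyp_space x *\<^sub>R (hyp_factor x ^ DIM('a) *\<^sub>R f x))"
      proof (cases "x \<in> hyp_space")
        case True
        then have "1 \<le> \<bar>hyp_factor x ^ DIM('a)\<bar>" using one_le_power[OF one_le_hyp_factor[OF True], of "DIM('a)"] by linarith
        then show ?thesis using True mult_right_mono[of 1 "\<bar>hyp_factor x ^ DIM('a)\<bar>" "\<bar>f x\<bar>"] by (simp add: abs_mult)
      qed simp
    qed
  qed
qed

lemma integral_hyp_le_lebesgue: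
  fixes F g :: "'a::euclidean_space \<Rightarrow> real"
  assumes g: "integrable lebesgue g" "\<And>x. 0 \<le> g x" and F: "F \<in> borel_measurable hyp_measure" "\<And>x. 0 \<le> F x"
    and le: "\<And>x. x \<in> hyp_space \<Longrightarrow> hyp_factor x ^ DIM('a) * F x \<le> C * g x" and C: "0 \<le> C"
  shows "integrable hyp_measure F" "(\<integral>x. F x \<partial>hyp_measure) \<le> C * (\<integral>x. g x \<partial>lebesgue)"
proof -
  have le': "0 \<le> indicat_real hyp_space x *\<^sub>R (hyp_factor x ^ DIM('a) *\<^sub>R F x)"
    "indicat_real hyp_space x *\<^sub>R (hyp_factor x ^ DIM('a) *\<^sub>R F x) \<le> C * g x" for x
    using le[of x] F(2)[of x] g(2)[of x] C hyp_factor_pos[of x] by (cases "x \<in> hyp_space"; simp)+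
  have m: "(\<lambda>x. indicat_real hyp_space x *\<^sub>R (hyp_factor x ^ DIM('a) *\<^sub>R F x)) \<in> borel_measurable lebesgue"
  proof -
    have "(\<lambda>x. hyp_factor x ^ DIM('a) *\<^sub>R F x) \<in> borel_measurable (lebesgue_on hyp_space)"
      using F(1) hyp_factor_measurable[where 'a='a] by (simp add: measurable_hyp)
    then have "(\<lambda>x. if x \<in> hyp_space then hyp_factor x ^ DIM('a) *\<^sub>R F x else 0) \<in> borel_measurable lebesgue"
      by (rule borel_measurable_if_I) simp
    moreover have "(\<lambda>x. if x \<in> hyp_space then hyp_factor x ^ DIM('a) *\<^sub>R F x else 0) = (\<lambda>x. indicat_real hyp_space x *\<^sub>R (hyp_factor x ^ DIM('a) *\<^sub>R F x))"
      by (auto simp: fun_eq_iff)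
    ultimately show ?thesis by (simp only:)
  qed
  have iC: "integrable lebesgue (\<lambda>x. C * g x)" using g by simp
  have i: "integrable lebesgue (\<lambda>x. indicat_real hyp_space x *\<^sub>R (hyp_factor x ^ DIM('a) *\<^sub>R F x))"
    by (rule Bochner_Integration.integrable_bound[OF iC m], rule AE_I2)
       (use le' in \<open>auto simp del: scaleR_conv_of_real real_scaleR_def intro: order_trans[OF _ abs_ge_self]\<close>)
  then show "integrable hyp_measure F" using integrable_hyp_iff[OF F(1)] by blast
  have "(\<integral>x. F x \<partial>hyp_measure) \<le> (\<integral>x. C * g x \<partial>lebesgue)"
    unfolding integral_hyp[OF F(1)] by (rule integral_mono[OF i iC le'(2)])
  then show "(\<integral>x. F x \<partial>hyp_measure) \<le> C * (\<integral>x. g x \<partial>lebesgue)" by simp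
qed

lemma powr_sum_le:
  fixes a :: "'i \<Rightarrow> real"
  assumes I: "finite I" and a: "\<And>i. i \<in> I \<Longrightarrow> 0 \<le> a i" and p: "1 \<le> p"
  shows "(\<Sum>i\<in>I. a i) powr p \<le> real (card I) powr p * (\<Sum>i\<in>I. a i powr p)"
proof (cases "I = {}")
  case False
  have "Max (a ` I) \<in> a ` I" using I False by (intro Max_in) auto
  then obtain j where j': "j \<in> I" "Max (a ` I) = a j" by blast
  then have j: "j \<in> I" "\<And>i. i \<in> I \<Longrightarrow> a i \<le> a j"
    using Max_ge[of "a ` I"] I by auto
  have "(\<Sum>i\<in>I. a i) \<le> real (card I) * a j" using sum_bounded_above[of I a "a j"] j by simp
  then have "(\<Sum>i\<in>I. a i) powr p \<le> (real (card I) * a j) powr p"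
    using a p by (intro powr_mono2) (auto intro: sum_nonneg)
  also have "\<dots> = real (card I) powr p * a j powr p" using a j by (simp add: powr_mult)
  also have "\<dots> \<le> real (card I) powr p * (\<Sum>i\<in>I. a i powr p)"
    using j I by (intro mult_left_mono member_le_sum[of j I "\<lambda>i. a i powr p"]) auto
  finally show ?thesis .
qed (use p in auto)

lemma Cc_smoothI:
  assumes "\<And>k. Ck k f" "compact K" "K \<subseteq> U" "\<And>x. x \<notin> K \<Longrightarrow> f x = 0"
  shows "f \<in> Cc_smooth U"
  unfolding Cc_smooth_def using assms by (intro CollectI conjI allI exI[of _ K] impI)

lemma pd_mollifier_0: "0 < \<epsilon> \<Longrightarrow> \<epsilon> < norm x \<Longrightarrow> pd (mollifier \<epsilon>) b x = 0"
  by (rule pd_eq_0_outside[of \<epsilon>, OF mollifier_eq_0])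

text \<open>The derivative of the mollification is the mollification of the Euclidean weak
  derivative, because a translated mollifier is a test function. Near the sphere it is not supported
  in the ball, but there both sides vanish by the support of w.\<close>

lemma pd_moll:
  fixes w :: "'a::euclidean_space \<Rightarrow> real"
  assumes wH: "hyp_weak_grad w H" and b: "b \<in> Basis" and \<epsilon>: "0 < \<epsilon>" "r + 2 * \<epsilon> < 1"
    and w0: "\<And>x. r < norm x \<Longrightarrow> w x = 0" and H0: "\<And>x. r < norm x \<Longrightarrow> H x = 0"
    and wi: "integrable lebesgue (\<lambda>x. indicat_real hyp_space x * w x)"
  shows "pd (moll \<epsilon> (\<lambda>x. indicat_real hyp_space x * w x)) b x
     = moll \<epsilon> (\<lambda>x. indicat_real hyp_space x * ((hyp_factor x)\<^sup>2 * (H x \<bullet> b))) x"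
proof -
  let ?W = "\<lambda>x. indicat_real hyp_space x * w x"
  have D: "pd (moll \<epsilon> ?W) b x = (\<integral>y. pd (mollifier \<epsilon>) b (x - y) * ?W y \<partial>lebesgue)"
  proof -
    have "pd (moll \<epsilon> ?W) b x = (\<Sum>b'\<in>Basis. (b \<bullet> b') * (\<integral>y. pd (mollifier \<epsilon>) b' (x - y) * ?W y \<partial>lebesgue))"
      unfolding moll_def[abs_def]
      by (rule pd_eq[OF conv_has_derivative[OF wi Ck_mollifier mollifier_eq_0[OF \<epsilon>(1)]]])
    also have "\<dots> = (\<Sum>b'\<in>Basis. if b' = b then (\<integral>y. pd (mollifier \<epsilon>) b (x - y) * ?W y \<partial>lebesgue) else 0)"
      using b by (intro sum.cong) (auto simp: inner_Basis)
    finally show ?thesis using b by simp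
  qed
  show ?thesis
  proof (cases "norm x < 1 - \<epsilon>")
    case True
    define \<zeta> where "\<zeta> y = mollifier \<epsilon> (x - y)" for y
    have ck: "Ck k \<zeta>" for k
      unfolding \<zeta>_def using Ck_affine[OF Ck_mollifier, of k \<epsilon> x "-1"] by simp
    have "cball x \<epsilon> \<subseteq> hyp_space"
    proof
      fix y assume "y \<in> cball x \<epsilon>"
      then have "norm (y - x) \<le> \<epsilon>" by (simp add: dist_norm norm_minus_commute)
      then show "y \<in> hyp_space" using True norm_triangle_ineq[of x "y - x"] by simp
    qed
    moreover have "\<zeta> y = 0" if "y \<notin> cball x \<epsilon>" for y
      unfolding \<zeta>_def using that \<epsilon>(1) by (intro mollifier_eq_0) (auto simp: dist_norm)
    ultimately have z: "\<zeta> \<in> Cc_smooth hyp_space"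
      by (intro Cc_smoothI[of \<zeta>, OF ck compact_cball])
    have pz: "pd \<zeta> b y = - pd (mollifier \<epsilon>) b (x - y)" for y
    proof -
      have df: "mollifier \<epsilon> differentiable (at (x - y))" by (rule Ck_differentiable[OF Ck_mollifier])
      have l: "linear (frechet_derivative (mollifier \<epsilon>) (at (x - y)))"
        by (rule linear_frechet_derivative[OF df])
      have "(\<zeta> has_derivative (\<lambda>h. frechet_derivative (mollifier \<epsilon>) (at (x - y)) (- h))) (at y)"
        unfolding \<zeta>_def
        by (rule has_derivative_compose[of "\<lambda>y. x - y" _ _ _ "mollifier \<epsilon>"])
           (use df in \<open>auto simp: frechet_derivative_works intro!: derivative_eq_intros\<close>)
      from pd_eq[OF this, of b] show ?thesis by (simp add: linear_neg[OF l])
    qed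
    have "moll \<epsilon> (\<lambda>x. indicat_real hyp_space x * ((hyp_factor x)\<^sup>2 * (H x \<bullet> b))) x
       = (\<integral>y. indicat_real hyp_space y * ((hyp_factor y)\<^sup>2 * (H y \<bullet> b) * \<zeta> y) \<partial>lebesgue)"
      unfolding moll_def \<zeta>_def by (intro Bochner_Integration.integral_cong refl) (simp add: mult_ac)
    also have "\<dots> = - (\<integral>y. indicat_real hyp_space y * (w y * pd \<zeta> b y) \<partial>lebesgue)"
      by (rule hyp_weak_grad_euclidean(1)[OF wH z b])
    also have "\<dots> = (\<integral>y. - (indicat_real hyp_space y * (w y * pd \<zeta> b y)) \<partial>lebesgue)" by simp
    also have "\<dots> = (\<integral>y. pd (mollifier \<epsilon>) b (x - y) * ?W y \<partial>lebesgue)"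
      by (intro Bochner_Integration.integral_cong refl) (simp add: pz mult_ac)
    finally show ?thesis using D by simp
  next
    case False
    \<comment> \<open>With norm x at least 1 - \<epsilon> and \<open>r + 2 * \<epsilon> < 1\<close>,
      the support of the mollifier around \<open>x\<close> misses the ball of radius
      \<open>r\<close>.\<close>
    have far: "\<epsilon> < norm (x - y)" if "norm y \<le> r" for y
      using that False \<epsilon> norm_triangle_ineq2[of x y] by linarith
    have 1: "pd (mollifier \<epsilon>) b (x - y) * ?W y = 0" for y
      using far[of y] w0[of y] pd_mollifier_0[OF \<epsilon>(1), of "x - y"] by (cases "norm y \<le> r") auto
    have 2: "mollifier \<epsilon> (x - y) * (indicat_real hyp_space y * ((hyp_factor y)\<^sup>2 * (H y \<bullet> b))) = 0" for y
      using far[of y] H0[of y] mollifier_eq_0[OF \<epsilon>(1), of "x - y"] by (cases "norm y \<le> r") auto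
    show ?thesis unfolding D moll_def 1 2 by simp
  qed
qed

lemma powr_ge_self_bound: "0 \<le> a \<Longrightarrow> 1 \<le> p \<Longrightarrow> a \<le> 1 + a powr p" for a p :: real
proof (cases "a \<le> 1")
  case False
  assume "1 \<le> p"
  then have "a powr 1 \<le> a powr p" using False by (intro powr_mono) auto
  then show ?thesis using False by simp
qed (simp add: add_increasing2)

lemma integrable_of_powr:
  fixes f :: "'a::euclidean_space \<Rightarrow> real"
  assumes f: "f \<in> borel_measurable lebesgue" and i: "integrable lebesgue (\<lambda>x. \<bar>f x\<bar> powr p)" and p: "1 \<le> p"
    and z: "\<And>x. r < norm x \<Longrightarrow> f x = 0"
  shows "integrable lebesgue f"
proof (rule Bochner_Integration.integrable_bound)
  show "integrable lebesgue (\<lambda>x. indicat_real (cball 0 r) x + \<bar>f x\<bar> powr p)"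
    using i emeasure_lborel_cball_finite[of "0::'a" r] by (intro Bochner_Integration.integrable_add integrable_real_indicator) auto
  show "AE x in lebesgue. norm (f x) \<le> norm (indicat_real (cball 0 r) x + \<bar>f x\<bar> powr p)"
  proof (rule AE_I2)
    fix x :: 'a
    show "norm (f x) \<le> norm (indicat_real (cball 0 r) x + \<bar>f x\<bar> powr p)"
      using powr_ge_self_bound[of "\<bar>f x\<bar>" p] p z[of x] by (cases "norm x \<le> r") auto
  qed
qed (rule f)

text \<open>Euclidean mollification at a small scale keeps the support in a fixed smaller ball.
  There the conformal factor is bounded, so Euclidean L^p convergence of the function and of its
  weak partial derivatives implies hyperbolic convergence.\<close>

lemma W1p_compact_support_approx:
  fixes w :: "'a::euclidean_space \<Rightarrow> real"
  assumes p: "1 \<le> p" and wp: "w \<in> Lp_hyp p" and wH: "hyp_weak_grad w H"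
    and Hp: "integrable hyp_measure (\<lambda>x. hyp_norm x (H x) powr p)" and r: "0 < r" "r < 1"
    and w0: "\<And>x. r < norm x \<Longrightarrow> w x = 0" and H0: "\<And>x. r < norm x \<Longrightarrow> H x = 0" and e: "0 < e"
  obtains \<phi> where "\<phi> \<in> Cc_smooth hyp_space" "(\<lambda>x. w x - \<phi> x) \<in> W1p_hyp p"
    "Lp_int p (\<lambda>x. w x - \<phi> x) + grad_energy p (\<lambda>x. w x - \<phi> x) \<le> e"
proof -
  let ?n = "DIM('a)"
  define W where "W x = indicat_real hyp_space x * w x" for x
  define E where "E b x = indicat_real hyp_space x * ((hyp_factor x)\<^sup>2 * (H x \<bullet> b))" for b x
  have W0: "W x = 0" "E b x = 0" if "r < norm x" for x b using that w0 H0 by (auto simp: W_def E_def)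
  \<comment> \<open>Midway between the support of \<open>w\<close> and the sphere: room for the
    support to spread.\<close>
  define r1 where "r1 = (1 + r) / 2"
  have r1: "r < r1" "r1 < 1" "0 < r1" using r by (auto simp: r1_def)
  have cbr: "cball (0::'a) r1 \<subseteq> hyp_space" using r1 by auto
  obtain B where B: "0 \<le> B" "\<And>x. x \<in> cball (0::'a) r1 \<Longrightarrow> norm (hyp_factor x) \<le> B"
    using continuous_on_compact_bound[OF compact_cball continuous_on_factor[OF cbr]] by blast
  have mwi: "W \<in> borel_measurable lebesgue"
  proof -
    have "(\<lambda>x. if x \<in> hyp_space then w x else 0) \<in> borel_measurable lebesgue"
      using Lp_hypD(1)[OF wp] unfolding measurable_hyp by (rule borel_measurable_if_I) simp
    moreover have "(\<lambda>x. if x \<in> hyp_space then w x else 0) = W" by (auto simp: fun_eq_iff W_def)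
    ultimately show ?thesis by simp
  qed
  have Wp: "integrable lebesgue (\<lambda>x. \<bar>W x\<bar> powr p)"
  proof -
    have "(\<lambda>x. indicat_real hyp_space x * \<bar>w x\<bar> powr p) = (\<lambda>x. \<bar>W x\<bar> powr p)"
      using p by (auto simp: fun_eq_iff W_def indicator_def)
    then show ?thesis using integrable_lebesgue_of_hyp[OF Lp_hypD(2)[OF wp]] by simp
  qed
  have Wi: "integrable lebesgue W" by (rule integrable_of_powr[OF mwi Wp p W0(1)])
  have mE: "E b \<in> borel_measurable lebesgue" for b
  proof -
    have "(\<lambda>x. (hyp_factor x)\<^sup>2 * (H x \<bullet> b)) \<in> borel_measurable (lebesgue_on hyp_space)"
      using hyp_weak_grad_measurable(2)[OF wH] hyp_factor_measurable[where 'a='a] by (simp add: measurable_hyp)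
    then have "(\<lambda>x. if x \<in> hyp_space then (hyp_factor x)\<^sup>2 * (H x \<bullet> b) else 0) \<in> borel_measurable lebesgue"
      by (rule borel_measurable_if_I) simp
    moreover have "(\<lambda>x. if x \<in> hyp_space then (hyp_factor x)\<^sup>2 * (H x \<bullet> b) else 0) = E b" by (auto simp: fun_eq_iff E_def)
    ultimately show ?thesis by simp
  qed
  have Ep: "integrable lebesgue (\<lambda>x. \<bar>E b x\<bar> powr p)" if b: "b \<in> Basis" for b
  proof (rule Bochner_Integration.integrable_bound)
    show "integrable lebesgue (\<lambda>x. B powr p * (indicat_real hyp_space x * hyp_norm x (H x) powr p))"
      by (intro integrable_mult_right integrable_lebesgue_of_hyp Hp)
    show "(\<lambda>x. \<bar>E b x\<bar> powr p) \<in> borel_measurable lebesgue" using mE by simp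
    show "AE x in lebesgue. norm (\<bar>E b x\<bar> powr p) \<le> norm (B powr p * (indicat_real hyp_space x * hyp_norm x (H x) powr p))"
    proof (rule AE_I2)
      fix x :: 'a
      show "norm (\<bar>E b x\<bar> powr p) \<le> norm (B powr p * (indicat_real hyp_space x * hyp_norm x (H x) powr p))"
      proof (cases "norm x \<le> r")
        case True
        then have x: "x \<in> hyp_space" "x \<in> cball 0 r1" using r1 by auto
        have "\<bar>E b x\<bar> = \<bar>hyp_factor x\<bar> * (\<bar>hyp_factor x\<bar> * \<bar>H x \<bullet> b\<bar>)"
          using x by (simp add: E_def abs_mult power2_eq_square)
        also have "\<dots> \<le> B * hyp_norm x (H x)"
          unfolding hyp_norm_eq using B(1) B(2)[OF x(2)] Basis_le_norm[OF b, of "H x"] by (intro mult_mono) auto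
        finally have "\<bar>E b x\<bar> powr p \<le> (B * hyp_norm x (H x)) powr p" using p by (intro powr_mono2) auto
        then show ?thesis using x B(1) by (simp add: powr_mult)
      qed (use W0(2) in simp)
    qed
  qed
  have Ei: "integrable lebesgue (E b)" if "b \<in> Basis" for b
    by (rule integrable_of_powr[OF mE Ep[OF that] p W0(2)])
  \<comment> \<open>The density is at most B^n on the smaller ball; summing the n components in
    \<open>powr_sum_le\<close> costs n^p, and each of the n component errors is at most
    \<open>c\<close>. The added ones keep the denominators positive.\<close>
  define c where "c = e / (2 * (B ^ ?n + 1) * (real ?n powr p * real ?n + 1))"
  have c: "0 < c" using e B(1) by (simp add: c_def add_nonneg_pos)
  obtain d0 where d0: "0 < d0" "\<And>\<epsilon>. 0 < \<epsilon> \<Longrightarrow> \<epsilon> < d0 \<Longrightarrow>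
    integrable lebesgue (\<lambda>x. \<bar>moll \<epsilon> W x - W x\<bar> powr p) \<and> (\<integral>x. \<bar>moll \<epsilon> W x - W x\<bar> powr p \<partial>lebesgue) \<le> c"
    using moll_Lp_tendsto[OF Wi Wp p c] by blast
  define ok where "ok b \<epsilon> \<longleftrightarrow> integrable lebesgue (\<lambda>x. \<bar>moll \<epsilon> (E b) x - E b x\<bar> powr p) \<and>
    (\<integral>x. \<bar>moll \<epsilon> (E b) x - E b x\<bar> powr p \<partial>lebesgue) \<le> c" for b \<epsilon>
  have "\<forall>b\<in>Basis. \<exists>d. 0 < d \<and> (\<forall>\<epsilon>. 0 < \<epsilon> \<longrightarrow> \<epsilon> < d \<longrightarrow> ok b \<epsilon>)"
  proof
    fix b :: 'a assume b: "b \<in> Basis"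
    from moll_Lp_tendsto[OF Ei[OF b] Ep[OF b] p c]
    show "\<exists>d. 0 < d \<and> (\<forall>\<epsilon>. 0 < \<epsilon> \<longrightarrow> \<epsilon> < d \<longrightarrow> ok b \<epsilon>)" unfolding ok_def by blast
  qed
  from bchoice[OF this] obtain db where db': "\<forall>b\<in>Basis. 0 < db b \<and> (\<forall>\<epsilon>. 0 < \<epsilon> \<longrightarrow> \<epsilon> < db b \<longrightarrow> ok b \<epsilon>)" ..
  then have db: "\<And>b. b \<in> Basis \<Longrightarrow> 0 < db b" "\<And>b \<epsilon>. b \<in> Basis \<Longrightarrow> 0 < \<epsilon> \<Longrightarrow> \<epsilon> < db b \<Longrightarrow> ok b \<epsilon>"
    by auto
  define m where "m = Min (db ` Basis)"
  have m: "0 < m" "\<And>b. b \<in> Basis \<Longrightarrow> m \<le> db b" using db(1) by (auto simp: m_def)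
  \<comment> \<open>The quarter makes all comparisons strict and gives both
    \<open>r + 2 * \<epsilon> < 1\<close> and \<open>r + \<epsilon> \<le> r1\<close>.\<close>
  define \<epsilon> where "\<epsilon> = min (min d0 m) (1 - r) / 4"
  have "\<epsilon> \<le> d0 / 4" "\<epsilon> \<le> m / 4" "\<epsilon> \<le> (1 - r) / 4" "0 < \<epsilon>"
    using d0(1) m(1) r by (auto simp: \<epsilon>_def)
  then have \<epsilon>: "0 < \<epsilon>" "\<epsilon> < d0" "\<epsilon> < m" "r + 2 * \<epsilon> < 1" "r + \<epsilon> \<le> r1"
    using d0(1) m(1) r by (auto simp: r1_def field_simps)
  define \<phi> where "\<phi> = moll \<epsilon> W"
  have ck: "Ck k \<phi>" for k unfolding \<phi>_def by (rule Ck_moll[OF Wi \<epsilon>(1)])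
  have moll0: "moll \<epsilon> f x = 0" if "r1 < norm x" "\<And>y. r < norm y \<Longrightarrow> f y = 0" for f and x :: 'a
  proof -
    have "mollifier \<epsilon> (x - y) * f y = 0" for y
    proof (cases "norm y \<le> r")
      case True
      then have "\<epsilon> \<le> norm (x - y)" using that(1) \<epsilon>(5) norm_triangle_ineq2[of x y] by linarith
      then show ?thesis using mollifier_eq_0[OF \<epsilon>(1), of "x - y"] by simp
    qed (use that(2) in simp)
    then have "(\<lambda>y. mollifier \<epsilon> (x - y) * f y) = (\<lambda>y. 0)" by (simp only:)
    then show ?thesis unfolding moll_def by simp
  qed
  have \<phi>0: "\<phi> x = 0" if "x \<notin> cball 0 r1" for x
    unfolding \<phi>_def by (rule moll0[OF _ W0(1)]) (use that in auto)
  have cc: "\<phi> \<in> Cc_smooth hyp_space" by (rule Cc_smoothI[of \<phi>, OF ck compact_cball cbr \<phi>0])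
  have pd\<phi>: "pd \<phi> b x = moll \<epsilon> (E b) x" if "b \<in> Basis" for b x
    unfolding \<phi>_def W_def E_def
    by (rule pd_moll[OF wH that \<epsilon>(1,4) w0 H0 Wi[unfolded W_def]])
  have g: "hyp_weak_grad (\<lambda>x. w x - \<phi> x) (\<lambda>x. H x - (hyp_dfac x)\<^sup>2 *\<^sub>R egrad \<phi> x)"
    using hyp_weak_grad_linear[OF wH hyp_weak_grad_smooth[OF ck], of 1 "-1"] by simp
  have Bn: "hyp_factor x ^ ?n \<le> B ^ ?n + 1" if "norm x \<le> r1" for x :: 'a
  proof -
    have "x \<in> hyp_space" using that r1 by simp
    then have "hyp_factor x ^ ?n \<le> B ^ ?n" using B(2)[of x] that hyp_factor_pos[of x] by (intro power_mono) auto
    then show ?thesis by simp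
  qed
  have L: "integrable hyp_measure (\<lambda>x. \<bar>w x - \<phi> x\<bar> powr p)"
    "(\<integral>x. \<bar>w x - \<phi> x\<bar> powr p \<partial>hyp_measure) \<le> (B ^ ?n + 1) * (\<integral>x. \<bar>moll \<epsilon> W x - W x\<bar> powr p \<partial>lebesgue)"
  proof -
    have mm: "(\<lambda>x. \<bar>w x - \<phi> x\<bar> powr p) \<in> borel_measurable hyp_measure"
      using hyp_weak_grad_measurable(1)[OF g] by simp
    have le: "hyp_factor x ^ ?n * \<bar>w x - \<phi> x\<bar> powr p \<le> (B ^ ?n + 1) * \<bar>moll \<epsilon> W x - W x\<bar> powr p" if "x \<in> hyp_space" for x
    proof (cases "norm x \<le> r1")
      case True
      have "\<bar>w x - \<phi> x\<bar> = \<bar>moll \<epsilon> W x - W x\<bar>" using that by (simp add: \<phi>_def W_def abs_minus_commute)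
      then show ?thesis using Bn[OF True] by (simp add: mult_right_mono)
    next
      case False
      then have "w x = 0" "\<phi> x = 0" using r1 w0[of x] \<phi>0[of x] by auto
      then show ?thesis using B(1) p by (simp add: add_nonneg_nonneg)
    qed
    have C0: "0 \<le> B ^ ?n + 1" using B(1) by simp
    have i0: "integrable lebesgue (\<lambda>x. \<bar>moll \<epsilon> W x - W x\<bar> powr p)" using d0(2)[OF \<epsilon>(1,2)] by blast
    show "integrable hyp_measure (\<lambda>x. \<bar>w x - \<phi> x\<bar> powr p)"
      "(\<integral>x. \<bar>w x - \<phi> x\<bar> powr p \<partial>hyp_measure) \<le> (B ^ ?n + 1) * (\<integral>x. \<bar>moll \<epsilon> W x - W x\<bar> powr p \<partial>lebesgue)"
      by (rule integral_hyp_le_lebesgue[OF i0 powr_ge_zero mm powr_ge_zero le C0], assumption)+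
  qed
  define S where "S x = (\<Sum>b\<in>Basis. \<bar>moll \<epsilon> (E b) x - E b x\<bar> powr p)" for x
  have Si: "integrable lebesgue S" "(\<integral>x. S x \<partial>lebesgue) \<le> real ?n * c"
  proof -
    have i: "integrable lebesgue (\<lambda>x. \<bar>moll \<epsilon> (E b) x - E b x\<bar> powr p)" "(\<integral>x. \<bar>moll \<epsilon> (E b) x - E b x\<bar> powr p \<partial>lebesgue) \<le> c"
      if "b \<in> Basis" for b using db(2)[OF that \<epsilon>(1)] m(2)[OF that] \<epsilon>(3) unfolding ok_def by auto
    then show "integrable lebesgue S" unfolding S_def by simp
    have "(\<integral>x. S x \<partial>lebesgue) = (\<Sum>b\<in>Basis. \<integral>x. \<bar>moll \<epsilon> (E b) x - E b x\<bar> powr p \<partial>lebesgue)"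
      unfolding S_def using i(1) by (rule Bochner_Integration.integral_sum)
    also have "\<dots> \<le> (\<Sum>b\<in>(Basis::'a set). c)" by (intro sum_mono i(2))
    finally show "(\<integral>x. S x \<partial>lebesgue) \<le> real ?n * c" by simp
  qed
  have "integrable hyp_measure (\<lambda>x. hyp_norm x (H x - (hyp_dfac x)\<^sup>2 *\<^sub>R egrad \<phi> x) powr p)
    \<and> (\<integral>x. hyp_norm x (H x - (hyp_dfac x)\<^sup>2 *\<^sub>R egrad \<phi> x) powr p \<partial>hyp_measure) \<le> ((B ^ ?n + 1) * real ?n powr p) * (\<integral>x. S x \<partial>lebesgue)"
  proof -
    have mm: "(\<lambda>x. hyp_norm x (H x - (hyp_dfac x)\<^sup>2 *\<^sub>R egrad \<phi> x) powr p) \<in> borel_measurable hyp_measure"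
      using hyp_norm_measurable[OF hyp_weak_grad_measurable(2)[OF g]] by simp
    have le: "hyp_factor x ^ ?n * hyp_norm x (H x - (hyp_dfac x)\<^sup>2 *\<^sub>R egrad \<phi> x) powr p \<le> ((B ^ ?n + 1) * real ?n powr p) * S x" if x: "x \<in> hyp_space" for x
    proof (cases "norm x \<le> r1")
      case True
      define V where "V = H x - (hyp_dfac x)\<^sup>2 *\<^sub>R egrad \<phi> x"
      have dd: "(hyp_dfac x)\<^sup>2 * (hyp_factor x)\<^sup>2 = 1" using hyp_dfac_factor[OF x] by (metis power_mult_distrib power_one)
      have Vb: "V \<bullet> b = (hyp_dfac x)\<^sup>2 * (E b x - moll \<epsilon> (E b) x)" if b: "b \<in> Basis" for b
      proof -
        have "(hyp_dfac x)\<^sup>2 * E b x = ((hyp_dfac x)\<^sup>2 * (hyp_factor x)\<^sup>2) * (H x \<bullet> b)"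
          using x by (simp add: E_def)
        then show ?thesis using b dd by (simp add: V_def inner_diff_left egrad_inner_Basis pd\<phi> right_diff_distrib)
      qed
      \<comment> \<open>The hyperbolic norm contributes one factor \<open>hyp_factor\<close> and the
        inverse metric two factors \<open>hyp_dfac\<close>; one \<open>hyp_dfac\<close>, at most 1,
        survives.\<close>
      have "hyp_norm x V \<le> hyp_factor x * (\<Sum>b\<in>Basis. \<bar>V \<bullet> b\<bar>)"
        unfolding hyp_norm_eq using norm_le_l1[of V] hyp_factor_pos[OF x] by simp
      also have "\<dots> = (hyp_dfac x * hyp_factor x) * hyp_dfac x * (\<Sum>b\<in>Basis. \<bar>moll \<epsilon> (E b) x - E b x\<bar>)"
        by (simp add: Vb abs_mult sum_distrib_left[symmetric] power2_eq_square abs_minus_commute)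
      also have "\<dots> \<le> (\<Sum>b\<in>Basis. \<bar>moll \<epsilon> (E b) x - E b x\<bar>)"
        using hyp_dfac_factor[OF x] hyp_dfac_le_1[of x] hyp_dfac_pos[OF x] by (simp add: mult_left_le_one_le sum_nonneg)
      finally have "hyp_norm x V powr p \<le> (\<Sum>b\<in>Basis. \<bar>moll \<epsilon> (E b) x - E b x\<bar>) powr p" using p by (intro powr_mono2) auto
      also have "\<dots> \<le> real ?n powr p * S x" unfolding S_def using p by (intro powr_sum_le) auto
      finally have "hyp_factor x ^ ?n * hyp_norm x V powr p \<le> (B ^ ?n + 1) * (real ?n powr p * S x)"
        using Bn[OF True] B(1) by (intro mult_mono) auto
      then show ?thesis by (simp add: V_def mult.assoc)
    next
      case False
      have "egrad \<phi> x = 0" using False moll0[OF _ W0(2), of x] by (simp add: egrad_def pd\<phi>)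
      then have "H x - (hyp_dfac x)\<^sup>2 *\<^sub>R egrad \<phi> x = 0" using False r1 H0[of x] by simp
      moreover have "0 \<le> S x" by (simp add: S_def sum_nonneg)
      ultimately show ?thesis using p B(1) by (simp add: hyp_norm_eq)
    qed
    have S0: "0 \<le> S x" for x by (simp add: S_def sum_nonneg)
    have C0: "0 \<le> (B ^ ?n + 1) * real ?n powr p" using B(1) by simp
    show ?thesis
      using integral_hyp_le_lebesgue[OF Si(1) S0 mm powr_ge_zero le C0] by simp
  qed
  then have G: "integrable hyp_measure (\<lambda>x. hyp_norm x (H x - (hyp_dfac x)\<^sup>2 *\<^sub>R egrad \<phi> x) powr p)"
    "(\<integral>x. hyp_norm x (H x - (hyp_dfac x)\<^sup>2 *\<^sub>R egrad \<phi> x) powr p \<partial>hyp_measure) \<le> ((B ^ ?n + 1) * real ?n powr p) * (\<integral>x. S x \<partial>lebesgue)"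
    by auto
  have lp: "(\<lambda>x. w x - \<phi> x) \<in> Lp_hyp p" using L(1) hyp_weak_grad_measurable(1)[OF g] by (simp add: Lp_hyp_def)
  have "Lp_int p (\<lambda>x. w x - \<phi> x) \<le> (B ^ ?n + 1) * c"
    unfolding Lp_int_def using B(1) d0(2)[OF \<epsilon>(1,2)] by (intro order_trans[OF L(2)] mult_left_mono) auto
  moreover have "grad_energy p (\<lambda>x. w x - \<phi> x) \<le> ((B ^ ?n + 1) * real ?n powr p) * (real ?n * c)"
    unfolding grad_energy_eq[OF g] using B(1) by (intro order_trans[OF G(2)] mult_left_mono Si(2)) auto
  ultimately have "Lp_int p (\<lambda>x. w x - \<phi> x) + grad_energy p (\<lambda>x. w x - \<phi> x) \<le> (B ^ ?n + 1) * (real ?n powr p * real ?n + 1) * c"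
    by (simp add: algebra_simps)
  also have "\<dots> = e / 2" unfolding c_def using B(1) by (simp add: add_nonneg_eq_0_iff field_simps add_nonneg_pos)
  also have "\<dots> \<le> e" using e by simp
  finally show ?thesis
    by (intro that[OF cc W1p_hypI[OF lp g G(1)]])
qed

text \<open>A smooth function of \<open>hyp_dfac\<close> alone, vanishing where it is below 1/k. It
  never reaches the value 1 but tends to 1 at every point of the ball as k grows, which is enough
  for dominated convergence and dispenses with a plateau function.\<close>

definition cutoff :: "real \<Rightarrow> 'a::euclidean_space \<Rightarrow> real" where
  "cutoff k x = flat_exp 1 (k * hyp_dfac x - 1)"

lemma Ck_cutoff: "Ck j (cutoff k :: 'a::euclidean_space \<Rightarrow> real)"
  unfolding cutoff_def[abs_def]
proof (rule Ck_compose_real[where S = "range flat_exp" and f = "\<lambda>x. k * hyp_dfac x - 1" and g = "flat_exp 1"])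
  show "\<exists>g'\<in>range flat_exp. \<forall>s. (g has_real_derivative g' s) (at s)" if "g \<in> range flat_exp" for g
    using flat_exp_deriv that by blast
qed (auto intro!: Ck_diff Ck_mult Ck_dfac)

lemma cutoff_bounds: "0 \<le> cutoff k x" "cutoff k x \<le> 1"
  by (auto simp: cutoff_def flat_exp_def)

lemma hyp_dfac_le_dist:
  assumes "0 < c" "1 - c < norm x"
  shows "hyp_dfac x < c"
proof (cases "norm x \<le> 1")
  case True
  have "hyp_dfac x = (1 - norm x) * ((1 + norm x) / 2)" by (simp add: hyp_dfac_def power2_eq_square field_simps)
  also have "\<dots> \<le> (1 - norm x) * 1" using True by (intro mult_left_mono) auto
  finally show ?thesis using assms by simp
next
  case False
  then have "1 < norm x * norm x" by (intro less_1_mult) auto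
  then have "hyp_dfac x \<le> 0" by (simp add: hyp_dfac_def power2_eq_square)
  then show ?thesis using assms by simp
qed

lemma cutoff_eq_0:
  fixes x :: "'a::euclidean_space"
  assumes "0 < k" "1 - 1 / k < norm x"
  shows "cutoff k x = 0" "egrad (cutoff k) x = 0"
proof -
  have z: "cutoff k y = 0" if "1 - 1 / k < norm y" for y :: 'a
  proof -
    have "hyp_dfac y < 1 / k" using hyp_dfac_le_dist[of "1 / k" y] assms(1) that by simp
    then have "k * hyp_dfac y - 1 < 0" using assms(1) by (simp add: field_simps)
    then show ?thesis by (simp add: cutoff_def flat_exp_def)
  qed
  show "cutoff k x = 0" by (rule z[OF assms(2)])
  have "pd (cutoff k) b x = 0" for b
  proof (rule pd_eq_0_off_closed[of "cball 0 (1 - 1 / k)"])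
    show "cutoff k y = 0" if "y \<notin> cball 0 (1 - 1 / k)" for y :: 'a
      by (rule z) (use that in \<open>simp only: mem_cball_0 not_le\<close>)
    show "x \<notin> cball 0 (1 - 1 / k)" using assms(2) by (simp only: mem_cball_0 not_le)
  qed (rule closed_cball)
  then show "egrad (cutoff k) x = 0" by (simp add: egrad_def)
qed

lemma has_derivative_dfac: "(hyp_dfac has_derivative (\<lambda>h. - (x \<bullet> h))) (at x)"
  unfolding hyp_dfac_def[abs_def] power2_norm_eq_inner
  by (auto intro!: derivative_eq_intros simp: inner_commute)

text \<open>The derivative of \<open>flat_exp 1\<close>, that is exp(-1/s) / s^2 for positive
  s.\<close>

definition flat_exp' :: "real \<Rightarrow> real" where
  "flat_exp' s = flat_exp ([:0,0,1:] * (1 - pderiv 1)) s"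

text \<open>In terms of w = 1/s the product is (w + w^2) exp(-w), bounded and tending to 0 with w.
  The factor s + 1 is k \<open>hyp_dfac\<close> for the argument of the cutoff.\<close>

lemma flat_exp'_bound:
  assumes "0 < s"
  shows "0 \<le> flat_exp' s" "(s + 1) * flat_exp' s \<le> 3" "(s + 1) * flat_exp' s \<le> 1 / s + (1 / s)\<^sup>2"
proof -
  define w where "w = 1 / s"
  have w: "0 < w" using assms by (simp add: w_def)
  have f: "flat_exp' s = w\<^sup>2 * exp (- w)"
    using assms by (simp add: flat_exp'_def flat_exp_def w_def power2_eq_square pderiv_1)
  then show "0 \<le> flat_exp' s" by simp
  have eq: "(s + 1) * flat_exp' s = (w + w\<^sup>2) * exp (- w)"
    unfolding f using assms by (simp add: w_def field_simps power2_eq_square)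
  \<comment> \<open>It gives w \<le> exp w and w^2 \<le> 2 exp w, hence the constant 3.\<close>
  have "1 + w + w\<^sup>2 / 2 \<le> exp w" using w by (intro exp_lower_Taylor_quadratic) simp
  moreover have "0 \<le> w\<^sup>2" by simp
  ultimately have "w + w\<^sup>2 \<le> 3 * exp w" using w by linarith
  then have "(w + w\<^sup>2) * exp (- w) \<le> 3 * exp w * exp (- w)" by (intro mult_right_mono) auto
  then show "(s + 1) * flat_exp' s \<le> 3" unfolding eq by (simp add: mult.assoc exp_add[symmetric])
  have "(w + w\<^sup>2) * exp (- w) \<le> (w + w\<^sup>2) * 1" using w by (intro mult_left_mono) auto
  then show "(s + 1) * flat_exp' s \<le> 1 / s + (1 / s)\<^sup>2" unfolding eq by (simp add: w_def)
qed

lemma egrad_cutoff: "egrad (cutoff k) x = (- (k * flat_exp' (k * hyp_dfac x - 1))) *\<^sub>R x"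
proof -
  let ?s = "k * hyp_dfac x - 1"
  have 1: "((\<lambda>x. k * hyp_dfac x - 1) has_derivative (\<lambda>h. k * (- (x \<bullet> h)))) (at x)"
    by (auto intro!: derivative_eq_intros has_derivative_dfac)
  have 2: "(flat_exp 1 has_derivative (\<lambda>h. flat_exp' ?s * h)) (at ?s)"
    using flat_exp_deriv[of 1 ?s] by (simp add: flat_exp'_def has_field_derivative_def)
  have "(cutoff k has_derivative (\<lambda>h. flat_exp' ?s * (k * (- (x \<bullet> h))))) (at x)"
    unfolding cutoff_def[abs_def] by (rule has_derivative_compose[OF 1 2])
  from pd_eq[OF this] have "egrad (cutoff k) x = (\<Sum>b\<in>Basis. (- (k * flat_exp' ?s)) *\<^sub>R ((x \<bullet> b) *\<^sub>R b))"
    unfolding egrad_def by (intro sum.cong) (auto simp: mult_ac)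
  then show ?thesis by (simp only: scaleR_right.sum[symmetric] euclidean_representation)
qed

text \<open>The hyperbolic length of the gradient is \<open>hyp_dfac\<close> times the Euclidean
  one, and k \<open>hyp_dfac\<close> is exactly s + 1; so the growth of the Euclidean gradient with
  k is absorbed and the bound 3 does not depend on k.\<close>

lemma cutoff_gradient_bound:
  assumes x: "x \<in> hyp_space" and k: "0 < k"
  shows "hyp_dfac x * norm (egrad (cutoff k) x) \<le> 3"
    and "1 < k * hyp_dfac x \<Longrightarrow> hyp_dfac x * norm (egrad (cutoff k) x)
      \<le> 1 / (k * hyp_dfac x - 1) + (1 / (k * hyp_dfac x - 1))\<^sup>2"
proof -
  let ?s = "k * hyp_dfac x - 1"
  have le: "hyp_dfac x * norm (egrad (cutoff k) x) \<le> (?s + 1) * flat_exp' ?s" if "0 < ?s"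
  proof -
    have "hyp_dfac x * norm (egrad (cutoff k) x) = (?s + 1) * flat_exp' ?s * norm x"
      using flat_exp'_bound(1)[OF that] k by (simp add: egrad_cutoff abs_mult mult_ac)
    also have "\<dots> \<le> (?s + 1) * flat_exp' ?s * 1"
      using x that flat_exp'_bound(1)[OF that] by (intro mult_left_mono) auto
    finally show ?thesis by simp
  qed
  show "hyp_dfac x * norm (egrad (cutoff k) x) \<le> 3"
  proof (cases "0 < ?s")
    case True
    then show ?thesis using le flat_exp'_bound(2) order_trans by blast
  next
    case False
    then have "flat_exp' ?s = 0" by (simp add: flat_exp'_def flat_exp_def)
    then show ?thesis by (simp add: egrad_cutoff)
  qed
  assume "1 < k * hyp_dfac x"
  then have "0 < ?s" by simp
  from order_trans[OF le[OF this] flat_exp'_bound(3)[OF this]]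
  show "hyp_dfac x * norm (egrad (cutoff k) x) \<le> 1 / ?s + (1 / ?s)\<^sup>2" .
qed

lemma hyp_norm_dfac: "x \<in> hyp_space \<Longrightarrow> hyp_norm x ((hyp_dfac x)\<^sup>2 *\<^sub>R e) = hyp_dfac x * norm e"
proof -
  assume x: "x \<in> hyp_space"
  have "hyp_norm x ((hyp_dfac x)\<^sup>2 *\<^sub>R e) = (hyp_dfac x * hyp_factor x) * hyp_dfac x * norm e"
    using hyp_factor_pos[OF x] by (simp add: hyp_norm_eq power2_eq_square)
  then show ?thesis by (simp add: hyp_dfac_factor[OF x])
qed

lemma filterlim_cutoff_arg:
  assumes "x \<in> hyp_space"
  shows "filterlim (\<lambda>k. real (k + 2) * hyp_dfac x - 1) at_top sequentially"
proof -
  have d: "0 < hyp_dfac x" by (rule hyp_dfac_pos[OF assms])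
  show ?thesis
  proof (subst filterlim_at_top, intro allI)
    fix Z :: real
    obtain N where N: "(Z + 1) / hyp_dfac x \<le> real N" using real_arch_simple by blast
    have "Z \<le> real (k + 2) * hyp_dfac x - 1" if "N \<le> k" for k
    proof -
      have "(Z + 1) / hyp_dfac x \<le> real (k + 2)" using N that by linarith
      then show ?thesis using d by (simp add: pos_divide_le_eq)
    qed
    then show "\<forall>\<^sub>F k in sequentially. Z \<le> real (k + 2) * hyp_dfac x - 1"
      by (rule eventually_sequentiallyI)
  qed
qed

lemma cutoff_tendsto:
  assumes x: "x \<in> hyp_space"
  shows "(\<lambda>k. cutoff (real (k + 2)) x) \<longlonglongrightarrow> 1"
    "(\<lambda>k. hyp_dfac x * norm (egrad (cutoff (real (k + 2))) x)) \<longlonglongrightarrow> 0"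
proof -
  let ?s = "\<lambda>k. real (k + 2) * hyp_dfac x - 1"
  have inv: "(\<lambda>k. 1 / ?s k) \<longlonglongrightarrow> 0"
    using filterlim_compose[OF tendsto_inverse_0_at_top filterlim_cutoff_arg[OF x]]
    using tendsto_inverse_0_at_top[OF filterlim_cutoff_arg[OF x]] by (simp add: inverse_eq_divide)
  have ev: "\<forall>\<^sub>F k in sequentially. 0 < ?s k"
    using filterlim_cutoff_arg[OF x] unfolding filterlim_at_top_dense by blast
  have "(\<lambda>k. exp (- (1 / ?s k))) \<longlonglongrightarrow> exp (- 0)" by (intro tendsto_intros inv)
  then have "(\<lambda>k. exp (- (1 / ?s k))) \<longlonglongrightarrow> 1" by simp
  then show "(\<lambda>k. cutoff (real (k + 2)) x) \<longlonglongrightarrow> 1"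
    by (rule Lim_transform_eventually) (use ev in \<open>auto elim!: eventually_mono simp: cutoff_def flat_exp_def\<close>)
  have "(\<lambda>k. 1 / ?s k + (1 / ?s k)\<^sup>2) \<longlonglongrightarrow> 0 + 0\<^sup>2" by (intro tendsto_intros inv)
  then have lim: "(\<lambda>k. 1 / ?s k + (1 / ?s k)\<^sup>2) \<longlonglongrightarrow> 0" by simp
  show "(\<lambda>k. hyp_dfac x * norm (egrad (cutoff (real (k + 2))) x)) \<longlonglongrightarrow> 0"
  proof (rule tendsto_sandwich[OF _ _ tendsto_const lim])
    show "\<forall>\<^sub>F k in sequentially. 0 \<le> hyp_dfac x * norm (egrad (cutoff (real (k + 2))) x)"
      using hyp_dfac_pos[OF x] by simp
    show "\<forall>\<^sub>F k in sequentially. hyp_dfac x * norm (egrad (cutoff (real (k + 2))) x) \<le> 1 / ?s k + (1 / ?s k)\<^sup>2"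
      using ev
    proof eventually_elim
      case (elim k)
      then show ?case by (intro cutoff_gradient_bound(2)[OF x]) auto
    qed
  qed
qed

text \<open>Dominated convergence in both integrals; the gradient of the cutoff multiplies v itself,
  so membership of v in L^p enters the majorant.\<close>

lemma W1p_cutoff_approx:
  fixes v :: "'a::euclidean_space \<Rightarrow> real"
  assumes p: "1 \<le> p" and v: "v \<in> W1p_hyp p"
  defines "w \<equiv> \<lambda>k x. cutoff (real (k + 2)) x * v x"
  shows "w k \<in> W1p_hyp p"
    and "(\<lambda>k. Lp_int p (\<lambda>x. v x - w k x) + grad_energy p (\<lambda>x. v x - w k x)) \<longlonglongrightarrow> 0"
proof -
  let ?\<kappa> = "\<lambda>k::nat. cutoff (real (k + 2)) :: 'a \<Rightarrow> real"
  note V = W1p_hypD[OF v] and L = Lp_hypD[OF W1p_hypD(1)[OF v]]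
  define H where "H k x = ?\<kappa> k x *\<^sub>R hyp_grad v x + (v x * (hyp_dfac x)\<^sup>2) *\<^sub>R egrad (?\<kappa> k) x" for k x
  have wg: "hyp_weak_grad (w k) (H k)" for k
    unfolding w_def H_def by (rule hyp_weak_grad_mult[OF V(2) Ck_cutoff])
  have dg: "hyp_weak_grad (\<lambda>x. v x - w k x) (\<lambda>x. hyp_grad v x - H k x)" for k
    using hyp_weak_grad_linear[OF V(2) wg, of 1 "-1"] by simp
  have dle: "\<bar>v x - w k x\<bar> = (1 - ?\<kappa> k x) * \<bar>v x\<bar>" for k x
  proof -
    have "v x - w k x = (1 - ?\<kappa> k x) * v x" by (simp add: w_def algebra_simps)
    then show ?thesis using cutoff_bounds(2)[of "real (k + 2)" x] by (simp add: abs_mult)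
  qed
  have gle: "hyp_norm x (hyp_grad v x - H k x) \<le> (1 - ?\<kappa> k x) * hyp_norm x (hyp_grad v x)
      + \<bar>v x\<bar> * (hyp_dfac x * norm (egrad (?\<kappa> k) x))" if x: "x \<in> hyp_space" for k x
  proof -
    have "hyp_grad v x - H k x = (1 - ?\<kappa> k x) *\<^sub>R hyp_grad v x + (- v x) *\<^sub>R ((hyp_dfac x)\<^sup>2 *\<^sub>R egrad (?\<kappa> k) x)"
      by (simp add: H_def algebra_simps)
    also have "hyp_norm x \<dots> \<le> hyp_norm x ((1 - ?\<kappa> k x) *\<^sub>R hyp_grad v x) + hyp_norm x ((- v x) *\<^sub>R ((hyp_dfac x)\<^sup>2 *\<^sub>R egrad (?\<kappa> k) x))"
      by (rule hyp_norm_triangle)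
    also have "\<dots> = (1 - ?\<kappa> k x) * hyp_norm x (hyp_grad v x) + \<bar>v x\<bar> * (hyp_dfac x * norm (egrad (?\<kappa> k) x))"
      unfolding hyp_norm_scale[of x "1 - ?\<kappa> k x"] hyp_norm_scale[of x "- v x"] hyp_norm_dfac[OF x]
      using cutoff_bounds(2)[of "real (k + 2)" x] by simp
    finally show ?thesis .
  qed
  \<comment> \<open>The 3 is the uniform bound on the cutoff gradient, the leading
    \<open>2 powr p\<close> comes from \<open>powr_add_le\<close>.\<close>
  define U where "U x = 2 powr p * (hyp_norm x (hyp_grad v x) powr p + 3 powr p * \<bar>v x\<bar> powr p)" for x
  have Ui: "integrable hyp_measure U" unfolding U_def using V(5) L(2) by simp
  have gU: "hyp_norm x (hyp_grad v x - H k x) powr p \<le> U x" if x: "x \<in> hyp_space" for k x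
  proof -
    have "(1 - ?\<kappa> k x) * hyp_norm x (hyp_grad v x) \<le> 1 * hyp_norm x (hyp_grad v x)"
      using cutoff_bounds[of "real (k + 2)" x] by (intro mult_right_mono) auto
    moreover have "\<bar>v x\<bar> * (hyp_dfac x * norm (egrad (?\<kappa> k) x)) \<le> \<bar>v x\<bar> * 3"
      by (intro mult_left_mono cutoff_gradient_bound(1)[OF x]) auto
    ultimately have "hyp_norm x (hyp_grad v x - H k x) \<le> hyp_norm x (hyp_grad v x) + 3 * \<bar>v x\<bar>"
      using gle[OF x, of k] by linarith
    then have "hyp_norm x (hyp_grad v x - H k x) powr p \<le> (hyp_norm x (hyp_grad v x) + 3 * \<bar>v x\<bar>) powr p"
      using p by (intro powr_mono2) auto
    also have "\<dots> \<le> 2 powr p * (hyp_norm x (hyp_grad v x) powr p + (3 * \<bar>v x\<bar>) powr p)"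
      using p by (intro powr_add_le) auto
    also have "\<dots> = U x" by (simp add: U_def powr_mult)
    finally show ?thesis .
  qed
  have mH: "(\<lambda>x. hyp_norm x (hyp_grad v x - H k x) powr p) \<in> borel_measurable hyp_measure" for k
    using hyp_norm_measurable[OF hyp_weak_grad_measurable(2)[OF dg[of k]]] by simp
  have md: "(\<lambda>x. \<bar>v x - w k x\<bar> powr p) \<in> borel_measurable hyp_measure" for k
    using hyp_weak_grad_measurable(1)[OF dg[of k]] by simp
  have dL: "\<bar>v x - w k x\<bar> powr p \<le> \<bar>v x\<bar> powr p" for k x
  proof -
    have "(1 - ?\<kappa> k x) * \<bar>v x\<bar> \<le> 1 * \<bar>v x\<bar>"
      using cutoff_bounds[of "real (k + 2)" x] by (intro mult_right_mono) auto
    then show ?thesis unfolding dle using p cutoff_bounds[of "real (k + 2)" x] by (intro powr_mono2) auto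
  qed
  have di: "(\<lambda>x. v x - w k x) \<in> W1p_hyp p" for k
  proof (rule W1p_hypI[OF _ dg])
    have "integrable hyp_measure (\<lambda>x. \<bar>v x - w k x\<bar> powr p)"
      by (rule Bochner_Integration.integrable_bound[OF L(2) md]) (intro AE_I2, use dL in simp)
    then show "(\<lambda>x. v x - w k x) \<in> Lp_hyp p"
      using hyp_weak_grad_measurable(1)[OF dg[of k]] by (simp add: Lp_hyp_def)
    show "integrable hyp_measure (\<lambda>x. hyp_norm x (hyp_grad v x - H k x) powr p)"
    proof (rule Bochner_Integration.integrable_bound[OF Ui mH], rule AE_I2)
      fix x :: 'a assume "x \<in> space hyp_measure"
      then show "norm (hyp_norm x (hyp_grad v x - H k x) powr p) \<le> norm (U x)"
        using gU[of x k] by simp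
    qed
  qed
  show "w k \<in> W1p_hyp p"
    using cf_diff[OF convex_functional_grad_energy[OF p] v di[of k]] by simp
  have "(\<lambda>k. Lp_int p (\<lambda>x. v x - w k x)) \<longlonglongrightarrow> (\<integral>x. 0 \<partial>(hyp_measure::'a measure))"
    unfolding Lp_int_def
  proof (rule integral_dominated_convergence[OF _ md L(2)])
    show "AE x in hyp_measure. (\<lambda>k. \<bar>v x - w k x\<bar> powr p) \<longlonglongrightarrow> 0"
    proof (rule AE_I2)
      fix x :: 'a assume "x \<in> space hyp_measure"
      then have x: "x \<in> hyp_space" by simp
      have "(\<lambda>k. ((1 - ?\<kappa> k x) * \<bar>v x\<bar>) powr p) \<longlonglongrightarrow> ((1 - 1) * \<bar>v x\<bar>) powr p"
        using p cutoff_bounds[of _ x] by (intro tendsto_powr2 tendsto_intros cutoff_tendsto(1)[OF x]) auto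
      then show "(\<lambda>k. \<bar>v x - w k x\<bar> powr p) \<longlonglongrightarrow> 0" unfolding dle using p by simp
    qed
    show "AE x in hyp_measure. norm (\<bar>v x - w k x\<bar> powr p) \<le> \<bar>v x\<bar> powr p" for k
      by (intro AE_I2) (use dL in simp)
  qed simp
  moreover have "(\<lambda>k. grad_energy p (\<lambda>x. v x - w k x)) \<longlonglongrightarrow> (\<integral>x. 0 \<partial>(hyp_measure::'a measure))"
    unfolding grad_energy_eq[OF dg]
  proof (rule integral_dominated_convergence[OF _ mH Ui])
    show "AE x in hyp_measure. (\<lambda>k. hyp_norm x (hyp_grad v x - H k x) powr p) \<longlonglongrightarrow> 0"
    proof (rule AE_I2)
      fix x :: 'a assume "x \<in> space hyp_measure"
      then have x: "x \<in> hyp_space" by simp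
      have "(\<lambda>k. (1 - ?\<kappa> k x) * hyp_norm x (hyp_grad v x) + \<bar>v x\<bar> * (hyp_dfac x * norm (egrad (?\<kappa> k) x)))
         \<longlonglongrightarrow> (1 - 1) * hyp_norm x (hyp_grad v x) + \<bar>v x\<bar> * 0"
        by (intro tendsto_intros cutoff_tendsto[OF x])
      then have "(\<lambda>k. (1 - ?\<kappa> k x) * hyp_norm x (hyp_grad v x) + \<bar>v x\<bar> * (hyp_dfac x * norm (egrad (?\<kappa> k) x))) \<longlonglongrightarrow> 0" (is "?lim") by simp
      then have lim: ?lim .
      have "(\<lambda>k. hyp_norm x (hyp_grad v x - H k x)) \<longlonglongrightarrow> 0"
        by (rule tendsto_sandwich[OF _ _ tendsto_const lim]) (use gle[OF x] in \<open>auto intro!: always_eventually\<close>)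
      then have "(\<lambda>k. hyp_norm x (hyp_grad v x - H k x) powr p) \<longlonglongrightarrow> 0 powr p"
        using p by (intro tendsto_powr2) auto
      then show "(\<lambda>k. hyp_norm x (hyp_grad v x - H k x) powr p) \<longlonglongrightarrow> 0" using p by simp
    qed
    show "AE x in hyp_measure. norm (hyp_norm x (hyp_grad v x - H k x) powr p) \<le> U x" for k
    proof (rule AE_I2)
      fix x :: 'a assume "x \<in> space hyp_measure"
      then show "norm (hyp_norm x (hyp_grad v x - H k x) powr p) \<le> U x"
        using gU[of x k] by simp
    qed
  qed simp
  ultimately show "(\<lambda>k. Lp_int p (\<lambda>x. v x - w k x) + grad_energy p (\<lambda>x. v x - w k x)) \<longlonglongrightarrow> 0"
    using tendsto_add[of "\<lambda>k. Lp_int p (\<lambda>x. v x - w k x)" 0 sequentially "\<lambda>k. grad_energy p (\<lambda>x. v x - w k x)" 0] by simp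
qed

lemma W1p_smooth_approx:
  fixes v :: "'a::euclidean_space \<Rightarrow> real"
  assumes p: "1 \<le> p" and v: "v \<in> W1p_hyp p" and e: "0 < e"
  shows "\<exists>\<phi>. \<phi> \<in> Cc_smooth hyp_space \<and> Lp_int p (\<lambda>x. v x - \<phi> x) + grad_energy p (\<lambda>x. v x - \<phi> x) \<le> e"
proof -
  define c where "c = e / (2 * 2 powr p)"
  have c: "0 < c" using e by (simp add: c_def)
  let ?w = "\<lambda>k x. cutoff (real (k + 2)) x * v x"
  have "\<forall>\<^sub>F k in sequentially. Lp_int p (\<lambda>x. v x - ?w k x) + grad_energy p (\<lambda>x. v x - ?w k x) < c"
    by (rule order_tendstoD(2)[OF W1p_cutoff_approx(2)[OF p v] c])
  then obtain k where k: "Lp_int p (\<lambda>x. v x - ?w k x) + grad_energy p (\<lambda>x. v x - ?w k x) < c"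
    by (auto simp: eventually_sequentially)
  have w: "?w k \<in> W1p_hyp p" by (rule W1p_cutoff_approx(1)[OF p v])
  define H where "H x = cutoff (real (k + 2)) x *\<^sub>R hyp_grad v x + (v x * (hyp_dfac x)\<^sup>2) *\<^sub>R egrad (cutoff (real (k + 2))) x" for x
  have wg: "hyp_weak_grad (?w k) H"
    unfolding H_def by (rule hyp_weak_grad_mult[OF W1p_hypD(2)[OF v] Ck_cutoff])
  have "AE x in hyp_measure. hyp_norm x (hyp_grad (?w k) x) powr p = hyp_norm x (H x) powr p"
    using hyp_grad_AE[OF wg] by eventually_elim simp
  then have Hp: "integrable hyp_measure (\<lambda>x. hyp_norm x (H x) powr p)"
    using hyp_norm_measurable[OF hyp_weak_grad_measurable(2)[OF wg]]
    by (intro integrable_cong_AE_imp[OF W1p_hypD(5)[OF w]]) auto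
  \<comment> \<open>Indexing the cutoffs by k + 2 makes this support radius positive.\<close>
  let ?r = "1 - 1 / real (k + 2)"
  have r: "0 < ?r" "?r < 1" by (auto simp: field_simps)
  have k0: "0 < real (k + 2)" by simp
  have z: "?w k x = 0" "H x = 0" if "?r < norm x" for x
    using cutoff_eq_0[OF k0 that] by (auto simp: H_def)
  obtain \<phi> where \<phi>: "\<phi> \<in> Cc_smooth hyp_space" "(\<lambda>x. ?w k x - \<phi> x) \<in> W1p_hyp p"
    "Lp_int p (\<lambda>x. ?w k x - \<phi> x) + grad_energy p (\<lambda>x. ?w k x - \<phi> x) \<le> c"
    using W1p_compact_support_approx[OF p W1p_hypD(1)[OF w] wg Hp r z c] by blast
  note Q = convex_functional_W1p[OF p, where 'a = 'a]
  have "(\<lambda>x. (v x - ?w k x) + (?w k x - \<phi> x)) = (\<lambda>x. v x - \<phi> x)" by auto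
  then have "Lp_int p (\<lambda>x. v x - \<phi> x) + grad_energy p (\<lambda>x. v x - \<phi> x) \<le>
     2 powr p * ((Lp_int p (\<lambda>x. v x - ?w k x) + grad_energy p (\<lambda>x. v x - ?w k x)) + (Lp_int p (\<lambda>x. ?w k x - \<phi> x) + grad_energy p (\<lambda>x. ?w k x - \<phi> x)))"
    using cf_quasi[OF Q cf_diff[OF Q v w] \<phi>(2)] by simp
  also have "\<dots> \<le> 2 powr p * (c + c)" using k \<phi>(3) by (intro mult_left_mono add_mono) auto
  also have "\<dots> = e" by (simp add: c_def)
  finally show ?thesis using \<phi>(1) by blast
qed

text \<open>Hyperbolic space is complete, so cutting off costs nothing: the hyperbolic gradients of the
  cutoffs are uniformly bounded and converge to zero pointwise.\<close>

proposition W1p_hyp_subset_W1p0: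
  fixes v :: "'a::euclidean_space \<Rightarrow> real"
  assumes p: "1 \<le> p" and v: "v \<in> W1p_hyp p"
  shows "v \<in> W1p0_hyp p"
proof -
  have "\<forall>k::nat. \<exists>\<phi>. \<phi> \<in> Cc_smooth hyp_space \<and> Lp_int p (\<lambda>x. v x - \<phi> x) + grad_energy p (\<lambda>x. v x - \<phi> x) \<le> 1 / real (Suc k)"
    by (intro allI W1p_smooth_approx[OF p v]) simp
  from choice[OF this] obtain \<phi> where \<phi>: "\<And>k. \<phi> k \<in> Cc_smooth hyp_space"
    "\<And>k. Lp_int p (\<lambda>x. v x - \<phi> k x) + grad_energy p (\<lambda>x. v x - \<phi> k x) \<le> 1 / real (Suc k)" by blast
  have lim: "(\<lambda>k. 1 / real (Suc k)) \<longlonglongrightarrow> 0" by (rule LIMSEQ_Suc[OF lim_1_over_n])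
  have "(\<lambda>k. Lp_int p (\<lambda>x. v x - \<phi> k x) + grad_energy p (\<lambda>x. v x - \<phi> k x)) \<longlonglongrightarrow> 0"
    by (rule tendsto_sandwich[OF _ _ tendsto_const lim])
       (use \<phi>(2) in \<open>auto intro!: always_eventually add_nonneg_nonneg Lp_int_nonneg grad_energy_nonneg\<close>)
  then have "(\<lambda>k. (Lp_int p (\<lambda>x. v x - \<phi> k x) + grad_energy p (\<lambda>x. v x - \<phi> k x)) powr (1 / p)) \<longlonglongrightarrow> 0 powr (1 / p)"
    using p by (intro tendsto_powr2) (auto intro!: always_eventually add_nonneg_nonneg Lp_int_nonneg grad_energy_nonneg)
  then have "(\<lambda>k. W1p_norm p (\<lambda>x. v x - \<phi> k x)) \<longlonglongrightarrow> 0" by (simp add: W1p_norm_eq)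
  then show ?thesis unfolding W1p0_hyp_def using v \<phi>(1) by blast
qed

section \<open>A Sobolev-type inequality\<close>

text \<open>Young's inequality with crude constants: a case split on b \<le> \<epsilon> a replaces
  conjugate exponents.\<close>

lemma powr_young:
  fixes a b \<epsilon> p :: real
  assumes "0 \<le> a" "0 \<le> b" "1 \<le> p" "0 < \<epsilon>"
  shows "a powr (p - 1) * b \<le> \<epsilon> * a powr p + \<epsilon> powr (1 - p) * b powr p"
proof (cases "b \<le> \<epsilon> * a")
  case True
  have "a powr (p - 1) * b \<le> a powr (p - 1) * (\<epsilon> * a)" using True by (intro mult_left_mono) auto
  also have "\<dots> = \<epsilon> * a powr p"
    using assms by (cases "a = 0") (auto simp: powr_diff)
  also have "\<dots> \<le> \<epsilon> * a powr p + \<epsilon> powr (1 - p) * b powr p" by simp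
  finally show ?thesis .
next
  case False
  have "0 \<le> \<epsilon> * a" using assms by simp
  then have "0 < b" using False by linarith
  moreover have "a \<le> b / \<epsilon>" using assms False by (simp add: pos_le_divide_eq mult.commute)
  ultimately have ab: "a \<le> b / \<epsilon>" "0 < b" by auto
  have "a powr (p - 1) * b \<le> (b / \<epsilon>) powr (p - 1) * b" using ab assms by (intro mult_right_mono powr_mono2) auto
  also have "\<dots> = \<epsilon> powr (1 - p) * b powr p"
    using ab assms by (simp add: powr_divide powr_diff)
  also have "\<dots> \<le> \<epsilon> * a powr p + \<epsilon> powr (1 - p) * b powr p" using assms by simp
  finally show ?thesis .
qed

text \<open>The derivative of |s|^p. Writing it with the positive parts of s and -s makes its
  continuity at 0 visible for p > 1.\<close>

definition dabs_powr :: "real \<Rightarrow> real \<Rightarrow> real" where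
  "dabs_powr p s = p * (max s 0 powr (p - 1) - max (- s) 0 powr (p - 1))"

lemma abs_dabs_powr: "0 \<le> p \<Longrightarrow> \<bar>dabs_powr p s\<bar> = p * \<bar>s\<bar> powr (p - 1)"
  by (cases "0 \<le> s") (auto simp: dabs_powr_def abs_mult max_def)

lemma DERIV_abs_powr:
  assumes p: "1 < p"
  shows "((\<lambda>s. \<bar>s\<bar> powr p) has_real_derivative dabs_powr p s) (at s)"
proof (cases s "0::real" rule: linorder_cases)
  case greater
  have "((\<lambda>s. s powr p) has_real_derivative dabs_powr p s) (at s)"
    using greater by (auto intro!: derivative_eq_intros simp: dabs_powr_def powr_diff max_def)
  then show ?thesis
    by (rule has_field_derivative_transform_within_open[of _ _ _ "{0<..}"]) (use greater in auto)
next
  case less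
  have "((\<lambda>s. (- s) powr p) has_real_derivative dabs_powr p s) (at s)"
    using less by (auto intro!: derivative_eq_intros simp: dabs_powr_def powr_diff max_def)
  then show ?thesis
    by (rule has_field_derivative_transform_within_open[of _ _ _ "{..<0}"]) (use less in auto)
next
  case equal
  have lim: "((\<lambda>h::real. \<bar>h\<bar> powr (p - 1)) \<longlongrightarrow> \<bar>0\<bar> powr (p - 1)) (at 0)"
    using p by (intro tendsto_powr2 tendsto_intros) auto
  have "((\<lambda>h::real. (\<bar>0 + h\<bar> powr p - \<bar>0\<bar> powr p) / h) \<longlongrightarrow> 0) (at 0)"
  proof (rule Lim_null_comparison[where g = "\<lambda>h. \<bar>h\<bar> powr (p - 1)"])
    show "\<forall>\<^sub>F h in at 0. norm ((\<bar>0 + h\<bar> powr p - \<bar>0\<bar> powr p) / h) \<le> \<bar>h\<bar> powr (p - 1)"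
      using p by (auto simp: eventually_at_filter powr_diff abs_mult)
    show "((\<lambda>h::real. \<bar>h\<bar> powr (p - 1)) \<longlongrightarrow> 0) (at 0)" using lim p by simp
  qed
  then show ?thesis using equal by (simp add: DERIV_def dabs_powr_def)
qed

lemma continuous_dabs_powr: "1 < p \<Longrightarrow> continuous_on UNIV (dabs_powr p)"
  unfolding dabs_powr_def[abs_def] by (intro continuous_intros continuous_on_powr') auto

lemma abs_powr_C1:
  fixes \<phi> :: "'a::euclidean_space \<Rightarrow> real"
  assumes p: "1 < p" and \<phi>: "Ck 1 \<phi>"
  shows "Ck 1 (\<lambda>x. \<bar>\<phi> x\<bar> powr p)" "egrad (\<lambda>x. \<bar>\<phi> x\<bar> powr p) x = dabs_powr p (\<phi> x) *\<^sub>R egrad \<phi> x"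
proof -
  have D: "((\<lambda>x. \<bar>\<phi> x\<bar> powr p) has_derivative (\<lambda>h. dabs_powr p (\<phi> x) * pd \<phi> h x)) (at x)" for x
  proof -
    have 1: "(\<phi> has_derivative frechet_derivative \<phi> (at x)) (at x)"
      using \<phi> by (simp add: frechet_derivative_works[symmetric])
    have 2: "((\<lambda>s. \<bar>s\<bar> powr p) has_derivative (*) (dabs_powr p (\<phi> x))) (at (\<phi> x))"
      using DERIV_abs_powr[OF p] by (simp add: has_field_derivative_def)
    show ?thesis using has_derivative_compose[OF 1 2] .
  qed
  have pd: "pd (\<lambda>x. \<bar>\<phi> x\<bar> powr p) b = (\<lambda>x. dabs_powr p (\<phi> x) * pd \<phi> b x)" for b
    using pd_eq[OF D] by auto
  have c: "continuous_on UNIV (\<lambda>x. dabs_powr p (\<phi> x))"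
    by (rule continuous_on_compose2[OF continuous_dabs_powr[OF p] Ck_continuous[OF \<phi>]]) simp
  have "continuous_on UNIV (\<lambda>x. dabs_powr p (\<phi> x) * pd \<phi> b x)" if "b \<in> Basis" for b
    using \<phi> that by (intro continuous_on_mult c) simp
  moreover have "(\<lambda>x. \<bar>\<phi> x\<bar> powr p) differentiable (at x)" for x using D unfolding differentiable_def by blast
  ultimately show "Ck 1 (\<lambda>x. \<bar>\<phi> x\<bar> powr p)" by (simp add: pd)
  show "egrad (\<lambda>x. \<bar>\<phi> x\<bar> powr p) x = dabs_powr p (\<phi> x) *\<^sub>R egrad \<phi> x"
    by (simp add: egrad_def pd_eq[OF D] scaleR_sum_right)
qed

section \<open>The spectral gap for smooth functions\<close>

lemma hyp_integrable_continuous: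
  fixes f :: "'a::euclidean_space \<Rightarrow> real"
  assumes "continuous_on hyp_space f" "compact K" "K \<subseteq> hyp_space" "\<And>x. x \<in> hyp_space \<Longrightarrow> x \<notin> K \<Longrightarrow> f x = 0"
  shows "integrable hyp_measure f"
proof -
  have "integrable hyp_measure (\<lambda>x. indicat_real K x *\<^sub>R f x)"
    using set_integrable_hyp_continuous[OF assms(2,3,1)] by (simp add: set_integrable_def)
  then show ?thesis
    by (subst Bochner_Integration.integrable_cong[OF refl, of _ _ "\<lambda>x. indicat_real K x *\<^sub>R f x"])
       (use assms(4) in \<open>auto simp: indicator_def\<close>)
qed

lemma Cc_smooth_support:
  assumes "\<phi> \<in> Cc_smooth hyp_space"
  obtains K where "compact K" "K \<subseteq> hyp_space" "\<And>x. x \<notin> K \<Longrightarrow> \<phi> x = 0" "\<And>x. x \<notin> K \<Longrightarrow> egrad \<phi> x = 0"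
proof -
  obtain K where K: "compact K" "K \<subseteq> hyp_space" "\<And>x. x \<notin> K \<Longrightarrow> \<phi> x = 0"
    using assms by (auto simp: Cc_smooth_def)
  have "egrad \<phi> x = 0" if "x \<notin> K" for x
    using pd_eq_0_off_closed[OF compact_imp_closed[OF K(1)] K(3) that] by (simp add: egrad_def)
  then show ?thesis using that K by blast
qed

lemma smooth_W1p:
  fixes \<phi> :: "'a::euclidean_space \<Rightarrow> real"
  assumes \<phi>: "\<phi> \<in> Cc_smooth hyp_space" and p: "1 \<le> p"
  shows "\<phi> \<in> W1p_hyp p" "grad_energy p \<phi> = (\<integral>x. (hyp_dfac x * norm (egrad \<phi> x)) powr p \<partial>hyp_measure)"
    "integrable hyp_measure (\<lambda>x. (hyp_dfac x * norm (egrad \<phi> x)) powr p)"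
    "integrable hyp_measure (\<lambda>x. \<bar>\<phi> x\<bar> powr p)"
proof -
  note ck = Cc_smooth_Ck[OF \<phi>]
  obtain K where K: "compact K" "K \<subseteq> hyp_space" "\<And>x. x \<notin> K \<Longrightarrow> \<phi> x = 0" "\<And>x. x \<notin> K \<Longrightarrow> egrad \<phi> x = 0"
    using Cc_smooth_support[OF \<phi>] by blast
  have c: "continuous_on hyp_space \<phi>" "continuous_on hyp_space (egrad \<phi>)"
    by (rule continuous_on_subset[OF Ck_continuous[OF ck]], simp)
       (rule continuous_on_subset[OF continuous_egrad[OF ck]], simp)
  note wg = hyp_weak_grad_smooth[of \<phi>, OF ck]
  show i1: "integrable hyp_measure (\<lambda>x. (hyp_dfac x * norm (egrad \<phi> x)) powr p)"
  proof (rule hyp_integrable_continuous[OF _ K(1,2)])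
    show "continuous_on hyp_space (\<lambda>x. (hyp_dfac x * norm (egrad \<phi> x)) powr p)"
      using p hyp_dfac_pos[THEN less_imp_le]
      by (intro continuous_on_powr' continuous_intros continuous_on_dfac c) (auto intro!: mult_nonneg_nonneg)
  qed (use K(4) p in simp)
  show i2: "integrable hyp_measure (\<lambda>x. \<bar>\<phi> x\<bar> powr p)"
  proof (rule hyp_integrable_continuous[OF _ K(1,2)])
    show "continuous_on hyp_space (\<lambda>x. \<bar>\<phi> x\<bar> powr p)"
      using p by (intro continuous_on_powr' continuous_intros c) auto
  qed (use K(3) p in simp)
  have lp: "\<phi> \<in> Lp_hyp p" using i2 continuous_measurable_hyp[OF c(1)] by (simp add: Lp_hyp_def)
  have "integrable hyp_measure (\<lambda>x. hyp_norm x ((hyp_dfac x)\<^sup>2 *\<^sub>R egrad \<phi> x) powr p)"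
    by (subst Bochner_Integration.integrable_cong[OF refl, of _ _ "\<lambda>x. (hyp_dfac x * norm (egrad \<phi> x)) powr p"])
       (use i1 in \<open>auto simp: hyp_norm_dfac\<close>)
  then show "\<phi> \<in> W1p_hyp p" by (rule W1p_hypI[OF lp wg])
  show "grad_energy p \<phi> = (\<integral>x. (hyp_dfac x * norm (egrad \<phi> x)) powr p \<partial>hyp_measure)"
    unfolding grad_energy_eq[OF wg] by (intro Bochner_Integration.integral_cong refl) (simp add: hyp_norm_dfac)
qed

text \<open>The vector field \<open>X = ((1 - |x|\<^sup>2) / 2) x\<close> has divergence at least \<open>1\<close> and hyperbolic norm at most
  \<open>1\<close>; integrate \<open>|\<phi>|\<^sup>p div X\<close> by parts.\<close>

proposition poincare_smooth:
  fixes \<phi> :: "'a::euclidean_space \<Rightarrow> real"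
  assumes \<phi>: "\<phi> \<in> Cc_smooth hyp_space" and p: "1 < p" and n: "2 \<le> DIM('a)"
  shows "Lp_int p \<phi> \<le> (2 * p) powr p * grad_energy p \<phi>"
proof -
  let ?n = "real DIM('a)"
  note ck = Cc_smooth_Ck[OF \<phi>]
  have p1: "1 \<le> p" using p by simp
  obtain K where K: "compact K" "K \<subseteq> hyp_space" "\<And>x. x \<notin> K \<Longrightarrow> \<phi> x = 0" "\<And>x. x \<notin> K \<Longrightarrow> egrad \<phi> x = 0"
    using Cc_smooth_support[OF \<phi>] by blast
  have c: "continuous_on hyp_space \<phi>" "continuous_on hyp_space (egrad \<phi>)"
    by (rule continuous_on_subset[OF Ck_continuous[OF ck]], simp)
       (rule continuous_on_subset[OF continuous_egrad[OF ck]], simp)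
  define X :: "'a \<Rightarrow> 'a" where "X x = hyp_dfac x *\<^sub>R x" for x
  define f where "f x = \<bar>\<phi> x\<bar> powr p" for x
  have f1: "Ck 1 f" unfolding f_def by (rule abs_powr_C1(1)[OF p ck])
  have X1: "Ck 1 (\<lambda>x. X x \<bullet> b)" for b
    unfolding X_def by (simp add: Ck_mult[OF Ck_dfac Ck_inner])
  have divX: "hyp_div X x = ?n * hyp_dfac x + (?n - 1) * (norm x)\<^sup>2" if x: "x \<in> hyp_space" for x
  proof -
    have "pd (\<lambda>x::'a. x \<bullet> b) b x = b \<bullet> b" for b
      by (rule pd_eq) (auto intro!: derivative_eq_intros)
    moreover have "(\<lambda>x::'a. x \<bullet> b) differentiable (at x)" for b
      by (rule Ck_differentiable[OF Ck_inner])
    ultimately have "hyp_div (\<lambda>x. x) x = ?n + ?n * hyp_factor x * (x \<bullet> x)"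
      using hyp_div_formula[OF x, of "\<lambda>x. x"] by (simp add: inner_Basis)
    moreover have "egrad hyp_dfac x = - x"
      by (simp add: egrad_def pd_eq[OF has_derivative_dfac] sum_negf euclidean_representation)
    ultimately have "hyp_div X x = hyp_dfac x * ?n + ?n * (hyp_dfac x * hyp_factor x) * (x \<bullet> x) - x \<bullet> x"
      using hyp_div_mult[OF x Ck_dfac Ck_inner] unfolding X_def by (simp add: algebra_simps)
    then show ?thesis using hyp_dfac_factor[OF x] by (simp add: power2_norm_eq_inner algebra_simps)
  qed
  have divX1: "1 \<le> hyp_div X x" if x: "x \<in> hyp_space" for x
  proof -
    \<comment> \<open>Both terms on the right are controlled by n \<ge> 2: the first is at least 1,
      the second nonnegative.\<close>
    have "?n * hyp_dfac x + (?n - 1) * (norm x)\<^sup>2 = ?n / 2 + (?n / 2 - 1) * (norm x)\<^sup>2"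
      by (simp add: hyp_dfac_def field_simps)
    moreover have "0 \<le> (?n / 2 - 1) * (norm x)\<^sup>2" using n by (intro mult_nonneg_nonneg) auto
    ultimately show ?thesis unfolding divX[OF x] using n by linarith
  qed
  have Z: "C1_field (\<lambda>x. f x *\<^sub>R X x)"
    unfolding C1_field_def
  proof (intro conjI ballI exI[of _ K] K allI impI)
    show "Ck 1 (\<lambda>x. (f x *\<^sub>R X x) \<bullet> b)" for b using Ck_mult[OF f1 X1] by simp
    show "f x *\<^sub>R X x = 0" if "x \<notin> K" for x using K(3)[OF that] p by (simp add: f_def)
  qed
  have cf: "continuous_on hyp_space f" by (rule continuous_on_subset[OF Ck_continuous[OF f1]]) simp
  have cdiv: "continuous_on hyp_space (hyp_div X)"
    by (subst continuous_on_cong[OF refl divX]) (auto intro!: continuous_intros continuous_on_dfac)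
  define g where "g x = egrad f x \<bullet> X x" for x
  have cg: "continuous_on hyp_space g"
    unfolding g_def X_def
    by (intro continuous_intros continuous_on_dfac continuous_on_subset[OF continuous_egrad[OF f1]]) simp
  have i1: "integrable hyp_measure (\<lambda>x. f x * hyp_div X x)"
    by (rule hyp_integrable_continuous[OF continuous_on_mult[OF cf cdiv] K(1,2)]) (use K(3) p in \<open>simp add: f_def\<close>)
  have ef: "egrad f x = dabs_powr p (\<phi> x) *\<^sub>R egrad \<phi> x" for x
    unfolding f_def by (rule abs_powr_C1(2)[OF p ck])
  have i2: "integrable hyp_measure g"
    by (rule hyp_integrable_continuous[OF cg K(1,2)]) (use K(4) in \<open>simp add: g_def ef\<close>)
  note S = smooth_W1p[OF \<phi> p1]
  have "0 = (\<integral>x. hyp_div (\<lambda>x. f x *\<^sub>R X x) x \<partial>hyp_measure)"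
    using hyp_divergence_theorem[OF Z] by simp
  also have "\<dots> = (\<integral>x. f x * hyp_div X x + g x \<partial>hyp_measure)"
    unfolding g_def by (intro Bochner_Integration.integral_cong refl hyp_div_mult f1 X1) auto
  also have "\<dots> = (\<integral>x. f x * hyp_div X x \<partial>hyp_measure) + (\<integral>x. g x \<partial>hyp_measure)" using i1 i2 by simp
  finally have eq: "(\<integral>x. f x * hyp_div X x \<partial>hyp_measure) = - (\<integral>x. g x \<partial>hyp_measure)" by simp
  have "Lp_int p \<phi> = (\<integral>x. f x \<partial>hyp_measure)" by (simp add: Lp_int_def f_def)
  also have "\<dots> \<le> (\<integral>x. f x * hyp_div X x \<partial>hyp_measure)"
  proof (rule integral_mono)
    show "integrable hyp_measure f" using S(4) by (simp add: f_def[abs_def])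
    show "f x \<le> f x * hyp_div X x" if "x \<in> space hyp_measure" for x
      using mult_left_mono[OF divX1[of x], of "f x"] that by (simp add: f_def)
  qed (rule i1)
  also have "\<dots> = (\<integral>x. - g x \<partial>hyp_measure)" using eq by simp
  \<comment> \<open>Young's parameter 1/(2p) leaves exactly half of the L^p term, which is absorbed
    on the left; doubling the remaining constant gives (2p)^p.\<close>
  also have "\<dots> \<le> (\<integral>x. (1/2) * \<bar>\<phi> x\<bar> powr p + (p * (1 / (2 * p)) powr (1 - p)) * (hyp_dfac x * norm (egrad \<phi> x)) powr p \<partial>hyp_measure)"
  proof (rule integral_mono)
    fix x :: 'a assume "x \<in> space hyp_measure"
    then have x: "x \<in> hyp_space" by simp
    let ?b = "hyp_dfac x * norm (egrad \<phi> x)"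
    have "- g x \<le> \<bar>g x\<bar>" by simp
    also have "\<bar>g x\<bar> = (p * \<bar>\<phi> x\<bar> powr (p - 1)) * (hyp_dfac x * \<bar>egrad \<phi> x \<bullet> x\<bar>)"
      using hyp_dfac_pos[OF x] p by (simp add: g_def ef X_def abs_mult abs_dabs_powr mult_ac)
    also have "\<dots> \<le> (p * \<bar>\<phi> x\<bar> powr (p - 1)) * ?b"
    proof (intro mult_left_mono)
      have "\<bar>egrad \<phi> x \<bullet> x\<bar> \<le> norm (egrad \<phi> x) * norm x" by (rule Cauchy_Schwarz_ineq2)
      also have "\<dots> \<le> norm (egrad \<phi> x) * 1" using x by (intro mult_left_mono) auto
      finally show "\<bar>egrad \<phi> x \<bullet> x\<bar> \<le> norm (egrad \<phi> x)" by simp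
    qed (use hyp_dfac_pos[OF x] p in auto)
    also have "\<dots> = p * (\<bar>\<phi> x\<bar> powr (p - 1) * ?b)" by simp
    also have "\<dots> \<le> p * ((1 / (2 * p)) * \<bar>\<phi> x\<bar> powr p + (1 / (2 * p)) powr (1 - p) * ?b powr p)"
      using p hyp_dfac_pos[OF x] by (intro mult_left_mono powr_young) auto
    also have "\<dots> = (1/2) * \<bar>\<phi> x\<bar> powr p + (p * (1 / (2 * p)) powr (1 - p)) * ?b powr p"
      using p by (simp add: algebra_simps)
    finally show "- g x \<le> (1/2) * \<bar>\<phi> x\<bar> powr p + (p * (1 / (2 * p)) powr (1 - p)) * ?b powr p" .
  qed (use i2 S in auto)
  also have "\<dots> = (1/2) * Lp_int p \<phi> + (p * (1 / (2 * p)) powr (1 - p)) * grad_energy p \<phi>"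
    using S by (simp add: Lp_int_def)
  finally have "Lp_int p \<phi> \<le> 2 * (p * (1 / (2 * p)) powr (1 - p)) * grad_energy p \<phi>" by simp
  also have "2 * (p * (1 / (2 * p)) powr (1 - p)) = (2 * p) powr p"
  proof -
    have "(1 / (2 * p)) powr (1 - p) = (2 * p) powr (p - 1)"
      using p by (simp add: powr_divide powr_minus_divide[symmetric])
    then show ?thesis using p by (simp add: powr_diff)
  qed
  finally show ?thesis .
qed

section \<open>Averages over small hyperbolic balls\<close>

lemma hyp_dfac_pos_iff: "0 < hyp_dfac x \<longleftrightarrow> x \<in> hyp_space"
proof
  assume "0 < hyp_dfac x"
  then have "(norm x)\<^sup>2 < 1" by (simp add: hyp_dfac_def)
  then have "norm x < 1" using abs_square_less_1[of "norm x"] by simp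
  then show "x \<in> hyp_space" by simp
qed (rule hyp_dfac_pos)

text \<open>A Euclidean step of length at most \<open>hyp_dfac x / 4\<close> is bounded in the
  hyperbolic metric, so the conformal factor changes by at most 2. This makes
  \<open>\<delta> * hyp_dfac x\<close> the Euclidean radius of what is in effect a hyperbolic ball
  of radius \<delta>.\<close>

lemma hyp_dfac_add:
  fixes x z :: "'a::euclidean_space"
  assumes x: "x \<in> hyp_space" and z: "norm z \<le> hyp_dfac x / 4"
  shows "hyp_dfac x / 2 \<le> hyp_dfac (x + z)" "hyp_dfac (x + z) \<le> 2 * hyp_dfac x"
proof -
  have d: "0 < hyp_dfac x" "hyp_dfac x \<le> 1" using hyp_dfac_pos[OF x] hyp_dfac_le_1 by auto
  have eq: "hyp_dfac (x + z) = hyp_dfac x - (x \<bullet> z + (norm z * norm z) / 2)"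
    by (simp add: hyp_dfac_def power2_norm_eq_inner inner_add_left inner_add_right inner_commute[of z x]
        norm_eq_sqrt_inner[of z] field_simps)
  have "\<bar>x \<bullet> z\<bar> \<le> norm x * norm z" by (rule Cauchy_Schwarz_ineq2)
  also have "\<dots> \<le> 1 * norm z" using x by (intro mult_right_mono) auto
  finally have 1: "\<bar>x \<bullet> z\<bar> \<le> hyp_dfac x / 4" using z by simp
  have "norm z * norm z \<le> (hyp_dfac x / 4) * 1" using z d by (intro mult_mono) auto
  then have 2: "norm z * norm z \<le> hyp_dfac x / 4" by simp
  have 3: "0 \<le> norm z * norm z" by simp
  show "hyp_dfac x / 2 \<le> hyp_dfac (x + z)" "hyp_dfac (x + z) \<le> 2 * hyp_dfac x"
    unfolding eq using 1 2 3 d by linarith+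
qed

lemma nn_integral_hyp:
  fixes f :: "'a::euclidean_space \<Rightarrow> real"
  assumes "integrable hyp_measure f" "\<And>x. 0 \<le> f x"
  shows "(\<integral>\<^sup>+x. ennreal (indicat_real hyp_space x * (hyp_factor x ^ DIM('a) * f x)) \<partial>lborel) = ennreal (\<integral>x. f x \<partial>hyp_measure)"
proof -
  have m: "f \<in> borel_measurable hyp_measure" using assms(1) by (rule borel_measurable_integrable)
  have i: "integrable lebesgue (\<lambda>x. indicat_real hyp_space x *\<^sub>R (hyp_factor x ^ DIM('a) *\<^sub>R f x))"
    using integrable_hyp_iff[OF m] assms(1) by blast
  have nn: "0 \<le> indicat_real hyp_space x *\<^sub>R (hyp_factor x ^ DIM('a) *\<^sub>R f x)" for x
    using hyp_factor_pos[of x] assms(2)[of x] by (cases "x \<in> hyp_space") auto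
  have "ennreal (\<integral>x. f x \<partial>hyp_measure) = (\<integral>\<^sup>+x. ennreal (indicat_real hyp_space x *\<^sub>R (hyp_factor x ^ DIM('a) *\<^sub>R f x)) \<partial>lebesgue)"
    unfolding integral_hyp[OF m] by (rule nn_integral_eq_integral[symmetric, OF i AE_I2[OF nn]])
  then show ?thesis by (simp add: nn_integral_completion)
qed

text \<open>The fundamental theorem of calculus along the segment, then Jensen on the unit interval
  to move the p-th power inside.\<close>

lemma increment_powr_le:
  fixes \<phi> :: "'a::euclidean_space \<Rightarrow> real"
  assumes \<phi>: "Ck 1 \<phi>" and p: "1 \<le> p"
  shows "ennreal (\<bar>\<phi> (x + z) - \<phi> x\<bar> powr p)
     \<le> (\<integral>\<^sup>+\<tau>. ennreal (indicat_real {0..1} \<tau> * (norm z * norm (egrad \<phi> (x + \<tau> *\<^sub>R z))) powr p) \<partial>lborel)"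
proof -
  define f where "f \<tau> = egrad \<phi> (x + \<tau> *\<^sub>R z) \<bullet> z" for \<tau>
  have cf: "continuous_on UNIV f"
    unfolding f_def by (intro continuous_intros continuous_on_compose2[OF continuous_egrad[OF \<phi>]]) auto
  have D: "((\<lambda>\<tau>. \<phi> (x + \<tau> *\<^sub>R z)) has_real_derivative f \<tau>) (at \<tau>)" for \<tau>
  proof -
    have d: "\<phi> differentiable (at (x + \<tau> *\<^sub>R z))" using \<phi> by simp
    have 1: "((\<lambda>\<tau>. x + \<tau> *\<^sub>R z) has_derivative (\<lambda>h. h *\<^sub>R z)) (at \<tau>)" by (auto intro!: derivative_eq_intros)
    have 2: "(\<phi> has_derivative frechet_derivative \<phi> (at (x + \<tau> *\<^sub>R z))) (at (x + \<tau> *\<^sub>R z))"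
      using d by (simp add: frechet_derivative_works)
    have "((\<lambda>\<tau>. \<phi> (x + \<tau> *\<^sub>R z)) has_derivative (\<lambda>h. frechet_derivative \<phi> (at (x + \<tau> *\<^sub>R z)) (h *\<^sub>R z))) (at \<tau>)"
      using has_derivative_compose[OF 1 2] .
    moreover have "(\<lambda>h. frechet_derivative \<phi> (at (x + \<tau> *\<^sub>R z)) (h *\<^sub>R z)) = (*) (f \<tau>)"
    proof
      fix h :: real
      have "frechet_derivative \<phi> (at (x + \<tau> *\<^sub>R z)) (h *\<^sub>R z) = (\<Sum>b\<in>Basis. ((h *\<^sub>R z) \<bullet> b) * pd \<phi> b (x + \<tau> *\<^sub>R z))"
        by (rule frechet_derivative_expand[OF d])
      also have "\<dots> = f \<tau> * h" by (simp add: f_def egrad_inner sum_distrib_left mult_ac)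
      finally show "frechet_derivative \<phi> (at (x + \<tau> *\<^sub>R z)) (h *\<^sub>R z) = f \<tau> * h" .
    qed
    ultimately show ?thesis by (simp add: has_field_derivative_def)
  qed
  have I: "(\<integral>\<tau>. f \<tau> * indicat_real {0..1} \<tau> \<partial>lborel) = \<phi> (x + 1 *\<^sub>R z) - \<phi> (x + 0 *\<^sub>R z)"
    by (rule integral_FTC_Icc_real) (use D cf in \<open>auto simp: continuous_on_eq_continuous_at\<close>)
  have int: "integrable lborel (\<lambda>\<tau>. indicat_real {0..1} \<tau> * f \<tau>)"
    using borel_integrable_compact[of "{0..1}" f] cf by (auto intro: continuous_on_subset)
  have "ennreal (\<bar>\<integral>\<tau>. indicat_real {0..1} \<tau> * f \<tau> \<partial>lborel\<bar> powr p) \<le> (\<integral>\<^sup>+\<tau>. ennreal (indicat_real {0..1} \<tau> * \<bar>f \<tau>\<bar> powr p) \<partial>lborel)"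
    by (rule integral_jensen_powr[OF p _ _ _ _ int])
       (use cf in \<open>auto intro: borel_measurable_continuous_onI\<close>)
  also have "\<dots> \<le> (\<integral>\<^sup>+\<tau>. ennreal (indicat_real {0..1} \<tau> * (norm z * norm (egrad \<phi> (x + \<tau> *\<^sub>R z))) powr p) \<partial>lborel)"
  proof (intro nn_integral_mono ennreal_leI mult_left_mono powr_mono2)
    fix \<tau> :: real
    show "\<bar>f \<tau>\<bar> \<le> norm z * norm (egrad \<phi> (x + \<tau> *\<^sub>R z))"
      unfolding f_def using Cauchy_Schwarz_ineq2[of "egrad \<phi> (x + \<tau> *\<^sub>R z)" z] by (simp add: mult.commute)
  qed (use p in auto)
  finally show ?thesis using I by (simp add: mult.commute)
qed

text \<open>A point where \<open>|\<phi>|\<^sup>p\<close> is large compared with its mean value over the ball of hyperbolic radius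
  about \<open>\<delta>\<close> is controlled by the oscillation of \<open>\<phi>\<close> on that ball, which costs only
  \<open>\<delta>\<^sup>p\<close> times the energy.\<close>

lemma tail_pointwise:
  fixes \<phi> :: "'a::euclidean_space \<Rightarrow> real" and L :: real
  assumes m: "\<phi> \<in> borel_measurable borel" and p: "1 \<le> p" and \<delta>: "0 < \<delta>" "\<delta> \<le> 1/4" and x: "x \<in> hyp_space" and L: "0 \<le> L"
    and Lp: "(\<integral>\<^sup>+x. ennreal (indicat_real hyp_space x * (hyp_factor x ^ DIM('a) * \<bar>\<phi> x\<bar> powr p)) \<partial>lborel) = ennreal L"
    and \<Lambda>: "2 * 2 powr p * 2 ^ DIM('a) * L \<le> \<bar>\<phi> x\<bar> powr p * (unit_ball_vol (DIM('a)) * \<delta> ^ DIM('a))"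
  shows "ennreal (hyp_factor x ^ DIM('a) * \<bar>\<phi> x\<bar> powr p) \<le>
     ennreal (2 * 2 powr p / (unit_ball_vol (DIM('a)) * \<delta> ^ DIM('a)) * hyp_factor x ^ (2 * DIM('a)))
     * (\<integral>\<^sup>+z. ennreal (indicat_real (ball 0 (\<delta> * hyp_dfac x)) z * \<bar>\<phi> (x + z) - \<phi> x\<bar> powr p) \<partial>lborel)"
proof -
  let ?n = "DIM('a)"
  define c where "c = unit_ball_vol (real ?n)"
  have c: "0 < c" by (simp add: c_def)
  have d: "0 < hyp_dfac x" by (rule hyp_dfac_pos[OF x])
  define s where "s = \<delta> * hyp_dfac x"
  have s: "0 < s" "s \<le> hyp_dfac x / 4" using \<delta> d mult_right_mono[OF \<delta>(2), of "hyp_dfac x"] by (auto simp: s_def)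
  define I where "I = (\<integral>\<^sup>+z. ennreal (indicat_real (ball 0 s) z * \<bar>\<phi> (x + z) - \<phi> x\<bar> powr p) \<partial>lborel)"
  have mx: "(\<lambda>z. \<phi> (x + z)) \<in> borel_measurable borel" by (rule measurable_compose[OF _ m]) simp
  have mI: "(\<lambda>z::'a. indicat_real (ball 0 s) z) \<in> borel_measurable borel"
    by (intro borel_measurable_indicator) simp
  \<comment> \<open>The constant |\<phi>(x)|^p is integrated over the ball and split into the
    oscillation and the values |\<phi>(x+z)|^p, the latter bounded by the whole L^p
    integral.\<close>
  have "ennreal (\<bar>\<phi> x\<bar> powr p * (c * s ^ ?n)) = (\<integral>\<^sup>+z. ennreal (\<bar>\<phi> x\<bar> powr p) * indicator (ball (0::'a) s) z \<partial>lborel)"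
    using s c by (subst nn_integral_cmult_indicator) (auto simp: emeasure_ball c_def ennreal_mult)
  also have "\<dots> \<le> (\<integral>\<^sup>+z. ennreal (2 powr p) * ennreal (indicat_real (ball 0 s) z * \<bar>\<phi> (x + z) - \<phi> x\<bar> powr p)
      + ennreal (2 powr p * (2 * hyp_dfac x) ^ ?n) * ennreal (indicat_real hyp_space (z + x) * (hyp_factor (z + x) ^ ?n * \<bar>\<phi> (z + x)\<bar> powr p)) \<partial>lborel)"
  proof (rule nn_integral_mono)
    fix z :: 'a
    show "ennreal (\<bar>\<phi> x\<bar> powr p) * indicator (ball 0 s) z \<le> ennreal (2 powr p) * ennreal (indicat_real (ball 0 s) z * \<bar>\<phi> (x + z) - \<phi> x\<bar> powr p)
      + ennreal (2 powr p * (2 * hyp_dfac x) ^ ?n) * ennreal (indicat_real hyp_space (z + x) * (hyp_factor (z + x) ^ ?n * \<bar>\<phi> (z + x)\<bar> powr p))"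
    proof (cases "z \<in> ball 0 s")
      case True
      then have z: "norm z \<le> hyp_dfac x / 4" using s by simp
      note D = hyp_dfac_add[OF x z]
      have x': "z + x \<in> hyp_space" "0 < hyp_dfac (z + x)" using D(1) d hyp_dfac_pos_iff[of "x + z"] by (auto simp: add.commute)
      \<comment> \<open>Bounded distortion inserts the Riemannian density at \<open>z + x\<close>
        into a Lebesgue integral, at the price of the factor (2
        \<open>hyp_dfac x\<close>)^n.\<close>
      have "1 \<le> 2 * hyp_dfac x * hyp_factor (z + x)"
        using D(2) x'(2) by (simp add: hyp_factor_eq add.commute)
      then have "1 \<le> (2 * hyp_dfac x * hyp_factor (z + x)) ^ ?n" by (rule one_le_power)
      then have one: "1 \<le> (2 * hyp_dfac x) ^ ?n * hyp_factor (z + x) ^ ?n" by (simp add: power_mult_distrib)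
      have "\<bar>\<phi> x\<bar> powr p \<le> (\<bar>\<phi> (x + z) - \<phi> x\<bar> + \<bar>\<phi> (x + z)\<bar>) powr p" using p by (intro powr_mono2) auto
      also have "\<dots> \<le> 2 powr p * (\<bar>\<phi> (x + z) - \<phi> x\<bar> powr p + \<bar>\<phi> (x + z)\<bar> powr p)" using p by (intro powr_add_le) auto
      also have "\<dots> = 2 powr p * \<bar>\<phi> (x + z) - \<phi> x\<bar> powr p + 2 powr p * \<bar>\<phi> (z + x)\<bar> powr p * 1"
        by (simp add: algebra_simps)
      also have "\<dots> \<le> 2 powr p * \<bar>\<phi> (x + z) - \<phi> x\<bar> powr p + 2 powr p * \<bar>\<phi> (z + x)\<bar> powr p * ((2 * hyp_dfac x) ^ ?n * hyp_factor (z + x) ^ ?n)"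
        by (intro add_left_mono mult_left_mono one) auto
      finally have "ennreal (\<bar>\<phi> x\<bar> powr p) \<le> ennreal (2 powr p * \<bar>\<phi> (x + z) - \<phi> x\<bar> powr p
          + (2 powr p * (2 * hyp_dfac x) ^ ?n) * (hyp_factor (z + x) ^ ?n * \<bar>\<phi> (z + x)\<bar> powr p))"
        by (intro ennreal_leI) (simp add: mult_ac)
      then show ?thesis using True x' d hyp_factor_pos[OF x'(1)] by (simp add: ennreal_mult ennreal_plus)
    qed simp
  qed
  also have "\<dots> = ennreal (2 powr p) * I + ennreal (2 powr p * (2 * hyp_dfac x) ^ ?n) * ennreal L"
  proof -
    let ?f = "\<lambda>x. ennreal (indicat_real hyp_space x * (hyp_factor x ^ ?n * \<bar>\<phi> x\<bar> powr p))"
    have mf: "?f \<in> borel_measurable borel"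
    proof -
      have "hyp_dfac \<in> borel_measurable (borel :: 'a measure)" by (rule borel_measurable_continuous_onI[OF continuous_on_dfac])
      then have "(hyp_factor :: 'a \<Rightarrow> real) \<in> borel_measurable borel" unfolding hyp_factor_eq[abs_def] by simp
      moreover have "(\<lambda>x::'a. indicat_real hyp_space x) \<in> borel_measurable borel" by (intro borel_measurable_indicator) simp
      ultimately show ?thesis using m by simp
    qed
    have mf': "(\<lambda>z. ?f (z + x)) \<in> borel_measurable borel" by (rule measurable_compose[OF _ mf]) simp
    have mg: "(\<lambda>z. ennreal (indicat_real (ball 0 s) z * \<bar>\<phi> (x + z) - \<phi> x\<bar> powr p)) \<in> borel_measurable borel"
      using mx mI by simp
    have "(\<integral>\<^sup>+z. ?f (z + x) \<partial>lborel) = ennreal L" using nn_integral_lborel_translate[OF mf, of x] Lp by simp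
    then show ?thesis unfolding I_def
      using mf' mg by (subst nn_integral_add) (auto simp: nn_integral_cmult)
  qed
  finally have main: "ennreal (\<bar>\<phi> x\<bar> powr p * (c * s ^ ?n)) \<le> ennreal (2 powr p) * I + ennreal (2 powr p * (2 * hyp_dfac x) ^ ?n) * ennreal L" .
  define C where "C = 2 * 2 powr p / (c * \<delta> ^ ?n) * hyp_factor x ^ (2 * ?n)"
  have C: "0 < C" using c \<delta> hyp_factor_pos[OF x] by (simp add: C_def)
  have "ennreal (hyp_factor x ^ ?n * \<bar>\<phi> x\<bar> powr p) \<le> ennreal C * I"
  proof (cases "I = top")
    case True
    then show ?thesis using C by (simp add: ennreal_mult_top)
  next
    case False
    then obtain i where i: "0 \<le> i" "I = ennreal i" by (cases I) auto
    have "ennreal (\<bar>\<phi> x\<bar> powr p * (c * s ^ ?n)) \<le> ennreal (2 powr p * i + 2 powr p * (2 * hyp_dfac x) ^ ?n * L)"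
      using main i L d by (simp add: ennreal_mult ennreal_plus)
    then have le: "\<bar>\<phi> x\<bar> powr p * (c * s ^ ?n) \<le> 2 powr p * i + 2 powr p * (2 * hyp_dfac x) ^ ?n * L"
      using i L d by (subst (asm) ennreal_le_iff) auto
    \<comment> \<open>The largeness hypothesis says precisely that the second contribution is at
      most half of the left side, so it can be absorbed and only the oscillation remains.\<close>
    have "2 * (2 powr p * (2 * hyp_dfac x) ^ ?n * L) = hyp_dfac x ^ ?n * (2 * 2 powr p * 2 ^ ?n * L)"
      by (simp add: power_mult_distrib mult_ac)
    also have "\<dots> \<le> hyp_dfac x ^ ?n * (\<bar>\<phi> x\<bar> powr p * (c * \<delta> ^ ?n))"
      using \<Lambda> d by (intro mult_left_mono) (auto simp: c_def)
    also have "\<dots> = \<bar>\<phi> x\<bar> powr p * (c * s ^ ?n)" by (simp add: s_def power_mult_distrib mult_ac)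
    finally have "\<bar>\<phi> x\<bar> powr p * (c * s ^ ?n) \<le> 2 * 2 powr p * i" using le by linarith
    then have "\<bar>\<phi> x\<bar> powr p * (hyp_dfac x ^ ?n * (c * \<delta> ^ ?n)) \<le> 2 * 2 powr p * i"
      by (simp add: s_def power_mult_distrib mult_ac)
    then have "\<bar>\<phi> x\<bar> powr p \<le> 2 * 2 powr p * i / (hyp_dfac x ^ ?n * (c * \<delta> ^ ?n))"
      using c \<delta> d by (simp add: pos_le_divide_eq)
    then have "hyp_factor x ^ ?n * \<bar>\<phi> x\<bar> powr p \<le> hyp_factor x ^ ?n * (2 * 2 powr p * i / (hyp_dfac x ^ ?n * (c * \<delta> ^ ?n)))"
      using hyp_factor_pos[OF x] by (intro mult_left_mono) auto
    also have "\<dots> = C * i"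
    proof -
      have "hyp_factor x ^ (2 * ?n) = hyp_factor x ^ ?n * hyp_factor x ^ ?n" by (simp only: mult_2 power_add)
      moreover have "hyp_factor x ^ ?n = 1 / hyp_dfac x ^ ?n" by (simp add: hyp_factor_eq power_one_over)
      ultimately show ?thesis by (simp add: C_def)
    qed
    finally show ?thesis using i C by (simp add: ennreal_mult[symmetric])
  qed
  then show ?thesis by (simp add: I_def C_def s_def c_def)
qed

text \<open>The increment is replaced by the gradient at x + \<tau> z, all weights are moved to that
  point, and Tonelli allows integrating in x first, where the shift by \<tau> z disappears. What is
  left is the energy times the volume of a small ball and \<delta>^p.\<close>

lemma tail_double_integral:
  fixes \<phi> :: "'a::euclidean_space \<Rightarrow> real"
  assumes \<phi>: "\<phi> \<in> Cc_smooth hyp_space" and p: "1 \<le> p" and \<delta>: "0 < \<delta>" "\<delta> \<le> 1/4"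
  shows "(\<integral>\<^sup>+x. ennreal (indicat_real hyp_space x * hyp_factor x ^ (2 * DIM('a))) *
      (\<integral>\<^sup>+z. ennreal (indicat_real (ball 0 (\<delta> * hyp_dfac x)) z * \<bar>\<phi> (x + z) - \<phi> x\<bar> powr p) \<partial>lborel) \<partial>lborel)
    \<le> ennreal (8 ^ DIM('a) * 2 powr p * unit_ball_vol (DIM('a)) * \<delta> ^ DIM('a) * \<delta> powr p * grad_energy p \<phi>)"
proof -
  let ?n = "DIM('a)"
  define c where "c = unit_ball_vol (real ?n)"
  have c: "0 < c" by (simp add: c_def)
  note ck = Cc_smooth_Ck[OF \<phi>]
  define G where "G x = norm (egrad \<phi> x)" for x
  have cG: "continuous_on UNIV G" unfolding G_def by (intro continuous_on_norm continuous_egrad[OF ck])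
  have mG: "G \<in> borel_measurable borel" by (rule borel_measurable_continuous_onI[OF cG])
  have m\<phi>: "\<phi> \<in> borel_measurable borel" by (rule borel_measurable_continuous_onI[OF Ck_continuous[OF ck]])
  have md: "(hyp_dfac :: 'a \<Rightarrow> real) \<in> borel_measurable borel" by (rule borel_measurable_continuous_onI[OF continuous_on_dfac])
  then have mf: "(hyp_factor :: 'a \<Rightarrow> real) \<in> borel_measurable borel" unfolding hyp_factor_eq[abs_def] by simp
  \<comment> \<open>An upper bound for the weighted gradient term, expressed at the intermediate
    point; every 2 pays for replacing \<open>x\<close> by x + \<tau> z.\<close>
  define g where "g x = (2 * hyp_factor x) ^ (2 * ?n) * (2 * \<delta> * hyp_dfac x * G x) powr p" for x
  have mg: "g \<in> borel_measurable borel" unfolding g_def using mf md mG by simp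
  have g0: "0 \<le> g x" for x by (simp add: g_def)
  \<comment> \<open>The radius is doubled so that the condition, now stated at the intermediate
    point, still admits every pair that occurs. Openness gives measurability.\<close>
  define \<Omega> where "\<Omega> = {xz. norm (snd xz) < 2 * \<delta> * hyp_dfac (fst xz :: 'a)} \<inter> {xz :: 'a \<times> 'a. True}"
  have "open \<Omega>"
    unfolding \<Omega>_def by (intro open_Int open_Collect_less continuous_intros continuous_on_compose2[OF continuous_on_dfac[of UNIV]]) auto
  then have m\<Omega>: "\<Omega> \<in> sets borel" by simp
  define F where "F xz = ennreal (indicat_real \<Omega> xz * g (fst xz))" for xz
  have mF: "F \<in> borel_measurable borel"
  proof -
    have "(\<lambda>xz::'a\<times>'a. g (fst xz)) \<in> borel_measurable borel"
      by (rule measurable_compose[OF _ mg]) (simp add: borel_measurable_continuous_onI continuous_on_fst continuous_on_id)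
    moreover have "(\<lambda>xz. indicat_real \<Omega> xz) \<in> borel_measurable borel" by (intro borel_measurable_indicator m\<Omega>)
    ultimately show ?thesis unfolding F_def by simp
  qed
  have key: "ennreal (indicat_real hyp_space x * hyp_factor x ^ (2 * ?n)) *
       ennreal (indicat_real (ball 0 (\<delta> * hyp_dfac x)) z * \<bar>\<phi> (x + z) - \<phi> x\<bar> powr p)
     \<le> (\<integral>\<^sup>+\<tau>. indicator {0..1} \<tau> * F (x + \<tau> *\<^sub>R z, z) \<partial>lborel)" for x z
  proof (cases "x \<in> hyp_space \<and> z \<in> ball 0 (\<delta> * hyp_dfac x)")
    case True
    then have x: "x \<in> hyp_space" and z: "norm z < \<delta> * hyp_dfac x" by auto
    have d: "0 < hyp_dfac x" by (rule hyp_dfac_pos[OF x])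
    have f: "0 < hyp_factor x" by (rule hyp_factor_pos[OF x])
    have "\<delta> * hyp_dfac x \<le> 1/4 * hyp_dfac x" using \<delta>(2) d by (intro mult_right_mono) auto
    then have z4: "norm z \<le> hyp_dfac x / 4" using z by linarith
    have "ennreal (hyp_factor x ^ (2 * ?n)) * ennreal (\<bar>\<phi> (x + z) - \<phi> x\<bar> powr p)
       \<le> ennreal (hyp_factor x ^ (2 * ?n)) * (\<integral>\<^sup>+\<tau>. ennreal (indicat_real {0..1} \<tau> * (norm z * norm (egrad \<phi> (x + \<tau> *\<^sub>R z))) powr p) \<partial>lborel)"
      by (intro mult_left_mono increment_powr_le ck p) auto
    also have "\<dots> = (\<integral>\<^sup>+\<tau>. ennreal (hyp_factor x ^ (2 * ?n)) * ennreal (indicat_real {0..1} \<tau> * (norm z * norm (egrad \<phi> (x + \<tau> *\<^sub>R z))) powr p) \<partial>lborel)"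
    proof (rule nn_integral_cmult[symmetric])
      have "continuous_on UNIV (\<lambda>\<tau>. G (x + \<tau> *\<^sub>R z))"
        by (intro continuous_on_compose2[OF cG] continuous_intros) auto
      then have "(\<lambda>\<tau>. norm (egrad \<phi> (x + \<tau> *\<^sub>R z))) \<in> borel_measurable borel"
        unfolding G_def by (rule borel_measurable_continuous_onI)
      then show "(\<lambda>\<tau>. ennreal (indicat_real {0..1} \<tau> * (norm z * norm (egrad \<phi> (x + \<tau> *\<^sub>R z))) powr p)) \<in> borel_measurable lborel"
        by simp
    qed
    also have "\<dots> \<le> (\<integral>\<^sup>+\<tau>. indicator {0..1} \<tau> * F (x + \<tau> *\<^sub>R z, z) \<partial>lborel)"
    proof (rule nn_integral_mono)
      fix \<tau> :: real
      show "ennreal (hyp_factor x ^ (2 * ?n)) * ennreal (indicat_real {0..1} \<tau> * (norm z * norm (egrad \<phi> (x + \<tau> *\<^sub>R z))) powr p)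
        \<le> indicator {0..1} \<tau> * F (x + \<tau> *\<^sub>R z, z)"
      proof (cases "\<tau> \<in> {0..1}")
        case True
        define x' where "x' = x + \<tau> *\<^sub>R z"
        have "norm (\<tau> *\<^sub>R z) \<le> 1 * norm z" using True by (simp add: mult_left_le_one_le)
        then have "norm (\<tau> *\<^sub>R z) \<le> hyp_dfac x / 4" using z4 by linarith
        note D = hyp_dfac_add[OF x this, folded x'_def]
        have d': "0 < hyp_dfac x'" using D(1) d by linarith
        have "\<delta> * hyp_dfac x \<le> \<delta> * (2 * hyp_dfac x')" using D(1) \<delta>(1) by (intro mult_left_mono) auto
        then have z': "norm z < 2 * \<delta> * hyp_dfac x'" using z by simp
        then have om: "(x', z) \<in> \<Omega>" by (simp add: \<Omega>_def)
        have "hyp_factor x \<le> 2 * hyp_factor x'"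
          using D(2) d d' by (simp add: hyp_factor_eq field_simps)
        then have 1: "hyp_factor x ^ (2 * ?n) \<le> (2 * hyp_factor x') ^ (2 * ?n)" using f by (intro power_mono) auto
        have "norm z * G x' \<le> 2 * \<delta> * hyp_dfac x' * G x'" using z' by (intro mult_right_mono) (auto simp: G_def)
        then have 2: "(norm z * G x') powr p \<le> (2 * \<delta> * hyp_dfac x' * G x') powr p"
          using p by (intro powr_mono2) (auto simp: G_def)
        have "hyp_factor x ^ (2 * ?n) * (norm z * G x') powr p \<le> g x'"
          unfolding g_def by (rule mult_mono[OF 1 2]) auto
        then have "ennreal (hyp_factor x ^ (2 * ?n) * (norm z * G x') powr p) \<le> ennreal (g x')" by (rule ennreal_leI)
        then show ?thesis using True om f by (simp add: F_def x'_def[symmetric] G_def ennreal_mult)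
      qed simp
    qed
    finally show ?thesis using True by simp
  next
    case False
    then have "indicat_real hyp_space x = 0 \<or> indicat_real (ball 0 (\<delta> * hyp_dfac x)) z = 0"
      by (auto simp only: indicator_eq_0_iff)
    then show ?thesis by auto
  qed
  have mI: "(\<lambda>\<tau>. indicator {0..1} \<tau> :: ennreal) \<in> borel_measurable (borel :: real measure)" by simp
  have mT: "(\<lambda>(y, \<tau>). indicator {0..1} \<tau> * F (fst y + \<tau> *\<^sub>R snd y, snd y)) \<in> borel_measurable ((lborel \<Otimes>\<^sub>M lborel) \<Otimes>\<^sub>M (lborel :: real measure))"
  proof -
    have "(\<lambda>w::('a \<times> 'a) \<times> real. F (fst (fst w) + snd w *\<^sub>R snd (fst w), snd (fst w))) \<in> borel_measurable borel"
      by (rule measurable_compose[OF _ mF], rule borel_measurable_continuous_onI) (intro continuous_intros)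
    moreover have "(\<lambda>w::('a \<times> 'a) \<times> real. indicator {0..1} (snd w) :: ennreal) \<in> borel_measurable borel"
      by (rule measurable_compose[OF _ mI], rule borel_measurable_continuous_onI) (intro continuous_intros)
    ultimately have "(\<lambda>w::('a \<times> 'a) \<times> real. indicator {0..1} (snd w) * F (fst (fst w) + snd w *\<^sub>R snd (fst w), snd (fst w))) \<in> borel_measurable borel"
      by (rule borel_measurable_times_ennreal[rotated])
    then show ?thesis
      by (simp add: case_prod_beta' lborel_prod)
  qed
  have mS: "(\<lambda>y. \<integral>\<^sup>+\<tau>. indicator {0..1} \<tau> * F (fst y + \<tau> *\<^sub>R snd y, snd y) \<partial>lborel) \<in> borel_measurable (lborel \<Otimes>\<^sub>M lborel)"
    by (rule lborel.borel_measurable_nn_integral[OF mT])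
  have mS': "(\<lambda>y::'a\<times>'a. \<integral>\<^sup>+\<tau>. indicator {0..1} \<tau> * F (snd y + \<tau> *\<^sub>R fst y, fst y) \<partial>lborel) \<in> borel_measurable (lborel \<Otimes>\<^sub>M lborel)"
    using measurable_compose[OF measurable_pair_swap'[of lborel lborel] mS] by (simp add: case_prod_beta comp_def)
  have "(\<integral>\<^sup>+x. ennreal (indicat_real hyp_space x * hyp_factor x ^ (2 * ?n)) *
      (\<integral>\<^sup>+z. ennreal (indicat_real (ball 0 (\<delta> * hyp_dfac x)) z * \<bar>\<phi> (x + z) - \<phi> x\<bar> powr p) \<partial>lborel) \<partial>lborel)
     = (\<integral>\<^sup>+x. \<integral>\<^sup>+z. ennreal (indicat_real hyp_space x * hyp_factor x ^ (2 * ?n)) *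
       ennreal (indicat_real (ball 0 (\<delta> * hyp_dfac x)) z * \<bar>\<phi> (x + z) - \<phi> x\<bar> powr p) \<partial>lborel \<partial>lborel)"
  proof (rule nn_integral_cong, rule nn_integral_cmult[symmetric])
    fix x :: 'a
    have "(\<lambda>z. \<phi> (x + z)) \<in> borel_measurable borel" by (rule measurable_compose[OF _ m\<phi>]) simp
    moreover have "(\<lambda>z::'a. indicat_real (ball 0 (\<delta> * hyp_dfac x)) z) \<in> borel_measurable borel"
      by (intro borel_measurable_indicator) simp
    ultimately show "(\<lambda>z. ennreal (indicat_real (ball 0 (\<delta> * hyp_dfac x)) z * \<bar>\<phi> (x + z) - \<phi> x\<bar> powr p)) \<in> borel_measurable lborel"
      by simp
  qed
  also have "\<dots> \<le> (\<integral>\<^sup>+x. \<integral>\<^sup>+z. \<integral>\<^sup>+\<tau>. indicator {0..1} \<tau> * F (x + \<tau> *\<^sub>R z, z) \<partial>lborel \<partial>lborel \<partial>lborel)"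
    by (intro nn_integral_mono key)
  also have "\<dots> = (\<integral>\<^sup>+z. \<integral>\<^sup>+x. \<integral>\<^sup>+\<tau>. indicator {0..1} \<tau> * F (x + \<tau> *\<^sub>R z, z) \<partial>lborel \<partial>lborel \<partial>lborel)"
    by (rule lborel_pair.Fubini') (use mS' in \<open>simp add: case_prod_beta\<close>)
  also have "\<dots> = (\<integral>\<^sup>+z. \<integral>\<^sup>+\<tau>. \<integral>\<^sup>+x. indicator {0..1} \<tau> * F (x + \<tau> *\<^sub>R z, z) \<partial>lborel \<partial>lborel \<partial>lborel)"
  proof (rule nn_integral_cong, rule lborel_pair.Fubini')
    fix z :: 'a
    have "(\<lambda>w::real \<times> 'a. F (snd w + fst w *\<^sub>R z, z)) \<in> borel_measurable borel"
      by (rule measurable_compose[OF _ mF], rule borel_measurable_continuous_onI) (intro continuous_intros)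
    moreover have "(\<lambda>w::real \<times> 'a. indicator {0..1} (fst w) :: ennreal) \<in> borel_measurable borel"
      by (rule measurable_compose[OF _ mI], rule borel_measurable_continuous_onI) (intro continuous_intros)
    ultimately have "(\<lambda>w::real \<times> 'a. indicator {0..1} (fst w) * F (snd w + fst w *\<^sub>R z, z)) \<in> borel_measurable borel"
      by (rule borel_measurable_times_ennreal[rotated])
    then show "(\<lambda>(\<tau>, x). indicator {0..1} \<tau> * F (x + \<tau> *\<^sub>R z, z)) \<in> borel_measurable (lborel \<Otimes>\<^sub>M lborel)"
      by (simp add: case_prod_beta' lborel_prod)
  qed
  \<comment> \<open>For fixed z and \<tau> translation invariance removes the shift; the integrand
    no longer depends on \<tau>, which ranges over an interval of length 1.\<close>
  also have "\<dots> = (\<integral>\<^sup>+z. \<integral>\<^sup>+x. F (x, z) \<partial>lborel \<partial>lborel)"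
  proof (rule nn_integral_cong)
    fix z :: 'a
    have mz: "(\<lambda>x. F (x, z)) \<in> borel_measurable borel"
      by (rule measurable_compose[OF _ mF], rule borel_measurable_continuous_onI) (intro continuous_intros)
    have "(\<integral>\<^sup>+x. indicator {0..1} \<tau> * F (x + \<tau> *\<^sub>R z, z) \<partial>lborel) = (\<integral>\<^sup>+x. F (x, z) \<partial>lborel) * indicator {0..1} \<tau>" for \<tau> :: real
    proof -
      have "(\<lambda>x. F (x + \<tau> *\<^sub>R z, z)) \<in> borel_measurable lborel"
        using measurable_compose[of "\<lambda>x. x + \<tau> *\<^sub>R z" borel borel "\<lambda>x. F (x, z)", OF _ mz] by simp
      then have "(\<integral>\<^sup>+x. indicator {0..1} \<tau> * F (x + \<tau> *\<^sub>R z, z) \<partial>lborel) = indicator {0..1} \<tau> * (\<integral>\<^sup>+x. F (x + \<tau> *\<^sub>R z, z) \<partial>lborel)"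
        by (rule nn_integral_cmult)
      then show ?thesis using nn_integral_lborel_translate[OF mz, of "\<tau> *\<^sub>R z"] by (simp add: mult.commute)
    qed
    then have "(\<integral>\<^sup>+\<tau>. \<integral>\<^sup>+x. indicator {0..1} \<tau> * F (x + \<tau> *\<^sub>R z, z) \<partial>lborel \<partial>lborel)
       = (\<integral>\<^sup>+\<tau>. (\<integral>\<^sup>+x. F (x, z) \<partial>lborel) * indicator {0..1::real} \<tau> \<partial>lborel)" by (simp only:)
    also have "\<dots> = (\<integral>\<^sup>+x. F (x, z) \<partial>lborel)"
      by (subst nn_integral_cmult_indicator) auto
    finally show "(\<integral>\<^sup>+\<tau>. \<integral>\<^sup>+x. indicator {0..1::real} \<tau> * F (x + \<tau> *\<^sub>R z, z) \<partial>lborel \<partial>lborel) = (\<integral>\<^sup>+x. F (x, z) \<partial>lborel)" .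
  qed
  also have "\<dots> = (\<integral>\<^sup>+x. \<integral>\<^sup>+z. F (x, z) \<partial>lborel \<partial>lborel)"
    by (rule lborel_pair.Fubini') (use mF in \<open>simp add: case_prod_beta' lborel_prod\<close>)
  also have "\<dots> = (\<integral>\<^sup>+x. ennreal (8 ^ ?n * 2 powr p * c * \<delta> ^ ?n * \<delta> powr p) *
      ennreal (indicat_real hyp_space x * (hyp_factor x ^ ?n * (hyp_dfac x * norm (egrad \<phi> x)) powr p)) \<partial>lborel)"
  proof (rule nn_integral_cong)
    fix x :: 'a
    show "(\<integral>\<^sup>+z. F (x, z) \<partial>lborel) = ennreal (8 ^ ?n * 2 powr p * c * \<delta> ^ ?n * \<delta> powr p) *
      ennreal (indicat_real hyp_space x * (hyp_factor x ^ ?n * (hyp_dfac x * norm (egrad \<phi> x)) powr p))"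
    proof (cases "x \<in> hyp_space")
      case True
      have d: "0 < hyp_dfac x" by (rule hyp_dfac_pos[OF True])
      let ?s = "2 * \<delta> * hyp_dfac x"
      have "(\<integral>\<^sup>+z. F (x, z) \<partial>lborel) = (\<integral>\<^sup>+z. ennreal (g x) * indicator (ball (0::'a) ?s) z \<partial>lborel)"
        by (intro nn_integral_cong) (auto simp: F_def \<Omega>_def indicator_def)
      also have "\<dots> = ennreal (g x) * ennreal (c * ?s ^ ?n)"
        using d \<delta> by (subst nn_integral_cmult_indicator) (auto simp: emeasure_ball c_def)
      also have "\<dots> = ennreal (g x * (c * ?s ^ ?n))" by (rule ennreal_mult[symmetric]) (use g0 c d \<delta> in auto)
      also have "g x * (c * ?s ^ ?n) = (8 ^ ?n * 2 powr p * c * \<delta> ^ ?n * \<delta> powr p) * (hyp_factor x ^ ?n * (hyp_dfac x * norm (egrad \<phi> x)) powr p)"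
      proof -
        have "(2 * \<delta> * hyp_dfac x * G x) powr p = 2 powr p * \<delta> powr p * (hyp_dfac x * G x) powr p"
          using d \<delta> by (simp add: powr_mult G_def mult.assoc)
        \<comment> \<open>4^n from moving the density and 2^n from the doubled radius make 8^n. Half
          of the power 2n of \<open>hyp_factor\<close> is used up by the Euclidean ball volume; the
          other half is the Riemannian density.\<close>
        moreover have "(2 * hyp_factor x) ^ (2 * ?n) * ?s ^ ?n = 8 ^ ?n * \<delta> ^ ?n * hyp_factor x ^ ?n"
        proof -
          have "(2 * hyp_factor x) ^ (2 * ?n) * ?s ^ ?n = ((2 * hyp_factor x)\<^sup>2 * ?s) ^ ?n"
            by (simp only: power_mult power_mult_distrib)
          also have "(2 * hyp_factor x)\<^sup>2 * ?s = 8 * \<delta> * hyp_factor x"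
            using hyp_dfac_factor[OF True] by (simp add: power2_eq_square mult_ac)
          finally show ?thesis by (simp add: power_mult_distrib)
        qed
        ultimately show ?thesis unfolding g_def G_def by (simp add: mult_ac)
      qed
      also have "ennreal ((8 ^ ?n * 2 powr p * c * \<delta> ^ ?n * \<delta> powr p) * (hyp_factor x ^ ?n * (hyp_dfac x * norm (egrad \<phi> x)) powr p))
         = ennreal (8 ^ ?n * 2 powr p * c * \<delta> ^ ?n * \<delta> powr p) * ennreal (hyp_factor x ^ ?n * (hyp_dfac x * norm (egrad \<phi> x)) powr p)"
        using c \<delta> hyp_factor_pos[OF True] by (intro ennreal_mult) auto
      finally show ?thesis using True by simp
    next
      case False
      then have "hyp_dfac x \<le> 0" using hyp_dfac_pos_iff[of x] by linarith
      then have "2 * \<delta> * hyp_dfac x \<le> 0" using \<delta> by (simp add: mult_nonneg_nonpos)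
      then have "(x, z) \<notin> \<Omega>" for z using norm_ge_zero[of z] by (auto simp: \<Omega>_def simp del: norm_ge_zero)
      then show ?thesis using False by (simp add: F_def)
    qed
  qed
  also have "\<dots> = ennreal (8 ^ ?n * 2 powr p * c * \<delta> ^ ?n * \<delta> powr p) * ennreal (grad_energy p \<phi>)"
  proof -
    have "(\<lambda>x. ennreal (indicat_real hyp_space x * (hyp_factor x ^ ?n * (hyp_dfac x * norm (egrad \<phi> x)) powr p))) \<in> borel_measurable lborel"
    proof -
      have "(\<lambda>x::'a. indicat_real hyp_space x) \<in> borel_measurable borel" by (intro borel_measurable_indicator) simp
      then show ?thesis using mf md mG unfolding G_def by simp
    qed
    then show ?thesis
      using smooth_W1p(2,3)[OF \<phi> p] by (simp add: nn_integral_cmult nn_integral_hyp)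
  qed
  also have "\<dots> = ennreal (8 ^ ?n * 2 powr p * c * \<delta> ^ ?n * \<delta> powr p * grad_energy p \<phi>)"
    by (rule ennreal_mult[symmetric]) (use c \<delta> grad_energy_nonneg in auto)
  finally show ?thesis by (simp only: c_def)
qed

text \<open>The pointwise bound is integrated over the set of large values. The volume of the
  averaging ball cancels between numerator and denominator, so only \<delta>^p times the energy is
  left.\<close>

proposition tail_smooth:
  fixes \<phi> :: "'a::euclidean_space \<Rightarrow> real"
  assumes \<phi>: "\<phi> \<in> Cc_smooth hyp_space" and p: "1 \<le> p" and \<delta>: "0 < \<delta>" "\<delta> \<le> 1/4"
    and \<Lambda>: "2 * 2 powr p * 2 ^ DIM('a) * Lp_int p \<phi> \<le> \<Lambda> * (unit_ball_vol (DIM('a)) * \<delta> ^ DIM('a))"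
  shows "integrable hyp_measure (\<lambda>x. indicat_real {x. \<Lambda> \<le> \<bar>\<phi> x\<bar> powr p} x * \<bar>\<phi> x\<bar> powr p)"
    "(\<integral>x. indicat_real {x. \<Lambda> \<le> \<bar>\<phi> x\<bar> powr p} x * \<bar>\<phi> x\<bar> powr p \<partial>hyp_measure)
      \<le> 2 * 4 powr p * 8 ^ DIM('a) * \<delta> powr p * grad_energy p \<phi>"
proof -
  let ?n = "DIM('a)"
  define c where "c = unit_ball_vol (real ?n)"
  have c: "0 < c" by (simp add: c_def)
  let ?T = "\<lambda>x. indicat_real {x. \<Lambda> \<le> \<bar>\<phi> x\<bar> powr p} x * \<bar>\<phi> x\<bar> powr p"
  note ck = Cc_smooth_Ck[OF \<phi>]
  note S = smooth_W1p[OF \<phi> p]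
  have m\<phi>: "\<phi> \<in> borel_measurable borel" by (rule borel_measurable_continuous_onI[OF Ck_continuous[OF ck]])
  have c\<phi>: "\<phi> \<in> borel_measurable hyp_measure"
    by (rule continuous_measurable_hyp[OF continuous_on_subset[OF Ck_continuous[OF ck]]]) simp
  have mT: "?T \<in> borel_measurable hyp_measure"
  proof -
    have "(\<lambda>x. if \<Lambda> \<le> \<bar>\<phi> x\<bar> powr p then \<bar>\<phi> x\<bar> powr p else 0) \<in> borel_measurable hyp_measure"
      using c\<phi> by measurable
    moreover have "(\<lambda>x. if \<Lambda> \<le> \<bar>\<phi> x\<bar> powr p then \<bar>\<phi> x\<bar> powr p else 0) = ?T" by (auto simp: fun_eq_iff)
    ultimately show ?thesis by (simp only:)
  qed
  have T0: "0 \<le> ?T x" for x by simp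
  show iT: "integrable hyp_measure ?T"
    by (rule Bochner_Integration.integrable_bound[OF S(4) mT]) (auto intro!: AE_I2 simp: indicator_def)
  define C where "C = 2 * 2 powr p / (c * \<delta> ^ ?n)"
  have C: "0 < C" using c \<delta> by (simp add: C_def)
  have L: "(\<integral>\<^sup>+x. ennreal (indicat_real hyp_space x * (hyp_factor x ^ ?n * \<bar>\<phi> x\<bar> powr p)) \<partial>lborel) = ennreal (Lp_int p \<phi>)"
    unfolding Lp_int_def by (rule nn_integral_hyp[OF S(4)]) simp
  let ?I = "\<lambda>x. (\<integral>\<^sup>+z. ennreal (indicat_real (ball 0 (\<delta> * hyp_dfac x)) z * \<bar>\<phi> (x + z) - \<phi> x\<bar> powr p) \<partial>lborel)"
  have "ennreal (\<integral>x. ?T x \<partial>hyp_measure) = (\<integral>\<^sup>+x. ennreal (indicat_real hyp_space x * (hyp_factor x ^ ?n * ?T x)) \<partial>lborel)"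
    by (rule nn_integral_hyp[OF iT T0, symmetric])
  also have "\<dots> \<le> (\<integral>\<^sup>+x. ennreal C * (ennreal (indicat_real hyp_space x * hyp_factor x ^ (2 * ?n)) * ?I x) \<partial>lborel)"
  proof (rule nn_integral_mono)
    fix x :: 'a
    show "ennreal (indicat_real hyp_space x * (hyp_factor x ^ ?n * ?T x)) \<le> ennreal C * (ennreal (indicat_real hyp_space x * hyp_factor x ^ (2 * ?n)) * ?I x)"
    proof (cases "x \<in> hyp_space \<and> \<Lambda> \<le> \<bar>\<phi> x\<bar> powr p")
      case True
      then have x: "x \<in> hyp_space" and l: "\<Lambda> \<le> \<bar>\<phi> x\<bar> powr p" by auto
      have "\<Lambda> * (unit_ball_vol ?n * \<delta> ^ ?n) \<le> \<bar>\<phi> x\<bar> powr p * (unit_ball_vol ?n * \<delta> ^ ?n)"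
        using l \<delta> by (intro mult_right_mono) auto
      then have l': "2 * 2 powr p * 2 ^ ?n * Lp_int p \<phi> \<le> \<bar>\<phi> x\<bar> powr p * (unit_ball_vol ?n * \<delta> ^ ?n)" using \<Lambda> by linarith
      have "ennreal (hyp_factor x ^ ?n * \<bar>\<phi> x\<bar> powr p) \<le> ennreal (C * hyp_factor x ^ (2 * ?n)) * ?I x"
        unfolding C_def c_def by (rule tail_pointwise[OF m\<phi> p \<delta> x Lp_int_nonneg L l'])
      then show ?thesis using True C hyp_factor_pos[OF x] by (simp add: ennreal_mult mult.assoc)
    qed auto
  qed
  also have "\<dots> \<le> ennreal C * ennreal (8 ^ ?n * 2 powr p * c * \<delta> ^ ?n * \<delta> powr p * grad_energy p \<phi>)"
  proof -
    have "(\<integral>\<^sup>+x. ennreal C * (ennreal (indicat_real hyp_space x * hyp_factor x ^ (2 * ?n)) * ?I x) \<partial>lborel)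
      = ennreal C * (\<integral>\<^sup>+x. (ennreal (indicat_real hyp_space x * hyp_factor x ^ (2 * ?n)) * ?I x) \<partial>lborel)"
    proof (rule nn_integral_cmult)
      have md: "(hyp_dfac :: 'a \<Rightarrow> real) \<in> borel_measurable borel" by (rule borel_measurable_continuous_onI[OF continuous_on_dfac])
      then have mf: "(hyp_factor :: 'a \<Rightarrow> real) \<in> borel_measurable borel" unfolding hyp_factor_eq[abs_def] by simp
      have mi: "(\<lambda>x::'a. indicat_real hyp_space x) \<in> borel_measurable borel" by (intro borel_measurable_indicator) simp
      define \<Omega> where "\<Omega> = {xz :: 'a \<times> 'a. norm (snd xz) < \<delta> * hyp_dfac (fst xz)}"
      have "open \<Omega>"
        unfolding \<Omega>_def by (intro open_Collect_less continuous_intros continuous_on_compose2[OF continuous_on_dfac[of UNIV]]) auto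
      then have "(\<lambda>xz. indicat_real \<Omega> xz) \<in> borel_measurable borel" by (intro borel_measurable_indicator) simp
      moreover have "(\<lambda>xz::'a\<times>'a. \<phi> (fst xz + snd xz)) \<in> borel_measurable borel" "(\<lambda>xz::'a\<times>'a. \<phi> (fst xz)) \<in> borel_measurable borel"
        by (rule measurable_compose[OF _ m\<phi>], rule borel_measurable_continuous_onI, intro continuous_intros)+
      ultimately have "(\<lambda>xz. ennreal (indicat_real \<Omega> xz * \<bar>\<phi> (fst xz + snd xz) - \<phi> (fst xz)\<bar> powr p)) \<in> borel_measurable borel"
        by simp
      moreover have "indicat_real \<Omega> (x, z) = indicat_real (ball 0 (\<delta> * hyp_dfac x)) z" for x z
        by (simp add: \<Omega>_def indicator_def)
      ultimately have "(\<lambda>(x, z). ennreal (indicat_real (ball 0 (\<delta> * hyp_dfac x)) z * \<bar>\<phi> (x + z) - \<phi> x\<bar> powr p)) \<in> borel_measurable (lborel \<Otimes>\<^sub>M lborel)"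
        by (simp add: case_prod_beta' lborel_prod) (metis (no_types, lifting) measurable_cong prod.collapse)
      from lborel.borel_measurable_nn_integral[OF this]
      show "(\<lambda>x. ennreal (indicat_real hyp_space x * hyp_factor x ^ (2 * ?n)) * ?I x) \<in> borel_measurable lborel"
        using mf mi by (intro borel_measurable_times_ennreal) simp_all
    qed
    then show ?thesis using tail_double_integral[OF \<phi> p \<delta>] by (simp add: c_def mult_left_mono)
  qed
  also have "\<dots> = ennreal (C * (8 ^ ?n * 2 powr p * c * \<delta> ^ ?n * \<delta> powr p * grad_energy p \<phi>))"
    using C c \<delta> by (intro ennreal_mult[symmetric]) (auto simp: grad_energy_nonneg)
  also have "C * (8 ^ ?n * 2 powr p * c * \<delta> ^ ?n * \<delta> powr p * grad_energy p \<phi>) = 2 * (2 powr p * 2 powr p) * 8 ^ ?n * \<delta> powr p * grad_energy p \<phi>"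
    using c \<delta> by (simp add: C_def)
  also have "2 powr p * 2 powr p = (4::real) powr p" using powr_mult[of 2 2 p] by simp
  finally show "(\<integral>x. ?T x \<partial>hyp_measure) \<le> 2 * 4 powr p * 8 ^ ?n * \<delta> powr p * grad_energy p \<phi>"
    by (subst (asm) ennreal_le_iff) (auto simp: grad_energy_nonneg)
qed

text \<open>For functions bounded by \<open>M\<close> this is \<open>|t|\<^sup>r\<close>, but it is controlled by \<open>|t|\<^sup>p\<close> for all \<open>t\<close> and so
  passes to the limit along smooth approximations that need not respect the bound.\<close>

definition trunc_powr :: "real \<Rightarrow> real \<Rightarrow> real \<Rightarrow> real \<Rightarrow> real" where
  "trunc_powr p r M t = min \<bar>t\<bar> M powr (r - p) * \<bar>t\<bar> powr p"

text \<open>With \<open>A\<close> the energy and \<open>\<Lambda>\<close> of order \<open>A\<^bsup>1/2\<^esup>\<close>, the part where \<open>|\<phi>|\<^sup>p \<le> \<Lambda>\<close> contributes at most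
  \<open>\<Lambda>\<^bsup>(r-p)/p\<^esup>\<close> times a multiple of \<open>A\<close> by the Poincare inequality, and the part where \<open>|\<phi>|\<^sup>p > \<Lambda>\<close>
  at most a multiple of \<open>\<delta>\<^sup>p A\<close>, where \<open>\<delta>\<^sup>n\<close> is of order \<open>A\<^bsup>1/2\<^esup>\<close>. Both carry an extra positive power of \<open>A\<close>.\<close>

lemma sobolev_smooth:
  fixes p r M :: real
  assumes p: "1 < p" and n: "2 \<le> DIM('a::euclidean_space)" and r: "p < r" and M: "0 < M"
  obtains C \<eta> where "0 < C" "0 < \<eta>"
    "\<And>\<phi> :: 'a \<Rightarrow> real. \<phi> \<in> Cc_smooth hyp_space \<Longrightarrow> grad_energy p \<phi> < 1 \<Longrightarrow>
      integrable hyp_measure (\<lambda>x. trunc_powr p r M (\<phi> x)) \<and>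
      (\<integral>x. trunc_powr p r M (\<phi> x) \<partial>hyp_measure) \<le> C * grad_energy p \<phi> powr (1 + \<eta>)"
proof -
  let ?n = "DIM('a)"
  have p1: "1 \<le> p" using p by simp
  define c where "c = unit_ball_vol (real ?n)"
  have c: "0 < c" by (simp add: c_def)
  define P where "P = (2 * p) powr p"
  have P: "0 < P" using p by (simp add: P_def)
  \<comment> \<open>With L \<le> P A from the Poincare inequality, \<Lambda> = K0 A^(1/2) and
    \<delta>^n = 4^(-n) A^(1/2), this value makes the hypothesis of \<open>tail_smooth\<close> hold:
    the two roots multiply to A.\<close>
  define K0 where "K0 = 2 * 2 powr p * 2 ^ ?n * P * 4 ^ ?n / c"
  have K0: "0 < K0" using P c by (simp add: K0_def)
  define K2 where "K2 = 2 * 4 powr p * (8::real) ^ ?n"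
  have K2: "0 < K2" by (simp add: K2_def)
  \<comment> \<open>So that |\<phi>|^(r-p) = (|\<phi>|^p)^s, bounded by \<Lambda>^s on the set of
    small values.\<close>
  define s where "s = (r - p) / p"
  have s: "0 < s" "s * p = r - p" using p r by (auto simp: s_def)
  \<comment> \<open>The smaller of the two gains: \<Lambda>^s contributes A^(s/2) and \<delta>^p
    contributes A^(p/(2n)). As A < 1, the smaller exponent gives the weaker bound.\<close>
  define \<eta> where "\<eta> = min (s / 2) (p / (2 * real ?n))"
  have \<eta>: "0 < \<eta>" using s p by (simp add: \<eta>_def)
  define C where "C = K0 powr s * P + M powr (r - p) * K2"
  have C: "0 < C" unfolding C_def using K0 P K2 M by (intro add_pos_pos) auto
  show ?thesis
  proof (rule that[OF C \<eta>], goal_cases)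
    case (1 \<phi>)
    note \<phi> = 1(1) and A1 = 1(2)
    let ?A = "grad_energy p \<phi>" and ?L = "Lp_int p \<phi>"
    let ?h = "\<lambda>x. trunc_powr p r M (\<phi> x)"
    have A0: "0 \<le> ?A" by (rule grad_energy_nonneg)
    note S = smooth_W1p[OF \<phi> p1]
    have m: "\<phi> \<in> borel_measurable hyp_measure"
      by (rule continuous_measurable_hyp[OF continuous_on_subset[OF Ck_continuous[OF Cc_smooth_Ck[OF \<phi>]]]]) simp
    have mh: "?h \<in> borel_measurable hyp_measure" unfolding trunc_powr_def using m by measurable
    have hM: "?h x \<le> M powr (r - p) * \<bar>\<phi> x\<bar> powr p" for x
      unfolding trunc_powr_def using r M by (intro mult_right_mono powr_mono2) auto
    have h0: "0 \<le> ?h x" for x by (simp add: trunc_powr_def)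
    have ih: "integrable hyp_measure ?h"
      by (rule Bochner_Integration.integrable_bound[OF integrable_mult_right[OF S(4), of "M powr (r - p)"] mh])
         (intro AE_I2, use hM h0 in simp)
    have L: "?L \<le> P * ?A" unfolding P_def by (rule poincare_smooth[OF \<phi> p n])
    show ?case
    proof (intro conjI ih)
      show "(\<integral>x. ?h x \<partial>hyp_measure) \<le> C * ?A powr (1 + \<eta>)"
      proof (cases "?A = 0")
        case True
        \<comment> \<open>With zero energy \<delta> would be 0; here the Poincare inequality already
          makes the L^p integral vanish.\<close>
        have "(\<integral>x. ?h x \<partial>hyp_measure) \<le> (\<integral>x. M powr (r - p) * \<bar>\<phi> x\<bar> powr p \<partial>hyp_measure)"
          by (intro integral_mono ih integrable_mult_right S(4) hM)
        also have "\<dots> = M powr (r - p) * ?L" by (simp add: Lp_int_def)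
        also have "\<dots> \<le> M powr (r - p) * 0" using L True by (intro mult_left_mono) auto
        finally show ?thesis using True by simp
      next
        case False
        then have A: "0 < ?A" using A0 by simp
        define \<delta> where "\<delta> = 1/4 * ?A powr (1 / (2 * real ?n))"
        have "?A powr (1 / (2 * real ?n)) \<le> 1" using A A1 by (intro powr_le1) auto
        then have \<delta>: "0 < \<delta>" "\<delta> \<le> 1/4" using A by (auto simp: \<delta>_def)
        have dn: "\<delta> ^ ?n = (1/4) ^ ?n * ?A powr (1/2)"
        proof -
          have "(?A powr (1 / (2 * real ?n))) ^ ?n = ?A powr (1/2)" using powr_power[of ?A "1 / (2 * real ?n)" ?n] A by simp
          then show ?thesis unfolding \<delta>_def power_mult_distrib by simp
        qed
        define \<Lambda> where "\<Lambda> = K0 * ?A powr (1/2)"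
        have \<Lambda>0: "0 < \<Lambda>" using K0 A by (simp add: \<Lambda>_def)
        have AA: "?A powr (1/2) * ?A powr (1/2) = ?A" using A by (simp add: powr_add[symmetric])
        have "\<Lambda> * (c * \<delta> ^ ?n) = (K0 * c * (1/4) ^ ?n) * (?A powr (1/2) * ?A powr (1/2))"
          unfolding \<Lambda>_def dn by (simp add: mult_ac)
        also have "\<dots> = (2 * 2 powr p * 2 ^ ?n * P) * ?A"
        proof -
          have "(4::real) ^ ?n * (1/4) ^ ?n = 1" by (simp add: power_mult_distrib[symmetric])
          then have "K0 * c * (1/4) ^ ?n = 2 * 2 powr p * 2 ^ ?n * P"
            using c by (simp add: K0_def mult.assoc)
          then show ?thesis unfolding AA by simp
        qed
        finally have "2 * 2 powr p * 2 ^ ?n * ?L \<le> \<Lambda> * (unit_ball_vol ?n * \<delta> ^ ?n)"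
          using mult_left_mono[OF L, of "2 * 2 powr p * 2 ^ ?n"] by (simp add: c_def mult.assoc)
        note T = tail_smooth[OF \<phi> p1 \<delta> this]
        let ?T = "\<lambda>x. indicat_real {x. \<Lambda> \<le> \<bar>\<phi> x\<bar> powr p} x * \<bar>\<phi> x\<bar> powr p"
        have hle: "?h x \<le> \<Lambda> powr s * \<bar>\<phi> x\<bar> powr p + M powr (r - p) * ?T x" for x
        proof (cases "\<Lambda> \<le> \<bar>\<phi> x\<bar> powr p")
          case True
          then show ?thesis using hM[of x] by (simp add: add_increasing)
        next
          case False
          have "min \<bar>\<phi> x\<bar> M powr (r - p) \<le> \<bar>\<phi> x\<bar> powr (r - p)" using r M by (intro powr_mono2) auto
          also have "\<dots> = (\<bar>\<phi> x\<bar> powr p) powr s" using s(2) by (simp add: powr_powr mult.commute)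
          also have "\<dots> \<le> \<Lambda> powr s" using False s(1) by (intro powr_mono2) auto
          finally have "?h x \<le> \<Lambda> powr s * \<bar>\<phi> x\<bar> powr p" unfolding trunc_powr_def by (intro mult_right_mono) auto
          then show ?thesis using False by simp
        qed
        have "(\<integral>x. ?h x \<partial>hyp_measure) \<le> (\<integral>x. \<Lambda> powr s * \<bar>\<phi> x\<bar> powr p + M powr (r - p) * ?T x \<partial>hyp_measure)"
          by (intro integral_mono ih Bochner_Integration.integrable_add integrable_mult_right S(4) T(1) hle)
        also have "\<dots> = \<Lambda> powr s * ?L + M powr (r - p) * (\<integral>x. ?T x \<partial>hyp_measure)"
          using S(4) T(1) by (simp add: Lp_int_def)
        also have "\<dots> \<le> (K0 powr s * ?A powr \<eta>) * (P * ?A) + M powr (r - p) * (K2 * ?A powr \<eta> * ?A)"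
        proof (intro add_mono mult_mono L)
          have mono: "?A powr a \<le> ?A powr \<eta>" if "\<eta> \<le> a" for a
            using A A1 that by (intro powr_mono') auto
          have "\<Lambda> powr s = K0 powr s * ?A powr (s / 2)"
            using K0 A by (simp add: \<Lambda>_def powr_mult powr_powr)
          also have "\<dots> \<le> K0 powr s * ?A powr \<eta>" by (intro mult_left_mono mono) (auto simp: \<eta>_def)
          finally show "\<Lambda> powr s \<le> K0 powr s * ?A powr \<eta>" .
          have "\<delta> powr p = (1/4) powr p * ?A powr (p / (2 * real ?n))"
            unfolding \<delta>_def by (subst powr_mult) (auto simp: powr_powr)
          also have "\<dots> \<le> 1 * ?A powr \<eta>"
            using p by (intro mult_mono mono powr_le1) (auto simp: \<eta>_def)
          finally have "K2 * \<delta> powr p * ?A \<le> K2 * ?A powr \<eta> * ?A"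
            using K2 A0 by (intro mult_right_mono mult_left_mono) auto
          then show "(\<integral>x. ?T x \<partial>hyp_measure) \<le> K2 * ?A powr \<eta> * ?A"
            using T(2) unfolding K2_def[symmetric] by (rule order_trans[rotated])
        qed (use K0 K2 A0 Lp_int_nonneg in \<open>auto intro!: integral_nonneg_AE\<close>)
        also have "\<dots> = C * (?A powr \<eta> * ?A)" by (simp add: C_def algebra_simps)
        also have "?A powr \<eta> * ?A = ?A powr (1 + \<eta>)" using A by (simp add: powr_add mult.commute)
        finally show ?thesis .
      qed
    qed
  qed
qed

text \<open>Fatou's lemma along smooth approximants. Their energies converge, so they are eventually
  below 1, and for values in [0, M] the truncated power in the limit is v^r itself.\<close>

proposition sobolev_W1p:
  fixes p r M :: real
  assumes p: "1 < p" and n: "2 \<le> DIM('a::euclidean_space)" and r: "p < r" and M: "0 < M"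
  obtains C \<eta> where "0 < C" "0 < \<eta>"
    "\<And>v :: 'a \<Rightarrow> real. v \<in> W1p_hyp p \<Longrightarrow> (AE x in hyp_measure. 0 \<le> v x \<and> v x \<le> M) \<Longrightarrow>
      grad_energy p v < 1 \<Longrightarrow> Lp_int r v \<le> C * grad_energy p v powr (1 + \<eta>)"
proof -
  have p1: "1 \<le> p" using p by simp
  obtain C \<eta> where C: "0 < C" "0 < \<eta>"
    and S: "\<And>\<phi> :: 'a \<Rightarrow> real. \<phi> \<in> Cc_smooth hyp_space \<Longrightarrow> grad_energy p \<phi> < 1 \<Longrightarrow>
      integrable hyp_measure (\<lambda>x. trunc_powr p r M (\<phi> x)) \<and>
      (\<integral>x. trunc_powr p r M (\<phi> x) \<partial>hyp_measure) \<le> C * grad_energy p \<phi> powr (1 + \<eta>)"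
    using sobolev_smooth[OF p n r M] by blast
  show ?thesis
  proof (rule that[OF C], goal_cases)
    case (1 v)
    note v = 1(1) and bd = 1(2) and E1 = 1(3)
    let ?E = "grad_energy p v"
    obtain \<phi> where \<phi>: "\<And>k::nat. \<phi> k \<in> Cc_smooth hyp_space" and lim: "(\<lambda>k. W1p_norm p (\<lambda>x. v x - \<phi> k x)) \<longlonglongrightarrow> 0"
      using W1p_hyp_subset_W1p0[OF p1 v] unfolding W1p0_hyp_def by blast
    note cf = convex_functional_grad_energy[OF p1, where 'a = 'a]
    have \<phi>W: "\<phi> k \<in> W1p_hyp p" for k by (rule smooth_W1p(1)[OF \<phi> p1])
    have dW: "(\<lambda>x. v x - \<phi> k x) \<in> W1p_hyp p" for k by (rule cf_diff[OF cf v \<phi>W])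
    have "(\<lambda>k. W1p_norm p (\<lambda>x. v x - \<phi> k x) powr p) \<longlonglongrightarrow> 0 powr p"
      using p by (intro tendsto_powr2 lim tendsto_const) (auto simp: W1p_norm_def)
    then have Q: "(\<lambda>k. Lp_int p (\<lambda>x. v x - \<phi> k x) + grad_energy p (\<lambda>x. v x - \<phi> k x)) \<longlonglongrightarrow> 0"
      by (simp add: W1p_norm_powr[OF p1])
    have QL: "(\<lambda>k. Lp_int p (\<lambda>x. v x - \<phi> k x)) \<longlonglongrightarrow> 0"
      by (rule tendsto_sandwich[OF _ _ tendsto_const Q]) (auto simp: Lp_int_nonneg grad_energy_nonneg)
    have QE: "(\<lambda>k. grad_energy p (\<lambda>x. v x - \<phi> k x)) \<longlonglongrightarrow> 0"
      by (rule tendsto_sandwich[OF _ _ tendsto_const Q]) (auto simp: Lp_int_nonneg grad_energy_nonneg)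
    have E: "(\<lambda>k. grad_energy p (\<phi> k)) \<longlonglongrightarrow> ?E"
    proof (rule cf_tendsto[OF cf v])
      show "(\<lambda>k. grad_energy p (\<lambda>x. \<phi> k x - v x)) \<longlonglongrightarrow> 0"
        using QE by (simp add: cf_swap[OF cf v \<phi>W])
    qed (use \<phi>W in simp)
    have ui: "integrable hyp_measure (\<lambda>x. \<bar>v x - \<phi> k x\<bar> powr p)" for k
      by (rule Lp_hypD(2)[OF W1p_hypD(1)[OF dW]])
    \<comment> \<open>Convergence of |v - \<phi>_k|^p in L^1 yields pointwise convergence only along
      a subsequence, which is all that Fatou requires.\<close>
    obtain s :: "nat \<Rightarrow> nat" where s: "strict_mono s" and ae: "AE x in hyp_measure. (\<lambda>k. \<bar>v x - \<phi> (s k) x\<bar> powr p) \<longlonglongrightarrow> 0"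
      using tendsto_L1_AE_subseq[of hyp_measure "\<lambda>k x. \<bar>v x - \<phi> k x\<bar> powr p", OF ui] QL
      by (auto simp: Lp_int_def)
    let ?H = "trunc_powr p r M"
    have Hlim: "AE x in hyp_measure. ennreal (\<bar>v x\<bar> powr r) = liminf (\<lambda>k. ennreal (?H (\<phi> (s k) x)))"
      using ae bd
    proof eventually_elim
      case (elim x)
      have "(\<lambda>k. (\<bar>v x - \<phi> (s k) x\<bar> powr p) powr (1 / p)) \<longlonglongrightarrow> 0 powr (1 / p)"
        using p by (intro tendsto_powr2 elim(1) tendsto_const) auto
      then have "(\<lambda>k. \<bar>v x - \<phi> (s k) x\<bar>) \<longlonglongrightarrow> 0" using p by (simp add: powr_powr)
      then have "(\<lambda>k. v x - \<phi> (s k) x) \<longlonglongrightarrow> 0" by (rule tendsto_rabs_zero_cancel)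
      then have "(\<lambda>k. v x - (v x - \<phi> (s k) x)) \<longlonglongrightarrow> v x - 0" by (intro tendsto_intros)
      then have lx: "(\<lambda>k. \<phi> (s k) x) \<longlonglongrightarrow> v x" by simp
      have "(\<lambda>k. ?H (\<phi> (s k) x)) \<longlonglongrightarrow> ?H (v x)"
        unfolding trunc_powr_def using p r M
        by (intro tendsto_mult tendsto_powr2 tendsto_min tendsto_rabs tendsto_const lx) auto
      moreover have "?H (v x) = \<bar>v x\<bar> powr r"
        using elim(2) unfolding trunc_powr_def by (simp add: powr_add[symmetric])
      ultimately have "(\<lambda>k. ennreal (?H (\<phi> (s k) x))) \<longlonglongrightarrow> ennreal (\<bar>v x\<bar> powr r)"
        by (intro tendsto_ennrealI) simp
      then show ?case by (simp add: lim_imp_Liminf)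
    qed
    have mH: "(\<lambda>x. ennreal (?H (\<phi> k x))) \<in> borel_measurable hyp_measure" for k
    proof -
      have "\<phi> k \<in> borel_measurable hyp_measure" by (rule Lp_hypD(1)[OF W1p_hypD(1)[OF \<phi>W]])
      then show ?thesis unfolding trunc_powr_def by measurable
    qed
    have mv: "v \<in> borel_measurable hyp_measure" by (rule Lp_hypD(1)[OF W1p_hypD(1)[OF v]])
    have Es: "(\<lambda>k. grad_energy p (\<phi> (s k))) \<longlonglongrightarrow> ?E"
      using LIMSEQ_subseq_LIMSEQ[OF E s] by (simp add: comp_def)
    have ev: "\<forall>\<^sub>F k in sequentially. grad_energy p (\<phi> (s k)) < 1" by (rule order_tendstoD(2)[OF Es E1])
    have "(\<integral>\<^sup>+x. ennreal (\<bar>v x\<bar> powr r) \<partial>hyp_measure) = (\<integral>\<^sup>+x. liminf (\<lambda>k. ennreal (?H (\<phi> (s k) x))) \<partial>hyp_measure)"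
      by (rule nn_integral_cong_AE[OF Hlim])
    also have "\<dots> \<le> liminf (\<lambda>k. \<integral>\<^sup>+x. ennreal (?H (\<phi> (s k) x)) \<partial>hyp_measure)"
      by (rule nn_integral_liminf[OF mH])
    also have "\<dots> \<le> liminf (\<lambda>k. ennreal (C * grad_energy p (\<phi> (s k)) powr (1 + \<eta>)))"
    proof (rule Liminf_mono)
      show "\<forall>\<^sub>F k in sequentially. (\<integral>\<^sup>+x. ennreal (?H (\<phi> (s k) x)) \<partial>hyp_measure) \<le> ennreal (C * grad_energy p (\<phi> (s k)) powr (1 + \<eta>))"
        using ev
      proof eventually_elim
        case (elim k)
        note SS = S[OF \<phi> elim]
        have "(\<integral>\<^sup>+x. ennreal (?H (\<phi> (s k) x)) \<partial>hyp_measure) = ennreal (\<integral>x. ?H (\<phi> (s k) x) \<partial>hyp_measure)"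
          using SS by (intro nn_integral_eq_integral) (auto simp: trunc_powr_def)
        then show ?case using SS by (simp add: ennreal_leI)
      qed
    qed
    also have "\<dots> = ennreal (C * ?E powr (1 + \<eta>))"
    proof (rule lim_imp_Liminf)
      show "(\<lambda>k. ennreal (C * grad_energy p (\<phi> (s k)) powr (1 + \<eta>))) \<longlonglongrightarrow> ennreal (C * ?E powr (1 + \<eta>))"
        using C by (intro tendsto_ennrealI tendsto_mult tendsto_powr2 Es tendsto_const) (auto simp: grad_energy_nonneg)
    qed simp
    finally have le: "(\<integral>\<^sup>+x. ennreal (\<bar>v x\<bar> powr r) \<partial>hyp_measure) \<le> ennreal (C * ?E powr (1 + \<eta>))" .
    have "integrable hyp_measure (\<lambda>x. \<bar>v x\<bar> powr r)"
      using mv le by (intro integrableI_nonneg) (auto intro: le_less_trans)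
    then have "ennreal (\<integral>x. \<bar>v x\<bar> powr r \<partial>hyp_measure) \<le> ennreal (C * ?E powr (1 + \<eta>))"
      using le by (subst (asm) nn_integral_eq_integral) auto
    then show ?case using C by (subst (asm) ennreal_le_iff) (auto simp: Lp_int_def)
  qed
qed

section \<open>Strongly measurable curves\<close>

text \<open>Viewed as a function into the space of functions, such a curve has finitely many values
  with measurable level sets. Composition with an arbitrary functional is then measurable, with no
  measurable structure on the function space.\<close>

lemma simple_curve_simple_function:
  assumes "simple_curve_integral X I s S"
  shows "simple_function lebesgue s"
proof -
  obtain m A f where A: "\<And>i. i < (m::nat) \<Longrightarrow> A i \<in> lmeasurable" and s: "s = (\<lambda>t x. \<Sum>i<m. indicat_real (A i) t * f i x)"
    using assms unfolding simple_curve_integral_def by blast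
  have "simple_function lebesgue (\<lambda>t x. \<Sum>i<j. indicat_real (A i) t * f i x)" if "j \<le> m" for j
    using that
  proof (induction j)
    case 0
    then show ?case by simp
  next
    case (Suc j)
    have "simple_function lebesgue (\<lambda>t. indicat_real (A j) t)"
      using A[of j] Suc.prems by (intro simple_function_indicator) auto
    moreover have "simple_function lebesgue (\<lambda>t x. \<Sum>i<j. indicat_real (A i) t * f i x)"
      using Suc.prems by (intro Suc.IH) simp
    ultimately have "simple_function lebesgue (\<lambda>t x. (\<Sum>i<j. indicat_real (A i) t * f i x) + indicat_real (A j) t * f j x)"
      using simple_function_compose2[of lebesgue "\<lambda>t x. \<Sum>i<j. indicat_real (A i) t * f i x" "\<lambda>t. indicat_real (A j) t" "\<lambda>g c x. g x + c * f j x"]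
      by (simp only: simp_thms)
    then show ?case by (simp only: sum.lessThan_Suc)
  qed
  from this[OF order_refl] show ?thesis unfolding s .
qed

lemma simple_curve_in:
  assumes "simple_curve_integral X I s S" and cf: "convex_functional p X A" and w: "w \<in> X"
  shows "s t \<in> X"
proof -
  obtain m A f where f: "\<And>i. i < (m::nat) \<Longrightarrow> f i \<in> X" and s: "s = (\<lambda>t x. \<Sum>i<m. indicat_real (A i) t * f i x)"
    using assms(1) unfolding simple_curve_integral_def by blast
  have "(\<lambda>x. \<Sum>i<j. c i * f i x) \<in> X" if "j \<le> m" for j and c :: "nat \<Rightarrow> real"
    using that
  proof (induction j)
    case 0
    \<comment> \<open>The empty sum is the zero function; the element \<open>w\<close> witnesses
      that the space contains it.\<close>
    then show ?case using cf_scale[OF cf w, of 0] by simp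
  next
    case (Suc j)
    then show ?case using cf_lin[OF cf Suc.IH f[of j], of 1 "c j"] by simp
  qed
  from this[OF order_refl, of "\<lambda>i. indicat_real (A i) t"] show ?thesis unfolding s .
qed

text \<open>Completeness of Lebesgue measure allows the limit to be changed on the exceptional null
  set.\<close>

lemma measurable_AE_limit:
  fixes g :: "real \<Rightarrow> real"
  assumes S: "S \<in> sets lebesgue" and f: "\<And>k. f k \<in> borel_measurable (lebesgue_on S)"
    and ae: "AE t in lebesgue_on S. (\<lambda>k. f k t) \<longlonglongrightarrow> g t"
  shows "g \<in> borel_measurable (lebesgue_on S)"
proof -
  have m: "(\<lambda>t. lim (\<lambda>k. f k t)) measurable_on S"
    using borel_measurable_lim_metric[OF f] S by (simp add: measurable_on_iff_borel_measurable)
  have "AE t in lebesgue. t \<in> S \<longrightarrow> (\<lambda>k. f k t) \<longlonglongrightarrow> g t"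
    using ae S by (simp add: AE_restrict_space_iff)
  from AE_E3[OF this] obtain N where N: "\<And>t. t \<in> space lebesgue - N \<Longrightarrow> t \<in> S \<longrightarrow> (\<lambda>k. f k t) \<longlonglongrightarrow> g t" "N \<in> null_sets lebesgue"
    by blast
  have "g measurable_on S"
  proof (rule measurable_on_spike[OF m])
    show "negligible N" using N(2) by (simp only: negligible_iff_null_sets)
    show "g t = lim (\<lambda>k. f k t)" if "t \<in> S - N" for t
      using N(1)[of t] that by (intro limI[symmetric]) auto
  qed
  then show ?thesis using S by (simp add: measurable_on_iff_borel_measurable)
qed

text \<open>The functional is continuous along the approximating simple curves by
  \<open>cf_tendsto\<close>. The perturbation \<open>c\<close> serves two purposes: subtracting a
  simple curve from v, and adding a multiple of a fixed function.\<close>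

lemma strongly_measurable_functional:
  fixes v c :: "real \<Rightarrow> 'a \<Rightarrow> real"
  assumes v: "strongly_measurable X N I v" and I: "I \<in> sets lebesgue" and cf: "convex_functional p X A"
    and N: "\<And>f. f \<in> X \<Longrightarrow> 0 \<le> N f" "\<And>f. f \<in> X \<Longrightarrow> A f \<le> N f powr p"
    and c: "simple_function lebesgue c" "\<And>t. c t \<in> X"
  shows "(\<lambda>t. A (\<lambda>x. v t x + c t x)) \<in> borel_measurable (lebesgue_on I)"
proof -
  obtain s S where s: "\<And>k::nat. simple_curve_integral X I (s k) (S k)"
    and lim: "AE t in lebesgue_on I. (\<lambda>k. N (\<lambda>x. v t x - s k t x)) \<longlonglongrightarrow> 0"
    using v unfolding strongly_measurable_def by blast
  have vX: "AE t in lebesgue_on I. v t \<in> X" using v unfolding strongly_measurable_def by blast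
  have p: "1 \<le> p" by (rule cf_ge_1[OF cf])
  have sX: "s k t \<in> X" for k t by (rule simple_curve_in[OF s cf c(2)])
  show ?thesis
  proof (rule measurable_AE_limit[OF I])
    fix k
    have "simple_function lebesgue (\<lambda>t. A (\<lambda>x. s k t x + c t x))"
      by (rule simple_function_compose2[where h = "\<lambda>g h. A (\<lambda>x. g x + h x)", OF simple_curve_simple_function[OF s] c(1)])
    then have "(\<lambda>t. A (\<lambda>x. s k t x + c t x)) \<in> borel_measurable lebesgue"
      by (rule borel_measurable_simple_function)
    then show "(\<lambda>t. A (\<lambda>x. s k t x + c t x)) \<in> borel_measurable (lebesgue_on I)"
      by (rule measurable_restrict_space1)
  next
    show "AE t in lebesgue_on I. (\<lambda>k. A (\<lambda>x. s k t x + c t x)) \<longlonglongrightarrow> A (\<lambda>x. v t x + c t x)"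
      using lim vX
    proof eventually_elim
      case (elim t)
      have dX: "(\<lambda>x. v t x - s k t x) \<in> X" for k by (rule cf_diff[OF cf elim(2) sX])
      have "(\<lambda>k. N (\<lambda>x. v t x - s k t x) powr p) \<longlonglongrightarrow> 0 powr p"
        using p N(1)[OF dX] by (intro tendsto_powr2 elim(1) tendsto_const) auto
      then have N0: "(\<lambda>k. N (\<lambda>x. v t x - s k t x) powr p) \<longlonglongrightarrow> 0" using p by simp
      have "(\<lambda>k. A (\<lambda>x. v t x - s k t x)) \<longlonglongrightarrow> 0"
        by (rule tendsto_sandwich[OF _ _ tendsto_const N0]) (auto simp: N(2)[OF dX] cf_nonneg[OF cf dX])
      then have "(\<lambda>k. A (\<lambda>x. (s k t x + c t x) - (v t x + c t x))) \<longlonglongrightarrow> 0"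
        by (simp add: cf_swap[OF cf elim(2) sX])
      then show ?case
        by (intro cf_tendsto[OF cf cf_add[OF cf elim(2) c(2)]])
           (auto intro!: always_eventually cf_add[OF cf sX c(2)])
    qed
  qed
qed

text \<open>On the span of finitely many functions the functional is controlled by the coefficients,
  by iterating the quasi-triangle inequality. Continuity of coefficients in time thus becomes
  continuity of the curve.\<close>

lemma cf_sum_bound:
  assumes cf: "convex_functional p X A" and w: "w \<in> X" and f: "\<And>i. i < (m::nat) \<Longrightarrow> f i \<in> X"
  shows "\<exists>K\<ge>0. \<forall>c. (\<lambda>x. \<Sum>i<m. c i * f i x) \<in> X \<and> A (\<lambda>x. \<Sum>i<m. c i * f i x) \<le> K * (\<Sum>i<m. \<bar>c i\<bar> powr p)"
  using f
proof (induction m)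
  case 0
  have "(\<lambda>x. 0) \<in> X" "A (\<lambda>x. 0) = 0" using cf_scale[OF cf w, of 0] cf_homog[OF cf w, of 0] by auto
  then show ?case by auto
next
  case (Suc m)
  have "\<exists>K\<ge>0. \<forall>c. (\<lambda>x. \<Sum>i<m. c i * f i x) \<in> X \<and> A (\<lambda>x. \<Sum>i<m. c i * f i x) \<le> K * (\<Sum>i<m. \<bar>c i\<bar> powr p)"
    by (rule Suc.IH) (use Suc.prems in auto)
  then obtain K where K: "0 \<le> K" "\<And>c. (\<lambda>x. \<Sum>i<m. c i * f i x) \<in> X"
    "\<And>c. A (\<lambda>x. \<Sum>i<m. c i * f i x) \<le> K * (\<Sum>i<m. \<bar>c i\<bar> powr p)" by blast
  have fm: "f m \<in> X" using Suc.prems by simp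
  define K' where "K' = 2 powr p * (K + A (f m))"
  have Am: "0 \<le> A (f m)" by (rule cf_nonneg[OF cf fm])
  have K': "0 \<le> K'" using K(1) Am by (simp add: K'_def)
  have "(\<lambda>x. \<Sum>i<Suc m. c i * f i x) \<in> X \<and> A (\<lambda>x. \<Sum>i<Suc m. c i * f i x) \<le> K' * (\<Sum>i<Suc m. \<bar>c i\<bar> powr p)" for c
  proof
    show "(\<lambda>x. \<Sum>i<Suc m. c i * f i x) \<in> X" using cf_lin[OF cf K(2) fm, of 1 c "c m"] by simp
    have "A (\<lambda>x. \<Sum>i<Suc m. c i * f i x) \<le> 2 powr p * (A (\<lambda>x. \<Sum>i<m. c i * f i x) + A (\<lambda>x. c m * f m x))"
      using cf_quasi[OF cf K(2)[of c] cf_scale[OF cf fm, of "c m"]] by simp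
    also have "\<dots> \<le> 2 powr p * (K * (\<Sum>i<m. \<bar>c i\<bar> powr p) + \<bar>c m\<bar> powr p * A (f m))"
      using K(3)[of c] by (intro mult_left_mono add_mono) (auto simp: cf_homog[OF cf fm])
    also have "\<dots> \<le> 2 powr p * ((K + A (f m)) * (\<Sum>i<m. \<bar>c i\<bar> powr p) + (K + A (f m)) * \<bar>c m\<bar> powr p)"
    proof (intro mult_left_mono add_mono)
      show "K * (\<Sum>i<m. \<bar>c i\<bar> powr p) \<le> (K + A (f m)) * (\<Sum>i<m. \<bar>c i\<bar> powr p)"
        using Am by (intro mult_right_mono sum_nonneg) auto
      have "\<bar>c m\<bar> powr p * A (f m) \<le> \<bar>c m\<bar> powr p * (K + A (f m))"
        using K(1) by (intro mult_left_mono) auto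
      then show "\<bar>c m\<bar> powr p * A (f m) \<le> (K + A (f m)) * \<bar>c m\<bar> powr p" by (simp add: mult.commute)
    qed simp
    also have "\<dots> = K' * (\<Sum>i<Suc m. \<bar>c i\<bar> powr p)" by (simp add: K'_def algebra_simps)
    finally show "A (\<lambda>x. \<Sum>i<Suc m. c i * f i x) \<le> K' * (\<Sum>i<Suc m. \<bar>c i\<bar> powr p)" .
  qed
  then show ?case using K' by blast
qed

lemma indicator_continuous_approx:
  fixes B :: "real set"
  assumes B: "B \<in> sets lebesgue"
  obtains N \<theta> where "negligible N" "\<And>j::nat. continuous_on UNIV (\<theta> j)" "\<And>j t. 0 \<le> \<theta> j t \<and> \<theta> j t \<le> 1"
    "\<And>t. t \<notin> N \<Longrightarrow> (\<lambda>j. \<theta> j t) \<longlonglongrightarrow> indicat_real B t"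
proof -
  have "indicat_real B \<in> borel_measurable lebesgue" using B by (intro borel_measurable_indicator)
  then have "indicat_real B measurable_on UNIV" by (simp add: measurable_on_iff_borel_measurable)
  then obtain N g where N: "negligible N" and g: "\<And>n::nat. continuous_on UNIV (g n)"
    "\<And>x. x \<notin> N \<Longrightarrow> (\<lambda>n. g n x) \<longlonglongrightarrow> indicat_real B x"
    unfolding measurable_on_def by auto
  show ?thesis
  proof (rule that[OF N, of "\<lambda>j t. max 0 (min 1 (g j t))"])
    show "continuous_on UNIV (\<lambda>t. max 0 (min 1 (g j t)))" for j by (intro continuous_intros g)
    show "(\<lambda>j. max 0 (min 1 (g j t))) \<longlonglongrightarrow> indicat_real B t" if "t \<notin> N" for t
    proof -
      have "(\<lambda>j. max 0 (min 1 (g j t))) \<longlonglongrightarrow> max 0 (min 1 (indicat_real B t))"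
        by (intro tendsto_max tendsto_min tendsto_const g(2) that)
      then show ?thesis by (simp add: indicator_def split: if_splits)
    qed
  qed auto
qed

text \<open>Mean continuity in time: up to a remainder \<open>R\<close> with small integral, the curve follows a continuous one.\<close>

lemma curve_continuous_approx:
  fixes v :: "real \<Rightarrow> 'a \<Rightarrow> real"
  assumes v: "strongly_measurable X N {0..} v" and cf: "convex_functional p X A"
    and N: "\<And>f. f \<in> X \<Longrightarrow> 0 \<le> N f" "\<And>f. f \<in> X \<Longrightarrow> A f \<le> N f powr p"
    and w: "w \<in> X" and T: "0 < T" and int: "integrable (lebesgue_on {0..T}) (\<lambda>t. N (v t) powr p)" and e: "0 < e"
  obtains Z R where "\<And>t. Z t \<in> X"
    "\<And>\<delta>. 0 < \<delta> \<Longrightarrow> \<exists>h>0. \<forall>t\<in>{0..T}. \<forall>\<tau>\<in>{0..T}. \<bar>t - \<tau>\<bar> < h \<longrightarrow> A (\<lambda>x. Z t x - Z \<tau> x) \<le> \<delta>"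
    "integrable (lebesgue_on {0..T}) R" "\<And>t. 0 \<le> R t" "(\<integral>t. R t \<partial>lebesgue_on {0..T}) \<le> e"
    "AE t in lebesgue_on {0..T}. v t \<in> X \<and> A (\<lambda>x. v t x - Z t x) \<le> R t"
proof -
  let ?J = "{0..T}"
  have p: "1 \<le> p" by (rule cf_ge_1[OF cf])
  obtain s S where s: "\<And>k::nat. simple_curve_integral X {0..} (s k) (S k)"
    and lim: "AE t in lebesgue_on {0..}. (\<lambda>k. N (\<lambda>x. v t x - s k t x)) \<longlonglongrightarrow> 0"
    using v unfolding strongly_measurable_def by blast
  have vX0: "AE t in lebesgue_on {0..}. v t \<in> X" using v unfolding strongly_measurable_def by blast
  have sub: "AE t in lebesgue_on ?J. P t" if "AE t in lebesgue_on {0..}. P t" for P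
    using that by (auto simp: AE_restrict_space_iff elim!: eventually_mono)
  note vX = sub[OF vX0] and limJ = sub[OF lim]
  have sX: "s k t \<in> X" for k t by (rule simple_curve_in[OF s cf w])
  define r where "r k t = A (\<lambda>x. v t x - s k t x)" for k t
  have I0: "{0::real..} \<in> sets lebesgue" by auto
  have rm0: "r k \<in> borel_measurable (lebesgue_on {0..})" for k
  proof -
    have sf: "simple_function lebesgue (\<lambda>t x. - s k t x)"
      by (rule simple_function_compose1[where g = "\<lambda>g x. - g x", OF simple_curve_simple_function[OF s]])
    have "(\<lambda>t. A (\<lambda>x. v t x + - s k t x)) \<in> borel_measurable (lebesgue_on {0..})"
      by (rule strongly_measurable_functional[OF v I0 cf N sf]) (use cf_scale[OF cf sX, of "-1"] in auto)
    then show ?thesis by (simp add: r_def[abs_def])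
  qed
  have rm: "r k \<in> borel_measurable (lebesgue_on ?J)" for k
    by (rule measurable_restrict_mono[OF rm0]) auto
  have zero: "(\<lambda>x. 0) \<in> X" using cf_scale[OF cf w, of 0] by simp
  have Am: "(\<lambda>t. A (v t)) \<in> borel_measurable (lebesgue_on ?J)"
    using measurable_restrict_mono[OF strongly_measurable_functional[OF v I0 cf N, of "\<lambda>t x. 0"], of ?J] zero by simp
  \<comment> \<open>One share for the error of the simple curve and one for smoothing its
    indicators, joined by \<open>cf_quasi\<close>.\<close>
  define c where "c = e / (2 * 2 powr p)"
  have c: "0 < c" using e by (simp add: c_def)
  define \<eta> where "\<eta> = c / (2 * T)"
  have \<eta>: "0 < \<eta>" using c T by (simp add: \<eta>_def)
  \<comment> \<open>The error of the simple curve after it is reset to 0 at times where it misses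
    \<open>v\<close> by more than \<open>\<eta>\<close>. Unlike \<open>r k\<close>, it has an
    integrable majorant independent of k, so dominated convergence applies.\<close>
  define \<rho> where "\<rho> k t = (if r k t \<le> \<eta> then r k t else A (v t))" for k t
  have \<rho>m: "\<rho> k \<in> borel_measurable (lebesgue_on ?J)" for k
    unfolding \<rho>_def using rm Am by measurable
  have intd: "integrable (lebesgue_on ?J) (\<lambda>t. \<eta> + N (v t) powr p)"
    using int by simp
  have r0: "AE t in lebesgue_on ?J. \<forall>k. 0 \<le> r k t"
    using vX by eventually_elim (auto simp: r_def intro!: cf_nonneg[OF cf] cf_diff[OF cf] sX)
  have \<rho>b: "AE t in lebesgue_on ?J. norm (\<rho> k t) \<le> \<eta> + N (v t) powr p" for k
    using vX r0
  proof eventually_elim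
    case (elim t)
    have "0 \<le> r k t" using elim(2) by blast
    then show ?case using N(2)[OF elim(1)] cf_nonneg[OF cf elim(1)] \<eta> by (auto simp: \<rho>_def add_increasing add_increasing2)
  qed
  have "(\<lambda>k. \<integral>t. \<rho> k t \<partial>lebesgue_on ?J) \<longlonglongrightarrow> (\<integral>t. 0 \<partial>lebesgue_on ?J)"
  proof (rule integral_dominated_convergence[OF _ \<rho>m intd _ \<rho>b])
    show "AE t in lebesgue_on ?J. (\<lambda>k. \<rho> k t) \<longlonglongrightarrow> 0"
      using limJ vX
    proof eventually_elim
      case (elim t)
      have dX: "(\<lambda>x. v t x - s k t x) \<in> X" for k by (rule cf_diff[OF cf elim(2) sX])
      have "(\<lambda>k. N (\<lambda>x. v t x - s k t x) powr p) \<longlonglongrightarrow> 0 powr p"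
        using p N(1)[OF dX] by (intro tendsto_powr2 elim(1) tendsto_const) auto
      then have N0: "(\<lambda>k. N (\<lambda>x. v t x - s k t x) powr p) \<longlonglongrightarrow> 0" using p by simp
      have l: "(\<lambda>k. r k t) \<longlonglongrightarrow> 0"
        unfolding r_def by (rule tendsto_sandwich[OF _ _ tendsto_const N0]) (auto simp: N(2)[OF dX] cf_nonneg[OF cf dX])
      have "\<forall>\<^sub>F k in sequentially. r k t < \<eta>" by (rule order_tendstoD(2)[OF l \<eta>])
      then show ?case
        by (intro Lim_transform_eventually[OF l]) (auto elim!: eventually_mono simp: \<rho>_def)
    qed
  qed simp
  then have "\<forall>\<^sub>F k in sequentially. (\<integral>t. \<rho> k t \<partial>lebesgue_on ?J) < c"
    using c by (intro order_tendstoD(2)) auto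
  then obtain k where k: "(\<integral>t. \<rho> k t \<partial>lebesgue_on ?J) < c" by (auto simp: eventually_sequentially)
  have \<rho>i: "integrable (lebesgue_on ?J) (\<rho> k)"
    by (rule Bochner_Integration.integrable_bound[OF intd \<rho>m]) (use \<rho>b[of k] in \<open>auto elim!: eventually_mono intro: order_trans[OF _ abs_ge_self]\<close>)
  obtain m B f where B: "\<And>i. i < (m::nat) \<Longrightarrow> B i \<in> lmeasurable" and f: "\<And>i. i < m \<Longrightarrow> f i \<in> X"
    and sk: "s k = (\<lambda>t x. \<Sum>i<m. indicat_real (B i) t * f i x)"
    using s[of k] unfolding simple_curve_integral_def by blast
  have "\<exists>K\<ge>0. \<forall>c. (\<lambda>x. \<Sum>i<m. c i * f i x) \<in> X \<and> A (\<lambda>x. \<Sum>i<m. c i * f i x) \<le> K * (\<Sum>i<m. \<bar>c i\<bar> powr p)"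
    by (rule cf_sum_bound[OF cf w f])
  then obtain K where K: "0 \<le> K" "\<And>c. (\<lambda>x. \<Sum>i<m. c i * f i x) \<in> X"
    "\<And>c. A (\<lambda>x. \<Sum>i<m. c i * f i x) \<le> K * (\<Sum>i<m. \<bar>c i\<bar> powr p)" by blast
  \<comment> \<open>Intersecting with the good times carries out the reset while keeping the same
    finitely many values \<open>f i\<close>.\<close>
  define D where "D i = B i \<inter> {t \<in> ?J. r k t \<le> \<eta>}" for i
  have Dm: "D i \<in> sets lebesgue" if "i < m" for i
  proof -
    have "{t \<in> space (lebesgue_on ?J). r k t \<le> \<eta>} \<in> sets (lebesgue_on ?J)" using rm by measurable
    then have "{t \<in> ?J. r k t \<le> \<eta>} \<in> sets lebesgue" by (simp add: sets_restrict_space_iff)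
    then show ?thesis unfolding D_def using B[OF that] by auto
  qed
  define P where "P i N\<theta> \<longleftrightarrow> negligible (fst N\<theta>) \<and> (\<forall>j::nat. continuous_on UNIV (snd N\<theta> j)) \<and>
    (\<forall>j t. 0 \<le> snd N\<theta> j t \<and> snd N\<theta> j t \<le> (1::real)) \<and> (\<forall>t. t \<notin> fst N\<theta> \<longrightarrow> (\<lambda>j. snd N\<theta> j t) \<longlonglongrightarrow> indicat_real (D i) t)" for i and N\<theta> :: "real set \<times> (nat \<Rightarrow> real \<Rightarrow> real)"
  have "\<forall>i\<in>{..<m}. \<exists>N\<theta>. P i N\<theta>"
  proof
    fix i assume "i \<in> {..<m}"
    then have "D i \<in> sets lebesgue" using Dm by simp
    from indicator_continuous_approx[OF this] obtain N' \<theta>' where "negligible N'" "\<And>j::nat. continuous_on UNIV (\<theta>' j)"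
      "\<And>j t. 0 \<le> \<theta>' j t \<and> \<theta>' j t \<le> 1" "\<And>t. t \<notin> N' \<Longrightarrow> (\<lambda>j. \<theta>' j t) \<longlonglongrightarrow> indicat_real (D i) t" by blast
    then have "P i (N', \<theta>')" by (simp add: P_def)
    then show "\<exists>N\<theta>. P i N\<theta>" by blast
  qed
  from bchoice[OF this] obtain N\<theta> where N\<theta>: "\<forall>i\<in>{..<m}. P i (N\<theta> i)" by blast
  define \<theta> where "\<theta> i = snd (N\<theta> i)" for i
  have \<theta>: "negligible (fst (N\<theta> i))" "continuous_on UNIV (\<theta> i j)" "0 \<le> \<theta> i j t" "\<theta> i j t \<le> 1"
    "t \<notin> fst (N\<theta> i) \<Longrightarrow> (\<lambda>j. \<theta> i j t) \<longlonglongrightarrow> indicat_real (D i) t" if "i < m" for i j t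
    using N\<theta> that by (auto simp: P_def \<theta>_def)
  define \<kappa> where "\<kappa> j t = K * (\<Sum>i<m. \<bar>indicat_real (D i) t - \<theta> i j t\<bar> powr p)" for j t
  have \<kappa>m: "\<kappa> j \<in> borel_measurable (lebesgue_on ?J)" for j
  proof -
    have "(\<lambda>t. \<bar>indicat_real (D i) t - \<theta> i j t\<bar> powr p) \<in> borel_measurable (lebesgue_on ?J)" if "i < m" for i
    proof -
      have "indicat_real (D i) \<in> borel_measurable lebesgue" by (intro borel_measurable_indicator Dm that)
      moreover have "\<theta> i j \<in> borel_measurable lebesgue" by (intro continuous_lebesgue_measurable \<theta>(2) that)
      ultimately have "(\<lambda>t. \<bar>indicat_real (D i) t - \<theta> i j t\<bar> powr p) \<in> borel_measurable lebesgue" by simp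
      then show ?thesis by (rule measurable_restrict_space1)
    qed
    then show ?thesis unfolding \<kappa>_def by (intro borel_measurable_times borel_measurable_const borel_measurable_sum) auto
  qed
  have \<kappa>0: "0 \<le> \<kappa> j t" for j t unfolding \<kappa>_def using K(1) by (intro mult_nonneg_nonneg sum_nonneg) auto
  have \<kappa>b: "\<kappa> j t \<le> K * real m" for j t
  proof -
    have "\<bar>indicat_real (D i) t - \<theta> i j t\<bar> \<le> 1" if "i < m" for i
      using \<theta>(3)[OF that, of j t] \<theta>(4)[OF that, of j t] by (cases "t \<in> D i") auto
    then have "(\<Sum>i<m. \<bar>indicat_real (D i) t - \<theta> i j t\<bar> powr p) \<le> (\<Sum>i<m. 1)"
      using p by (intro sum_mono powr_le1) auto
    then show ?thesis unfolding \<kappa>_def using K(1) by (intro mult_left_mono) auto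
  qed
  have intK: "integrable (lebesgue_on ?J) (\<lambda>t. K * real m)" by simp
  have "(\<lambda>j. \<integral>t. \<kappa> j t \<partial>lebesgue_on ?J) \<longlonglongrightarrow> (\<integral>t. 0 \<partial>lebesgue_on ?J)"
  proof (rule integral_dominated_convergence[OF _ \<kappa>m intK])
    have "AE t in lebesgue. t \<notin> fst (N\<theta> i)" if "i < m" for i
      using \<theta>(1)[OF that] by (intro AE_not_in) (simp add: negligible_iff_null_sets)
    then have "AE t in lebesgue. \<forall>i\<in>{..<m}. t \<notin> fst (N\<theta> i)" by (intro AE_finite_allI) auto
    then have "AE t in lebesgue_on ?J. \<forall>i\<in>{..<m}. t \<notin> fst (N\<theta> i)"
      by (auto simp: AE_restrict_space_iff elim!: eventually_mono)
    then show "AE t in lebesgue_on ?J. (\<lambda>j. \<kappa> j t) \<longlonglongrightarrow> 0"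
    proof eventually_elim
      case (elim t)
      have "(\<lambda>j. \<kappa> j t) \<longlonglongrightarrow> K * (\<Sum>i<m. \<bar>indicat_real (D i) t - indicat_real (D i) t\<bar> powr p)"
        unfolding \<kappa>_def using p elim by (intro tendsto_mult tendsto_sum tendsto_const tendsto_powr2 tendsto_rabs tendsto_diff \<theta>(5)) auto
      then show ?case using p by simp
    qed
    show "AE t in lebesgue_on ?J. norm (\<kappa> j t) \<le> K * real m" for j
      using \<kappa>0 \<kappa>b by (intro AE_I2) simp
  qed simp
  then have "\<forall>\<^sub>F j in sequentially. (\<integral>t. \<kappa> j t \<partial>lebesgue_on ?J) < c"
    using c by (intro order_tendstoD(2)) auto
  then obtain j where j: "(\<integral>t. \<kappa> j t \<partial>lebesgue_on ?J) < c" by (auto simp: eventually_sequentially)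
  have \<kappa>i: "integrable (lebesgue_on ?J) (\<kappa> j)"
    by (rule Bochner_Integration.integrable_bound[OF intK \<kappa>m]) (intro AE_I2, use \<kappa>0 \<kappa>b in \<open>auto intro: order_trans[OF _ abs_ge_self]\<close>)
  define Z where "Z t = (\<lambda>x. \<Sum>i<m. \<theta> i j t * f i x)" for t
  \<comment> \<open>The absolute value makes \<open>R\<close> nonnegative at every time;
    \<open>\<rho> k\<close> is so only almost everywhere.\<close>
  define R where "R t = \<bar>2 powr p * (\<rho> k t + \<kappa> j t)\<bar>" for t
  have \<rho>0: "AE t in lebesgue_on ?J. 0 \<le> \<rho> k t"
    using vX r0 by eventually_elim (auto simp: \<rho>_def cf_nonneg[OF cf])
  have Ri: "integrable (lebesgue_on ?J) R" unfolding R_def using \<rho>i \<kappa>i by simp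
  show ?thesis
  proof (rule that[of Z R])
    show "Z t \<in> X" for t unfolding Z_def by (rule K(2))
    show "\<exists>h>0. \<forall>t\<in>?J. \<forall>\<tau>\<in>?J. \<bar>t - \<tau>\<bar> < h \<longrightarrow> A (\<lambda>x. Z t x - Z \<tau> x) \<le> \<delta>" if \<delta>: "0 < \<delta>" for \<delta>
    proof -
      \<comment> \<open>\<open>g\<close> vanishes on the diagonal, so its uniform continuity on the
        square is a modulus of continuity for \<open>Z\<close>.\<close>
      define g where "g = (\<lambda>w::real \<times> real. K * (\<Sum>i<m. \<bar>\<theta> i j (fst w) - \<theta> i j (snd w)\<bar> powr p))"
      have "continuous_on (?J \<times> ?J) g"
        unfolding g_def using p
        by (intro continuous_intros continuous_on_powr' continuous_on_compose2[OF \<theta>(2)]) auto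
      then have "uniformly_continuous_on (?J \<times> ?J) g"
        by (intro compact_uniformly_continuous compact_Times) auto
      then obtain h where h: "0 < h" "\<And>w w'. w \<in> ?J \<times> ?J \<Longrightarrow> w' \<in> ?J \<times> ?J \<Longrightarrow> dist w' w < h \<Longrightarrow> dist (g w') (g w) < \<delta>"
        unfolding uniformly_continuous_on_def using \<delta> by meson
      have "A (\<lambda>x. Z t x - Z \<tau> x) \<le> \<delta>" if t: "t \<in> ?J" "\<tau> \<in> ?J" "\<bar>t - \<tau>\<bar> < h" for t \<tau>
      proof -
        have "(\<lambda>x. Z t x - Z \<tau> x) = (\<lambda>x. \<Sum>i<m. (\<theta> i j t - \<theta> i j \<tau>) * f i x)"
          by (simp add: Z_def sum_subtractf left_diff_distrib)
        then have "A (\<lambda>x. Z t x - Z \<tau> x) \<le> g (t, \<tau>)" using K(3)[of "\<lambda>i. \<theta> i j t - \<theta> i j \<tau>"] by (simp add: g_def)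
        moreover have "dist (t, \<tau>) (t, t) < h" using t(3) by (simp add: dist_Pair_Pair dist_real_def abs_minus_commute)
        then have "dist (g (t, \<tau>)) (g (t, t)) < \<delta>" using t by (intro h(2)) auto
        then have "g (t, \<tau>) \<le> \<delta>" using p by (simp add: g_def dist_real_def abs_less_iff)
        ultimately show ?thesis by linarith
      qed
      then show ?thesis using h(1) by blast
    qed
    have "(\<integral>t. R t \<partial>lebesgue_on ?J) = (\<integral>t. 2 powr p * (\<rho> k t + \<kappa> j t) \<partial>lebesgue_on ?J)"
    proof (rule integral_cong_AE)
      show "AE t in lebesgue_on ?J. R t = 2 powr p * (\<rho> k t + \<kappa> j t)"
        using \<rho>0 by eventually_elim (use \<kappa>0 in \<open>simp add: R_def\<close>)
      show "R \<in> borel_measurable (lebesgue_on ?J)" using Ri by (rule borel_measurable_integrable)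
      show "(\<lambda>t. 2 powr p * (\<rho> k t + \<kappa> j t)) \<in> borel_measurable (lebesgue_on ?J)"
        by (intro borel_measurable_times borel_measurable_const borel_measurable_add \<rho>m \<kappa>m)
    qed
    also have "\<dots> = 2 powr p * ((\<integral>t. \<rho> k t \<partial>lebesgue_on ?J) + (\<integral>t. \<kappa> j t \<partial>lebesgue_on ?J))" using \<rho>i \<kappa>i by simp
    also have "\<dots> \<le> 2 powr p * (c + c)" using k j by (intro mult_left_mono) auto
    also have "\<dots> = e" by (simp add: c_def)
    finally show "(\<integral>t. R t \<partial>lebesgue_on ?J) \<le> e" .
    show "AE t in lebesgue_on ?J. v t \<in> X \<and> A (\<lambda>x. v t x - Z t x) \<le> R t"
      using vX AE_space
    proof eventually_elim
      case (elim t)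
      then have t: "t \<in> ?J" by simp
      let ?s = "\<lambda>x. \<Sum>i<m. indicat_real (D i) t * f i x"
      have v\<rho>: "A (\<lambda>x. v t x - ?s x) = \<rho> k t"
      proof (cases "r k t \<le> \<eta>")
        case True
        then have "indicat_real (D i) t = indicat_real (B i) t" for i using t by (auto simp: D_def indicator_def)
        then show ?thesis using True by (simp add: \<rho>_def r_def sk)
      next
        case False
        then have "indicat_real (D i) t = 0" for i by (auto simp: D_def)
        then show ?thesis using False by (simp add: \<rho>_def)
      qed
      have "(\<lambda>x. ?s x - Z t x) = (\<lambda>x. \<Sum>i<m. (indicat_real (D i) t - \<theta> i j t) * f i x)"
        by (simp add: Z_def sum_subtractf left_diff_distrib)
      then have s\<kappa>: "A (\<lambda>x. ?s x - Z t x) \<le> \<kappa> j t" "(\<lambda>x. ?s x - Z t x) \<in> X"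
        using K(2,3)[of "\<lambda>i. indicat_real (D i) t - \<theta> i j t"] by (simp_all add: \<kappa>_def)
      have "A (\<lambda>x. v t x - Z t x) \<le> 2 powr p * (A (\<lambda>x. v t x - ?s x) + A (\<lambda>x. ?s x - Z t x))"
        using cf_quasi[OF cf cf_diff[OF cf elim(1) K(2)[of "\<lambda>i. indicat_real (D i) t"]] s\<kappa>(2)] by (simp only: add_diff_eq diff_add_cancel)
      also have "\<dots> \<le> 2 powr p * (\<rho> k t + \<kappa> j t)" using s\<kappa>(1) unfolding v\<rho> by (intro mult_left_mono add_left_mono) auto
      also have "\<dots> \<le> R t" by (simp add: R_def)
      finally show ?case using elim(1) by simp
    qed
  qed (rule Ri, simp add: R_def)
qed

section \<open>Constant test functions\<close>

text \<open>This is the vanishing weak time derivative of a constant curve. The approximating step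
  functions take the mean of g on each cell of a grid, so their integrals telescope to G(B) - G(0) =
  0 exactly, for every k.\<close>

lemma has_curve_integral_deriv:
  fixes G g :: "real \<Rightarrow> real" and B :: nat and w :: "'a \<Rightarrow> real"
  assumes der: "\<And>t. (G has_real_derivative g t) (at t)" and cont: "continuous_on UNIV g"
    and z: "\<And>t. t \<le> 0 \<or> real B \<le> t \<Longrightarrow> G t = 0 \<and> g t = 0"
    and X: "\<And>c. (\<lambda>x. c * w x) \<in> X" and hom: "\<And>c. N (\<lambda>x. c * w x) = \<bar>c\<bar> * N w" and Nw: "0 \<le> N w"
  shows "has_curve_integral X N {0..} (\<lambda>t x. g t * w x) (\<lambda>x. 0)"
proof -
  define a where "a k i = real i / real (Suc k)" for k i :: nat
  \<comment> \<open>The mean value of g on the i-th cell of width 1/(k+1).\<close>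
  define c where "c k i = real (Suc k) * (G (a k (Suc i)) - G (a k i))" for k i
  define I where "I k i = {a k i..<a k (Suc i)}" for k i
  define \<sigma> where "\<sigma> k t = (\<Sum>i<B * Suc k. indicat_real (I k i) t * c k i)" for k t
  have a: "a k (Suc i) - a k i = 1 / real (Suc k)" for k i by (simp add: a_def add_divide_distrib diff_divide_distrib[symmetric])
  have a0: "0 \<le> a k i" for k i by (simp add: a_def)
  have amono: "a k i \<le> a k j \<longleftrightarrow> i \<le> j" "a k i < a k j \<longleftrightarrow> i < j" for k i j
    by (simp_all add: a_def divide_le_cancel divide_less_cancel)
  have aB: "a k (B * Suc k) = real B" for k unfolding a_def of_nat_mult by (rule nonzero_mult_div_cancel_right) simp
  have \<sigma>0: "\<sigma> k t = 0" if "real B \<le> t" for k t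
    unfolding \<sigma>_def
  proof (intro sum.neutral ballI)
    fix i assume "i \<in> {..<B * Suc k}"
    then have "a k (Suc i) \<le> real B" unfolding aB[of k, symmetric] amono by simp
    then show "indicat_real (I k i) t * c k i = 0" using that by (simp add: I_def)
  qed
  have \<sigma>1: "\<exists>i. t \<in> I k i \<and> \<sigma> k t = c k i" if t: "0 \<le> t" "t < real B" for k t
  proof -
    define i where "i = nat \<lfloor>t * real (Suc k)\<rfloor>"
    have i: "real i \<le> t * real (Suc k)" "t * real (Suc k) < real i + 1"
      using t by (simp_all add: i_def)
    have ti: "t \<in> I k i" using i by (simp add: I_def a_def divide_le_eq less_divide_eq)
    have "a k i < a k (B * Suc k)" using ti t unfolding aB I_def by simp
    then have iB: "i < B * Suc k" unfolding amono .
    have ind: "indicat_real (I k j) t = (if j = i then 1 else 0)" for j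
    proof (cases "j = i")
      case False
      have "t \<notin> I k j"
      proof
        assume tj: "t \<in> I k j"
        have "a k j < a k (Suc i)" "a k i < a k (Suc j)" using ti tj by (simp_all add: I_def)
        then have "j < Suc i" "i < Suc j" unfolding amono by simp_all
        then show False using False by simp
      qed
      then show ?thesis using False by simp
    qed (use ti in simp)
    have "\<sigma> k t = (\<Sum>j<B * Suc k. if j = i then c k j else 0)"
      unfolding \<sigma>_def ind by (intro sum.cong) auto
    then have "\<sigma> k t = c k i" using iB by simp
    then show ?thesis using ti by blast
  qed
  have unif: "\<exists>K. \<forall>k\<ge>K. \<forall>t\<ge>0. \<bar>g t - \<sigma> k t\<bar> \<le> e * indicat_real {0..real B} t" if e: "0 < e" for e
  proof -
    have "g x = 0" if "real B \<le> norm x" for x using z[of x] that by (cases "0 \<le> x") auto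
    from uniformly_continuous_compact_support[OF cont this e] obtain d where d: "0 < d" "d \<le> 1"
      "\<And>x h. norm h < d \<Longrightarrow> \<bar>g (x + h) - g x\<bar> < e" by metis
    obtain K :: nat where K: "1 / d < real K" using reals_Archimedean2 by blast
    have "\<bar>g t - \<sigma> k t\<bar> \<le> e * indicat_real {0..real B} t" if k: "K \<le> k" and t: "0 \<le> t" for k t
    proof (cases "t < real B")
      case False
      then show ?thesis using \<sigma>0[of t k] z[of t] e by simp
    next
      case True
      from \<sigma>1[OF t True, of k] obtain i where i: "t \<in> I k i" "\<sigma> k t = c k i" by blast
      have "a k i < a k (Suc i)" unfolding amono by simp
      \<comment> \<open>The cell mean is a value of \<open>g\<close> inside the same cell, so
        uniform continuity bounds the error at every point of the cell.\<close>
      from MVT2[OF this, of G g] der obtain \<xi> where \<xi>: "a k i < \<xi>" "\<xi> < a k (Suc i)"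
        "G (a k (Suc i)) - G (a k i) = (a k (Suc i) - a k i) * g \<xi>" by blast
      have "c k i = g \<xi>" unfolding c_def \<xi>(3) a by simp
      moreover have "\<bar>t - \<xi>\<bar> < 1 / real (Suc k)" using i(1) \<xi>(1,2) a[of k i] unfolding I_def by auto
      moreover have "1 / real (Suc k) < d"
      proof -
        have "1 / d < real (Suc k)" using K k by simp
        then show ?thesis using d(1) by (simp add: divide_less_eq mult.commute)
      qed
      ultimately have "\<bar>g (\<xi> + (t - \<xi>)) - g \<xi>\<bar> < e" using d(3)[of "t - \<xi>" \<xi>] by simp
      then show ?thesis using t True i(2) \<open>c k i = g \<xi>\<close> by simp
    qed
    then show ?thesis by blast
  qed
  define s where "s k t x = (\<Sum>i<B * Suc k. indicat_real (I k i) t * (c k i * w x))" for k t x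
  have s: "s k t x = \<sigma> k t * w x" for k t x by (simp add: s_def \<sigma>_def sum_distrib_right mult.assoc)
  have sI: "simple_curve_integral X {0..} (s k) (\<lambda>x. 0)" for k
    unfolding simple_curve_integral_def
  proof (intro exI conjI)
    show "\<forall>i<B * Suc k. I k i \<in> lmeasurable \<and> I k i \<subseteq> {0..} \<and> (\<lambda>x. c k i * w x) \<in> X"
      using X order_trans[OF a0] by (auto simp: I_def intro!: bounded_set_imp_lmeasurable)
    show "s k = (\<lambda>t x. \<Sum>i<B * Suc k. indicat_real (I k i) t * (c k i * w x))" by (simp add: s_def[abs_def])
    have "measure lebesgue (I k i) * c k i = G (a k (Suc i)) - G (a k i)" for i
    proof -
      have "a k i \<le> a k (Suc i)" unfolding amono by simp
      then have "measure lebesgue (I k i) = 1 / real (Suc k)" by (simp add: I_def a)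
      then show ?thesis by (simp add: c_def)
    qed
    then have "(\<Sum>i<B * Suc k. measure lebesgue (I k i) * (c k i * w x)) = (\<Sum>i<B * Suc k. G (a k (Suc i)) - G (a k i)) * w x" for x
      by (simp only: sum_distrib_right mult.assoc[symmetric])
    moreover have "(\<Sum>i<B * Suc k. G (a k (Suc i)) - G (a k i)) = G (a k (B * Suc k)) - G (a k 0)"
      by (rule sum_lessThan_telescope)
    moreover have "G (a k (B * Suc k)) - G (a k 0) = 0"
      using z[of 0] z[of "real B"] unfolding aB by (simp add: a_def)
    ultimately show "(\<lambda>x. 0) = (\<lambda>x. \<Sum>i<B * Suc k. measure lebesgue (I k i) * (c k i * w x))" by simp
  qed
  have Ns: "N (\<lambda>x. g t * w x - s k t x) = \<bar>g t - \<sigma> k t\<bar> * N w" for k t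
    using hom[of "g t - \<sigma> k t"] by (simp add: s left_diff_distrib)
  have zero: "(\<lambda>x. 0) \<in> X" "N (\<lambda>x. 0) = 0" using X[of 0] hom[of 0] by simp_all
  have \<sigma>m: "\<sigma> k \<in> borel_measurable lebesgue" for k
    unfolding \<sigma>_def I_def by (intro borel_measurable_sum borel_measurable_times borel_measurable_const borel_measurable_indicator) auto
  have dm: "(\<lambda>t. \<bar>g t - \<sigma> k t\<bar>) \<in> borel_measurable (lebesgue_on {0..})" for k
    using \<sigma>m[of k] continuous_lebesgue_measurable[OF cont] by (intro measurable_restrict_space1) simp
  have Ib: "integrable (lebesgue_on {0..}) (\<lambda>t. b * indicat_real {0..real B} t)" for b
  proof -
    have "integrable lebesgue (\<lambda>t. indicat_real {0..} t *\<^sub>R indicat_real {0..real B} t)"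
      by (intro integrable_mult_indicator) auto
    then show ?thesis by (simp add: integrable_restrict_space)
  qed
  show ?thesis
    unfolding has_curve_integral_def
  proof (intro conjI exI[where x = s] exI[where x = "\<lambda>k::nat. \<lambda>x. 0"] allI sI zero)
    show "strongly_measurable X N {0..} (\<lambda>t x. g t * w x)"
      unfolding strongly_measurable_def
    proof (intro conjI exI[where x = s] exI[where x = "\<lambda>k::nat. \<lambda>x. 0"] allI sI AE_I2)
      fix t :: real assume "t \<in> space (lebesgue_on {0..})"
      then have t: "0 \<le> t" by simp
      have "(\<lambda>k. \<bar>g t - \<sigma> k t\<bar>) \<longlonglongrightarrow> 0"
      proof (rule LIMSEQ_I)
        fix r :: real assume r: "0 < r"
        from unif[of "r/2"] r obtain K where K: "\<forall>k\<ge>K. \<forall>t\<ge>0. \<bar>g t - \<sigma> k t\<bar> \<le> r / 2 * indicat_real {0..real B} t" by auto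
        have "norm (\<bar>g t - \<sigma> k t\<bar> - 0) < r" if "K \<le> k" for k
        proof -
          have "\<bar>g t - \<sigma> k t\<bar> \<le> r / 2 * indicat_real {0..real B} t" using K that t by blast
          also have "\<dots> \<le> r / 2" using r by (simp add: indicator_def)
          finally show ?thesis using r by simp
        qed
        then show "\<exists>K. \<forall>k\<ge>K. norm (\<bar>g t - \<sigma> k t\<bar> - 0) < r" by blast
      qed
      then show "(\<lambda>k. N (\<lambda>x. g t * w x - s k t x)) \<longlonglongrightarrow> 0"
        unfolding Ns by (rule tendsto_mult_left_zero)
    qed (rule X)
    have bd: "\<exists>b. \<forall>t. 0 \<le> t \<longrightarrow> \<bar>g t - \<sigma> k t\<bar> \<le> b * indicat_real {0..real B} t" for k
    proof -
      have "bounded (g ` {0..real B})"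
        by (intro compact_imp_bounded compact_continuous_image continuous_on_subset[OF cont]) auto
      then obtain b where "\<forall>y\<in>g ` {0..real B}. norm y \<le> b" unfolding bounded_iff ..
      then have b: "\<bar>g t\<bar> \<le> b" if "t \<in> {0..real B}" for t using that by simp
      have "\<bar>g t - \<sigma> k t\<bar> \<le> (b + (\<Sum>i<B * Suc k. \<bar>c k i\<bar>)) * indicat_real {0..real B} t" if "0 \<le> t" for t
      proof (cases "t \<le> real B")
        case False
        then show ?thesis using \<sigma>0[of t k] z[of t] by simp
      next
        case True
        have "\<bar>\<sigma> k t\<bar> \<le> (\<Sum>i<B * Suc k. \<bar>indicat_real (I k i) t * c k i\<bar>)" unfolding \<sigma>_def by (rule sum_abs)
        also have "\<dots> \<le> (\<Sum>i<B * Suc k. \<bar>c k i\<bar>)" by (intro sum_mono) (simp add: indicator_def)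
        finally show ?thesis using True that b[of t] by simp
      qed
      then show ?thesis by blast
    qed
    show I: "integrable (lebesgue_on {0..}) (\<lambda>t. N (\<lambda>x. g t * w x - s k t x))" for k
    proof -
      from bd[of k] obtain b where b: "\<And>t. 0 \<le> t \<Longrightarrow> \<bar>g t - \<sigma> k t\<bar> \<le> b * indicat_real {0..real B} t" by blast
      have "integrable (lebesgue_on {0..}) (\<lambda>t. \<bar>g t - \<sigma> k t\<bar>)"
        by (rule Bochner_Integration.integrable_bound[OF Ib[of b] dm]) (use b in \<open>auto intro!: AE_I2 intro: order_trans[OF _ abs_ge_self]\<close>)
      then show ?thesis unfolding Ns by simp
    qed
    show "(\<lambda>k. \<integral>t. N (\<lambda>x. g t * w x - s k t x) \<partial>lebesgue_on {0..}) \<longlonglongrightarrow> 0"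
    proof (rule LIMSEQ_I)
      fix r :: real assume r: "0 < r"
      define J where "J = (\<integral>t. indicat_real {0..real B} t \<partial>lebesgue_on {0..})"
      have J: "0 \<le> J" by (simp add: J_def)
      define e where "e = r / (2 * (J * N w + 1))"
      have JN: "0 \<le> J * N w" using J Nw by simp
      have e: "0 < e" using r JN by (simp add: e_def)
      from unif[OF e] obtain K where K: "\<forall>k\<ge>K. \<forall>t\<ge>0. \<bar>g t - \<sigma> k t\<bar> \<le> e * indicat_real {0..real B} t" by blast
      have "norm ((\<integral>t. N (\<lambda>x. g t * w x - s k t x) \<partial>lebesgue_on {0..}) - 0) < r" if "K \<le> k" for k
      proof -
        have "(\<integral>t. N (\<lambda>x. g t * w x - s k t x) \<partial>lebesgue_on {0..}) \<le> (\<integral>t. (e * N w) * indicat_real {0..real B} t \<partial>lebesgue_on {0..})"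
        proof (rule integral_mono[OF I Ib])
          fix t :: real assume "t \<in> space (lebesgue_on {0..})"
          then have "\<bar>g t - \<sigma> k t\<bar> * N w \<le> (e * indicat_real {0..real B} t) * N w" using K that Nw by (intro mult_right_mono) auto
          then show "N (\<lambda>x. g t * w x - s k t x) \<le> (e * N w) * indicat_real {0..real B} t" unfolding Ns by (simp add: ac_simps)
        qed
        also have "\<dots> = e * (J * N w)" by (simp add: J_def ac_simps)
        also have "\<dots> \<le> e * (J * N w + 1)" using e by simp
        also have "\<dots> = r / 2" using JN by (simp add: e_def field_simps)
        finally have "(\<integral>t. N (\<lambda>x. g t * w x - s k t x) \<partial>lebesgue_on {0..}) < r" using r by simp
        moreover have "0 \<le> (\<integral>t. N (\<lambda>x. g t * w x - s k t x) \<partial>lebesgue_on {0..})"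
          unfolding Ns using Nw by simp
        ultimately show ?thesis by simp
      qed
      then show "\<exists>K. \<forall>k\<ge>K. norm ((\<integral>t. N (\<lambda>x. g t * w x - s k t x) \<partial>lebesgue_on {0..}) - 0) < r" by blast
    qed
    show "(\<lambda>k. N (\<lambda>x. 0 - 0)) \<longlonglongrightarrow> 0" using zero by simp
  qed
qed

text \<open>Simple curves live on sets of finite measure, so the constant is approximated by its
  restrictions to [0, k], which agree with it eventually at each time.\<close>

lemma strongly_measurable_const:
  assumes X: "\<And>c. (\<lambda>x. c * w x) \<in> X" and hom: "\<And>c. N (\<lambda>x. c * w x) = \<bar>c\<bar> * N w"
  shows "strongly_measurable X N {0..} (\<lambda>t. w)"
  unfolding strongly_measurable_def
proof (intro conjI exI[where x = "\<lambda>k t x. indicat_real {0..real k} t * w x"] exI[where x = "\<lambda>k x. real k * w x"] allI AE_I2)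
  show "w \<in> X" using X[of 1] by simp
  show "simple_curve_integral X {0..} (\<lambda>t x. indicat_real {0..real k} t * w x) (\<lambda>x. real k * w x)" for k
    unfolding simple_curve_integral_def using X[of 1]
    by (intro exI[where x = "1::nat"] exI[where x = "\<lambda>_. {0..real k}"] exI[where x = "\<lambda>_. w"]) auto
  fix t :: real assume "t \<in> space (lebesgue_on {0..})"
  then have t: "0 \<le> t" by simp
  show "(\<lambda>k. N (\<lambda>x. w x - indicat_real {0..real k} t * w x)) \<longlonglongrightarrow> 0"
  proof (rule tendsto_eventually)
    obtain K :: nat where K: "t < real K" using reals_Archimedean2 by blast
    have "N (\<lambda>x. w x - indicat_real {0..real k} t * w x) = 0" if "K \<le> k" for k
      using K that t hom[of 0] by simp
    then show "\<forall>\<^sub>F k in sequentially. N (\<lambda>x. w x - indicat_real {0..real k} t * w x) = 0"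
      by (auto simp: eventually_sequentially)
  qed
qed

lemma Lp_loc_curve_const:
  assumes "\<And>c. (\<lambda>x. c * w x) \<in> X" "\<And>c. N (\<lambda>x. c * w x) = \<bar>c\<bar> * N w"
  shows "Lp_loc_curve r X N {0..} (\<lambda>t. w)"
  unfolding Lp_loc_curve_def
proof (intro conjI allI impI strongly_measurable_const[where X = X and N = N, OF assms])
  fix J :: "real set" assume "compact J"
  then have "finite_measure (lebesgue_on J)" by (intro finite_measure_lebesgue_on lmeasurable_compact)
  then show "integrable (lebesgue_on J) (\<lambda>t. N w powr r)" by (rule finite_measure.integrable_const)
qed

lemma Lp_norm_scale: "1 \<le> p \<Longrightarrow> w \<in> Lp_hyp p \<Longrightarrow> Lp_norm p (\<lambda>x. c * w x) = \<bar>c\<bar> * Lp_norm p w"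
  using Lp_hyp_scale[of w p c] by (simp add: Lp_norm_eq powr_mult powr_powr)

lemma W1p_norm_scale: "1 \<le> p \<Longrightarrow> w \<in> W1p_hyp p \<Longrightarrow> W1p_norm p (\<lambda>x. c * w x) = \<bar>c\<bar> * W1p_norm p w"
  using Lp_hyp_scale[OF W1p_hypD(1)[of w p], of c] W1p_hyp_scale[of w p c] 
  by (simp add: W1p_norm_eq powr_powr distrib_left[symmetric] powr_mult)

text \<open>Constancy in time gives derivative 0 and continuity; the zero boundary condition is
  supplied by \<open>W1p_hyp_subset_W1p0\<close>.\<close>

lemma test_function_const:
  fixes w :: "'a::euclidean_space \<Rightarrow> real"
  assumes p: "1 \<le> p" and q: "0 < q" and w: "w \<in> W1p_hyp p" "w \<in> Lp_hyp (1 + 1 / q)"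
  shows "test_function p q {0..} (\<lambda>t. w) (\<lambda>t x. 0)"
proof -
  let ?X = "Lp_hyp (1 + 1 / q) :: ('a \<Rightarrow> real) set" and ?N = "Lp_norm (1 + 1 / q) :: ('a \<Rightarrow> real) \<Rightarrow> real"
  have r: "1 \<le> 1 + 1 / q" using q by simp
  have X: "(\<lambda>x. c * w x) \<in> ?X" for c using Lp_hyp_scale[OF w(2)] by blast
  have hom: "?N (\<lambda>x. c * w x) = \<bar>c\<bar> * ?N w" for c by (rule Lp_norm_scale[OF r w(2)])
  have N0: "0 \<le> ?N w" by (simp add: Lp_norm_def)
  have zX: "(\<lambda>x. c * 0) \<in> ?X" and zN: "?N (\<lambda>x. c * 0) = \<bar>c\<bar> * ?N (\<lambda>x. 0)" for c :: real
    using X[of 0] hom[of 0] by simp_all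
  have zero: "has_curve_integral ?X ?N {0..} (\<lambda>t x. 0) (\<lambda>x. 0)"
    using has_curve_integral_deriv[of "\<lambda>t. 0" "\<lambda>t. 0" 0 w ?X ?N, OF _ _ _ X hom N0] by simp
  have "W1r_loc_curve (1 + 1 / q) ?X ?N {0..} (\<lambda>t. w) (\<lambda>t x. 0)"
    unfolding W1r_loc_curve_def
  proof (intro conjI ballI)
    show "Lp_loc_curve (1 + 1 / q) ?X ?N {0..} (\<lambda>t. w)" by (rule Lp_loc_curve_const[where X = ?X and N = ?N, OF X hom])
    show "Lp_loc_curve (1 + 1 / q) ?X ?N {0..} (\<lambda>t x. 0)" by (rule Lp_loc_curve_const[where X = ?X and N = ?N, OF zX zN])
    fix \<eta> :: "real \<Rightarrow> real" assume "\<eta> \<in> Cc_smooth (interior {0..})"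
    then obtain K where Ck: "\<And>k. Ck k \<eta>" and K: "compact K" "K \<subseteq> {0<..}" "\<And>t. t \<notin> K \<Longrightarrow> \<eta> t = 0"
      unfolding Cc_smooth_def by auto
    have diff: "\<eta> differentiable (at t)" for t using Ck[of 1] by simp
    have der: "(\<eta> has_real_derivative deriv \<eta> t) (at t)" for t
      using diff[of t] by (simp add: DERIV_deriv_iff_real_differentiable)
    have "frechet_derivative \<eta> (at t) 1 = deriv \<eta> t" for t
      using frechet_derivative_at[OF der[of t, unfolded has_field_derivative_def]] by (metis mult.right_neutral)
    then have cont: "continuous_on UNIV (deriv \<eta>)" using Ck[of "Suc 0"] by simp
    have d0: "deriv \<eta> t = 0" if "t \<notin> K" for t
    proof -
      have "\<forall>\<^sub>F s in nhds t. s \<in> - K" using K(1) that by (intro eventually_nhds_in_open) (auto simp: compact_imp_closed open_Compl)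
      then have "\<forall>\<^sub>F s in nhds t. \<eta> s = 0" by eventually_elim (use K(3) in auto)
      then have "deriv \<eta> t = deriv (\<lambda>s. 0) t" by (intro deriv_cong_ev) auto
      then show ?thesis by simp
    qed
    \<comment> \<open>A compact support inside the open half-line: \<eta> vanishes at both ends of
      [0, B], as the telescoping sum requires.\<close>
    obtain b where b: "\<And>t. t \<in> K \<Longrightarrow> \<bar>t\<bar> \<le> b" using compact_imp_bounded[OF K(1)] unfolding bounded_iff by auto
    obtain B :: nat where B: "b < real B" using reals_Archimedean2 by blast
    have nK: "t \<notin> K" if "t \<le> 0 \<or> real B \<le> t" for t using that K(2) b[of t] B by force
    have z: "\<eta> t = 0 \<and> deriv \<eta> t = 0" if "t \<le> 0 \<or> real B \<le> t" for t using nK[OF that] K(3) d0 by simp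
    have "has_curve_integral ?X ?N {0..} (\<lambda>t x. deriv \<eta> t * w x) (\<lambda>x. 0)"
      by (rule has_curve_integral_deriv[where w = w and X = ?X and N = ?N, OF der cont z X hom N0])
    then show "\<exists>V. has_curve_integral ?X ?N {0..} (\<lambda>t x. deriv \<eta> t * w x) V \<and>
        has_curve_integral ?X ?N {0..} (\<lambda>t x. \<eta> t * 0) (\<lambda>x. - V x)"
      using zero by (intro exI[where x = "\<lambda>x. 0"]) simp
  qed
  moreover have "curve_continuous ?X ?N {0..} (\<lambda>t. w)"
    using w(2) zN[of 0] unfolding curve_continuous_def by simp
  moreover have "Lp_loc_curve p (W1p0_hyp p) (W1p_norm p) {0..} (\<lambda>t. w)"
    by (rule Lp_loc_curve_const[where X = "W1p0_hyp p"])
      (use W1p_hyp_scale[OF w(1)] W1p_hyp_subset_W1p0[OF p] W1p_norm_scale[OF p w(1)] in auto)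
  ultimately show ?thesis by (simp add: test_function_def)
qed

section \<open>The flux\<close>

definition flux :: "real \<Rightarrow> ('a::euclidean_space \<Rightarrow> real) \<Rightarrow> ('a \<Rightarrow> real) \<Rightarrow> real" where
  "flux p v w = (\<integral>x. hyp_norm x (hyp_grad v x) powr (p - 2) * hyp_inner x (hyp_grad v x) (hyp_grad w x) \<partial>hyp_measure)"

text \<open>For p < 2 the weight is singular where a vanishes; there the convention
  \<open>0 powr (p - 2) = 0\<close> makes both sides 0.\<close>

lemma hyp_norm_powr_inner_self: "hyp_norm x a powr (p - 2) * hyp_inner x a a = hyp_norm x a powr p"
proof (cases "hyp_norm x a = 0")
  case False
  have "hyp_inner x a a = hyp_norm x a powr 2"
    by (simp add: hyp_norm_eq hyp_inner_eq power_mult_distrib dot_square_norm)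
  then show ?thesis using powr_add[of "hyp_norm x a" "p - 2" 2, symmetric] by simp
qed (simp add: hyp_norm_def)

lemma hyp_inner_le: "\<bar>hyp_norm x a powr (p - 2) * hyp_inner x a b\<bar> \<le> hyp_norm x a powr (p - 1) * hyp_norm x b"
proof (cases "hyp_norm x a = 0")
  case False
  have "\<bar>hyp_inner x a b\<bar> \<le> hyp_norm x a * hyp_norm x b"
    using mult_left_mono[OF Cauchy_Schwarz_ineq2[of a b], of "(hyp_factor x)\<^sup>2"]
    by (simp add: hyp_norm_eq hyp_inner_eq abs_mult power2_eq_square ac_simps)
  then have "hyp_norm x a powr (p - 2) * \<bar>hyp_inner x a b\<bar> \<le> hyp_norm x a powr (p - 2) * (hyp_norm x a * hyp_norm x b)"
    by (intro mult_left_mono) auto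
  also have "\<dots> = hyp_norm x a powr (p - 1) * hyp_norm x b"
    using False powr_add[of "hyp_norm x a" "p - 2" 1] by (simp add: mult.assoc)
  finally show ?thesis by (simp add: abs_mult)
qed simp

text \<open>For the lower bound, the second argument is written as v + (w - v): the first part gives
  the full energy of v, and Young's inequality with parameter 1/2 lets the second part take away at
  most half of it plus a multiple of the energy of w - v.\<close>

lemma flux_bounds:
  fixes v w :: "'a::euclidean_space \<Rightarrow> real"
  assumes p: "1 \<le> p" and v: "v \<in> W1p_hyp p" and w: "w \<in> W1p_hyp p"
  shows "\<bar>flux p v w\<bar> \<le> grad_energy p v + grad_energy p w"
    and "flux p v w \<ge> grad_energy p v / 2 - (1/2) powr (1 - p) * grad_energy p (\<lambda>x. w x - v x)"
proof -
  let ?a = "hyp_grad v" and ?b = "hyp_grad w"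
  note D = W1p_hypD[OF v] W1p_hypD[OF w]
  let ?F = "\<lambda>x. hyp_norm x (?a x) powr (p - 2) * hyp_inner x (?a x) (?b x)"
  have Fm: "?F \<in> borel_measurable hyp_measure"
    using D(4) borel_measurable_inner[OF D(3) D(8)] unfolding hyp_inner_eq by measurable
  have Fb: "\<bar>?F x\<bar> \<le> hyp_norm x (?a x) powr p + hyp_norm x (?b x) powr p" for x
    using hyp_inner_le[of x "?a x" p "?b x"] powr_young[of "hyp_norm x (?a x)" "hyp_norm x (?b x)" p 1] p by simp
  have I: "integrable hyp_measure (\<lambda>x. hyp_norm x (?a x) powr p + hyp_norm x (?b x) powr p)" using D(5,10) by simp
  have Fi: "integrable hyp_measure ?F"
    by (rule Bochner_Integration.integrable_bound[OF I Fm]) (use Fb in \<open>auto intro!: AE_I2 intro: order_trans[OF _ abs_ge_self]\<close>)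
  have "\<bar>flux p v w\<bar> \<le> (\<integral>x. \<bar>?F x\<bar> \<partial>hyp_measure)" unfolding flux_def by (rule integral_abs_bound)
  also have "\<dots> \<le> (\<integral>x. hyp_norm x (?a x) powr p + hyp_norm x (?b x) powr p \<partial>hyp_measure)"
    using Fi I Fb by (intro integral_mono) auto
  also have "\<dots> = grad_energy p v + grad_energy p w" using D(5,10) by (simp add: grad_energy_def)
  finally show "\<bar>flux p v w\<bar> \<le> grad_energy p v + grad_energy p w" .
  have g: "hyp_weak_grad (\<lambda>x. w x - v x) (\<lambda>x. ?b x - ?a x)"
    using hyp_weak_grad_linear[OF D(7) D(2), of 1 "-1"] by simp
  have wv: "(\<lambda>x. w x - v x) \<in> W1p_hyp p" by (rule cf_diff[OF convex_functional_grad_energy[OF p] w v])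
  have Id: "integrable hyp_measure (\<lambda>x. hyp_norm x (?b x - ?a x) powr p)"
  proof -
    have m: "(\<lambda>x. hyp_norm x (?b x - ?a x)) \<in> borel_measurable hyp_measure"
      by (rule hyp_norm_measurable[OF hyp_weak_grad_measurable(2)[OF g]])
    have "AE x in hyp_measure. hyp_norm x (hyp_grad (\<lambda>x. w x - v x) x) powr p = hyp_norm x (?b x - ?a x) powr p"
      using hyp_grad_AE[OF g] by eventually_elim simp
    from integrable_cong_AE_imp[OF W1p_hypD(5)[OF wv] _ this] show ?thesis using m by simp
  qed
  have low: "hyp_norm x (?a x) powr p / 2 - (1/2) powr (1 - p) * hyp_norm x (?b x - ?a x) powr p \<le> ?F x" for x
  proof -
    have "?F x = hyp_norm x (?a x) powr p + hyp_norm x (?a x) powr (p - 2) * hyp_inner x (?a x) (?b x - ?a x)"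
      using hyp_norm_powr_inner_self[of x "?a x" p] by (simp add: hyp_inner_eq inner_diff_right right_diff_distrib)
    moreover have "\<bar>hyp_norm x (?a x) powr (p - 2) * hyp_inner x (?a x) (?b x - ?a x)\<bar>
      \<le> 1/2 * hyp_norm x (?a x) powr p + (1/2) powr (1 - p) * hyp_norm x (?b x - ?a x) powr p"
      using hyp_inner_le[of x "?a x" p "?b x - ?a x"] powr_young[of "hyp_norm x (?a x)" "hyp_norm x (?b x - ?a x)" p "1/2"] p by simp
    ultimately show ?thesis by linarith
  qed
  have "grad_energy p v / 2 - (1/2) powr (1 - p) * grad_energy p (\<lambda>x. w x - v x)
      = (\<integral>x. hyp_norm x (?a x) powr p / 2 - (1/2) powr (1 - p) * hyp_norm x (?b x - ?a x) powr p \<partial>hyp_measure)"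
    using D(5) Id by (simp add: grad_energy_eq[OF g] grad_energy_def[of p v])
  also have "\<dots> \<le> flux p v w" unfolding flux_def using D(5) Id Fi low by (intro integral_mono) auto
  finally show "flux p v w \<ge> grad_energy p v / 2 - (1/2) powr (1 - p) * grad_energy p (\<lambda>x. w x - v x)" .
qed

section \<open>The flux as a derivative of the energy\<close>

lemma DERIV_norm_powr:
  fixes a b :: "'a::euclidean_space"
  assumes p: "1 < p"
  shows "((\<lambda>s. norm (a + s *\<^sub>R b) powr p) has_real_derivative p * norm a powr (p - 2) * (a \<bullet> b)) (at 0)"
proof (cases "a = 0")
  case True
  \<comment> \<open>At a = 0 the function is a multiple of |s|^p, whose derivative at 0 vanishes
    because p > 1.\<close>
  have "((\<lambda>s. \<bar>s\<bar> powr p * norm b powr p) has_real_derivative dabs_powr p 0 * norm b powr p) (at 0)"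
    by (rule DERIV_cmult_right[OF DERIV_abs_powr[OF p]])
  then show ?thesis using True p by (simp add: dabs_powr_def powr_mult)
next
  case False
  have n: "norm z powr r = (z \<bullet> z) powr (r / 2)" for z :: 'a and r
    by (simp add: norm_eq_sqrt_inner powr_half_sqrt[symmetric] powr_powr)
  have eq: "(a + s *\<^sub>R b) \<bullet> (a + s *\<^sub>R b) = a \<bullet> a + 2 * s * (a \<bullet> b) + s * s * (b \<bullet> b)" for s
    by (simp add: inner_add_left inner_add_right inner_commute algebra_simps)
  have pos: "0 < a \<bullet> a" using False by simp
  have "((\<lambda>s. (a \<bullet> a + 2 * s * (a \<bullet> b) + s * s * (b \<bullet> b)) powr (p/2)) has_real_derivative
      (p/2) * (a \<bullet> a) powr (p/2 - 1) * (2 * (a \<bullet> b))) (at 0)"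
    using pos by (auto intro!: derivative_eq_intros)
  moreover have "p * norm a powr (p - 2) * (a \<bullet> b) = (p/2) * (a \<bullet> a) powr (p/2 - 1) * (2 * (a \<bullet> b))"
    unfolding n by (simp add: diff_divide_distrib)
  moreover have "(\<lambda>s. norm (a + s *\<^sub>R b) powr p) = (\<lambda>s. (a \<bullet> a + 2 * s * (a \<bullet> b) + s * s * (b \<bullet> b)) powr (p/2))"
    by (simp only: n eq)
  ultimately show ?thesis by (simp only:)
qed

text \<open>An integrable majorant for the difference quotients of the energy density, uniform in s.
  The tangent inequality is used at both end values, one for each sign of the difference.\<close>

lemma hyp_norm_powr_diff_bound:
  assumes p: "1 \<le> p" and s: "0 < s" "s \<le> 1"
  shows "\<bar>hyp_norm x (a + s *\<^sub>R b) powr p - hyp_norm x a powr p\<bar>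
    \<le> s * (p * (2 powr p + 1) * (hyp_norm x a powr p + hyp_norm x b powr p))"
proof -
  define X m n where "X = hyp_norm x (a + s *\<^sub>R b)" and "m = hyp_norm x a" and "n = hyp_norm x b"
  have pos: "0 \<le> X" "0 \<le> m" "0 \<le> n" by (simp_all add: X_def m_def n_def)
  have "X \<le> m + s * n" using hyp_norm_triangle[of x a "s *\<^sub>R b"] s by (simp add: X_def m_def n_def hyp_norm_scale)
  moreover have "m \<le> X + s * n"
    using hyp_norm_triangle[of x "a + s *\<^sub>R b" "(- s) *\<^sub>R b"] s unfolding hyp_norm_scale by (simp add: X_def m_def n_def)
  ultimately have Xm: "X - m \<le> s * n" "m - X \<le> s * n" by auto
  have "s * n \<le> 1 * n" using s pos by (intro mult_right_mono) auto
  then have "X \<le> m + n" using Xm(1) by simp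
  then have "X powr p \<le> (m + n) powr p" using pos p by (intro powr_mono2) auto
  also have "\<dots> \<le> 2 powr p * (m powr p + n powr p)" using pos p by (intro powr_add_le) auto
  finally have Xp: "X powr p \<le> 2 powr p * (m powr p + n powr p)" .
  have one: "1 \<le> 2 powr p" using p by (intro ge_one_powr_ge_zero) auto
  have bd: "y powr (p - 1) * n \<le> (2 powr p + 1) * (m powr p + n powr p)"
    if "0 \<le> y" "y powr p \<le> 2 powr p * (m powr p + n powr p)" for y
  proof -
    have "y powr (p - 1) * n \<le> y powr p + n powr p" using powr_young[of y n p 1] that pos p by simp
    moreover have "(2 powr p + 1) * (m powr p + n powr p) = 2 powr p * (m powr p + n powr p) + (m powr p + n powr p)"
      by (simp add: distrib_right)
    moreover have "0 \<le> m powr p" by simp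
    ultimately show ?thesis using that(2) by linarith
  qed
  have 1: "X powr p - m powr p \<le> s * (p * ((2 powr p + 1) * (m powr p + n powr p)))"
  proof -
    have "X powr p - m powr p \<le> p * X powr (p - 1) * (X - m)" using powr_tangent[of p m X] p pos by (simp add: algebra_simps)
    also have "\<dots> \<le> p * X powr (p - 1) * (s * n)" using Xm p by (intro mult_left_mono) auto
    also have "\<dots> = s * (p * (X powr (p - 1) * n))" by simp
    also have "\<dots> \<le> s * (p * ((2 powr p + 1) * (m powr p + n powr p)))" using s p bd[OF pos(1) Xp] by (intro mult_left_mono) auto
    finally show ?thesis .
  qed
  have mp: "m powr p \<le> 2 powr p * (m powr p + n powr p)"
  proof -
    have "m powr p \<le> 1 * (m powr p + n powr p)" by simp
    also have "\<dots> \<le> 2 powr p * (m powr p + n powr p)" using one by (intro mult_right_mono) auto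
    finally show ?thesis .
  qed
  have 2: "m powr p - X powr p \<le> s * (p * ((2 powr p + 1) * (m powr p + n powr p)))"
  proof -
    have "m powr p - X powr p \<le> p * m powr (p - 1) * (m - X)" using powr_tangent[of p X m] p pos by (simp add: algebra_simps)
    also have "\<dots> \<le> p * m powr (p - 1) * (s * n)" using Xm p by (intro mult_left_mono) auto
    also have "\<dots> = s * (p * (m powr (p - 1) * n))" by simp
    also have "\<dots> \<le> s * (p * ((2 powr p + 1) * (m powr p + n powr p)))" using s p bd[OF pos(2) mp] by (intro mult_left_mono) auto
    finally show ?thesis .
  qed
  show ?thesis using 1 2 unfolding X_def[symmetric] m_def[symmetric] n_def[symmetric] by (simp add: mult.assoc abs_le_iff)
qed

text \<open>The flux is a Gateaux derivative of the energy, which makes it measurable in time.\<close>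

lemma flux_limit:
  fixes v w :: "'a::euclidean_space \<Rightarrow> real"
  assumes p: "1 < p" and v: "v \<in> W1p_hyp p" and w: "w \<in> W1p_hyp p"
  shows "(\<lambda>j. real (Suc j) / p * (grad_energy p (\<lambda>x. v x + 1 / real (Suc j) * w x) - grad_energy p v)) \<longlonglongrightarrow> flux p v w"
proof -
  let ?a = "hyp_grad v" and ?b = "hyp_grad w"
  note D = W1p_hypD[OF v] W1p_hypD[OF w]
  have p1: "1 \<le> p" using p by simp
  define s where "s j = 1 / real (Suc j)" for j
  have s: "0 < s j" "s j \<le> 1" for j by (simp_all add: s_def)
  have sl: "filterlim s (at 0) sequentially"
    unfolding filterlim_at using s LIMSEQ_inverse_real_of_nat
    by (auto simp: s_def[abs_def] inverse_eq_divide intro!: always_eventually)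
  have g: "hyp_weak_grad (\<lambda>x. v x + s j * w x) (\<lambda>x. ?a x + s j *\<^sub>R ?b x)" for j
    using hyp_weak_grad_linear[OF D(2) D(7), of 1 "s j"] by simp
  let ?F = "\<lambda>j x. (hyp_norm x (?a x + s j *\<^sub>R ?b x) powr p - hyp_norm x (?a x) powr p) / s j / p"
  have m: "(\<lambda>x. hyp_norm x (?a x + s j *\<^sub>R ?b x)) \<in> borel_measurable hyp_measure" for j
    by (rule hyp_norm_measurable[OF hyp_weak_grad_measurable(2)[OF g]])
  have X: "(\<lambda>x. v x + s j * w x) \<in> W1p_hyp p" for j
    using cf_lin[OF convex_functional_grad_energy[OF p1] v w, of 1 "s j"] by simp
  have I: "integrable hyp_measure (\<lambda>x. hyp_norm x (?a x + s j *\<^sub>R ?b x) powr p)" for j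
  proof -
    have "AE x in hyp_measure. hyp_norm x (hyp_grad (\<lambda>x. v x + s j * w x) x) powr p = hyp_norm x (?a x + s j *\<^sub>R ?b x) powr p"
      using hyp_grad_AE[OF g[of j]] by eventually_elim simp
    from integrable_cong_AE_imp[OF W1p_hypD(5)[OF X[of j]] _ this] show ?thesis using m[of j] by simp
  qed
  have "(\<lambda>j. \<integral>x. ?F j x \<partial>hyp_measure) \<longlonglongrightarrow> flux p v w"
    unfolding flux_def
  proof (rule integral_dominated_convergence)
    show "(\<lambda>x. hyp_norm x (?a x) powr (p - 2) * hyp_inner x (?a x) (?b x)) \<in> borel_measurable hyp_measure"
      using D(4) borel_measurable_inner[OF D(3) D(8)] unfolding hyp_inner_eq by measurable
    show "?F j \<in> borel_measurable hyp_measure" for j using m[of j] D(4) by measurable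
    show "integrable hyp_measure (\<lambda>x. (2 powr p + 1) * (hyp_norm x (?a x) powr p + hyp_norm x (?b x) powr p))"
      using D(5,10) by simp
    show "AE x in hyp_measure. norm (?F j x) \<le> (2 powr p + 1) * (hyp_norm x (?a x) powr p + hyp_norm x (?b x) powr p)" for j
    proof (rule AE_I2)
      fix x :: 'a
      have "\<bar>hyp_norm x (?a x + s j *\<^sub>R ?b x) powr p - hyp_norm x (?a x) powr p\<bar> / s j / p
          \<le> s j * (p * (2 powr p + 1) * (hyp_norm x (?a x) powr p + hyp_norm x (?b x) powr p)) / s j / p"
        using s[of j] p by (intro divide_right_mono hyp_norm_powr_diff_bound) auto
      also have "\<dots> = (2 powr p + 1) * (hyp_norm x (?a x) powr p + hyp_norm x (?b x) powr p)" using s(1)[of j] p by simp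
      finally show "norm (?F j x) \<le> (2 powr p + 1) * (hyp_norm x (?a x) powr p + hyp_norm x (?b x) powr p)"
        using s[of j] p by simp
    qed
    show "AE x in hyp_measure. (\<lambda>j. ?F j x) \<longlonglongrightarrow> hyp_norm x (?a x) powr (p - 2) * hyp_inner x (?a x) (?b x)"
    proof (rule AE_I2)
      fix x :: 'a assume "x \<in> space hyp_measure"
      define f where "f = \<bar>hyp_factor x\<bar>"
      have "((\<lambda>s. f powr p * norm (?a x + s *\<^sub>R ?b x) powr p) has_real_derivative f powr p * (p * norm (?a x) powr (p - 2) * (?a x \<bullet> ?b x))) (at 0)"
        by (rule DERIV_cmult[OF DERIV_norm_powr[OF p]])
      moreover have "f powr p * norm (?a x + s *\<^sub>R ?b x) powr p = hyp_norm x (?a x + s *\<^sub>R ?b x) powr p" for s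
        by (simp add: hyp_norm_eq f_def powr_mult)
      moreover have "f powr p = f powr (p - 2) * (hyp_factor x)\<^sup>2"
      proof (cases "f = 0")
        case False
        have "(hyp_factor x)\<^sup>2 = f powr 2" by (simp add: f_def)
        then show ?thesis using False powr_add[of f "p - 2" 2, symmetric] by simp
      qed (simp add: f_def)
      then have "f powr p * (p * norm (?a x) powr (p - 2) * (?a x \<bullet> ?b x))
          = p * (hyp_norm x (?a x) powr (p - 2) * hyp_inner x (?a x) (?b x))"
        by (simp add: hyp_norm_eq hyp_inner_eq f_def powr_mult)
      ultimately have "((\<lambda>s. hyp_norm x (?a x + s *\<^sub>R ?b x) powr p) has_real_derivative
          p * (hyp_norm x (?a x) powr (p - 2) * hyp_inner x (?a x) (?b x))) (at 0)" by simp
      from filterlim_compose[OF this[unfolded DERIV_def] sl]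
      have "(\<lambda>j. (hyp_norm x (?a x + s j *\<^sub>R ?b x) powr p - hyp_norm x (?a x) powr p) / s j)
          \<longlonglongrightarrow> p * (hyp_norm x (?a x) powr (p - 2) * hyp_inner x (?a x) (?b x))" by simp
      from tendsto_divide[OF this tendsto_const[of p]] p
      show "(\<lambda>j. ?F j x) \<longlonglongrightarrow> hyp_norm x (?a x) powr (p - 2) * hyp_inner x (?a x) (?b x)" by simp
    qed
  qed
  moreover have "(\<integral>x. ?F j x \<partial>hyp_measure) = real (Suc j) / p * (grad_energy p (\<lambda>x. v x + 1 / real (Suc j) * w x) - grad_energy p v)" for j
  proof -
    have "(\<integral>x. ?F j x \<partial>hyp_measure) = (grad_energy p (\<lambda>x. v x + s j * w x) - grad_energy p v) / s j / p"
      using I[of j] D(5) by (simp add: grad_energy_eq[OF g] grad_energy_def[of p v])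
    then show ?thesis by (simp add: s_def)
  qed
  ultimately show ?thesis by simp
qed

lemma W1p_norm_ge:
  "1 \<le> p \<Longrightarrow> 0 \<le> W1p_norm p f" "1 \<le> p \<Longrightarrow> grad_energy p f \<le> W1p_norm p f powr p"
  using Lp_int_nonneg[of p f] by (simp_all add: W1p_norm_powr) (simp add: W1p_norm_def)

text \<open>Each difference quotient of the energy is a functional of the curve v plus a constant
  multiple of w, hence measurable in time; the flux is their almost everywhere limit and is bounded
  by two energies.\<close>

lemma flux_integrable:
  fixes v :: "real \<Rightarrow> 'a::euclidean_space \<Rightarrow> real"
  assumes p: "1 < p" and v: "Lp_loc_curve p (W1p_hyp p) (W1p_norm p) {0..} v" and w: "w \<in> W1p_hyp p" and st: "0 \<le> s"
  shows "integrable (lebesgue_on {s..t}) (\<lambda>\<tau>. grad_energy p (v \<tau>))"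
    "integrable (lebesgue_on {s..t}) (\<lambda>\<tau>. flux p (v \<tau>) w)"
    "(\<lambda>\<tau>. grad_energy p (\<lambda>x. w x - v \<tau> x)) \<in> borel_measurable (lebesgue_on {s..t})"
proof -
  have p1: "1 \<le> p" using p by simp
  note cf = convex_functional_grad_energy[OF p1, where 'a = 'a]
  have sm: "strongly_measurable (W1p_hyp p) (W1p_norm p) {0..} v" using v by (simp add: Lp_loc_curve_def)
  have sub: "{s..t} \<subseteq> {0..}" using st by auto
  have I0: "{0::real..} \<in> sets lebesgue" by auto
  have mc: "(\<lambda>\<tau>. grad_energy p (\<lambda>x. v \<tau> x + c * w x)) \<in> borel_measurable (lebesgue_on {0..})" for c
    by (rule strongly_measurable_functional[OF sm I0 cf, where c = "\<lambda>\<tau> x. c * w x"])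
      (use W1p_norm_ge[OF p1] cf_scale[OF cf w] in auto)
  have m0: "(\<lambda>\<tau>. grad_energy p (v \<tau>)) \<in> borel_measurable (lebesgue_on {0..})" using mc[of 0] by simp
  have vX: "AE \<tau> in lebesgue_on {0..}. v \<tau> \<in> W1p_hyp p" using sm by (simp add: strongly_measurable_def)
  have fm: "(\<lambda>\<tau>. flux p (v \<tau>) w) \<in> borel_measurable (lebesgue_on {0..})"
  proof (rule measurable_AE_limit[OF I0])
    show "(\<lambda>\<tau>. real (Suc j) / p * (grad_energy p (\<lambda>x. v \<tau> x + 1 / real (Suc j) * w x) - grad_energy p (v \<tau>))) \<in> borel_measurable (lebesgue_on {0..})" for j
      by (intro borel_measurable_times borel_measurable_diff borel_measurable_const mc m0)
    show "AE \<tau> in lebesgue_on {0..}. (\<lambda>j. real (Suc j) / p * (grad_energy p (\<lambda>x. v \<tau> x + 1 / real (Suc j) * w x) - grad_energy p (v \<tau>))) \<longlonglongrightarrow> flux p (v \<tau>) w"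
      using vX by eventually_elim (rule flux_limit[OF p _ w])
  qed
  have vXJ: "AE \<tau> in lebesgue_on {s..t}. v \<tau> \<in> W1p_hyp p"
    using vX st by (auto simp: AE_restrict_space_iff elim!: eventually_mono)
  have NI: "integrable (lebesgue_on {s..t}) (\<lambda>\<tau>. W1p_norm p (v \<tau>) powr p)"
    using v st unfolding Lp_loc_curve_def by auto
  show EI: "integrable (lebesgue_on {s..t}) (\<lambda>\<tau>. grad_energy p (v \<tau>))"
    by (rule Bochner_Integration.integrable_bound[OF NI measurable_restrict_mono[OF m0 sub]])
      (simp add: W1p_norm_ge(2)[OF p1] abs_of_nonneg[OF grad_energy_nonneg])
  have EI': "integrable (lebesgue_on {s..t}) (\<lambda>\<tau>. grad_energy p (v \<tau>) + grad_energy p w)" using EI by simp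
  show "integrable (lebesgue_on {s..t}) (\<lambda>\<tau>. flux p (v \<tau>) w)"
    by (rule Bochner_Integration.integrable_bound[OF EI' measurable_restrict_mono[OF fm sub]])
      (use vXJ in \<open>eventually_elim, use flux_bounds(1)[OF p1 _ w] in \<open>auto intro: order_trans[OF _ abs_ge_self]\<close>\<close>)
  have "AE \<tau> in lebesgue_on {0..}. grad_energy p (\<lambda>x. v \<tau> x + (-1) * w x) = grad_energy p (\<lambda>x. w x - v \<tau> x)"
    using vX by eventually_elim (simp add: cf_swap[OF cf _ w])
  \<comment> \<open>A constant sequence: \<open>measurable_AE_limit\<close> serves here to change a
    measurable function on a null set.\<close>
  then have *: "AE \<tau> in lebesgue_on {0..}. (\<lambda>k::nat. grad_energy p (\<lambda>x. v \<tau> x + (-1) * w x)) \<longlonglongrightarrow> grad_energy p (\<lambda>x. w x - v \<tau> x)"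
    by eventually_elim (simp only: tendsto_const)
  have "(\<lambda>\<tau>. grad_energy p (\<lambda>x. w x - v \<tau> x)) \<in> borel_measurable (lebesgue_on {0..})"
    by (rule measurable_AE_limit[OF I0 _ *]) (rule mc)
  from measurable_restrict_mono[OF this sub]
  show "(\<lambda>\<tau>. grad_energy p (\<lambda>x. w x - v \<tau> x)) \<in> borel_measurable (lebesgue_on {s..t})" .
qed

section \<open>Differential inequalities\<close>

text \<open>A difference quotient bound on the left at almost every time integrates, because the
  difference of two antiderivatives of \<open>Y\<close> at a small distance approximates \<open>Y\<close>.\<close>

lemma left_difference_bound:
  fixes Y \<rho> :: "real \<Rightarrow> real"
  assumes cont: "continuous_on {0..T} Y" and \<rho>: "integrable (lebesgue_on {0..T}) \<rho>" and h: "0 < h"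
    and le: "AE t in lebesgue_on {0..T}. \<forall>s. 0 \<le> s \<longrightarrow> s < t \<longrightarrow> t - s < h \<longrightarrow> Y t - Y s \<le> (t - s) * \<rho> t"
    and ab: "0 < a" "a < b" "b < T"
  shows "Y b - Y a \<le> integral {a..b} \<rho>"
proof -
  \<comment> \<open>The primitive of \<open>Y\<close> is differentiable although \<open>Y\<close> is
    merely continuous; its left difference quotients at a and b recover \<open>Y a\<close> and
    \<open>Y b\<close>.\<close>
  define Z where "Z x = integral {0..x} Y" for x
  have Yi: "Y integrable_on {0..x}" if "x \<le> T" for x
    using that by (intro integrable_continuous_real continuous_on_subset[OF cont]) auto
  have Zd: "Z y - Z x = integral {x..y} Y" if "0 \<le> x" "x \<le> y" "y \<le> T" for x y
    using Henstock_Kurzweil_Integration.integral_combine[OF that(1,2) Yi[OF that(3)]] by (simp add: Z_def)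
  have ZD: "(Z has_real_derivative Y x) (at x)" if "0 < x" "x < T" for x
  proof -
    have "((\<lambda>x. integral {0..x} Y) has_real_derivative Y x) (at x within {0..T})"
      using that by (intro integral_has_real_derivative cont) auto
    then show ?thesis using that by (simp add: Z_def[abs_def] at_within_Icc_at)
  qed
  define \<sigma> where "\<sigma> k = inverse (real (Suc k))" for k
  have \<sigma>0: "0 < \<sigma> k" for k by (simp add: \<sigma>_def)
  have \<sigma>l: "\<sigma> \<longlonglongrightarrow> 0" unfolding \<sigma>_def[abs_def] by (rule LIMSEQ_inverse_real_of_nat)
  have quot: "(\<lambda>k. (Z x - Z (x - \<sigma> k)) / \<sigma> k) \<longlonglongrightarrow> Y x" if x: "0 < x" "x < T" for x
  proof -
    have "(\<lambda>k. - \<sigma> k) \<longlonglongrightarrow> 0" using tendsto_minus[OF \<sigma>l] by simp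
    moreover have "\<forall>\<^sub>F k in sequentially. - \<sigma> k \<noteq> 0" using \<sigma>0 by (intro always_eventually allI) (simp add: less_imp_neq[symmetric])
    ultimately have "filterlim (\<lambda>k. - \<sigma> k) (at 0) sequentially" by (simp add: filterlim_at)
    from filterlim_compose[OF ZD[OF x, unfolded DERIV_def] this]
    have "(\<lambda>k. (Z (x + - \<sigma> k) - Z x) / (- \<sigma> k)) \<longlonglongrightarrow> Y x" .
    moreover have "(Z (x + - \<sigma> k) - Z x) / (- \<sigma> k) = (Z x - Z (x - \<sigma> k)) / \<sigma> k" for k
      by (simp add: minus_divide_left[symmetric] divide_minus_right diff_divide_distrib)
    ultimately show ?thesis by simp
  qed
  have lim: "(\<lambda>k. (Z b - Z (b - \<sigma> k)) / \<sigma> k - (Z a - Z (a - \<sigma> k)) / \<sigma> k) \<longlonglongrightarrow> Y b - Y a"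
    using ab by (intro tendsto_diff quot) auto
  have \<rho>ab: "integrable (lebesgue_on {a..b}) \<rho>" by (rule Equivalence_Lebesgue_Henstock_Integration.integrable_subinterval[OF \<rho>]) (use ab in auto)
  have le': "AE t in lebesgue_on {a..b}. \<forall>s. 0 \<le> s \<longrightarrow> s < t \<longrightarrow> t - s < h \<longrightarrow> Y t - Y s \<le> (t - s) * \<rho> t"
    using le ab by (auto simp: AE_restrict_space_iff elim!: eventually_mono)
  have bound: "(Z b - Z (b - \<sigma> k)) / \<sigma> k - (Z a - Z (a - \<sigma> k)) / \<sigma> k \<le> integral {a..b} \<rho>"
    if k: "\<sigma> k < h" "\<sigma> k < a" for k
  proof -
    have c1: "continuous_on {a..b} Y" by (rule continuous_on_subset[OF cont]) (use ab in auto)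
    have c2: "continuous_on {a..b} (\<lambda>t. Y (t - \<sigma> k))"
      by (rule continuous_on_compose2[OF cont]) (use ab k \<sigma>0[of k] in \<open>auto intro!: continuous_intros\<close>)
    note i = continuous_imp_integrable_real[OF c1] continuous_imp_integrable_real[OF c2]
    \<comment> \<open>The pointwise hypothesis is integrated with the fixed lag
      \<open>\<sigma> k\<close>. Shifting the variable then turns the left side into increments of
      \<open>Z\<close> at the two endpoints only.\<close>
    have "(\<integral>t. Y t - Y (t - \<sigma> k) \<partial>lebesgue_on {a..b}) \<le> (\<integral>t. \<sigma> k * \<rho> t \<partial>lebesgue_on {a..b})"
    proof (rule integral_mono_AE)
      show "AE t in lebesgue_on {a..b}. Y t - Y (t - \<sigma> k) \<le> \<sigma> k * \<rho> t"
        using le' AE_space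
      proof eventually_elim
        case (elim t)
        then have "a \<le> t" by simp
        then show ?case using elim(1)[rule_format, of "t - \<sigma> k"] k \<sigma>0[of k] by simp
      qed
    qed (use i \<rho>ab in auto)
    also have "\<dots> = \<sigma> k * integral {a..b} \<rho>" using lebesgue_integral_eq_integral[OF \<rho>ab] by simp
    finally have "integral {a..b} Y - integral {a..b} (\<lambda>t. Y (t - \<sigma> k)) \<le> \<sigma> k * integral {a..b} \<rho>"
      using i lebesgue_integral_eq_integral[OF i(1)] lebesgue_integral_eq_integral[OF i(2)] by simp
    moreover have "integral {a..b} (\<lambda>t. Y (t - \<sigma> k)) = integral {a - \<sigma> k..b - \<sigma> k} Y"
      using integral_shift_Icc_real[of a b Y "- \<sigma> k"] by (simp add: o_def)
    moreover have "integral {a..b} Y = Z b - Z a" using ab by (intro Zd[symmetric]) auto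
    moreover have "integral {a - \<sigma> k..b - \<sigma> k} Y = Z (b - \<sigma> k) - Z (a - \<sigma> k)"
      using ab k \<sigma>0[of k] by (intro Zd[symmetric]) auto
    ultimately have "(Z b - Z (b - \<sigma> k)) - (Z a - Z (a - \<sigma> k)) \<le> integral {a..b} \<rho> * \<sigma> k" by (simp add: mult.commute)
    then show ?thesis using \<sigma>0[of k] by (simp add: diff_divide_distrib[symmetric] divide_le_eq)
  qed
  show ?thesis
  proof (rule tendsto_upperbound[OF lim])
    show "\<forall>\<^sub>F k in sequentially. (Z b - Z (b - \<sigma> k)) / \<sigma> k - (Z a - Z (a - \<sigma> k)) / \<sigma> k \<le> integral {a..b} \<rho>"
      using order_tendstoD(2)[OF \<sigma>l h] order_tendstoD(2)[OF \<sigma>l ab(1)] by eventually_elim (rule bound)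
  qed simp
qed

text \<open>Since \<open>\<theta> < 1\<close>, the times needed to halve \<open>y\<close> are summable.\<close>

lemma finite_extinction:
  fixes y :: "real \<Rightarrow> real"
  assumes cont: "continuous_on {0..} y" and y0: "\<And>t. 0 \<le> y t"
    and \<kappa>: "0 < \<kappa>" and C: "0 < C" and \<theta>: "0 < \<theta>" "\<theta> < 1"
    and dec: "\<And>a b. 0 < a \<Longrightarrow> a < b \<Longrightarrow> y b - y a + \<kappa> * integral {a..b} (\<lambda>t. min 1 ((y t / C) powr \<theta>)) \<le> 0"
  shows "\<exists>T>0. \<forall>t\<ge>T. y t = 0"
proof -
  define g where "g t = min 1 ((y t / C) powr \<theta>)" for t
  have gc: "continuous_on {a..b} g" if "0 \<le> a" for a b
    unfolding g_def using that C \<theta> y0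
    by (intro continuous_intros continuous_on_powr' continuous_on_subset[OF cont]) auto
  have gi: "g integrable_on {a..b}" if "0 \<le> a" for a b by (rule integrable_continuous_real[OF gc[OF that]])
  note dec' = dec[folded g_def]
  have mono: "y b \<le> y a" if "0 < a" "a \<le> b" for a b
  proof (cases "a = b")
    case False
    have "0 \<le> integral {a..b} g" using that by (intro Henstock_Kurzweil_Integration.integral_nonneg gi) (auto simp: g_def)
    then have "0 \<le> \<kappa> * integral {a..b} g" using \<kappa> by simp
    then show ?thesis using dec'[of a b] that False by simp
  qed simp
  \<comment> \<open>A time sufficient for y to drop from 2e to e. While y is at least e, the rate is
    at least \<kappa> min(1, z) with z = (e/C)^\<theta>, and e + e/z with e/z = C^\<theta>
    e^(1-\<theta>) dominates e / min(1, z).\<close>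
  define \<Delta> where "\<Delta> e = (e + C powr \<theta> * e powr (1 - \<theta>)) / \<kappa>" for e
  have \<Delta>0: "0 < \<Delta> e" if "0 < e" for e unfolding \<Delta>_def using that \<kappa> C by (intro divide_pos_pos add_pos_pos) auto
  have halve: "y (t + \<Delta> e) \<le> e" if t: "0 < t" and e: "0 < e" and yt: "y t \<le> 2 * e" for t e
  proof (rule ccontr)
    assume "\<not> y (t + \<Delta> e) \<le> e"
    then have big: "e < y (t + \<Delta> e)" by simp
    define z where "z = (e / C) powr \<theta>"
    have z: "0 < z" using e C by (simp add: z_def)
    have low: "min 1 z \<le> g \<tau>" if "\<tau> \<in> {t..t + \<Delta> e}" for \<tau>
    proof -
      have "e \<le> y \<tau>" using mono[of \<tau> "t + \<Delta> e"] that t big by simp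
      then have "z \<le> (y \<tau> / C) powr \<theta>" unfolding z_def using C e \<theta> by (intro powr_mono2 divide_right_mono) auto
      then show ?thesis by (simp add: g_def min_def)
    qed
    have "integral {t..t + \<Delta> e} (\<lambda>_. min 1 z) \<le> integral {t..t + \<Delta> e} g"
      using t low by (intro integral_le gi) auto
    then have "\<Delta> e * min 1 z \<le> integral {t..t + \<Delta> e} g" using \<Delta>0[OF e] by simp
    then have "\<kappa> * (\<Delta> e * min 1 z) \<le> \<kappa> * integral {t..t + \<Delta> e} g" using \<kappa> by (intro mult_left_mono) auto
    moreover have "\<kappa> * (\<Delta> e * min 1 z) \<ge> e"
    proof -
      have "C powr \<theta> * e powr (1 - \<theta>) = e / z" using e C by (simp add: z_def powr_divide powr_diff)
      then have "\<kappa> * \<Delta> e = e + e / z" using \<kappa> by (simp add: \<Delta>_def)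
      then have "\<kappa> * (\<Delta> e * min 1 z) = (e + e / z) * min 1 z" by (simp add: mult.assoc[symmetric])
      also have "\<dots> \<ge> e" using z e by (cases "1 \<le> z") (auto simp: min_def distrib_right)
      finally show ?thesis .
    qed
    moreover have "y (t + \<Delta> e) - y t + \<kappa> * integral {t..t + \<Delta> e} g \<le> 0" using t \<Delta>0[OF e] by (intro dec') auto
    ultimately show False using big yt by linarith
  qed
  \<comment> \<open>The iteration starts at time 1 because the decay inequality is available only
    for a > 0; the added 1 makes \<open>E\<close> positive.\<close>
  define E where "E = y 1 + 1"
  have E: "0 < E" using y0[of 1] by (simp add: E_def)
  \<comment> \<open>One power ahead: the n-th stage starts below E / 2^n, which is twice
    \<open>e n\<close>.\<close>
  define e where "e k = E * (1/2) ^ Suc k" for k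
  have e0: "0 < e k" for k using E by (simp add: e_def)
  have "summable (\<lambda>k. \<Delta> (e k))"
  proof -
    \<comment> \<open>The ratio of the geometric series formed by e_k^(1-\<theta>); it is below 1
      because \<theta> < 1.\<close>
    define x where "x = (1/2::real) powr (1 - \<theta>)"
    have x: "0 \<le> x" "x < 1" using \<theta> powr_less_mono2[of "1 - \<theta>" "1/2" 1] by (auto simp: x_def)
    have "e k powr (1 - \<theta>) = E powr (1 - \<theta>) * x * x ^ k" for k
    proof -
      have "((1/2::real) ^ Suc k) powr (1 - \<theta>) = x ^ Suc k"
        unfolding x_def by (simp only: powr_realpow[symmetric] powr_powr powr_gt_zero half_gt_zero_iff zero_less_one mult.commute powr_power)
      moreover have "e k powr (1 - \<theta>) = E powr (1 - \<theta>) * ((1/2) ^ Suc k) powr (1 - \<theta>)"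
        unfolding e_def by (subst powr_mult) (use E in auto)
      ultimately show ?thesis by (simp only: power_Suc mult.assoc)
    qed
    then have "\<Delta> (e k) = E / (2 * \<kappa>) * (1/2) ^ k + C powr \<theta> * E powr (1 - \<theta>) * x / \<kappa> * x ^ k" for k
      by (simp add: \<Delta>_def e_def add_divide_distrib)
    moreover have "summable (\<lambda>k. E / (2 * \<kappa>) * (1/2) ^ k + C powr \<theta> * E powr (1 - \<theta>) * x / \<kappa> * x ^ k)"
      using x by (intro summable_add summable_mult summable_geometric) auto
    ultimately show ?thesis by simp
  qed
  then have S: "(\<Sum>k<n. \<Delta> (e k)) \<le> (\<Sum>k. \<Delta> (e k))" for n
    by (intro sum_le_suminf) (auto intro: less_imp_le[OF \<Delta>0[OF e0]])
  have it: "y (1 + (\<Sum>k<n. \<Delta> (e k))) \<le> E * (1/2) ^ n" for n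
  proof (induction n)
    case 0
    then show ?case by (simp add: E_def)
  next
    case (Suc n)
    have "0 \<le> (\<Sum>k<n. \<Delta> (e k))" by (intro sum_nonneg less_imp_le[OF \<Delta>0[OF e0]])
    then have "y ((1 + (\<Sum>k<n. \<Delta> (e k))) + \<Delta> (e n)) \<le> e n"
      using Suc by (intro halve e0) (auto simp: e_def)
    then show ?case by (simp add: e_def add.assoc)
  qed
  define T where "T = 1 + (\<Sum>k. \<Delta> (e k))"
  have T: "0 < T" using S[of 0] by (simp add: T_def)
  have "y t = 0" if t: "T \<le> t" for t
  proof -
    have "y t \<le> E * (1/2) ^ n" for n
    proof -
      have "0 \<le> (\<Sum>k<n. \<Delta> (e k))" by (intro sum_nonneg less_imp_le[OF \<Delta>0[OF e0]])
      then have "y t \<le> y (1 + (\<Sum>k<n. \<Delta> (e k)))" using S[of n] t by (intro mono) (auto simp: T_def)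
      then show ?thesis using it[of n] by linarith
    qed
    moreover have "(\<lambda>n. E * (1/2) ^ n) \<longlonglongrightarrow> 0"
      by (intro tendsto_mult_right_zero LIMSEQ_realpow_zero) auto
    ultimately have "y t \<le> 0" by (intro LIMSEQ_le_const) auto
    then show ?thesis using y0[of t] by simp
  qed
  then show ?thesis using T by blast
qed

section \<open>Energy decay\<close>

lemma weak_solution_constant_test:
  fixes u :: "real \<Rightarrow> 'a::euclidean_space \<Rightarrow> real"
  assumes p: "1 \<le> p" and q: "0 < q" and u: "weak_solution p q {0..} u"
    and w: "w \<in> W1p_hyp p" "w \<in> Lp_hyp (1 + 1 / q)" "\<And>x. 0 \<le> w x" and st: "0 \<le> s" "s < t"
  shows "(\<integral>x. u t x * w x \<partial>hyp_measure) - (\<integral>x. u s x * w x \<partial>hyp_measure)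
    = - (\<integral>\<tau>. flux p (\<lambda>x. u \<tau> x powr q) w \<partial>lebesgue_on {s..t})"
proof -
  have "\<forall>\<psi> \<psi>' t1 t2. test_function p q {0..} \<psi> \<psi>' \<longrightarrow> (\<forall>t\<in>{0..}. AE x in hyp_measure. 0 \<le> \<psi> t x) \<longrightarrow>
        t1 \<in> {0..} \<longrightarrow> t2 \<in> {0..} \<longrightarrow> t1 < t2 \<longrightarrow>
        (\<integral>x. u t2 x * \<psi> t2 x \<partial>hyp_measure) - (\<integral>x. u t1 x * \<psi> t1 x \<partial>hyp_measure)
        + (\<integral>t. (\<integral>x. - u t x * \<psi>' t x
                  + hyp_norm x (hyp_grad (\<lambda>y. u t y powr q) x) powr (p - 2)
                    * hyp_inner x (hyp_grad (\<lambda>y. u t y powr q) x) (hyp_grad (\<psi> t) x)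
               \<partial>hyp_measure) \<partial>lebesgue_on {t1..t2}) = 0"
    using u unfolding weak_solution_def by (elim conjE)
  from this[THEN spec, THEN spec, THEN spec, THEN spec, of "\<lambda>t. w" "\<lambda>t x. 0" s t] show ?thesis
    using test_function_const[OF p q w(1,2)] w(3) st by (simp add: flux_def)
qed

text \<open>The test function is taken at the right end t. The tangent at u(t) reads u(s)^(q+1)
  \<ge> (q+1) u(s) u(t)^q - q u(t)^(q+1), which bounds the increase of y from above by the tested
  equation.\<close>

lemma energy_step:
  fixes u :: "real \<Rightarrow> 'a::euclidean_space \<Rightarrow> real"
  assumes p: "1 \<le> p" and q: "0 < q" and u: "weak_solution p q {0..} u"
    and w: "(\<lambda>x. u t x powr q) \<in> W1p_hyp p" and st: "0 \<le> s" "s < t"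
  shows "Lp_int (q + 1) (u t) - Lp_int (q + 1) (u s)
    \<le> - ((q + 1) * (\<integral>\<tau>. flux p (\<lambda>x. u \<tau> x powr q) (\<lambda>x. u t x powr q) \<partial>lebesgue_on {s..t}))"
proof -
  have uX: "u \<tau> \<in> Lp_hyp (q + 1)" "AE x in hyp_measure. 0 \<le> u \<tau> x" if "0 \<le> \<tau>" for \<tau>
    using u that by (auto simp: weak_solution_def curve_continuous_def)
  have t: "0 \<le> t" using st by simp
  note D = Lp_hypD[OF uX(1)[OF st(1)]] Lp_hypD[OF uX(1)[OF t]]
  have wm: "(\<lambda>x. u t x powr q) \<in> borel_measurable hyp_measure" using D(3) by measurable
  \<comment> \<open>The exponents match: (u^q)^(1 + 1/q) = u^(q+1).\<close>
  have "(\<lambda>x. u t x powr q) \<in> Lp_hyp (1 + 1 / q)"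
    using wm D(4) q by (simp add: Lp_hyp_def powr_powr distrib_left)
       (rule integrable_cong_AE_imp[OF D(4)], use D(3) in measurable, use uX(2)[OF t] in \<open>auto elim!: eventually_mono\<close>)
  note weak = weak_solution_constant_test[OF p q u w this powr_ge_zero st]
  have I: "integrable hyp_measure (\<lambda>x. \<bar>u t x\<bar> powr (q + 1) + \<bar>u s x\<bar> powr (q + 1))" using D by simp
  have ints: "integrable hyp_measure (\<lambda>x. u s x * u t x powr q)"
  proof (rule Bochner_Integration.integrable_bound[OF I])
    show "(\<lambda>x. u s x * u t x powr q) \<in> borel_measurable hyp_measure" using D(1) wm by measurable
    show "AE x in hyp_measure. norm (u s x * u t x powr q) \<le> norm (\<bar>u t x\<bar> powr (q + 1) + \<bar>u s x\<bar> powr (q + 1))"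
      using uX(2)[OF st(1)] uX(2)[OF t]
    proof eventually_elim
      case (elim x)
      then show ?case using powr_young[of "u t x" "u s x" "q + 1" 1] q by (simp add: mult.commute)
    qed
  qed
  have eqt: "AE x in hyp_measure. \<bar>u t x\<bar> powr (q + 1) = u t x * u t x powr q"
    using uX(2)[OF t]
  proof eventually_elim
    case (elim x)
    then show ?case by (cases "u t x = 0") (simp_all add: powr_add)
  qed
  have intt: "integrable hyp_measure (\<lambda>x. u t x * u t x powr q)"
    by (rule integrable_cong_AE_imp[OF D(4) _ eqt]) (use D(3) wm in measurable)
  have yt: "Lp_int (q + 1) (u t) = (\<integral>x. u t x * u t x powr q \<partial>hyp_measure)"
    unfolding Lp_int_def by (rule integral_cong_AE) (use D(3) wm eqt in auto)
  have "(\<integral>x. (q + 1) * (u s x * u t x powr q) - q * (u t x * u t x powr q) \<partial>hyp_measure) \<le> Lp_int (q + 1) (u s)"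
    unfolding Lp_int_def
  proof (rule integral_mono_AE[OF _ D(2)])
    show "AE x in hyp_measure. (q + 1) * (u s x * u t x powr q) - q * (u t x * u t x powr q) \<le> \<bar>u s x\<bar> powr (q + 1)"
      using uX(2)[OF st(1)] uX(2)[OF t] eqt
    proof eventually_elim
      case (elim x)
      then show ?case using powr_tangent[of "q + 1" "u s x" "u t x"] q by (simp add: algebra_simps)
    qed
  qed (use ints intt in simp)
  then have "(q + 1) * (\<integral>x. u s x * u t x powr q \<partial>hyp_measure) - q * Lp_int (q + 1) (u t) \<le> Lp_int (q + 1) (u s)"
    using ints intt by (simp add: yt)
  moreover have "(\<integral>x. u s x * u t x powr q \<partial>hyp_measure) = Lp_int (q + 1) (u t)
      + (\<integral>\<tau>. flux p (\<lambda>x. u \<tau> x powr q) (\<lambda>x. u t x powr q) \<partial>lebesgue_on {s..t})"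
    using weak by (simp add: yt)
  ultimately show ?thesis by (simp add: algebra_simps)
qed


lemma W1p_hyp_zero: "(\<lambda>x. 0) \<in> W1p_hyp p"
  by (rule W1p_hypI[where G = "\<lambda>x. 0"]) (simp_all add: Lp_hyp_def hyp_weak_grad_def set_integrable_def hyp_inner_eq hyp_norm_eq)

lemma weak_solution_energy_continuous:
  fixes u :: "real \<Rightarrow> 'a::euclidean_space \<Rightarrow> real"
  assumes q: "0 < q" and u: "weak_solution p q {0..} u"
  shows "continuous_on {0..} (\<lambda>t. Lp_int (q + 1) (u t))"
  unfolding continuous_on_def
proof
  fix t :: real assume t: "t \<in> {0..}"
  have c: "curve_continuous (Lp_hyp (q + 1)) (Lp_norm (q + 1)) {0..} u" using u by (simp add: weak_solution_def)
  have q1: "1 \<le> q + 1" using q by simp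
  have "((\<lambda>s. Lp_norm (q + 1) (\<lambda>x. u s x - u t x)) \<longlongrightarrow> 0) (at t within {0..})"
    using c t unfolding curve_continuous_def by blast
  then have "((\<lambda>s. Lp_norm (q + 1) (\<lambda>x. u s x - u t x) powr (q + 1)) \<longlongrightarrow> 0 powr (q + 1)) (at t within {0..})"
    using q by (intro tendsto_powr2 tendsto_const always_eventually allI) (auto simp: Lp_norm_def)
  then have D: "((\<lambda>s. Lp_int (q + 1) (\<lambda>x. u s x - u t x)) \<longlongrightarrow> 0) (at t within {0..})"
    using q by (simp add: Lp_norm_powr[OF q1])
  have "\<forall>\<^sub>F s in at t within {0..}. u s \<in> Lp_hyp (q + 1)"
    using c unfolding curve_continuous_def by (simp add: eventually_at_filter)
  moreover have "u t \<in> Lp_hyp (q + 1)" using c t unfolding curve_continuous_def by blast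
  ultimately show "((\<lambda>s. Lp_int (q + 1) (u s)) \<longlongrightarrow> Lp_int (q + 1) (u t)) (at t within {0..})"
    by (intro cf_tendsto[OF convex_functional_Lp[OF q1]] D)
qed

text \<open>Testing with the value of \<open>u\<^sup>q\<close> at the right end of a short time interval replaces a chain rule
  in time. The error is the energy of \<open>u\<^sup>q(\<tau>) - u\<^sup>q(t)\<close>, which a continuous approximation of the curve
  makes small on average.\<close>

lemma energy_decay:
  fixes u :: "real \<Rightarrow> 'a::euclidean_space \<Rightarrow> real"
  assumes p: "1 < p" and q: "0 < q" and u: "weak_solution p q {0..} u"
    and G: "continuous_on {0..} G"
    and GE: "AE t in lebesgue_on {0..}. G t \<le> grad_energy p (\<lambda>x. u t x powr q)"
    and ab: "0 < a" "a < b"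
  shows "Lp_int (q + 1) (u b) - Lp_int (q + 1) (u a) + (q + 1) / 2 * integral {a..b} G \<le> 0"
proof (rule field_le_epsilon)
  fix \<epsilon> :: real assume \<epsilon>: "0 < \<epsilon>"
  \<comment> \<open>Slightly beyond b, since \<open>left_difference_bound\<close> asks for an
    endpoint strictly inside the interval.\<close>
  define T where "T = b + 1"
  have T: "0 < T" "b < T" using ab by (auto simp: T_def)
  define v where "v t x = u t x powr q" for t x
  define y where "y t = Lp_int (q + 1) (u t)" for t
  \<comment> \<open>\<open>c\<close> is the constant of the lower flux bound, \<open>Q\<close> that
    of two successive quasi-triangle inequalities; \<open>K\<close> collects them with the factor q
    + 1 of the energy step.\<close>
  define c Q where "c = (1/2::real) powr (1 - p)" and "Q = (2::real) powr p * 2 powr p"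
  define K where "K = (q + 1) * (c * Q)"
  have pos: "0 < c" "0 < Q" "0 < K" using q by (simp_all add: c_def Q_def K_def)
  have p1: "1 \<le> p" using p by simp
  note cf = convex_functional_grad_energy[OF p1, where 'a = 'a]
  have vL: "Lp_loc_curve p (W1p_hyp p) (W1p_norm p) {0..} v"
    using u by (simp add: weak_solution_def v_def[abs_def])
  then have sm: "strongly_measurable (W1p_hyp p) (W1p_norm p) {0..} v" by (simp add: Lp_loc_curve_def)
  have NI: "integrable (lebesgue_on {0..T}) (\<lambda>t. W1p_norm p (v t) powr p)"
    using vL unfolding Lp_loc_curve_def by auto
  \<comment> \<open>The remainder enters twice, once at the test time t and once averaged over the
    interval before it; with a quarter each time, half of \<epsilon> is left for
    \<open>\<delta>\<close>.\<close>
  have \<epsilon>K: "0 < \<epsilon> / (4 * K)" using \<epsilon> pos by simp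
  obtain Z R where Z: "\<And>t. Z t \<in> W1p_hyp p"
    and Zc: "\<And>\<delta>. 0 < \<delta> \<Longrightarrow> \<exists>h>0. \<forall>t\<in>{0..T}. \<forall>\<tau>\<in>{0..T}. \<bar>t - \<tau>\<bar> < h \<longrightarrow> grad_energy p (\<lambda>x. Z t x - Z \<tau> x) \<le> \<delta>"
    and R: "integrable (lebesgue_on {0..T}) R" "\<And>t. 0 \<le> R t" "(\<integral>t. R t \<partial>lebesgue_on {0..T}) \<le> \<epsilon> / (4 * K)"
    and vZ: "AE t in lebesgue_on {0..T}. v t \<in> W1p_hyp p \<and> grad_energy p (\<lambda>x. v t x - Z t x) \<le> R t"
    by (rule curve_continuous_approx[OF sm cf W1p_norm_ge(1)[OF p1] W1p_norm_ge(2)[OF p1] W1p_hyp_zero T(1) NI \<epsilon>K]) (rule that; (assumption | blast))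
  define \<delta> where "\<delta> = \<epsilon> / (2 * K * b)"
  have \<delta>: "0 < \<delta>" using \<epsilon> pos ab by (simp add: \<delta>_def)
  obtain h where h: "0 < h" and hZ: "\<forall>t\<in>{0..T}. \<forall>\<tau>\<in>{0..T}. \<bar>t - \<tau>\<bar> < h \<longrightarrow> grad_energy p (\<lambda>x. Z t x - Z \<tau> x) \<le> \<delta>"
    using Zc[OF \<delta>] by blast
  have Ri: "R integrable_on {0..T}" using R(1) by (intro integrable_on_lebesgue_on) auto
  have Rs: "R integrable_on {s..t}" if "0 \<le> s" "t \<le> T" for s t
    using that by (intro integrable_subinterval_real[OF Ri]) auto
  have Gs: "G integrable_on {s..t}" if "0 \<le> s" for s t
    using that by (intro integrable_continuous_real continuous_on_subset[OF G]) auto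
  \<comment> \<open>The integrals over (s, t) are absorbed into \<open>H\<close>, so that its left
    increments are bounded by (t - s) times a quantity depending on t alone.\<close>
  define H where "H x = y x + (q + 1) / 2 * integral {0..x} G - K * integral {0..x} R" for x
  \<comment> \<open>The path from v(t) to v(\<tau>) runs through Z(t) and Z(\<tau>): two
    approximation errors and one increment of a continuous curve.\<close>
  have error: "grad_energy p (\<lambda>x. v t x - v \<tau> x) \<le> Q * (R t + \<delta> + R \<tau>)"
    if t: "v t \<in> W1p_hyp p" "grad_energy p (\<lambda>x. v t x - Z t x) \<le> R t"
      and \<tau>: "v \<tau> \<in> W1p_hyp p" "grad_energy p (\<lambda>x. v \<tau> x - Z \<tau> x) \<le> R \<tau>"
      and near: "t \<in> {0..T}" "\<tau> \<in> {0..T}" "\<bar>t - \<tau>\<bar> < h" for t \<tau>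
  proof -
    let ?E = "grad_energy p"
    note d = cf_diff[OF cf t(1) Z[of t]] cf_diff[OF cf Z[of t] Z[of \<tau>]] cf_diff[OF cf Z[of \<tau>] \<tau>(1)]
    have one: "1 \<le> (2::real) powr p" using p by (intro ge_one_powr_ge_zero) auto
    have "?E (\<lambda>x. (Z t x - Z \<tau> x) + (Z \<tau> x - v \<tau> x)) \<le> 2 powr p * (\<delta> + R \<tau>)"
    proof (rule order_trans[OF cf_quasi[OF cf d(2,3)]])
      have "?E (\<lambda>x. Z \<tau> x - v \<tau> x) \<le> R \<tau>" using \<tau>(2) cf_swap[OF cf \<tau>(1) Z[of \<tau>]] by simp
      moreover have "?E (\<lambda>x. Z t x - Z \<tau> x) \<le> \<delta>" using hZ near by blast
      ultimately show "2 powr p * (?E (\<lambda>x. Z t x - Z \<tau> x) + ?E (\<lambda>x. Z \<tau> x - v \<tau> x)) \<le> 2 powr p * (\<delta> + R \<tau>)"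
        by (intro mult_left_mono add_mono) auto
    qed
    then have 1: "?E (\<lambda>x. Z t x - v \<tau> x) \<le> 2 powr p * (\<delta> + R \<tau>)" by simp
    have "?E (\<lambda>x. (v t x - Z t x) + (Z t x - v \<tau> x)) \<le> 2 powr p * (?E (\<lambda>x. v t x - Z t x) + ?E (\<lambda>x. Z t x - v \<tau> x))"
      by (rule cf_quasi[OF cf d(1) cf_diff[OF cf Z[of t] \<tau>(1)]])
    also have "\<dots> \<le> 2 powr p * (2 powr p * R t + 2 powr p * (\<delta> + R \<tau>))"
      using t(2) 1 mult_right_mono[OF one R(2)[of t]] by (intro mult_left_mono add_mono) auto
    also have "\<dots> = Q * (R t + \<delta> + R \<tau>)" by (simp add: Q_def algebra_simps)
    finally show ?thesis by simp
  qed
  have vZ0: "AE t in lebesgue. t \<in> {0..T} \<longrightarrow> v t \<in> W1p_hyp p \<and> grad_energy p (\<lambda>x. v t x - Z t x) \<le> R t"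
    using vZ by (simp add: AE_restrict_space_iff imp_conjR)
  have GE0: "AE t in lebesgue. t \<in> {0..} \<longrightarrow> G t \<le> grad_energy p (v t)"
    using GE by (simp add: AE_restrict_space_iff v_def[abs_def])
  have step: "H t - H s \<le> (t - s) * (K * (R t + \<delta>))"
    if t: "v t \<in> W1p_hyp p" "grad_energy p (\<lambda>x. v t x - Z t x) \<le> R t" and s: "0 \<le> s" "s < t" "t - s < h" "t \<le> T" for s t
  proof -
    let ?F = "\<lambda>\<tau>. flux p (v \<tau>) (v t)"
    have Fi: "integrable (lebesgue_on {s..t}) ?F" by (rule flux_integrable(2)[OF p vL t(1) s(1)])
    have Gi: "integrable (lebesgue_on {s..t}) G"
      using s by (intro continuous_imp_integrable_real continuous_on_subset[OF G]) auto
    have Ri': "integrable (lebesgue_on {s..t}) R"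
      by (rule Equivalence_Lebesgue_Henstock_Integration.integrable_subinterval[OF R(1)]) (use s in auto)
    have low: "AE \<tau> in lebesgue. \<tau> \<in> {s..t} \<longrightarrow> G \<tau> / 2 - c * (Q * (R t + \<delta> + R \<tau>)) \<le> ?F \<tau>"
      using vZ0 GE0
    proof eventually_elim
      case (elim \<tau>)
      show ?case
      proof
        assume \<tau>: "\<tau> \<in> {s..t}"
        have v\<tau>: "v \<tau> \<in> W1p_hyp p" "grad_energy p (\<lambda>x. v \<tau> x - Z \<tau> x) \<le> R \<tau>" "G \<tau> \<le> grad_energy p (v \<tau>)"
          using elim \<tau> s by auto
        have "grad_energy p (\<lambda>x. v t x - v \<tau> x) \<le> Q * (R t + \<delta> + R \<tau>)"
          by (rule error[OF t v\<tau>(1,2)]) (use \<tau> s in auto)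
        then have "c * grad_energy p (\<lambda>x. v t x - v \<tau> x) \<le> c * (Q * (R t + \<delta> + R \<tau>))" using pos by (intro mult_left_mono) auto
        then show "G \<tau> / 2 - c * (Q * (R t + \<delta> + R \<tau>)) \<le> ?F \<tau>"
          using flux_bounds(2)[OF p1 v\<tau>(1) t(1)] v\<tau>(3) unfolding c_def by linarith
      qed
    qed
    have "(\<integral>\<tau>. G \<tau> / 2 - c * (Q * (R t + \<delta> + R \<tau>)) \<partial>lebesgue_on {s..t}) \<le> (\<integral>\<tau>. ?F \<tau> \<partial>lebesgue_on {s..t})"
      using Gi Ri' low by (intro integral_mono_AE Fi) (auto simp: AE_restrict_space_iff)
    moreover have "(\<integral>\<tau>. G \<tau> / 2 - c * (Q * (R t + \<delta> + R \<tau>)) \<partial>lebesgue_on {s..t})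
        = integral {s..t} G / 2 - c * (Q * ((t - s) * (R t + \<delta>) + integral {s..t} R))"
      using Gi Ri' s lebesgue_integral_eq_integral[OF Gi] lebesgue_integral_eq_integral[OF Ri'] by (simp add: measure_restrict_space)
    ultimately have "(q + 1) * (integral {s..t} G / 2 - c * (Q * ((t - s) * (R t + \<delta>) + integral {s..t} R)))
        \<le> (q + 1) * (\<integral>\<tau>. ?F \<tau> \<partial>lebesgue_on {s..t})" using q by (intro mult_left_mono) auto
    moreover have "y t - y s \<le> - ((q + 1) * (\<integral>\<tau>. ?F \<tau> \<partial>lebesgue_on {s..t}))"
      using energy_step[OF p1 q u t(1)[unfolded v_def] s(1,2)] by (simp add: y_def v_def[abs_def])
    moreover have "(q + 1) * (integral {s..t} G / 2 - c * (Q * ((t - s) * (R t + \<delta>) + integral {s..t} R)))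
      = (q + 1) / 2 * integral {s..t} G - K * integral {s..t} R - (t - s) * (K * (R t + \<delta>))"
      unfolding K_def by (simp add: algebra_simps)
    moreover have "integral {0..t} G = integral {0..s} G + integral {s..t} G"
      by (rule Henstock_Kurzweil_Integration.integral_combine[symmetric]) (use s Gs in auto)
    moreover have "integral {0..t} R = integral {0..s} R + integral {s..t} R"
      by (rule Henstock_Kurzweil_Integration.integral_combine[symmetric]) (use s Rs in auto)
    ultimately show ?thesis unfolding H_def by (simp add: distrib_left)
  qed
  have "H b - H a \<le> integral {a..b} (\<lambda>t. K * (R t + \<delta>))"
  proof (rule left_difference_bound[OF _ _ h _ ab T(2)])
    have "continuous_on {0..T} y"
      using weak_solution_energy_continuous[OF q u] unfolding y_def by (rule continuous_on_subset) auto
    then show "continuous_on {0..T} H"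
      unfolding H_def by (intro continuous_intros indefinite_integral_continuous_1 Ri Gs) auto
    show "integrable (lebesgue_on {0..T}) (\<lambda>t. K * (R t + \<delta>))" using R(1) by simp
    show "AE t in lebesgue_on {0..T}. \<forall>s. 0 \<le> s \<longrightarrow> s < t \<longrightarrow> t - s < h \<longrightarrow> H t - H s \<le> (t - s) * (K * (R t + \<delta>))"
      using vZ AE_space
    proof eventually_elim
      case (elim t)
      then show ?case using step[of t] by simp
    qed
  qed
  also have "integral {a..b} (\<lambda>t. K * (R t + \<delta>)) = K * (integral {a..b} R + (b - a) * \<delta>)"
  proof -
    have "integral {a..b} (\<lambda>t. R t + \<delta>) = integral {a..b} R + integral {a..b} (\<lambda>t. \<delta>)"
      by (rule Henstock_Kurzweil_Integration.integral_add) (use Rs ab T in auto)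
    then show ?thesis using ab by simp
  qed
  finally have HH: "H b - H a \<le> K * (integral {a..b} R + (b - a) * \<delta>)" .
  have "integral {0..b} G = integral {0..a} G + integral {a..b} G"
    by (rule Henstock_Kurzweil_Integration.integral_combine[symmetric]) (use ab Gs in auto)
  moreover have "integral {0..b} R = integral {0..a} R + integral {a..b} R"
    by (rule Henstock_Kurzweil_Integration.integral_combine[symmetric]) (use ab T Rs in auto)
  ultimately have main: "y b - y a + (q + 1) / 2 * integral {a..b} G \<le> 2 * (K * integral {a..b} R) + K * ((b - a) * \<delta>)"
    using HH unfolding H_def by (simp add: distrib_left)
  \<comment> \<open>Only here does the smallness of the remainder enter, after all time intervals
    have been summed; at a single time \<open>R\<close> may be large.\<close>
  have "integral {a..b} R \<le> integral {0..T} R"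
    by (rule integral_subset_le) (use ab T Rs Ri R(2) in auto)
  also have "\<dots> \<le> \<epsilon> / (4 * K)" using R(3) lebesgue_integral_eq_integral[OF R(1)] by simp
  finally have "K * integral {a..b} R \<le> \<epsilon> / 4" using pos by (simp add: field_simps)
  moreover have "K * ((b - a) * \<delta>) \<le> K * (b * \<delta>)" using ab \<delta> pos by (intro mult_left_mono mult_right_mono) auto
  moreover have "K * (b * \<delta>) = \<epsilon> / 2" using ab pos by (simp add: \<delta>_def)
  ultimately show "Lp_int (q + 1) (u b) - Lp_int (q + 1) (u a) + (q + 1) / 2 * integral {a..b} G \<le> 0 + \<epsilon>"
    using main unfolding y_def by linarith
qed

theorem mainTheorem4:
  fixes p q :: real
    and u :: "real \<Rightarrow> 'a::euclidean_space \<Rightarrow> real"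
    and u0 :: "'a \<Rightarrow> real"
  assumes "DIM('a) \<ge> 2"
    and "1 < p" and "p < real DIM('a)"
    and "0 < q" and "q * (p - 1) < 1"
    and "weak_solution p q {0..} u"
    and "\<exists>C. \<forall>t\<ge>0. AE x in hyp_measure. u t x \<le> C"
    and "AE x in hyp_measure. 0 \<le> u0 x"
    and "u0 \<in> Lp_hyp 1" and "u0 \<in> Linf_hyp"
    and "AE x in hyp_measure. u 0 x = u0 x"
  shows "\<exists>T>0. \<forall>t\<ge>T. AE x in hyp_measure. u t x = 0"
proof -
  note n = assms(1) and p = assms(2) and q = assms(4) and u = assms(6)
  define r where "r = 1 + 1 / q"
  have pr: "p < r" using assms(5) q by (simp add: r_def field_simps)
  obtain C0 where C0: "\<And>t. 0 \<le> t \<Longrightarrow> AE x in hyp_measure. u t x \<le> C0" using assms(7) by blast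
  have uX: "u t \<in> Lp_hyp (q + 1)" "AE x in hyp_measure. 0 \<le> u t x" if "0 \<le> t" for t
    using u that by (auto simp: weak_solution_def curve_continuous_def)
  define v where "v t x = u t x powr q" for t x
  \<comment> \<open>The maximum with 1 keeps the bound positive whatever the sign of
    \<open>C0\<close>.\<close>
  define M where "M = max C0 1 powr q"
  have M: "0 < M" by (simp add: M_def)
  have vM: "AE x in hyp_measure. 0 \<le> v t x \<and> v t x \<le> M" if "0 \<le> t" for t
    using uX(2)[OF that] C0[OF that]
  proof eventually_elim
    case (elim x)
    then show ?case unfolding v_def M_def using q by (intro conjI powr_ge_zero powr_mono2) auto
  qed
  obtain C \<eta> where C: "0 < C" and \<eta>: "0 < \<eta>" and sob: "\<And>w::'a \<Rightarrow> real. w \<in> W1p_hyp p \<Longrightarrow>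
      (AE x in hyp_measure. 0 \<le> w x \<and> w x \<le> M) \<Longrightarrow> grad_energy p w < 1 \<Longrightarrow> Lp_int r w \<le> C * grad_energy p w powr (1 + \<eta>)"
    by (rule sobolev_W1p[OF p n pr M]) (rule that; (assumption | blast))
  \<comment> \<open>Inverting y \<le> C E^(1+\<eta>) bounds the energy E below by (y/C)^\<theta>;
    the gain \<eta> > 0 is exactly what makes \<theta> < 1.\<close>
  define \<theta> where "\<theta> = 1 / (1 + \<eta>)"
  have \<theta>: "0 < \<theta>" "\<theta> < 1" using \<eta> by (simp_all add: \<theta>_def)
  define y where "y t = Lp_int (q + 1) (u t)" for t
  have y0: "0 \<le> y t" for t unfolding y_def by (rule Lp_int_nonneg)
  have yc: "continuous_on {0..} y" unfolding y_def by (rule weak_solution_energy_continuous[OF q u])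
  have yv: "Lp_int r (v t) = y t" if t: "0 \<le> t" for t
    unfolding y_def Lp_int_def
  proof (rule integral_cong_AE)
    have m: "u t \<in> borel_measurable hyp_measure" by (rule Lp_hypD(1)[OF uX(1)[OF t]])
    show "(\<lambda>x. \<bar>v t x\<bar> powr r) \<in> borel_measurable hyp_measure" unfolding v_def using m by measurable
    show "(\<lambda>x. \<bar>u t x\<bar> powr (q + 1)) \<in> borel_measurable hyp_measure" using m by measurable
    show "AE x in hyp_measure. \<bar>v t x\<bar> powr r = \<bar>u t x\<bar> powr (q + 1)"
      using uX(2)[OF t] by eventually_elim (use q in \<open>simp add: v_def r_def powr_powr distrib_left\<close>)
  qed
  define G where "G t = min 1 ((y t / C) powr \<theta>)" for t
  have Gc: "continuous_on {0..} G"
    unfolding G_def using C \<theta> y0 by (intro continuous_intros continuous_on_powr' yc) auto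
  have "AE t in lebesgue_on {0..}. v t \<in> W1p_hyp p"
    using u by (simp add: weak_solution_def Lp_loc_curve_def strongly_measurable_def v_def[abs_def])
  then have GE: "AE t in lebesgue_on {0..}. G t \<le> grad_energy p (\<lambda>x. u t x powr q)"
    using AE_space
  proof eventually_elim
    case (elim t)
    then have t: "0 \<le> t" by simp
    have "G t \<le> grad_energy p (v t)"
    proof (cases "grad_energy p (v t) < 1")
      case True
      have "y t / C \<le> grad_energy p (v t) powr (1 + \<eta>)"
        using sob[OF elim(1) vM[OF t] True] C by (simp add: yv[OF t] divide_le_eq mult.commute)
      then have "(y t / C) powr \<theta> \<le> (grad_energy p (v t) powr (1 + \<eta>)) powr \<theta>"
        using y0[of t] C \<theta> by (intro powr_mono2) auto
      also have "\<dots> = grad_energy p (v t)"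
        using \<eta> grad_energy_nonneg[of p "v t"] by (simp add: powr_powr \<theta>_def)
      finally show ?thesis by (simp add: G_def)
    qed (simp add: G_def)
    then show ?case by (simp add: v_def[abs_def])
  qed
  have dec: "y b - y a + (q + 1) / 2 * integral {a..b} (\<lambda>t. min 1 ((y t / C) powr \<theta>)) \<le> 0" if "0 < a" "a < b" for a b
    using energy_decay[OF p q u Gc GE that] by (simp add: y_def G_def[abs_def])
  have "0 < (q + 1) / 2" using q by simp
  from finite_extinction[OF yc y0 this C \<theta> dec] obtain T where T: "0 < T" "\<And>t. T \<le> t \<Longrightarrow> y t = 0" by blast
  have "AE x in hyp_measure. u t x = 0" if t: "T \<le> t" for t
  proof -
    have "integrable hyp_measure (\<lambda>x. \<bar>u t x\<bar> powr (q + 1))" using uX(1)[of t] T(1) t by (intro Lp_hypD) auto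
    moreover have "(\<integral>x. \<bar>u t x\<bar> powr (q + 1) \<partial>hyp_measure) = 0" using T(2)[OF t] by (simp add: y_def Lp_int_def)
    \<comment> \<open>The integral representing y determines \<open>u t\<close> only almost
      everywhere, which is the sense of vanishing in the conclusion.\<close>
    ultimately have "AE x in hyp_measure. \<bar>u t x\<bar> powr (q + 1) = 0"
      by (subst integral_nonneg_eq_0_iff_AE[symmetric]) auto
    then show ?thesis by eventually_elim simp
  qed
  then show ?thesis using T(1) by blast
qed

end
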